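(* Let $p>0$, $s\in(0,2)$, let $f:\mathbb{C}\to\mathbb{C}$ be a homeomorphism with $p$-exponentially integrable distortion, let $A\subset\mathbb{C}$, and fix a branch of the argument. Assume that for every $z\in A$ there exists a sequence of nonzero complex numbers $\lambda_{z,n}$ with $|\lambda_{z,n}|\to0$ as $n\to\infty$ such that, for every $n$, $$|\arg(f(z+\lambda_{z,n})-f(z))|\ge\frac{(2-s)\sqrt{\tilde{C}\pi}\,\bar{C}}{\sqrt2\,p}\log^2\left(\frac{1}{|\lambda_{z,n}|}\right).$$ Then $$\dim(A)\le 2-\frac{\bar{C}\tilde{C}(2-s)}{\pi+2(e-1)}.$$
   Context: A sense-preserving homeomorphism $f:\mathbb{C}\to\mathbb{C}$ has finite distortion if $f\in W^{1,1}_{\mathrm{loc}}(\mathbb{C})$, its Jacobian satisfies $J_f\in L^1_{\mathrm{loc}}(\mathbb{C})$, and $|Df(z)|^2\le K(z)J_f(z)$ almost everywhere for some measurable $K\ge 1$ that is finite almost everywhere; here $|Df(z)|$ is the operator norm. The smallest such function is denoted $K_f$ (the distortion of $f$). For $p>0$, $f$ has $p$-exponentially integrable distortion if it has finite distortion and $e^{pK_f}\in L^1_{\mathrm{loc}}(\mathbb{C})$. $\dim$ denotes Hausdorff dimension. Branch of the argument: for each $z$, one fixes a choice of $\arg(f(z+te^{i\theta})-f(z))\in\mathbb{R}$ that is continuous in $(t,\theta)\in(0,\infty)\times[0,2\pi)$ (such a choice is unique up to an additive multiple of $2\pi$); for $\lambda=te^{i\theta}$ with $t>0$, $\theta\in[0,2\pi)$,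 $\arg(f(z+\lambda)-f(z))$ denotes this value. Thus the change of this quantity as $t$ goes from $1$ to a small $r$ along a fixed direction $\theta$ measures the winding of the path $f([z+re^{i\theta},z+e^{i\theta}])$ around $f(z)$. The constant $\bar{C}>0$ is the fixed constant (independent of $f$) of the known pointwise compression bound: every homeomorphism $f:\mathbb{C}\to\mathbb{C}$ with $p$-exponentially integrable distortion and $f(0)=0$ satisfies $|f(z)|\ge c\, e^{-\frac{\bar{C}}{p}\log^2(1/|z|)}$ for all small $|z|$, with some $c>0$ (allowed to depend on $f$). The constant $\tilde{C}>0$ is a fixed constant such that for all disjoint continua $E,F\subset\mathbb{C}$, the family $\Gamma$ of all paths connecting $E$ and $F$ satisfies $$M(\Gamma)\ge \tilde{C}\log\left(1+\frac{\min\{\mathrm{diam}(E),\mathrm{diam}(F)\}}{\mathrm{dist}(E,F)}\right),$$ where $M(\Gamma)=\inf_\rho\int_{\mathbb{C}}\rho^2\,dA$ is the (conformal) modulus, the infimum being over Borel functions $\rho:\mathbb{C}\to[0,\infty]$ with $\int_\gamma\rho\,|dz|\ge 1$ for every locally rectifiable $\gamma\in\Gamma$. *)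

theory Defs
  imports "HOL-Complex_Analysis.Complex_Analysis"
begin

section \<open>Hausdorff dimension\<close>

definition hausdorff_premeasure :: "real \<Rightarrow> real \<Rightarrow> 'a::metric_space set \<Rightarrow> ennreal" where
  "hausdorff_premeasure d \<delta> A =
     (INF U\<in>{U :: nat \<Rightarrow> 'a set. A \<subseteq> (\<Union>i. U i) \<and> (\<forall>i. bounded (U i) \<and> diameter (U i) \<le> \<delta>)}.
        \<Sum>i. ennreal (diameter (U i) powr d))"

definition hausdorff_measure :: "real \<Rightarrow> 'a::metric_space set \<Rightarrow> ennreal" where
  "hausdorff_measure d A = (SUP \<delta>\<in>{0<..}. hausdorff_premeasure d \<delta> A)"

text \<open>
  Only exponents \<open>d > 0\<close> enter the infimum: this does not change it, and it avoids
  \<open>0 powr 0 = 0\<close>. The empty set gets dimension \<open>-\<infinity>\<close>, the usual convention in multifractal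
  analysis, so that upper bounds for the dimension stay meaningful when they are negative.
\<close>
definition hausdorff_dim :: "'a::metric_space set \<Rightarrow> ereal" where
  "hausdorff_dim A =
     (if A = {} then -\<infinity> else Inf {ereal d | d. 0 < d \<and> hausdorff_measure d A = 0})"


section \<open>Local integrability and weak derivatives in the plane\<close>

definition locally_integrable ::
    "(complex \<Rightarrow> 'b::{banach, second_countable_topology}) \<Rightarrow> bool" where
  "locally_integrable f \<longleftrightarrow> (\<forall>S. compact S \<longrightarrow> set_integrable lebesgue S f)"

primrec Ck :: "nat \<Rightarrow> (complex \<Rightarrow> real) \<Rightarrow> bool" where
  "Ck 0 \<phi> \<longleftrightarrow> continuous_on UNIV \<phi>"
| "Ck (Suc k) \<phi> \<longleftrightarrow>
     (\<exists>\<phi>x \<phi>y. (\<forall>z. (\<phi> has_derivative (\<lambda>h. Re h * \<phi>x z + Im h * \<phi>y z)) (at z)) \<and>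
              Ck k \<phi>x \<and> Ck k \<phi>y)"

definition test_functions :: "(complex \<Rightarrow> real) set" where
  "test_functions = {\<phi>. (\<forall>k. Ck k \<phi>) \<and> compact (closure {z. \<phi> z \<noteq> 0})}"

text \<open>\<open>g\<close> is a weak derivative of \<open>f\<close> in the direction \<open>v\<close>.\<close>
definition has_weak_deriv ::
    "(complex \<Rightarrow> complex) \<Rightarrow> complex \<Rightarrow> (complex \<Rightarrow> complex) \<Rightarrow> bool" where
  "has_weak_deriv f v g \<longleftrightarrow> locally_integrable g \<and>
     (\<forall>\<phi>\<in>test_functions.
        (LINT z|lebesgue. frechet_derivative \<phi> (at z) v *\<^sub>R f z) = - (LINT z|lebesgue. \<phi> z *\<^sub>R g z))"

definition W11_loc :: "(complex \<Rightarrow> complex) \<Rightarrow> bool" where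
  "W11_loc f \<longleftrightarrow> locally_integrable f \<and>
     (\<exists>g. has_weak_deriv f 1 g) \<and> (\<exists>g. has_weak_deriv f \<i> g)"

text \<open>
  A representative of the weak derivative; weak derivatives are unique almost everywhere, and
  everything below depends on this choice only up to null sets.
\<close>
definition weak_deriv :: "(complex \<Rightarrow> complex) \<Rightarrow> complex \<Rightarrow> complex \<Rightarrow> complex" where
  "weak_deriv f v = (SOME g. has_weak_deriv f v g)"

definition weak_differential :: "(complex \<Rightarrow> complex) \<Rightarrow> complex \<Rightarrow> complex \<Rightarrow> complex" where
  "weak_differential f z = (\<lambda>h. Re h *\<^sub>R weak_deriv f 1 z + Im h *\<^sub>R weak_deriv f \<i> z)"

definition jacobian :: "(complex \<Rightarrow> complex) \<Rightarrow> complex \<Rightarrow> real" where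
  "jacobian f z = Re (weak_deriv f 1 z) * Im (weak_deriv f \<i> z)
                - Re (weak_deriv f \<i> z) * Im (weak_deriv f 1 z)"


section \<open>Mappings of exponentially integrable distortion\<close>

definition plane_homeomorphism :: "(complex \<Rightarrow> complex) \<Rightarrow> bool" where
  "plane_homeomorphism f \<longleftrightarrow> (\<exists>g. homeomorphism UNIV UNIV f g)"

text \<open>The local degree, computed by the winding number of the image of a small circle, is \<open>1\<close>.\<close>
definition sense_preserving :: "(complex \<Rightarrow> complex) \<Rightarrow> bool" where
  "sense_preserving f \<longleftrightarrow>
     (\<forall>z r. 0 < r \<longrightarrow> winding_number (f \<circ> circlepath z r) (f z) = 1)"

text \<open>
  A distortion function need only be finite almost everywhere; since all conditions hold up to
  null sets, it may be taken real-valued.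
\<close>
definition distortion_bound :: "(complex \<Rightarrow> complex) \<Rightarrow> (complex \<Rightarrow> real) \<Rightarrow> bool" where
  "distortion_bound f K \<longleftrightarrow> K \<in> borel_measurable lebesgue \<and> (\<forall>z. 1 \<le> K z) \<and>
     (AE z in lebesgue. (onorm (weak_differential f z))\<^sup>2 \<le> K z * jacobian f z)"

definition finite_distortion :: "(complex \<Rightarrow> complex) \<Rightarrow> bool" where
  "finite_distortion f \<longleftrightarrow> plane_homeomorphism f \<and> sense_preserving f \<and> W11_loc f \<and>
     locally_integrable (jacobian f) \<and> (\<exists>K. distortion_bound f K)"

text \<open>\<open>K\<close> is the smallest distortion function of \<open>f\<close>; it is unique almost everywhere.\<close>
definition is_distortion :: "(complex \<Rightarrow> complex) \<Rightarrow> (complex \<Rightarrow> real) \<Rightarrow> bool" where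
  "is_distortion f K \<longleftrightarrow> distortion_bound f K \<and>
     (\<forall>K'. distortion_bound f K' \<longrightarrow> (AE z in lebesgue. K z \<le> K' z))"

definition exp_integrable_distortion :: "real \<Rightarrow> (complex \<Rightarrow> complex) \<Rightarrow> bool" where
  "exp_integrable_distortion p f \<longleftrightarrow> finite_distortion f \<and>
     (\<exists>K. is_distortion f K \<and> locally_integrable (\<lambda>z. exp (p * K z)))"

definition compression_constant :: "real \<Rightarrow> bool" where
  "compression_constant C \<longleftrightarrow> 0 < C \<and>
     (\<forall>p f. 0 < p \<longrightarrow> exp_integrable_distortion p f \<longrightarrow> f 0 = 0 \<longrightarrow>
        (\<exists>c>0. \<forall>\<^sub>F z in at 0. c * exp (- (C / p) * (ln (1 / cmod z))\<^sup>2) \<le> cmod (f z)))"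


section \<open>Conformal modulus\<close>

definition curve_length :: "(real \<Rightarrow> complex) \<Rightarrow> real \<Rightarrow> real \<Rightarrow> ennreal" where
  "curve_length \<gamma> a b =
     (SUP ts\<in>{ts. sorted ts \<and> set ts \<subseteq> {a..b}}.
        \<Sum>i<length ts - 1. ennreal (dist (\<gamma> (ts ! i)) (\<gamma> (ts ! Suc i))))"

text \<open>Paths are parametrised by \<open>{0..1}\<close>, so rectifiable and locally rectifiable coincide.\<close>
definition rectifiable :: "(real \<Rightarrow> complex) \<Rightarrow> bool" where
  "rectifiable \<gamma> \<longleftrightarrow> path \<gamma> \<and> curve_length \<gamma> 0 1 < \<infinity>"

text \<open>
  The arc length parametrisation of a rectifiable \<open>\<gamma>\<close>; the choice of \<open>t\<close> is immaterial because
  \<open>\<gamma>\<close> is constant on the level sets of the length function.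
\<close>
definition arc_length_param :: "(real \<Rightarrow> complex) \<Rightarrow> real \<Rightarrow> complex" where
  "arc_length_param \<gamma> u = \<gamma> (SOME t. t \<in> {0..1} \<and> curve_length \<gamma> 0 t = ennreal u)"

definition line_integral :: "(complex \<Rightarrow> ennreal) \<Rightarrow> (real \<Rightarrow> complex) \<Rightarrow> ennreal" where
  "line_integral \<rho> \<gamma> =
     (\<integral>\<^sup>+u\<in>{0..enn2real (curve_length \<gamma> 0 1)}. \<rho> (arc_length_param \<gamma> u) \<partial>lborel)"

definition modulus :: "(real \<Rightarrow> complex) set \<Rightarrow> ennreal" where
  "modulus \<Gamma> =
     (INF \<rho>\<in>{\<rho> \<in> borel_measurable borel. \<forall>\<gamma>\<in>\<Gamma>. rectifiable \<gamma> \<longrightarrow> 1 \<le> line_integral \<rho> \<gamma>}.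
        \<integral>\<^sup>+z. (\<rho> z)\<^sup>2 \<partial>lborel)"

definition connecting_paths :: "complex set \<Rightarrow> complex set \<Rightarrow> (real \<Rightarrow> complex) set" where
  "connecting_paths E F = {\<gamma>. path \<gamma> \<and> pathstart \<gamma> \<in> E \<and> pathfinish \<gamma> \<in> F}"

definition continuum :: "complex set \<Rightarrow> bool" where
  "continuum E \<longleftrightarrow> compact E \<and> connected E \<and> E \<noteq> {}"

definition modulus_constant :: "real \<Rightarrow> bool" where
  "modulus_constant C \<longleftrightarrow> 0 < C \<and>
     (\<forall>E F. continuum E \<longrightarrow> continuum F \<longrightarrow> E \<inter> F = {} \<longrightarrow>
        ennreal (C * ln (1 + min (diameter E) (diameter F) / setdist E F))
          \<le> modulus (connecting_paths E F))"


section \<open>Branches of the argument\<close>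

text \<open>
  \<open>\<alpha> z \<lambda>\<close> is the chosen value of the argument of \<open>f (z + \<lambda>) - f z\<close>. Polar coordinates identify
  \<open>{0<..} \<times> {0..<2 * pi}\<close> bijectively with the nonzero \<open>\<lambda>\<close>; continuity is required in these
  coordinates only, so \<open>\<alpha> z\<close> may jump across the positive real axis.
\<close>
definition arg_branch ::
    "(complex \<Rightarrow> complex) \<Rightarrow> (complex \<Rightarrow> complex \<Rightarrow> real) \<Rightarrow> bool" where
  "arg_branch f \<alpha> \<longleftrightarrow>
     (\<forall>z. continuous_on ({0<..} \<times> {0..<2 * pi}) (\<lambda>(t, \<theta>). \<alpha> z (rcis t \<theta>)) \<and>
          (\<forall>l. l \<noteq> 0 \<longrightarrow> f (z + l) - f z = rcis (cmod (f (z + l) - f z)) (\<alpha> z l)))"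

end

theory Submission
  imports Defs "HOL-Real_Asymp.Real_Asymp"
begin

text \<open>
  Fix a point and suppose that the discs of radius \<open>\<rho>\<close> about it have mass at most \<open>C \<rho>\<^sup>d\<close> for the density
  \<open>exp (p K)\<close>. Average the variation of a logarithm of \<open>F v = f (c + v) - f c\<close> along the rays from \<open>exp (- X) w\<close>
  to \<open>w\<close> over the annulus \<open>1 \<le> |w| \<le> 2\<close>. By the Cauchy-Schwarz inequality its square is bounded by the
  product of the logarithmic area of the image and of the average of \<open>K\<close> over the shrinking annuli, and
  \<open>p K \<le> exp (p K - b) + b\<close> with \<open>b = (2 - d) s\<close> bounds the latter by \<open>(2 - d) X\<^sup>2 / (2 p) + O(X)\<close>. The area is
  \<open>O(ln (1 / |F|))\<close>. The compression bound is used only qualitatively: a logarithm of \<open>F\<close> oscillates by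
  \<open>O(X powr (3/2))\<close> on each annulus, so its real part satisfies a recursion, and both the real part and the argument are at most
  \<open>4 / 3 * (2 - d) / p * X\<^sup>2 + o(X\<^sup>2)\<close>. Fast rotation therefore forces \<open>d\<close> to be small, and the points whose
  discs have mass at least \<open>\<rho>\<^sup>d\<close> at arbitrarily small scales form a set of dimension at most \<open>d\<close> by Vitali's
  covering theorem. Testing the modulus on two discs gives \<open>Ctilde \<le> 14\<close>, which compares the constants.
\<close>

text \<open>Two obstacles shape the argument. Bounds by weak derivatives hold on almost every curve
  only, so the averaging yields one good ray, which depends on the scale, whereas the rotation is
  prescribed at arbitrary points. To pass from the ray to these points, good circles bound the
  oscillation of a logarithm on discs: an injective map has its largest image distances on the
  boundary. Each annulus is then crossed by a fixed number of such discs, at a cost of order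
  \<open>X powr (3/2)\<close>, negligible against the main term.

  Secondly, the logarithmic area needs a lower bound \<open>exp (- Y)\<close> for
  \<open>cmod (F v)\<close> at all scales up to \<open>X\<close> at once. So \<open>Y\<close> comes
  from a minimiser over the whole region, which may lie at any intermediate scale. The bound
  \<open>H_bound\<close> is uniform over these scales and therefore applies at the minimiser itself,
  which closes the recursion: \<open>Y\<close> is at most a multiple of \<open>X * sqrt Y\<close>
  plus lower order terms.

  The factor \<open>4 / 3\<close> is pure bookkeeping: the annulus has area \<open>3 * pi\<close>,
  the bound \<open>cmod w \<le> 2\<close> enters squared, and the time \<open>ln 2\<close> is
  rounded up to 1.\<close>

section \<open>Limits of smooth maps\<close>

definition v2c :: "real^2 \<Rightarrow> complex" where "v2c x = Complex (vec_nth x 1) (vec_nth x 2)"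
definition c2v :: "complex \<Rightarrow> real^2" where "c2v z = vector [Re z, Im z]"

lemma v2c_c2v [simp]: "v2c (c2v z) = z" "c2v (v2c x) = x"
  by (auto simp: v2c_def c2v_def vec_eq_iff forall_2)

lemma linear_v2c: "linear v2c" and linear_c2v: "linear c2v"
  by (auto intro!: linearI simp: v2c_def c2v_def vec_eq_iff forall_2 complex_eq_iff)

lemma bounded_linear_v2c: "bounded_linear v2c" and bounded_linear_c2v: "bounded_linear c2v"
  using linear_v2c linear_c2v linear_linear by blast+

lemma continuous_on_v2c: "continuous_on S v2c" and continuous_on_c2v: "continuous_on S' c2v"
  using bounded_linear_v2c bounded_linear_c2v linear_continuous_on by blast+

lemma borel_v2c [measurable]: "v2c \<in> borel \<rightarrow>\<^sub>M borel" and borel_c2v [measurable]: "c2v \<in> borel \<rightarrow>\<^sub>M borel"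
  by (auto intro!: borel_measurable_continuous_onI continuous_on_v2c continuous_on_c2v)

text \<open>Determinants and the change of variables formula live on \<open>real^2\<close>, while
  everything else is stated over the complex numbers. Agreement on boxes is enough to identify the
  two measures.\<close>

lemma distr_v2c: "distr lborel borel v2c = lborel"
proof (rule lborel_eqI[symmetric])
  fix l u :: complex assume le: "\<And>b. b \<in> Basis \<Longrightarrow> l \<bullet> b \<le> u \<bullet> b"
  have e: "v2c -` box l u = box (c2v l) (c2v u)"
    by (auto simp: mem_box_cart in_box_complex_iff v2c_def c2v_def forall_2)
  have le': "\<And>b. b \<in> Basis \<Longrightarrow> c2v l \<bullet> b \<le> c2v u \<bullet> b"
  proof -
    fix b :: "real^2" assume "b \<in> Basis"
    then obtain i where "b = axis i 1" by (auto simp: Basis_vec_def)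
    then show "c2v l \<bullet> b \<le> c2v u \<bullet> b"
      using le[of 1] le[of \<i>] exhaust_2[of i] by (auto simp: c2v_def inner_axis Basis_complex_def)
  qed
  have "emeasure (distr lborel borel v2c) (box l u) = emeasure lborel (box (c2v l) (c2v u))"
    by (subst emeasure_distr) (auto simp: e)
  also have "\<dots> = ennreal (\<Prod>b\<in>Basis. (c2v u - c2v l) \<bullet> b)"
    using le' by (simp add: emeasure_lborel_box_eq)
  also have "(\<Prod>b\<in>Basis. (c2v u - c2v l) \<bullet> b) = (\<Prod>i\<in>UNIV. vec_nth (c2v u - c2v l) i)"
    by (subst prod.reindex_cong[of "\<lambda>i. axis i 1" UNIV]) (auto simp: Basis_vec_def inner_axis inj_on_def axis_eq_axis)
  also have "\<dots> = (\<Prod>b\<in>Basis. (u - l) \<bullet> b)"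
    by (simp add: UNIV_2 c2v_def Basis_complex_def)
  finally show "emeasure (distr lborel borel v2c) (box l u) = ennreal (\<Prod>b\<in>Basis. (u - l) \<bullet> b)" .
qed simp

lemma emeasure_v2c_vimage:
  assumes "A \<in> sets borel"
  shows "emeasure lborel (v2c -` A) = emeasure lborel A"
  using assms emeasure_distr[of v2c lborel borel A] by (simp add: distr_v2c)

text \<open>Multiplication by \<open>inverse a\<close> acts on \<open>real^2\<close> as a similarity
  whose determinant is the inverse square of the modulus of \<open>a\<close>. The set enters through
  its preimage, which is Borel at once; boundedness makes both sides finite, and boxes are all that
  the next lemma needs.\<close>

lemma emeasure_lborel_affine_image:
  fixes A :: "complex set"
  assumes A: "A \<in> sets borel" "bounded A" and a: "a \<noteq> 0"
  shows "emeasure lborel ((\<lambda>w. a * w) -` A) * ennreal ((cmod a)\<^sup>2) = emeasure lborel A"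
proof -
  note that = a
  define g where "g = (\<lambda>x. c2v (inverse a * v2c x))"
  have lin: "linear g"
    unfolding g_def using linear_compose[OF linear_compose[OF linear_v2c, of "\<lambda>z. inverse a * z"] linear_c2v]
    by (simp add: o_def linear_times)
  have B: "v2c -` A \<in> sets borel" "c2v ` A = v2c -` A"
    using A(1) measurable_sets[OF borel_v2c A(1)] by (auto intro: image_eqI[of _ _ "v2c _"])
  have lm: "v2c -` A \<in> lmeasurable"
    using B A(2) bounded_linear_image[OF A(2) bounded_linear_c2v] by (intro bounded_set_imp_lmeasurable) auto
  have img: "g ` (v2c -` A) = v2c -` ((\<lambda>w. a * w) -` A)"
  proof (intro subset_antisym subsetI)
    fix y assume "y \<in> g ` (v2c -` A)"
    then show "y \<in> v2c -` ((\<lambda>w. a * w) -` A)" using that by (auto simp: g_def simp flip: mult.assoc)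
  next
    fix x assume *: "x \<in> v2c -` ((\<lambda>w. a * w) -` A)"
    have "x = g (c2v (a * v2c x))" using that by (simp add: g_def flip: mult.assoc)
    with * show "x \<in> g ` (v2c -` A)" by (metis imageI vimageI2 v2c_c2v(1) vimageE)
  qed
  have A': "(\<lambda>w. a * w) -` A \<in> sets borel"
    using measurable_sets[of "\<lambda>w. a * w" borel borel, OF _ A(1)] by simp
  have det: "\<bar>det (matrix g)\<bar> = inverse ((cmod a)\<^sup>2)"
  proof -
    define b where "b = inverse a"
    have "\<bar>det (matrix g)\<bar> = (cmod b)\<^sup>2"
      unfolding det_2 matrix_def g_def v2c_def c2v_def b_def[symmetric] cmod_power2
      by (simp add: axis_def power2_eq_square)
    then show ?thesis by (simp add: b_def norm_inverse power_inverse)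
  qed
  have mi: "measure lebesgue (g ` (v2c -` A)) = \<bar>det (matrix g)\<bar> * measure lebesgue (v2c -` A)"
    "g ` (v2c -` A) \<in> lmeasurable"
    using measure_linear_image[OF lin lm] measurable_linear_image[OF lin lm] by auto
  have "emeasure lborel ((\<lambda>w. a * w) -` A) = emeasure lebesgue (g ` (v2c -` A))"
    unfolding img by (subst emeasure_v2c_vimage[symmetric, OF A']) (use measurable_sets[OF borel_v2c A'] in simp)
  also have "\<dots> = ennreal (inverse ((cmod a)\<^sup>2)) * ennreal (measure lebesgue (v2c -` A))"
    using mi det by (simp add: emeasure_eq_measure2 ennreal_mult)
  also have "ennreal (measure lebesgue (v2c -` A)) = emeasure lborel A"
    using emeasure_eq_measure2[OF lm] B(1) emeasure_v2c_vimage[OF A(1)] by simp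
  finally show ?thesis using that
    by (simp add: mult.commute mult.left_commute flip: ennreal_mult mult.assoc)
qed

lemma lborel_complex_affine:
  fixes a c :: complex assumes "a \<noteq> 0"
  shows "lborel = density (distr lborel borel (\<lambda>w. c + a * w)) (\<lambda>_. ennreal ((cmod a)\<^sup>2))"
proof (rule lborel_eqI)
  fix l u :: complex assume le: "\<And>b. b \<in> Basis \<Longrightarrow> l \<bullet> b \<le> u \<bullet> b"
  have "(\<lambda>w. c + a * w) -` box l u = (\<lambda>w. a * w) -` box (l - c) (u - c)"
    by (auto simp: in_box_complex_iff)
  then show "emeasure (density (distr lborel borel (\<lambda>w. c + a * w)) (\<lambda>_. ennreal ((cmod a)\<^sup>2))) (box l u)
      = ennreal (\<Prod>b\<in>Basis. (u - l) \<bullet> b)"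
    using emeasure_lborel_affine_image[OF _ bounded_box assms, of "l - c" "u - c"] le
    by (simp add: emeasure_density_const emeasure_distr mult.commute emeasure_lborel_box_eq algebra_simps)
qed simp

lemma nn_integral_complex_affine:
  fixes a c :: complex
  assumes "a \<noteq> 0" and [measurable]: "g \<in> borel_measurable borel"
  shows "(\<integral>\<^sup>+v. g v \<partial>lborel) = ennreal ((cmod a)\<^sup>2) * (\<integral>\<^sup>+w. g (c + a * w) \<partial>lborel)"
  by (subst lborel_complex_affine[OF assms(1), of c])
     (simp add: nn_integral_density nn_integral_distr nn_integral_cmult)

lemma cball_borel [measurable]: "cball (c::'a::euclidean_space) r \<in> sets borel"
  by simp

text \<open>
  The \<open>W\<^sup>1\<^sup>,\<^sup>1\<close>-closure of the \<open>C\<^sup>1\<close> maps. Inequalities between images and derivatives are proved for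
  the approximations and survive the limit, which replaces the theory of absolute continuity on lines.
\<close>
definition C1_limit :: "(complex \<Rightarrow> complex) \<Rightarrow> (complex \<Rightarrow> complex) \<Rightarrow> (complex \<Rightarrow> complex) \<Rightarrow> bool" where
  "C1_limit u ux uy \<longleftrightarrow> continuous_on UNIV u \<and> ux \<in> borel_measurable borel \<and> uy \<in> borel_measurable borel \<and>
     (\<exists>\<phi> \<phi>x \<phi>y. (\<forall>n z. (\<phi> n has_derivative (\<lambda>h. Re h *\<^sub>R \<phi>x n z + Im h *\<^sub>R \<phi>y n z)) (at z)) \<and>
        (\<forall>n::nat. continuous_on UNIV (\<phi>x n)) \<and> (\<forall>n. continuous_on UNIV (\<phi>y n)) \<and>
        (\<forall>R. uniform_limit (cball 0 R) \<phi> u sequentially) \<and>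
        (\<forall>R. (\<lambda>n. \<integral>\<^sup>+z. ennreal (cmod (\<phi>x n z - ux z) + cmod (\<phi>y n z - uy z)) * indicator (cball 0 R) z \<partial>lborel)
           \<longlonglongrightarrow> 0))"

section \<open>Bounds along almost every curve\<close>

lemma norm_FTC_le_nn_integral:
  fixes F :: "real \<Rightarrow> complex"
  assumes "a \<le> b" "\<And>x. (F has_vector_derivative k x) (at x)" "continuous_on {a..b} k"
  shows "ennreal (cmod (F b - F a)) \<le> (\<integral>\<^sup>+x. ennreal (cmod (k x)) * indicator {a..b} x \<partial>lborel)"
proof -
  have "integral\<^sup>L lborel (\<lambda>x. indicator {a..b} x *\<^sub>R k x) = F b - F a"
    using assms by (intro integral_FTC_atLeastAtMost) (auto intro: has_vector_derivative_at_within)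
  moreover have "integrable lborel (\<lambda>x. indicator {a..b} x *\<^sub>R k x)"
    using borel_integrable_atLeastAtMost'[OF assms(3)] by (simp add: set_integrable_def)
  ultimately have "ennreal (cmod (F b - F a)) \<le> (\<integral>\<^sup>+x. ennreal (cmod (indicator {a..b} x *\<^sub>R k x)) \<partial>lborel)"
    using integral_norm_bound_ennreal by metis
  also have "\<dots> = (\<integral>\<^sup>+x. ennreal (cmod (k x)) * indicator {a..b} x \<partial>lborel)"
    by (intro nn_integral_cong) (auto simp: indicator_def)
  finally show ?thesis .
qed

text \<open>Without passing to a subsequence, Fatou's lemma makes only the lower limit of the errors
  vanish. For an upper bound of a convergent sequence that is enough.\<close>

lemma LIMSEQ_le_plus_liminf_zero:
  fixes a G :: "nat \<Rightarrow> ennreal"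
  assumes "a \<longlonglongrightarrow> l" "\<And>n. a n \<le> I + G n" "liminf G = 0"
  shows "l \<le> I"
proof (rule ccontr)
  assume "\<not> l \<le> I"
  then obtain m where m: "I < m" "m < l" using dense not_le by metis
  have "\<forall>\<^sub>F n in sequentially. m - I \<le> G n"
    using order_tendstoD(1)[OF assms(1) m(2)]
  proof eventually_elim
    case (elim n)
    then have "m \<le> G n + I" using assms(2)[of n] by (simp add: add.commute)
    then show ?case using m(1) by (auto simp: ennreal_minus_le_iff add.commute)
  qed
  then have "m - I \<le> liminf G" by (rule Liminf_bounded)
  with assms(3) m(1) show False
    by (auto simp: diff_eq_0_iff_ennreal dest: leD)
qed

text \<open>The exponent \<open>\<zeta> = - 1\<close> gives rays running into \<open>c\<close>, and
  \<open>\<zeta> = \<i>\<close> gives circles about \<open>c\<close>. For fixed \<open>s\<close> the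
  points are affine in \<open>w\<close>, so after the exchange the inner integral is an affine
  change of variables.\<close>

lemma nn_integral_path_swap:
  fixes \<zeta> c :: complex and N :: "complex \<Rightarrow> ennreal"
  assumes [measurable]: "N \<in> borel_measurable borel" "W \<in> sets borel"
  shows "(\<integral>\<^sup>+w. (\<integral>\<^sup>+s. N (c + exp (\<zeta> * complex_of_real s) * w) * ennreal (cmod (\<zeta> * exp (\<zeta> * s) * w)) * indicator {a..b} s \<partial>lborel)
              * indicator W w \<partial>lborel)
       = (\<integral>\<^sup>+s. (\<integral>\<^sup>+w. N (c + exp (\<zeta> * complex_of_real s) * w) * ennreal (cmod (\<zeta> * exp (\<zeta> * s) * w)) * indicator W w \<partial>lborel)
              * indicator {a..b} s \<partial>lborel)"
proof -
  define \<gamma> where "\<gamma> w s = c + exp (\<zeta> * of_real s) * w" for w and s :: real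
  define \<gamma>' where "\<gamma>' w s = \<zeta> * exp (\<zeta> * of_real s) * w" for w and s :: real
  have [measurable]: "(\<lambda>p. \<gamma> (fst p) (snd p)) \<in> borel \<Otimes>\<^sub>M borel \<rightarrow>\<^sub>M borel"
     "(\<lambda>p. \<gamma>' (fst p) (snd p)) \<in> borel \<Otimes>\<^sub>M borel \<rightarrow>\<^sub>M borel"
    unfolding \<gamma>_def \<gamma>'_def borel_prod by (intro borel_measurable_continuous_onI continuous_intros)+
  have [measurable]: "\<gamma> w \<in> borel_measurable borel" "\<gamma>' w \<in> borel_measurable borel" for w
    unfolding \<gamma>_def \<gamma>'_def by (intro borel_measurable_continuous_onI continuous_intros)+
  have [measurable]: "(\<lambda>w. \<gamma> w s) \<in> borel_measurable borel" "(\<lambda>w. \<gamma>' w s) \<in> borel_measurable borel" for s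
    unfolding \<gamma>_def \<gamma>'_def by measurable
  have "(\<integral>\<^sup>+w. (\<integral>\<^sup>+s. N (\<gamma> w s) * ennreal (cmod (\<gamma>' w s)) * indicator {a..b} s \<partial>lborel) * indicator W w \<partial>lborel)
     = (\<integral>\<^sup>+w. \<integral>\<^sup>+s. N (\<gamma> w s) * ennreal (cmod (\<gamma>' w s)) * indicator {a..b} s * indicator W w \<partial>lborel \<partial>lborel)"
    by (intro nn_integral_cong nn_integral_multc[symmetric]) measurable
  also have "\<dots> = (\<integral>\<^sup>+s. \<integral>\<^sup>+w. N (\<gamma> w s) * ennreal (cmod (\<gamma>' w s)) * indicator {a..b} s * indicator W w \<partial>lborel \<partial>lborel)"
  proof (rule lborel_pair.Fubini')
    have "(\<lambda>p. N (\<gamma> (fst p) (snd p)) * ennreal (cmod (\<gamma>' (fst p) (snd p))) * indicator {a..b} (snd p) * indicator W (fst p))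
      \<in> borel_measurable (borel \<Otimes>\<^sub>M borel)"
      by measurable
    from measurable_pair_swap[OF this] show "(\<lambda>(s, w). N (\<gamma> w s) * ennreal (cmod (\<gamma>' w s)) * indicator {a..b} s * indicator W w)
        \<in> borel_measurable (lborel \<Otimes>\<^sub>M lborel)"
      by (simp add: case_prod_beta cong: measurable_cong_sets)
  qed
  also have "\<dots> = (\<integral>\<^sup>+s. (\<integral>\<^sup>+w. N (\<gamma> w s) * ennreal (cmod (\<gamma>' w s)) * indicator W w \<partial>lborel) * indicator {a..b} s \<partial>lborel)"
    by (intro nn_integral_cong, subst nn_integral_multc[symmetric]) (auto simp: mult_ac)
  finally show ?thesis unfolding \<gamma>_def \<gamma>'_def .
qed

text \<open>This is Fuglede's lemma for the curves above. Convergence of the gradients in the mean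
  on discs makes the errors \<open>G n w\<close> along the curves small in the mean over
  \<open>w\<close>, so their lower limit vanishes for almost every \<open>w\<close>. As
  \<open>G\<close> integrates over all of \<open>{0..S}\<close>, the exceptional set does not depend
  on \<open>s1\<close> and \<open>s2\<close>.\<close>

lemma C1_limit_path_bound:
  fixes \<zeta> c :: complex and S :: real and N :: "complex \<Rightarrow> ennreal"
  assumes lim: "C1_limit u ux uy" and S: "0 \<le> S"
    and N [measurable]: "N \<in> borel_measurable borel"
    and bd: "\<And>z h. ennreal (cmod (Re h *\<^sub>R ux z + Im h *\<^sub>R uy z)) \<le> N z * ennreal (cmod h)"
  shows "AE w in lborel. \<forall>s1 s2::real. 0 \<le> s1 \<longrightarrow> s1 \<le> s2 \<longrightarrow> s2 \<le> S \<longrightarrow>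
     ennreal (cmod (u (c + exp (\<zeta> * complex_of_real s2) * w) - u (c + exp (\<zeta> * complex_of_real s1) * w)))
     \<le> (\<integral>\<^sup>+s. N (c + exp (\<zeta> * complex_of_real s) * w) * ennreal (cmod (\<zeta> * exp (\<zeta> * complex_of_real s) * w)) * indicator {s1..s2} s \<partial>lborel)"
proof -
  obtain \<phi> \<phi>x \<phi>y where
    der: "\<And>n z. (\<phi> n has_derivative (\<lambda>h. Re h *\<^sub>R \<phi>x n z + Im h *\<^sub>R \<phi>y n z)) (at z)"
    and cx: "\<And>n::nat. continuous_on UNIV (\<phi>x n)" and cy: "\<And>n. continuous_on UNIV (\<phi>y n)"
    and ul: "\<And>R. uniform_limit (cball 0 R) \<phi> u sequentially"
    and L1: "\<And>R. (\<lambda>n. \<integral>\<^sup>+z. ennreal (cmod (\<phi>x n z - ux z) + cmod (\<phi>y n z - uy z)) * indicator (cball 0 R) z \<partial>lborel)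
           \<longlonglongrightarrow> 0"
    and [measurable]: "ux \<in> borel_measurable borel" "uy \<in> borel_measurable borel"
    using lim unfolding C1_limit_def by blast
  have [measurable]: "\<phi>x n \<in> borel_measurable borel" "\<phi>y n \<in> borel_measurable borel" for n
    using cx cy borel_measurable_continuous_onI by auto
  define E where "E n z = ennreal (cmod (\<phi>x n z - ux z) + cmod (\<phi>y n z - uy z))" for n z
  have [measurable]: "E n \<in> borel_measurable borel" for n unfolding E_def by measurable
  define \<gamma> where "\<gamma> w s = c + exp (\<zeta> * of_real s) * w" for w and s :: real
  define \<gamma>' where "\<gamma>' w s = \<zeta> * exp (\<zeta> * of_real s) * w" for w and s :: real
  have der\<gamma>: "(\<gamma> w has_vector_derivative \<gamma>' w s) (at s)" for w s
    unfolding \<gamma>_def \<gamma>'_def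
    by (rule has_vector_derivative_real_field) (auto intro!: derivative_eq_intros)
  have c\<gamma>: "continuous_on T (\<gamma> w)" "continuous_on T (\<gamma>' w)" for w T
    unfolding \<gamma>_def \<gamma>'_def by (intro continuous_intros)+
  have [measurable]: "(\<lambda>p. \<gamma> (fst p) (snd p)) \<in> borel \<Otimes>\<^sub>M borel \<rightarrow>\<^sub>M borel"
     "(\<lambda>p. \<gamma>' (fst p) (snd p)) \<in> borel \<Otimes>\<^sub>M borel \<rightarrow>\<^sub>M borel"
    unfolding \<gamma>_def \<gamma>'_def borel_prod by (intro borel_measurable_continuous_onI continuous_intros)+
  have [measurable]: "\<gamma> w \<in> borel_measurable borel" "\<gamma>' w \<in> borel_measurable borel" for w
    by (intro borel_measurable_continuous_onI c\<gamma>)+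
  have [measurable]: "(\<lambda>w. \<gamma> w s) \<in> borel_measurable borel" "(\<lambda>w. \<gamma>' w s) \<in> borel_measurable borel" for s
    unfolding \<gamma>_def \<gamma>'_def by measurable
  define G where "G n w = (\<integral>\<^sup>+s. E n (\<gamma> w s) * ennreal (cmod (\<gamma>' w s)) * indicator {0..S} s \<partial>lborel)" for n w
  have measG2: "(\<lambda>p. E n (\<gamma> (fst p) (snd p)) * ennreal (cmod (\<gamma>' (fst p) (snd p))) * indicator {0..S} (snd p))
      \<in> borel_measurable (borel \<Otimes>\<^sub>M borel)" for n
    by measurable
  have [measurable]: "G n \<in> borel_measurable borel" for n
    unfolding G_def using measG2[of n]
    by (intro sigma_finite_measure.borel_measurable_nn_integral[OF sigma_finite_lborel])
       (simp add: case_prod_beta measurable_lborel1 cong: measurable_cong_sets)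
  \<comment> \<open>\<open>A\<close> bounds the modulus of \<open>exp (\<zeta> * s)\<close> and of
    its inverse for \<open>s\<close> in \<open>{0..S}\<close>, hence both the speed of the curves
    and the Jacobian of the affine map.\<close>
  define A where "A = exp (cmod \<zeta> * S)"
  have A1: "1 \<le> A" unfolding A_def using S by simp
  have ea: "inverse A \<le> cmod (exp (\<zeta> * of_real s))" "cmod (exp (\<zeta> * of_real s)) \<le> A" if "s \<in> {0..S}" for s
  proof -
    have "\<bar>Re \<zeta> * s\<bar> \<le> cmod \<zeta> * S"
      unfolding abs_mult using that by (intro mult_mono abs_Re_le_cmod) auto
    then show "inverse A \<le> cmod (exp (\<zeta> * of_real s))" "cmod (exp (\<zeta> * of_real s)) \<le> A"
      unfolding A_def by (auto simp: norm_exp_eq_Re simp flip: exp_minus)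
  qed
  have bound1: "ennreal (cmod (\<phi> n (\<gamma> w s2) - \<phi> n (\<gamma> w s1)))
      \<le> (\<integral>\<^sup>+s. N (\<gamma> w s) * ennreal (cmod (\<gamma>' w s)) * indicator {s1..s2} s \<partial>lborel) + G n w"
    if s: "0 \<le> s1" "s1 \<le> s2" "s2 \<le> S" for n w s1 s2
  proof -
    let ?k = "\<lambda>s. Re (\<gamma>' w s) *\<^sub>R \<phi>x n (\<gamma> w s) + Im (\<gamma>' w s) *\<^sub>R \<phi>y n (\<gamma> w s)"
    have "((\<lambda>s. \<phi> n (\<gamma> w s)) has_vector_derivative ?k s) (at s)" for s
      using diff_chain_at[OF der\<gamma>[of w s, unfolded has_vector_derivative_def] der[of n "\<gamma> w s"]]
      by (simp add: has_vector_derivative_def o_def algebra_simps)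
    moreover have "continuous_on {s1..s2} ?k"
      by (intro continuous_intros c\<gamma> continuous_on_compose2[OF cx c\<gamma>(1)] continuous_on_compose2[OF cy c\<gamma>(1)]) auto
    ultimately have "ennreal (cmod (\<phi> n (\<gamma> w s2) - \<phi> n (\<gamma> w s1)))
        \<le> (\<integral>\<^sup>+s. ennreal (cmod (?k s)) * indicator {s1..s2} s \<partial>lborel)"
      by (intro norm_FTC_le_nn_integral s)
    also have "\<dots> \<le> (\<integral>\<^sup>+s. N (\<gamma> w s) * ennreal (cmod (\<gamma>' w s)) * indicator {s1..s2} s
        + E n (\<gamma> w s) * ennreal (cmod (\<gamma>' w s)) * indicator {0..S} s \<partial>lborel)"
    proof (intro nn_integral_mono)
      fix s
      let ?h = "\<gamma>' w s" and ?z = "\<gamma> w s"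
      have "cmod (?k s) \<le> cmod (Re ?h *\<^sub>R ux ?z + Im ?h *\<^sub>R uy ?z)
           + cmod (Re ?h *\<^sub>R (\<phi>x n ?z - ux ?z) + Im ?h *\<^sub>R (\<phi>y n ?z - uy ?z))"
        by (rule order_trans[OF _ norm_triangle_ineq]) (simp add: algebra_simps)
      also have "cmod (Re ?h *\<^sub>R (\<phi>x n ?z - ux ?z) + Im ?h *\<^sub>R (\<phi>y n ?z - uy ?z))
          \<le> cmod ?h * cmod (\<phi>x n ?z - ux ?z) + cmod ?h * cmod (\<phi>y n ?z - uy ?z)"
        by (rule order_trans[OF norm_triangle_ineq])
           (auto intro!: add_mono mult_right_mono abs_Re_le_cmod abs_Im_le_cmod)
      finally have "ennreal (cmod (?k s)) \<le> ennreal (cmod (Re ?h *\<^sub>R ux ?z + Im ?h *\<^sub>R uy ?z)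
          + (cmod (\<phi>x n ?z - ux ?z) + cmod (\<phi>y n ?z - uy ?z)) * cmod ?h)"
        by (intro ennreal_leI) (simp add: distrib_left mult.commute)
      also have "\<dots> = ennreal (cmod (Re ?h *\<^sub>R ux ?z + Im ?h *\<^sub>R uy ?z))
          + ennreal ((cmod (\<phi>x n ?z - ux ?z) + cmod (\<phi>y n ?z - uy ?z)) * cmod ?h)"
        by (rule ennreal_plus) auto
      also have "\<dots> \<le> N ?z * ennreal (cmod ?h) + E n ?z * ennreal (cmod ?h)"
        unfolding E_def by (intro add_mono bd) (simp add: ennreal_mult)
      finally show "ennreal (cmod (?k s)) * indicator {s1..s2} s \<le>
         N ?z * ennreal (cmod ?h) * indicator {s1..s2} s + E n ?z * ennreal (cmod ?h) * indicator {0..S} s"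
        using s by (auto simp: indicator_def)
    qed
    also have "\<dots> = (\<integral>\<^sup>+s. N (\<gamma> w s) * ennreal (cmod (\<gamma>' w s)) * indicator {s1..s2} s \<partial>lborel) + G n w"
      unfolding G_def by (intro nn_integral_add) auto
    finally show ?thesis .
  qed
  have G0: "(\<lambda>n. \<integral>\<^sup>+w. G n w * indicator (cball 0 R) w \<partial>lborel) \<longlonglongrightarrow> 0" if R: "0 \<le> R" for R
  proof -
    \<comment> \<open>All curves that start in the disc of radius \<open>R\<close> stay in the disc
      of radius \<open>R'\<close> about the origin.\<close>
    define R' where "R' = cmod c + A * R"
    define I where "I n = (\<integral>\<^sup>+z. E n z * indicator (cball 0 R') z \<partial>lborel)" for n
    have le: "(\<integral>\<^sup>+w. G n w * indicator (cball 0 R) w \<partial>lborel) \<le> ennreal (cmod \<zeta> * A * R * A\<^sup>2 * S) * I n" for n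
    proof -
      have "(\<integral>\<^sup>+w. G n w * indicator (cball 0 R) w \<partial>lborel)
         = (\<integral>\<^sup>+s. (\<integral>\<^sup>+w. E n (\<gamma> w s) * ennreal (cmod (\<gamma>' w s)) * indicator (cball 0 R) w \<partial>lborel) * indicator {0..S} s \<partial>lborel)"
        unfolding G_def \<gamma>_def \<gamma>'_def using nn_integral_path_swap[of "E n" "cball 0 R" c \<zeta> 0 S] by simp
      also have "\<dots> \<le> (\<integral>\<^sup>+s. ennreal (cmod \<zeta> * A * R * A\<^sup>2) * I n * indicator {0..S} s \<partial>lborel)"
      proof (intro nn_integral_mono)
        fix s :: real
        show "(\<integral>\<^sup>+w. E n (\<gamma> w s) * ennreal (cmod (\<gamma>' w s)) * indicator (cball 0 R) w \<partial>lborel) * indicator {0..S} s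
            \<le> ennreal (cmod \<zeta> * A * R * A\<^sup>2) * I n * indicator {0..S} s"
        proof (cases "s \<in> {0..S}")
          case True
          define a where "a = exp (\<zeta> * of_real s)"
          have a: "a \<noteq> 0" "inverse A \<le> cmod a" "cmod a \<le> A" using ea[OF True] by (auto simp: a_def)
          have "(\<integral>\<^sup>+w. E n (\<gamma> w s) * ennreal (cmod (\<gamma>' w s)) * indicator (cball 0 R) w \<partial>lborel)
             \<le> (\<integral>\<^sup>+w. ennreal (cmod \<zeta> * A * R) * (E n (c + a * w) * indicator (cball 0 R') (c + a * w)) \<partial>lborel)"
          proof (intro nn_integral_mono)
            fix w
            show "E n (\<gamma> w s) * ennreal (cmod (\<gamma>' w s)) * indicator (cball 0 R) w
              \<le> ennreal (cmod \<zeta> * A * R) * (E n (c + a * w) * indicator (cball 0 R') (c + a * w))"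
            proof (cases "cmod w \<le> R")
              case wR: True
              have aw: "cmod a * cmod w \<le> A * R" using a wR A1 by (intro mult_mono) auto
              then have 1: "c + a * w \<in> cball 0 R'"
                unfolding R'_def using norm_triangle_ineq[of c "a * w"] by (auto simp: norm_mult)
              have "cmod (\<gamma>' w s) \<le> cmod \<zeta> * A * R"
                using mult_left_mono[OF aw norm_ge_zero[of \<zeta>]] by (simp add: \<gamma>'_def a_def norm_mult mult.assoc)
              then have "E n (\<gamma> w s) * ennreal (cmod (\<gamma>' w s)) \<le> E n (\<gamma> w s) * ennreal (cmod \<zeta> * A * R)"
                by (intro mult_left_mono ennreal_leI) auto
              then show ?thesis using 1 True wR by (simp add: \<gamma>_def a_def mult.commute)
            qed auto
          qed
          also have "\<dots> = ennreal (cmod \<zeta> * A * R) * (\<integral>\<^sup>+w. E n (c + a * w) * indicator (cball 0 R') (c + a * w) \<partial>lborel)"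
            by (intro nn_integral_cmult) measurable
          also have "\<dots> \<le> ennreal (cmod \<zeta> * A * R) * (ennreal (A\<^sup>2) * I n)"
          proof (intro mult_left_mono)
            have "(\<integral>\<^sup>+w. E n (c + a * w) * indicator (cball 0 R') (c + a * w) \<partial>lborel)
              \<le> ennreal (A\<^sup>2) * (ennreal ((cmod a)\<^sup>2) * (\<integral>\<^sup>+w. E n (c + a * w) * indicator (cball 0 R') (c + a * w) \<partial>lborel))"
            proof -
              have "1 \<le> A * cmod a" using a(2) A1 by (simp add: field_simps)
              then have "1 \<le> A\<^sup>2 * (cmod a)\<^sup>2" by (metis power_mult_distrib one_le_power)
              then have "1 \<le> ennreal (A\<^sup>2) * ennreal ((cmod a)\<^sup>2)"
                by (simp flip: ennreal_mult ennreal_1 add: ennreal_leI del: ennreal_1)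
              from mult_right_mono[OF this] show ?thesis by (simp add: mult.assoc)
            qed
            also have "\<dots> = ennreal (A\<^sup>2) * I n"
              unfolding I_def by (subst nn_integral_complex_affine[OF a(1), of "\<lambda>z. E n z * indicator (cball 0 R') z" c]) auto
            finally show "(\<integral>\<^sup>+w. E n (c + a * w) * indicator (cball 0 R') (c + a * w) \<partial>lborel) \<le> ennreal (A\<^sup>2) * I n" .
          qed simp
          also have "ennreal (cmod \<zeta> * A * R) * (ennreal (A\<^sup>2) * I n) = ennreal (cmod \<zeta> * A * R * A\<^sup>2) * I n * indicator {0..S} s"
            using True A1 R by (simp add: ennreal_mult mult.assoc)
          finally show ?thesis using True by simp
        qed auto
      qed
      also have "\<dots> = ennreal (cmod \<zeta> * A * R * A\<^sup>2) * I n * emeasure lborel {0..S}"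
        by (subst nn_integral_cmult) auto
      also have "\<dots> = ennreal (cmod \<zeta> * A * R * A\<^sup>2 * S) * I n"
        using S A1 R by (simp add: ennreal_mult mult_ac)
      finally show ?thesis .
    qed
    have lm: "(\<lambda>n. ennreal (cmod \<zeta> * A * R * A\<^sup>2 * S) * I n) \<longlonglongrightarrow> 0"
      using ennreal_tendsto_cmult[OF _ L1[of R'], of "ennreal (cmod \<zeta> * A * R * A\<^sup>2 * S)"]
      unfolding I_def E_def by simp
    show ?thesis
      by (rule tendsto_sandwich[OF always_eventually always_eventually tendsto_const lm]) (use le in simp_all)
  qed
  have "AE w in lborel. liminf (\<lambda>n. G n w) * indicator (cball 0 (real m)) w = 0" for m :: nat
  proof -
    have "(\<integral>\<^sup>+w. liminf (\<lambda>n. G n w) * indicator (cball 0 (real m)) w \<partial>lborel)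
       = (\<integral>\<^sup>+w. liminf (\<lambda>n. G n w * indicator (cball 0 (real m)) w) \<partial>lborel)"
      by (intro nn_integral_cong) (auto simp: indicator_def Liminf_const)
    also have "\<dots> \<le> liminf (\<lambda>n. \<integral>\<^sup>+w. G n w * indicator (cball 0 (real m)) w \<partial>lborel)"
      by (intro nn_integral_liminf) measurable
    also have "\<dots> = 0" using lim_imp_Liminf[OF _ G0] by simp
    finally show ?thesis by (subst (asm) le_zero_eq, subst (asm) nn_integral_0_iff_AE) auto
  qed
  then have "AE w in lborel. \<forall>m::nat. liminf (\<lambda>n. G n w) * indicator (cball 0 (real m)) w = 0"
    by (subst AE_all_countable) auto
  then show ?thesis
  proof eventually_elim
    case (elim w)
    obtain m :: nat where "cmod w \<le> real m" using real_arch_simple by blast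
    then have 0: "liminf (\<lambda>n. G n w) = 0" using elim[rule_format, of m] by simp
    show ?case
    proof (intro allI impI)
      fix s1 s2 :: real assume s: "0 \<le> s1" "s1 \<le> s2" "s2 \<le> S"
      have "(\<lambda>n. \<phi> n z) \<longlonglongrightarrow> u z" for z
        using tendsto_uniform_limitI[OF ul[of "cmod z"], of z] by simp
      then have "(\<lambda>n. ennreal (cmod (\<phi> n (\<gamma> w s2) - \<phi> n (\<gamma> w s1)))) \<longlonglongrightarrow> ennreal (cmod (u (\<gamma> w s2) - u (\<gamma> w s1)))"
        by (intro tendsto_intros)
      from LIMSEQ_le_plus_liminf_zero[OF this bound1[OF s] 0]
      show "ennreal (cmod (u (c + exp (\<zeta> * complex_of_real s2) * w) - u (c + exp (\<zeta> * complex_of_real s1) * w)))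
       \<le> (\<integral>\<^sup>+s. N (c + exp (\<zeta> * complex_of_real s) * w) * ennreal (cmod (\<zeta> * exp (\<zeta> * complex_of_real s) * w)) * indicator {s1..s2} s \<partial>lborel)"
        unfolding \<gamma>_def \<gamma>'_def .
    qed
  qed
qed

section \<open>The area inequality\<close>

lemma emeasure_cball_complex: "0 \<le> r \<Longrightarrow> emeasure lborel (cball (c::complex) r) = ennreal (pi * r\<^sup>2)"
  by (simp add: emeasure_cball unit_ball_vol_2)

lemma nn_integral_exp_minus_le:
  "0 \<le> b \<Longrightarrow> (\<integral>\<^sup>+s. ennreal (exp (- s)) * indicator {0..b} s \<partial>lborel) \<le> 1"
proof -
  assume b: "0 \<le> b"
  have "(\<integral>\<^sup>+s. ennreal (exp (- s)) * indicator {0..b} s \<partial>lborel) = ennreal (- exp (- b) - (- exp (- 0)))"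
    using b by (intro nn_integral_FTC_Icc) (auto intro!: derivative_eq_intros)
  also have "\<dots> \<le> 1" by (simp flip: ennreal_1 add: ennreal_leI del: ennreal_1)
  finally show ?thesis .
qed

text \<open>The rays \<open>x + exp (- s) * w\<close> never reach \<open>x\<close>, so they are
  followed up to time \<open>n\<close>, and Fatou's lemma with the continuity of \<open>u\<close>
  removes \<open>n\<close>. At time \<open>s\<close> they fill the disc of radius
  \<open>exp (- s) * r\<close>; there the mass bound cancels the Jacobian, and the speed leaves a
  factor \<open>exp (- s)\<close>, whose integral is at most 1.\<close>

lemma C1_limit_mean_bound:
  fixes x :: complex and N :: "complex \<Rightarrow> ennreal"
  assumes lim: "C1_limit u ux uy"
    and N [measurable]: "N \<in> borel_measurable borel"
    and bd: "\<And>z h. ennreal (cmod (Re h *\<^sub>R ux z + Im h *\<^sub>R uy z)) \<le> N z * ennreal (cmod h)"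
    and r: "0 < r" and l: "0 \<le> l"
    and dens: "\<And>\<rho>. 0 < \<rho> \<Longrightarrow> \<rho> \<le> r \<Longrightarrow> (\<integral>\<^sup>+z. N z * indicator (cball x \<rho>) z \<partial>lborel) \<le> ennreal (l * \<rho>\<^sup>2)"
  shows "(\<integral>\<^sup>+z. ennreal (cmod (u z - u x)) * indicator (cball x r) z \<partial>lborel) \<le> ennreal (l * r ^ 3)"
proof -
  have cu: "continuous_on UNIV u" using lim by (simp add: C1_limit_def)
  then have [measurable]: "u \<in> borel_measurable borel" by (rule borel_measurable_continuous_onI)
  define q where "q n w = ennreal (cmod (u (x + exp (- complex_of_real (real n)) * w) - u (x + w))) * indicator (cball 0 r) w" for n w
  have [measurable]: "q n \<in> borel_measurable borel" for n unfolding q_def by measurable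
  have qn: "(\<integral>\<^sup>+w. q n w \<partial>lborel) \<le> ennreal (l * r ^ 3)" for n
  proof -
    have "AE w in lborel. q n w \<le>
       (\<integral>\<^sup>+s. N (x + exp ((-1) * complex_of_real s) * w) * ennreal (cmod ((-1) * exp ((-1) * complex_of_real s) * w)) * indicator {0..real n} s \<partial>lborel)
        * indicator (cball 0 r) w"
      using C1_limit_path_bound[OF lim of_nat_0_le_iff[of n] N bd, of x "-1"]
    proof eventually_elim
      case (elim w)
      from elim[rule_format, of 0 "real n"] show ?case
        by (auto simp: q_def indicator_def norm_minus_commute)
    qed
    then have "(\<integral>\<^sup>+w. q n w \<partial>lborel) \<le> (\<integral>\<^sup>+w. (\<integral>\<^sup>+s. N (x + exp ((-1) * complex_of_real s) * w) * ennreal (cmod ((-1) * exp ((-1) * complex_of_real s) * w)) * indicator {0..real n} s \<partial>lborel)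
        * indicator (cball 0 r) w \<partial>lborel)"
      by (intro nn_integral_mono_AE)
    also have "\<dots> = (\<integral>\<^sup>+s. (\<integral>\<^sup>+w. N (x + exp ((-1) * complex_of_real s) * w) * ennreal (cmod ((-1) * exp ((-1) * complex_of_real s) * w))
        * indicator (cball 0 r) w \<partial>lborel) * indicator {0..real n} s \<partial>lborel)"
      by (intro nn_integral_path_swap) auto
    also have "\<dots> \<le> (\<integral>\<^sup>+s. ennreal (l * r ^ 3) * (ennreal (exp (- s)) * indicator {0..real n} s) \<partial>lborel)"
    proof (intro nn_integral_mono)
      fix s :: real
      show "(\<integral>\<^sup>+w. N (x + exp ((-1) * complex_of_real s) * w) * ennreal (cmod ((-1) * exp ((-1) * complex_of_real s) * w))
        * indicator (cball 0 r) w \<partial>lborel) * indicator {0..real n} s \<le> ennreal (l * r ^ 3) * (ennreal (exp (- s)) * indicator {0..real n} s)"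
      proof (cases "0 \<le> s \<and> s \<le> real n")
        case True
        define a where "a = complex_of_real (exp (- s))"
        have a: "exp ((-1) * complex_of_real s) = a" "a \<noteq> 0" "cmod a = exp (- s)"
          by (auto simp: a_def simp flip: exp_of_real)
        have "(\<integral>\<^sup>+w. N (x + a * w) * ennreal (cmod ((-1) * a * w)) * indicator (cball 0 r) w \<partial>lborel)
          \<le> (\<integral>\<^sup>+w. ennreal (exp (- s) * r) * (N (x + a * w) * indicator (cball x (exp (-s) * r)) (x + a * w)) \<partial>lborel)"
        proof (intro nn_integral_mono)
          fix w
          have "N (x + a * w) * ennreal (cmod ((-1) * a * w)) \<le> N (x + a * w) * ennreal (exp (- s) * r)" if "cmod w \<le> r"
            using that by (intro mult_left_mono ennreal_leI) (auto simp: norm_mult a)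
          then show "N (x + a * w) * ennreal (cmod ((-1) * a * w)) * indicator (cball 0 r) w
             \<le> ennreal (exp (- s) * r) * (N (x + a * w) * indicator (cball x (exp (-s) * r)) (x + a * w))"
            by (auto simp: indicator_def dist_norm norm_mult a mult.commute)
        qed
        also have "\<dots> = ennreal (exp (- s) * r) * (\<integral>\<^sup>+w. N (x + a * w) * indicator (cball x (exp (-s) * r)) (x + a * w) \<partial>lborel)"
          by (intro nn_integral_cmult) auto
        also have "(\<integral>\<^sup>+w. N (x + a * w) * indicator (cball x (exp (-s) * r)) (x + a * w) \<partial>lborel)
           = ennreal (exp (2 * s)) * (ennreal ((cmod a)\<^sup>2) * (\<integral>\<^sup>+w. N (x + a * w) * indicator (cball x (exp (-s) * r)) (x + a * w) \<partial>lborel))"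
          by (simp add: a flip: mult.assoc ennreal_mult exp_double exp_add)
        also have "\<dots> = ennreal (exp (2 * s)) * (\<integral>\<^sup>+z. N z * indicator (cball x (exp (-s) * r)) z \<partial>lborel)"
          by (subst nn_integral_complex_affine[OF a(2), of "\<lambda>z. N z * indicator (cball x (exp (-s) * r)) z" x]) auto
        also have "\<dots> \<le> ennreal (exp (2 * s)) * ennreal (l * (exp (-s) * r)\<^sup>2)"
          using r True by (intro mult_left_mono dens) auto
        also have "ennreal (exp (- s) * r) * (ennreal (exp (2 * s)) * ennreal (l * (exp (-s) * r)\<^sup>2)) = ennreal (l * r ^ 3) * ennreal (exp (- s))"
        proof -
          have "exp (2 * s) * (exp (- s))\<^sup>2 = 1"
            by (simp add: power2_eq_square flip: exp_add)
          then have "exp (- s) * r * (exp (2 * s) * (l * (exp (- s) * r)\<^sup>2)) = l * r ^ 3 * exp (- s)"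
            by (simp only: power_mult_distrib power2_eq_square power3_eq_cube) algebra
          then show ?thesis
            using l r by (simp flip: ennreal_mult)
        qed
        finally show ?thesis unfolding a(1) using True by (simp add: mult_left_mono)
      qed auto
    qed
    also have "\<dots> = ennreal (l * r ^ 3) * (\<integral>\<^sup>+s. (ennreal (exp (- s)) * indicator {0..real n} s) \<partial>lborel)"
      by (intro nn_integral_cmult) auto
    also have "\<dots> \<le> ennreal (l * r ^ 3) * 1"
      by (intro mult_left_mono nn_integral_exp_minus_le) auto
    finally show ?thesis by simp
  qed
  have lim_q: "(\<lambda>n. q n w) \<longlonglongrightarrow> ennreal (cmod (u x - u (x + w))) * indicator (cball 0 r) w" for w
  proof -
    have "(\<lambda>n. exp (- real n)) \<longlonglongrightarrow> 0"
      by (intro filterlim_compose[OF exp_at_bot] filterlim_uminus_at_bot_at_top filterlim_compose[OF filterlim_uminus_at_bot_at_top filterlim_real_sequentially])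
    then have "(\<lambda>n. complex_of_real (exp (- real n))) \<longlonglongrightarrow> of_real 0" by (intro tendsto_of_real)
    then have "(\<lambda>n. x + exp (- complex_of_real (real n)) * w) \<longlonglongrightarrow> x + 0 * w"
      by (intro tendsto_intros) (simp flip: exp_of_real)
    then have "(\<lambda>n. u (x + exp (- complex_of_real (real n)) * w)) \<longlonglongrightarrow> u x"
      using continuous_on_tendsto_compose[OF cu] by force
    then have "(\<lambda>n. ennreal (cmod (u (x + exp (- complex_of_real (real n)) * w) - u (x + w)))) \<longlonglongrightarrow> ennreal (cmod (u x - u (x + w)))"
      by (intro tendsto_intros)
    then show ?thesis unfolding q_def by (cases "w \<in> cball 0 r") auto
  qed
  have "(\<integral>\<^sup>+z. ennreal (cmod (u z - u x)) * indicator (cball x r) z \<partial>lborel)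
     = (\<integral>\<^sup>+w. ennreal (cmod (u x - u (x + w))) * indicator (cball 0 r) w \<partial>lborel)"
    using nn_integral_complex_affine[of 1 "\<lambda>z. ennreal (cmod (u z - u x)) * indicator (cball x r) z" x]
    by (auto simp: indicator_def dist_norm norm_minus_commute intro!: nn_integral_cong)
  also have "\<dots> = (\<integral>\<^sup>+w. liminf (\<lambda>n. q n w) \<partial>lborel)"
    using lim_imp_Liminf[OF _ lim_q] by simp
  also have "\<dots> \<le> liminf (\<lambda>n. \<integral>\<^sup>+w. q n w \<partial>lborel)"
    by (intro nn_integral_liminf) auto
  also have "\<dots> \<le> ennreal (l * r ^ 3)"
    by (intro Liminf_le) (auto simp: qn)
  finally show ?thesis .
qed

text \<open>Both values are compared with \<open>u z\<close> for \<open>z\<close> in the disc of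
  radius \<open>r / 2\<close> about the midpoint, which lies in the \<open>r\<close>-discs about
  \<open>x\<close> and about \<open>y\<close>. Averaging over it gives the constant
  \<open>8 / pi\<close>, which is below 3.\<close>

lemma C1_limit_pointwise_bound:
  fixes x y :: complex and N :: "complex \<Rightarrow> ennreal"
  assumes lim: "C1_limit u ux uy"
    and N [measurable]: "N \<in> borel_measurable borel"
    and bd: "\<And>z h. ennreal (cmod (Re h *\<^sub>R ux z + Im h *\<^sub>R uy z)) \<le> N z * ennreal (cmod h)"
    and l: "0 \<le> l" and xy: "dist x y \<le> 1"
    and dens: "\<And>\<rho> z. z \<in> {x, y} \<Longrightarrow> 0 < \<rho> \<Longrightarrow> \<rho> \<le> 1 \<Longrightarrow> (\<integral>\<^sup>+v. N v * indicator (cball z \<rho>) v \<partial>lborel) \<le> ennreal (l * \<rho>\<^sup>2)"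
  shows "cmod (u x - u y) \<le> 3 * l * cmod (x - y)"
proof (cases "x = y")
  case False
  define r where "r = dist x y"
  have r: "0 < r" "r \<le> 1" using False xy by (auto simp: r_def)
  define m where "m = midpoint x y"
  have mx: "dist m x = r / 2" "dist m y = r / 2"
    unfolding r_def m_def by (simp_all add: dist_midpoint)
  have cu: "continuous_on UNIV u" using lim by (simp add: C1_limit_def)
  then have [measurable]: "u \<in> borel_measurable borel" by (rule borel_measurable_continuous_onI)
  have sub: "z \<in> cball x r" "z \<in> cball y r" if "z \<in> cball m (r / 2)" for z
    using that mx dist_triangle[of x z m] dist_triangle[of y z m] by (auto simp: dist_commute)
  have "ennreal (cmod (u x - u y)) * emeasure lborel (cball m (r / 2)) = (\<integral>\<^sup>+z. ennreal (cmod (u x - u y)) * indicator (cball m (r / 2)) z \<partial>lborel)"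
    by (subst nn_integral_cmult) auto
  also have "\<dots> \<le> (\<integral>\<^sup>+z. ennreal (cmod (u z - u x)) * indicator (cball x r) z + ennreal (cmod (u z - u y)) * indicator (cball y r) z \<partial>lborel)"
  proof (intro nn_integral_mono)
    fix z
    have "cmod (u x - u y) \<le> cmod (u z - u x) + cmod (u z - u y)"
      using norm_triangle_ineq4[of "u z - u y" "u z - u x"] by simp
    then have "ennreal (cmod (u x - u y)) \<le> ennreal (cmod (u z - u x)) + ennreal (cmod (u z - u y))"
      by (simp flip: ennreal_plus add: ennreal_leI)
    then show "ennreal (cmod (u x - u y)) * indicator (cball m (r / 2)) z \<le> ennreal (cmod (u z - u x)) * indicator (cball x r) z + ennreal (cmod (u z - u y)) * indicator (cball y r) z"
      using sub[of z] by (cases "z \<in> cball m (r / 2)") auto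
  qed
  also have "\<dots> = (\<integral>\<^sup>+z. ennreal (cmod (u z - u x)) * indicator (cball x r) z \<partial>lborel) + (\<integral>\<^sup>+z. ennreal (cmod (u z - u y)) * indicator (cball y r) z \<partial>lborel)"
    by (intro nn_integral_add) auto
  also have "\<dots> \<le> ennreal (l * r ^ 3) + ennreal (l * r ^ 3)"
    using r dens by (intro add_mono C1_limit_mean_bound[OF lim N bd r(1) l]) auto
  also have "\<dots> = ennreal (2 * l * r ^ 3)"
    using r l by (simp flip: ennreal_plus)
  also have "emeasure lborel (cball m (r / 2)) = ennreal (pi * (r / 2)\<^sup>2)"
    using r by (intro emeasure_cball_complex) auto
  finally have "ennreal (cmod (u x - u y) * (pi * (r / 2)\<^sup>2)) \<le> ennreal (2 * l * r ^ 3)"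
    by (subst ennreal_mult) auto
  then have "cmod (u x - u y) * (pi * (r / 2)\<^sup>2) \<le> 2 * l * r ^ 3"
    using r l by (subst (asm) ennreal_le_iff) auto
  then have "(cmod (u x - u y) * pi) * r\<^sup>2 \<le> (8 * l * r) * r\<^sup>2"
    by (simp add: power2_eq_square power3_eq_cube algebra_simps)
  then have *: "cmod (u x - u y) * pi \<le> 8 * l * r"
    using r by (simp add: mult_le_cancel_right)
  have "cmod (u x - u y) * 3 \<le> cmod (u x - u y) * pi"
    using pi_gt3 by (intro mult_left_mono) auto
  also note *
  also have "8 * l * r \<le> 9 * l * r" using l r by (intro mult_right_mono) auto
  finally show ?thesis by (simp add: r_def dist_norm)
qed simp

section \<open>Vitali coverings and the weak type inequality\<close>

lemma Vitali_covering_sequence: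
  fixes a :: "'a \<Rightarrow> 'b::euclidean_space"
  assumes S: "S \<subseteq> (\<Union>i\<in>K. cball (a i) (r i))" and r: "\<And>i. i \<in> K \<Longrightarrow> 0 < r i \<and> r i \<le> B"
  obtains J :: "nat set" and e :: "nat \<Rightarrow> 'a" where "e ` J \<subseteq> K"
    "disjoint_family_on (\<lambda>n. cball (a (e n)) (r (e n))) J"
    "S \<subseteq> (\<Union>n\<in>J. cball (a (e n)) (5 * r (e n)))"
proof -
  obtain C where C: "countable C" "C \<subseteq> K"
     "pairwise (\<lambda>i j. disjnt (cball (a i) (r i)) (cball (a j) (r j))) C"
     "S \<subseteq> (\<Union>i\<in>C. cball (a i) (5 * r i))"
    by (rule Vitali_covering_lemma_cballs[OF S r])
  define J where "J = to_nat_on C ` C"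
  have e: "from_nat_into C n \<in> C" "to_nat_on C (from_nat_into C n) = n" if "n \<in> J" for n
  proof -
    from that obtain i where i: "i \<in> C" "n = to_nat_on C i" unfolding J_def by blast
    then have "from_nat_into C n = i" using from_nat_into_to_nat_on[OF C(1)] by simp
    then show "from_nat_into C n \<in> C" "to_nat_on C (from_nat_into C n) = n" using i by simp_all
  qed
  have e': "i \<in> C \<Longrightarrow> \<exists>n\<in>J. from_nat_into C n = i" for i
    unfolding J_def using from_nat_into_to_nat_on[OF C(1)] by blast
  show ?thesis
  proof
    show "from_nat_into C ` J \<subseteq> K" using e(1) C(2) by auto
    show "disjoint_family_on (\<lambda>n. cball (a (from_nat_into C n)) (r (from_nat_into C n))) J"
      unfolding disjoint_family_on_def
    proof (intro ballI impI)
      fix m n assume "m \<in> J" "n \<in> J" "m \<noteq> n"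
      then have "from_nat_into C m \<noteq> from_nat_into C n" using e(2) by metis
      then show "cball (a (from_nat_into C m)) (r (from_nat_into C m)) \<inter> cball (a (from_nat_into C n)) (r (from_nat_into C n)) = {}"
        using C(3) e(1) \<open>m \<in> J\<close> \<open>n \<in> J\<close> unfolding pairwise_def disjnt_def by blast
    qed
    show "S \<subseteq> (\<Union>n\<in>J. cball (a (from_nat_into C n)) (5 * r (from_nat_into C n)))"
    proof
      fix x assume "x \<in> S"
      then obtain i where "i \<in> C" "x \<in> cball (a i) (5 * r i)" using C(4) by auto
      then show "x \<in> (\<Union>n\<in>J. cball (a (from_nat_into C n)) (5 * r (from_nat_into C n)))"
        using e'[of i] by force
    qed
  qed
qed

lemma suminf_nn_integral_disjoint_le:
  fixes N :: "complex \<Rightarrow> ennreal"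
  assumes [measurable]: "N \<in> borel_measurable borel" "\<And>n::nat. X n \<in> sets borel" "Y \<in> sets borel"
    and "disjoint_family_on X J" and "\<And>n. n \<in> J \<Longrightarrow> X n \<subseteq> Y"
  shows "(\<Sum>n. if n \<in> J then (\<integral>\<^sup>+z. N z * indicator (X n) z \<partial>lborel) else 0) \<le> (\<integral>\<^sup>+z. N z * indicator Y z \<partial>lborel)"
proof -
  define X' where "X' n = (if n \<in> J then X n else {})" for n
  have X': "X' n \<in> sets borel" for n by (simp add: X'_def)
  have dis: "disjoint_family X'"
    using assms(4) unfolding disjoint_family_on_def X'_def by simp
  have "(if n \<in> J then (\<integral>\<^sup>+z. N z * indicator (X n) z \<partial>lborel) else 0) = emeasure (density lborel N) (X' n)" for n
    using X' by (cases "n \<in> J") (simp_all add: X'_def emeasure_density)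
  then have "(\<Sum>n. if n \<in> J then (\<integral>\<^sup>+z. N z * indicator (X n) z \<partial>lborel) else 0) = (\<Sum>n. emeasure (density lborel N) (X' n))"
    by simp
  also have "\<dots> = emeasure (density lborel N) (\<Union>n. X' n)"
    using dis X' by (intro suminf_emeasure) auto
  also have "\<dots> \<le> emeasure (density lborel N) Y"
    using assms(5) by (intro emeasure_mono) (auto simp: X'_def split: if_splits)
  also have "\<dots> = (\<integral>\<^sup>+z. N z * indicator Y z \<partial>lborel)"
    by (simp add: emeasure_density)
  finally show ?thesis .
qed

text \<open>\<open>B\<close> is a union of enlarged Vitali discs instead of the exact set where the
  maximal function is large, so that it is Borel by construction. The enlargement by 5 gives the
  factor 25. Radii up to 1 suffice, which is why only mass in the disc of radius
  \<open>R + 1\<close> counts.\<close>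

lemma maximal_weak_type:
  fixes N :: "complex \<Rightarrow> ennreal"
  assumes [measurable]: "N \<in> borel_measurable borel" and l: "0 < l"
  obtains B where "B \<in> sets borel"
    "emeasure lborel B \<le> ennreal (25 * pi / l) * (\<integral>\<^sup>+z. N z * indicator (cball 0 (R + 1)) z \<partial>lborel)"
    "\<And>x \<rho>. x \<in> cball 0 R \<Longrightarrow> x \<notin> B \<Longrightarrow> 0 < \<rho> \<Longrightarrow> \<rho> \<le> 1 \<Longrightarrow> (\<integral>\<^sup>+z. N z * indicator (cball x \<rho>) z \<partial>lborel) \<le> ennreal (l * \<rho>\<^sup>2)"
proof -
  define K where "K = {x \<in> cball 0 R. \<exists>\<rho>. 0 < \<rho> \<and> \<rho> \<le> 1 \<and> \<not> (\<integral>\<^sup>+z. N z * indicator (cball x \<rho>) z \<partial>lborel) \<le> ennreal (l * \<rho>\<^sup>2)}"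
  have "\<forall>x\<in>K. \<exists>\<rho>. 0 < \<rho> \<and> \<rho> \<le> 1 \<and> \<not> (\<integral>\<^sup>+z. N z * indicator (cball x \<rho>) z \<partial>lborel) \<le> ennreal (l * \<rho>\<^sup>2)"
    by (auto simp: K_def)
  then obtain r where r: "\<And>x. x \<in> K \<Longrightarrow> 0 < r x \<and> r x \<le> 1 \<and> \<not> (\<integral>\<^sup>+z. N z * indicator (cball x (r x)) z \<partial>lborel) \<le> ennreal (l * (r x)\<^sup>2)"
    by metis
  have "K \<subseteq> (\<Union>i\<in>K. cball (id i) (r i))" using r by (force intro: less_imp_le)
  then obtain J :: "nat set" and e where J: "e ` J \<subseteq> K"
    "disjoint_family_on (\<lambda>n. cball (id (e n)) (r (e n))) J"
    "K \<subseteq> (\<Union>n\<in>J. cball (id (e n)) (5 * r (e n)))"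
    by (rule Vitali_covering_sequence[where S=K and K=K and a=id and r=r and B=1]) (use r in auto)
  define X where "X n = (if n \<in> J then cball (e n) (5 * r (e n)) else {})" for n
  define B where "B = (\<Union>n. X n)"
  have [measurable]: "X n \<in> sets borel" for n by (auto simp: X_def)
  have eJ: "e n \<in> K" "0 < r (e n)" "r (e n) \<le> 1" if "n \<in> J" for n using J(1) that r by auto
  show ?thesis
  proof (rule that)
    show "B \<in> sets borel" unfolding B_def by measurable
    show "(\<integral>\<^sup>+z. N z * indicator (cball x \<rho>) z \<partial>lborel) \<le> ennreal (l * \<rho>\<^sup>2)" if "x \<in> cball 0 R" "x \<notin> B" "0 < \<rho>" "\<rho> \<le> 1" for x \<rho>
    proof (rule ccontr)
      assume "\<not> ?thesis"
      then have "x \<in> K" using that unfolding K_def by auto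
      then show False using J(3) that(2) unfolding B_def X_def by fastforce
    qed
    have "emeasure lborel B \<le> (\<Sum>n. emeasure lborel (X n))"
      unfolding B_def by (intro emeasure_subadditive_countably) auto
    also have "\<dots> \<le> (\<Sum>n. ennreal (25 * pi / l) * (if n \<in> J then (\<integral>\<^sup>+z. N z * indicator (cball (e n) (r (e n))) z \<partial>lborel) else 0))"
    proof (intro suminf_le summableI)
      fix n
      show "emeasure lborel (X n) \<le> ennreal (25 * pi / l) * (if n \<in> J then (\<integral>\<^sup>+z. N z * indicator (cball (e n) (r (e n))) z \<partial>lborel) else 0)"
      proof (cases "n \<in> J")
        case True
        have "emeasure lborel (X n) = ennreal (25 * pi / l) * ennreal (l * (r (e n))\<^sup>2)"
          using True eJ[OF True] l by (simp add: X_def emeasure_cball_complex power_mult_distrib flip: ennreal_mult)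
        also have "\<dots> \<le> ennreal (25 * pi / l) * (\<integral>\<^sup>+z. N z * indicator (cball (e n) (r (e n))) z \<partial>lborel)"
          using r[OF eJ(1)[OF True]] by (intro mult_left_mono) auto
        finally show ?thesis using True by simp
      qed (auto simp: X_def)
    qed
    also have "\<dots> = ennreal (25 * pi / l) * (\<Sum>n. (if n \<in> J then (\<integral>\<^sup>+z. N z * indicator (cball (e n) (r (e n))) z \<partial>lborel) else 0))"
      by (rule ennreal_suminf_cmult)
    also have "\<dots> \<le> ennreal (25 * pi / l) * (\<integral>\<^sup>+z. N z * indicator (cball 0 (R + 1)) z \<partial>lborel)"
    proof (intro mult_left_mono suminf_nn_integral_disjoint_le)
      show "cball (e n) (r (e n)) \<subseteq> cball 0 (R + 1)" if "n \<in> J" for n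
      proof
        fix z assume "z \<in> cball (e n) (r (e n))"
        then show "z \<in> cball 0 (R + 1)"
          using eJ[OF that] dist_triangle[of 0 z "e n"] unfolding K_def by auto
      qed
    qed (use J(2) in auto)
    finally show "emeasure lborel B \<le> ennreal (25 * pi / l) * (\<integral>\<^sup>+z. N z * indicator (cball 0 (R + 1)) z \<partial>lborel)" .
  qed
qed

text \<open>Applied with one of the smooth approximations as \<open>v\<close>: the gradient of
  \<open>u - v\<close> is small in the mean, and the pointwise bound turns this into a small
  Lipschitz constant off a small set.\<close>

lemma C1_limit_diff:
  assumes lim: "C1_limit u ux uy"
    and der: "\<And>z. (v has_derivative (\<lambda>h. Re h *\<^sub>R vx z + Im h *\<^sub>R vy z)) (at z)"
    and cx: "continuous_on UNIV vx" and cy: "continuous_on UNIV vy"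
  shows "C1_limit (\<lambda>z. u z - v z) (\<lambda>z. ux z - vx z) (\<lambda>z. uy z - vy z)"
proof -
  obtain \<phi> \<phi>x \<phi>y where *:
    "\<And>n z. (\<phi> n has_derivative (\<lambda>h. Re h *\<^sub>R \<phi>x n z + Im h *\<^sub>R \<phi>y n z)) (at z)"
    "\<And>n::nat. continuous_on UNIV (\<phi>x n)" "\<And>n. continuous_on UNIV (\<phi>y n)"
    "\<And>R. uniform_limit (cball 0 R) \<phi> u sequentially"
    "\<And>R. (\<lambda>n. \<integral>\<^sup>+z. ennreal (cmod (\<phi>x n z - ux z) + cmod (\<phi>y n z - uy z)) * indicator (cball 0 R) z \<partial>lborel)
           \<longlonglongrightarrow> 0"
    "continuous_on UNIV u" "ux \<in> borel_measurable borel" "uy \<in> borel_measurable borel"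
    using lim unfolding C1_limit_def by blast
  have cv: "continuous_on UNIV v"
    using der by (meson continuous_at_imp_continuous_on has_derivative_continuous)
  have "vx \<in> borel_measurable borel" "vy \<in> borel_measurable borel"
    using cx cy by (auto intro: borel_measurable_continuous_onI)
  note 1 = this
  show ?thesis unfolding C1_limit_def
  proof (intro conjI exI allI)
    show "((\<lambda>z. \<phi> n z - v z) has_derivative (\<lambda>h. Re h *\<^sub>R (\<phi>x n z - vx z) + Im h *\<^sub>R (\<phi>y n z - vy z))) (at z)" for n z
      by (rule has_derivative_eq_rhs[OF has_derivative_diff[OF *(1) der]]) (auto simp: algebra_simps)
    show "uniform_limit (cball 0 R) (\<lambda>n z. \<phi> n z - v z) (\<lambda>z. u z - v z) sequentially" for R
      by (intro uniform_limit_intros *)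
    show "(\<lambda>n. \<integral>\<^sup>+z. ennreal (cmod (\<phi>x n z - vx z - (ux z - vx z)) + cmod (\<phi>y n z - vy z - (uy z - vy z))) * indicator (cball 0 R) z \<partial>lborel)
           \<longlonglongrightarrow> 0" for R
      using *(5)[of R] by simp
    show "continuous_on UNIV (\<lambda>z. \<phi>x n z - vx z)" "continuous_on UNIV (\<lambda>z. \<phi>y n z - vy z)" for n
      by (intro continuous_intros * cx cy)+
    show "continuous_on UNIV (\<lambda>z. u z - v z)" by (intro continuous_intros * cv)
    show "(\<lambda>z. ux z - vx z) \<in> borel_measurable borel" "(\<lambda>z. uy z - vy z) \<in> borel_measurable borel"
      using 1 *(7,8) by simp_all
  qed
qed

text \<open>\<open>G m\<close> excludes the points where the maximal functions of the errors of fast approximations are large, so the difference quotients converge uniformly on it.\<close>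

lemma C1_limit_lusin:
  assumes lim: "C1_limit f fx fy" and R: "0 \<le> R"
  obtains G :: "nat \<Rightarrow> complex set" where
    "\<And>m. G m \<in> sets borel" "\<And>m. G m \<subseteq> cball 0 R"
    "\<And>m x. x \<in> G m \<Longrightarrow> (f has_derivative (\<lambda>h. Re h *\<^sub>R fx x + Im h *\<^sub>R fy x)) (at x within G m)"
    "AE x in lborel. x \<in> cball 0 R \<longrightarrow> (\<forall>\<^sub>F m in sequentially. x \<in> G m)"
proof -
  obtain \<phi> \<phi>x \<phi>y where
    der: "\<And>n z. (\<phi> n has_derivative (\<lambda>h. Re h *\<^sub>R \<phi>x n z + Im h *\<^sub>R \<phi>y n z)) (at z)"
    and cx: "\<And>n::nat. continuous_on UNIV (\<phi>x n)" and cy: "\<And>n. continuous_on UNIV (\<phi>y n)"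
    and L1: "\<And>R. (\<lambda>n. \<integral>\<^sup>+z. ennreal (cmod (\<phi>x n z - fx z) + cmod (\<phi>y n z - fy z)) * indicator (cball 0 R) z \<partial>lborel)
           \<longlonglongrightarrow> 0"
    and [measurable]: "fx \<in> borel_measurable borel" "fy \<in> borel_measurable borel"
    using lim unfolding C1_limit_def by blast
  have [measurable]: "\<phi>x n \<in> borel_measurable borel" "\<phi>y n \<in> borel_measurable borel" for n
    using cx cy borel_measurable_continuous_onI by auto
  define e where "e n z = cmod (\<phi>x n z - fx z) + cmod (\<phi>y n z - fy z)" for n z
  have e0: "0 \<le> e n z" for n z by (simp add: e_def)
  have em: "(\<lambda>z. e n z) \<in> borel_measurable borel" for n unfolding e_def by measurable
  note [measurable] = em
  \<comment> \<open>Errors below \<open>(1/4) ^ j\<close> tested at the level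
    \<open>(1/2) ^ j\<close> leave exceptional sets of area at most
    \<open>25 * pi * (1/2) ^ j\<close>. These areas are summable, as the Borel-Cantelli lemma
    requires, while the levels still tend to 0.\<close>
  have "\<exists>n. (\<integral>\<^sup>+z. ennreal (e n z) * indicator (cball 0 (R + 1)) z \<partial>lborel) < ennreal ((1/4) ^ j)" for j
  proof -
    have "(0::ennreal) < ennreal ((1/4) ^ j)" by simp
    from order_tendstoD(2)[OF L1[of "R + 1"] this] show ?thesis
      unfolding e_def by (auto dest: eventually_happens)
  qed
  then obtain k where k: "\<And>j. (\<integral>\<^sup>+z. ennreal (e (k j) z) * indicator (cball 0 (R + 1)) z \<partial>lborel) < ennreal ((1/4) ^ j)"
    by metis
  define N where "N j z = ennreal (e (k j) z)" for j z
  have [measurable]: "N j \<in> borel_measurable borel" for j unfolding N_def by measurable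
  define Q where "Q j B \<longleftrightarrow> B \<in> sets borel \<and>
    emeasure lborel B \<le> ennreal (25 * pi / ((1/2) ^ j)) * (\<integral>\<^sup>+z. N j z * indicator (cball 0 (R + 1)) z \<partial>lborel) \<and>
    (\<forall>x \<rho>. x \<in> cball 0 R \<longrightarrow> x \<notin> B \<longrightarrow> 0 < \<rho> \<longrightarrow> \<rho> \<le> 1 \<longrightarrow> (\<integral>\<^sup>+z. N j z * indicator (cball x \<rho>) z \<partial>lborel) \<le> ennreal ((1/2) ^ j * \<rho>\<^sup>2))" for j B
  have "\<exists>B. Q j B" for j
    unfolding Q_def by (rule maximal_weak_type[where N = "N j" and l = "(1/2) ^ j" and R = R]) auto
  then obtain B where B: "\<And>j. Q j (B j)" by metis
  have Bm [measurable]: "B j \<in> sets borel" 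
    and Be: "emeasure lborel (B j) \<le> ennreal (25 * pi / ((1/2) ^ j)) * (\<integral>\<^sup>+z. N j z * indicator (cball 0 (R + 1)) z \<partial>lborel)" for j
    using B[of j] by (auto simp: Q_def)
  have Bd: "(\<integral>\<^sup>+z. N j z * indicator (cball x \<rho>) z \<partial>lborel) \<le> ennreal ((1/2) ^ j * \<rho>\<^sup>2)"
    if "x \<in> cball 0 R" "x \<notin> B j" "0 < \<rho>" "\<rho> \<le> 1" for j x \<rho>
    using B[of j] that unfolding Q_def by blast
  have Bs: "emeasure lborel (B j) \<le> ennreal (25 * pi * (1/2) ^ j)" for j
  proof -
    have "emeasure lborel (B j) \<le> ennreal (25 * pi / ((1/2) ^ j)) * ennreal ((1/4) ^ j)"
      by (intro order_trans[OF Be] mult_left_mono) (use k[of j] in \<open>simp_all add: N_def less_imp_le\<close>)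
    also have "\<dots> = ennreal (25 * pi * (1/2) ^ j)"
      by (simp flip: ennreal_mult) (simp add: power_divide field_simps flip: power_mult_distrib)
    finally show ?thesis .
  qed
  have Bfin: "emeasure lborel (B j) < \<infinity>" for j
    using le_less_trans[OF Bs[of j] ennreal_less_top] by simp
  have mB: "measure lborel (B j) \<le> 25 * pi * (1/2) ^ j" for j
    using Bs[of j] by (simp add: measure_def enn2real_leI)
  have "summable (\<lambda>j. 25 * pi * (1/2::real) ^ j)"
    by (intro summable_mult summable_geometric) auto
  then have "summable (\<lambda>j. measure lborel (B j))"
    by (rule summable_comparison_test'[where N = 0]) (simp add: mB)
  from borel_cantelli_AE1[OF _ _ this] Bfin
  have AE1: "AE x in lborel. \<forall>\<^sub>F j in sequentially. x \<in> space lborel - B j"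
    by simp
  \<comment> \<open>Outside the sets \<open>B j\<close> only increments are controlled. That the
    derivative at the point is given by \<open>fx\<close> and \<open>fy\<close> needs, in addition,
    pointwise convergence of the approximating gradients, which the summability of the errors
    provides.\<close>
  have AE2: "AE x in lborel. x \<in> cball 0 R \<longrightarrow> (\<lambda>j. e (k j) x) \<longlonglongrightarrow> 0"
  proof -
    have "(\<integral>\<^sup>+x. (\<Sum>j. N j x * indicator (cball 0 (R + 1)) x) \<partial>lborel) = (\<Sum>j. \<integral>\<^sup>+x. N j x * indicator (cball 0 (R + 1)) x \<partial>lborel)"
      by (intro nn_integral_suminf) auto
    also have "\<dots> \<le> (\<Sum>j. ennreal ((1/4) ^ j))"
      using k by (intro suminf_le summableI) (auto simp: N_def intro: less_imp_le)
    also have "\<dots> < \<infinity>"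
    proof -
      have "summable (\<lambda>j. (1/4::real) ^ j)" by (intro summable_geometric) simp
      then have "(\<Sum>j. ennreal ((1/4) ^ j)) \<noteq> top" by (rule ennreal_suminf_neq_top) simp
      then show ?thesis by (simp only: infinity_ennreal_def less_top)
    qed
    finally have "(\<integral>\<^sup>+x. (\<Sum>j. N j x * indicator (cball 0 (R + 1)) x) \<partial>lborel) \<noteq> \<infinity>" by simp
    then have "AE x in lborel. (\<Sum>j. N j x * indicator (cball 0 (R + 1)) x) \<noteq> \<infinity>"
      by (intro nn_integral_PInf_AE) auto
    then show ?thesis
    proof eventually_elim
      case (elim x)
      show ?case
      proof
        assume "x \<in> cball 0 R"
        then have "x \<in> cball 0 (R + 1)" by auto
        with elim have "(\<Sum>j. ennreal (e (k j) x)) \<noteq> top" by (simp add: N_def)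
        then have "summable (\<lambda>j. e (k j) x)" by (intro summable_suminf_not_top e0)
        then show "(\<lambda>j. e (k j) x) \<longlonglongrightarrow> 0" by (rule summable_LIMSEQ_zero)
      qed
    qed
  qed
  from AE_E[OF AE2] obtain Z where "{x \<in> space lborel. \<not> (x \<in> cball 0 R \<longrightarrow> (\<lambda>j. e (k j) x) \<longlonglongrightarrow> 0)} \<subseteq> Z"
    and Z: "emeasure lborel Z = 0" "Z \<in> sets lborel"
    by blast
  then have Ze: "(\<lambda>j. e (k j) x) \<longlonglongrightarrow> 0" if "x \<in> cball 0 R" "x \<notin> Z" for x
    using that by auto
  have AE3: "AE x in lborel. x \<notin> Z"
    using Z by (intro AE_not_in) (simp add: null_setsI)
  \<comment> \<open>All the sets from index \<open>m\<close> on are removed, so one piece serves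
    every late approximation.\<close>
  define G where "G m = cball 0 R - Z - (\<Union>j\<in>{m..}. B j)" for m
  show ?thesis
  proof (rule that[of G])
    show "G m \<in> sets borel" for m
      unfolding G_def using Z(2) by (intro sets.Diff sets.countable_UN') auto
    show "G m \<subseteq> cball 0 R" for m unfolding G_def by auto
    show "AE x in lborel. x \<in> cball 0 R \<longrightarrow> (\<forall>\<^sub>F m in sequentially. x \<in> G m)"
      using AE1 AE3
    proof eventually_elim
      case (elim x)
      show ?case
      proof
        assume x: "x \<in> cball 0 R"
        obtain m where m: "\<And>j. m \<le> j \<Longrightarrow> x \<notin> B j"
          using elim(1) unfolding eventually_sequentially by auto
        show "\<forall>\<^sub>F m in sequentially. x \<in> G m"
          unfolding eventually_sequentially G_def using x m elim(2) by (intro exI[of _ m]) auto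
      qed
    qed
    fix m x assume x: "x \<in> G m"
    have diff_bd: "cmod ((f y - \<phi> (k j) y) - (f x - \<phi> (k j) x)) \<le> 3 * (1/2) ^ j * cmod (y - x)"
      if "y \<in> G m" "dist x y \<le> 1" "m \<le> j" for y j
    proof (rule C1_limit_pointwise_bound[OF C1_limit_diff[OF lim der cx cy], of "N j"])
      show "ennreal (cmod (Re h *\<^sub>R (fx z - \<phi>x (k j) z) + Im h *\<^sub>R (fy z - \<phi>y (k j) z))) \<le> N j z * ennreal (cmod h)" for z h
      proof -
        have "cmod (Re h *\<^sub>R (fx z - \<phi>x (k j) z) + Im h *\<^sub>R (fy z - \<phi>y (k j) z))
          \<le> cmod h * cmod (fx z - \<phi>x (k j) z) + cmod h * cmod (fy z - \<phi>y (k j) z)"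
          by (rule order_trans[OF norm_triangle_ineq])
             (auto intro!: add_mono mult_right_mono abs_Re_le_cmod abs_Im_le_cmod)
        also have "\<dots> = e (k j) z * cmod h" by (simp add: e_def algebra_simps norm_minus_commute)
        finally show ?thesis unfolding N_def by (simp add: e0 ennreal_leI flip: ennreal_mult)
      qed
      show "dist y x \<le> 1" using that by (simp add: dist_commute)
      show "(\<integral>\<^sup>+v. N j v * indicator (cball z \<rho>) v \<partial>lborel) \<le> ennreal ((1/2) ^ j * \<rho>\<^sup>2)"
        if "z \<in> {y, x}" "0 < \<rho>" "\<rho> \<le> 1" for \<rho> z
        using that \<open>y \<in> G m\<close> x \<open>m \<le> j\<close> by (intro Bd) (auto simp: G_def)
    qed auto
    show "(f has_derivative (\<lambda>h. Re h *\<^sub>R fx x + Im h *\<^sub>R fy x)) (at x within G m)"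
      unfolding has_derivative_within_alt
    proof (intro conjI allI impI)
      show "bounded_linear (\<lambda>h. Re h *\<^sub>R fx x + Im h *\<^sub>R fy x)"
        by (intro bounded_linear_add bounded_linear_scaleR_const bounded_linear_Re bounded_linear_Im)
      fix \<epsilon> :: real assume \<epsilon>: "0 < \<epsilon>"
      have t: "(\<lambda>j. 3 * (1/2) ^ j) \<longlonglongrightarrow> (3 * 0 :: real)"
        by (intro tendsto_mult tendsto_const LIMSEQ_power_zero) auto
      have "\<forall>\<^sub>F j in sequentially. 3 * (1/2) ^ j < \<epsilon> / 3"
        by (rule order_tendstoD(2)[OF t]) (use \<epsilon> in simp)
      moreover have "\<forall>\<^sub>F j in sequentially. e (k j) x < \<epsilon> / 3"
        using x \<epsilon> Ze[of x] unfolding G_def by (intro order_tendstoD) auto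
      moreover have "\<forall>\<^sub>F j in sequentially. m \<le> j" by (rule eventually_ge_at_top)
      ultimately have "\<forall>\<^sub>F j in sequentially. 3 * (1/2) ^ j < \<epsilon> / 3 \<and> e (k j) x < \<epsilon> / 3 \<and> m \<le> j"
        by eventually_elim auto
      \<comment> \<open>A single late index is enough: the Lipschitz bound of the error, the
        derivative of the smooth map, and the gradient error at \<open>x\<close> each take a third
        of \<open>\<epsilon>\<close>.\<close>
      then obtain j where j: "3 * (1/2) ^ j < \<epsilon> / 3" "e (k j) x < \<epsilon> / 3" "m \<le> j"
        by (auto dest: eventually_happens)
      obtain d where d: "0 < d" "\<And>y. norm (y - x) < d \<Longrightarrow>
          norm (\<phi> (k j) y - \<phi> (k j) x - (Re (y - x) *\<^sub>R \<phi>x (k j) x + Im (y - x) *\<^sub>R \<phi>y (k j) x)) \<le> \<epsilon> / 3 * norm (y - x)"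
        using der[of "k j" x] \<epsilon> unfolding has_derivative_at_alt by (metis divide_pos_pos zero_less_numeral)
      show "\<exists>d>0. \<forall>y\<in>G m. norm (y - x) < d \<longrightarrow>
          norm (f y - f x - (Re (y - x) *\<^sub>R fx x + Im (y - x) *\<^sub>R fy x)) \<le> \<epsilon> * norm (y - x)"
      proof (intro exI[of _ "min d 1"] conjI ballI impI)
        fix y assume y: "y \<in> G m" "norm (y - x) < min d 1"
        have 1: "cmod ((f y - \<phi> (k j) y) - (f x - \<phi> (k j) x)) \<le> \<epsilon> / 3 * cmod (y - x)"
          using diff_bd[OF y(1) _ j(3)] y(2) j(1) mult_right_mono[of "3 * (1/2) ^ j" "\<epsilon> / 3" "cmod (y - x)"]
          by (force simp: dist_norm norm_minus_commute)
        have 2: "norm (\<phi> (k j) y - \<phi> (k j) x - (Re (y - x) *\<^sub>R \<phi>x (k j) x + Im (y - x) *\<^sub>R \<phi>y (k j) x)) \<le> \<epsilon> / 3 * norm (y - x)"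
          using d(2) y(2) by auto
        have "cmod (Re (y - x) *\<^sub>R (\<phi>x (k j) x - fx x) + Im (y - x) *\<^sub>R (\<phi>y (k j) x - fy x))
          \<le> cmod (y - x) * cmod (\<phi>x (k j) x - fx x) + cmod (y - x) * cmod (\<phi>y (k j) x - fy x)"
          by (rule order_trans[OF norm_triangle_ineq])
             (auto intro!: add_mono mult_right_mono simp: abs_Re_le_cmod abs_Im_le_cmod simp del: minus_complex.simps)
        also have "\<dots> = e (k j) x * cmod (y - x)" by (simp add: e_def algebra_simps)
        also have "\<dots> \<le> \<epsilon> / 3 * cmod (y - x)" using j(2) by (intro mult_right_mono) auto
        finally have 3: "cmod (Re (y - x) *\<^sub>R (\<phi>x (k j) x - fx x) + Im (y - x) *\<^sub>R (\<phi>y (k j) x - fy x)) \<le> \<epsilon> / 3 * cmod (y - x)" .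
        have "f y - f x - (Re (y - x) *\<^sub>R fx x + Im (y - x) *\<^sub>R fy x)
          = ((f y - \<phi> (k j) y) - (f x - \<phi> (k j) x))
          + (\<phi> (k j) y - \<phi> (k j) x - (Re (y - x) *\<^sub>R \<phi>x (k j) x + Im (y - x) *\<^sub>R \<phi>y (k j) x))
          + (Re (y - x) *\<^sub>R (\<phi>x (k j) x - fx x) + Im (y - x) *\<^sub>R (\<phi>y (k j) x - fy x))"
          by (simp add: scaleR_diff_right)
        then have "cmod (f y - f x - (Re (y - x) *\<^sub>R fx x + Im (y - x) *\<^sub>R fy x))
          \<le> \<epsilon> / 3 * cmod (y - x) + \<epsilon> / 3 * cmod (y - x) + \<epsilon> / 3 * cmod (y - x)"
          using 1 2 3 by (metis (no_types, lifting) add_mono norm_triangle_le)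
        then show "norm (f y - f x - (Re (y - x) *\<^sub>R fx x + Im (y - x) *\<^sub>R fy x)) \<le> \<epsilon> * norm (y - x)" by simp
      qed (use d(1) in auto)
    qed
  qed
qed

section \<open>Change of variables on the pieces, and the area inequality\<close>

definition jac :: "complex \<Rightarrow> complex \<Rightarrow> real" where
  "jac a b = Re a * Im b - Re b * Im a"

lemma borel_jac [measurable]:
  assumes "fx \<in> borel_measurable M" "fy \<in> borel_measurable M"
  shows "(\<lambda>x. jac (fx x) (fy x)) \<in> borel_measurable M"
proof -
  have "Re \<in> borel_measurable borel" "Im \<in> borel_measurable borel"
    by (intro borel_measurable_continuous_onI continuous_intros)+
  then show ?thesis unfolding jac_def
    by (intro borel_measurable_diff borel_measurable_times) (auto intro: measurable_compose assms)
qed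

text \<open>Differentiability is asked for within \<open>B\<close> only, since the pieces of
  \<open>C1_limit_lusin\<close> need not contain any disc; the change of variables formula on
  \<open>real^2\<close> tolerates this. The image is Borel because it is a preimage under the
  continuous inverse.\<close>

lemma emeasure_image_eq_jac:
  assumes hom: "homeomorphism UNIV UNIV f g"
    and B: "B \<in> sets borel" "bounded B"
    and fx [measurable]: "fx \<in> borel_measurable borel" and fy [measurable]: "fy \<in> borel_measurable borel"
    and der: "\<And>x. x \<in> B \<Longrightarrow> (f has_derivative (\<lambda>h. Re h *\<^sub>R fx x + Im h *\<^sub>R fy x)) (at x within B)"
  shows "f ` B \<in> sets borel" "emeasure lborel (f ` B) = (\<integral>\<^sup>+x. ennreal \<bar>jac (fx x) (fy x)\<bar> * indicator B x \<partial>lborel)"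
proof -
  have fg: "f (g y) = y" "g (f x) = x" for x y
    using hom by (auto simp: homeomorphism_def)
  have cf: "continuous_on UNIV f" and cg: "continuous_on UNIV g" using hom by (auto simp: homeomorphism_def)
  have im: "f ` B = g -` B" using fg by (auto simp: image_iff) metis
  have gm: "g \<in> borel_measurable borel" using cg by (rule borel_measurable_continuous_onI)
  show fB: "f ` B \<in> sets borel" unfolding im using measurable_sets[OF gm B(1)] by simp
  have bfB: "bounded (f ` B)"
    using compact_continuous_image[OF continuous_on_subset[OF cf], of "closure B"] B(2)
    by (meson bounded_subset closure_subset compact_closure compact_imp_bounded image_mono subset_UNIV)
  define S where "S = v2c -` B"
  define F where "F = (\<lambda>x. c2v (f (v2c x)))"
  define D where "D x = (\<lambda>h. c2v (Re (v2c h) *\<^sub>R fx (v2c x) + Im (v2c h) *\<^sub>R fy (v2c x)))" for x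
  have S: "S \<in> sets borel" unfolding S_def using measurable_sets[OF borel_v2c B(1)] by simp
  have SL: "S \<in> sets lebesgue" using S by auto
  have FS: "F ` S = v2c -` (f ` B)"
  proof (intro subset_antisym subsetI)
    fix y assume "y \<in> v2c -` (f ` B)"
    then obtain b where b: "b \<in> B" "v2c y = f b" by auto
    then have "F (c2v b) = y" unfolding F_def by (metis v2c_c2v)
    then show "y \<in> F ` S" using b by (force simp: S_def)
  qed (auto simp: F_def S_def)
  have c2v_img: "c2v ` X = v2c -` X" for X
    by (auto intro: image_eqI[of _ _ "v2c _"])
  have FSm: "F ` S \<in> sets borel" unfolding FS using measurable_sets[OF borel_v2c fB] by simp
  have "bounded (F ` S)" unfolding FS c2v_img[symmetric]
    by (intro bounded_linear_image[OF bfB bounded_linear_c2v])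
  then have FSl: "F ` S \<in> lmeasurable" using FSm by (intro bounded_set_imp_lmeasurable) auto
  have Fder: "(F has_derivative D x) (at x within S)" if "x \<in> S" for x
  proof -
    have 1: "(v2c has_derivative v2c) (at x within S)"
      by (rule bounded_linear_imp_has_derivative[OF bounded_linear_v2c])
    have 2: "v2c ` S \<subseteq> B" by (auto simp: S_def)
    have "v2c x \<in> B" using that by (simp add: S_def)
    from has_derivative_in_compose2[OF der 2 that 1]
    have "((\<lambda>x. f (v2c x)) has_derivative (\<lambda>h. Re (v2c h) *\<^sub>R fx (v2c x) + Im (v2c h) *\<^sub>R fy (v2c x))) (at x within S)" .
    from bounded_linear.has_derivative[OF bounded_linear_c2v this] show ?thesis unfolding F_def D_def .
  qed
  have inj: "inj_on F S"
    unfolding F_def by (intro inj_onI) (metis fg(2) v2c_c2v)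
  have det: "\<bar>det (matrix (D x))\<bar> = \<bar>jac (fx (v2c x)) (fy (v2c x))\<bar>" for x
    unfolding det_2 matrix_def D_def v2c_def c2v_def jac_def by (simp add: axis_def mult.commute)
  have "((\<lambda>x. \<bar>det (matrix (D x))\<bar>) has_integral (measure lebesgue (F ` S))) S"
    using has_measure_differentiable_image[OF SL Fder inj, of "measure lebesgue (F ` S)"] FSl by simp
  then have hi: "((\<lambda>x. \<bar>jac (fx (v2c x)) (fy (v2c x))\<bar>) has_integral (measure lebesgue (F ` S))) S"
    unfolding det .
  have "emeasure lborel (f ` B) = emeasure lborel (F ` S)"
    unfolding FS by (rule emeasure_v2c_vimage[OF fB, symmetric])
  also have "\<dots> = emeasure lebesgue (F ` S)" using FSm by simp
  also have "\<dots> = ennreal (measure lebesgue (F ` S))" by (rule emeasure_eq_measure2[OF FSl])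
  also have "\<dots> = (\<integral>\<^sup>+x. ennreal (indicator S x * \<bar>jac (fx (v2c x)) (fy (v2c x))\<bar>) \<partial>lborel)"
    using nn_integral_has_integral_lebesgue[OF _ hi] by (simp add: nn_integral_completion)
  also have "\<dots> = (\<integral>\<^sup>+x. ennreal \<bar>jac (fx (v2c x)) (fy (v2c x))\<bar> * indicator B (v2c x) \<partial>lborel)"
    by (intro nn_integral_cong) (auto simp: indicator_def S_def)
  also have "\<dots> = (\<integral>\<^sup>+x. ennreal \<bar>jac (fx x) (fy x)\<bar> * indicator B x \<partial>distr lborel borel v2c)"
    using B(1) by (subst nn_integral_distr) auto
  also have "\<dots> = (\<integral>\<^sup>+x. ennreal \<bar>jac (fx x) (fy x)\<bar> * indicator B x \<partial>lborel)"
    by (simp add: distr_v2c)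
  finally show "emeasure lborel (f ` B) = (\<integral>\<^sup>+x. ennreal \<bar>jac (fx x) (fy x)\<bar> * indicator B x \<partial>lborel)" .
qed

text \<open>In terms of measures: \<open>f\<close> pushes the density \<open>jac\<close> on
  \<open>G\<close> forward to Lebesgue measure on the image, which the previous lemma verifies on
  all preimages of Borel sets.\<close>

lemma nn_integral_image_eq_jac:
  assumes hom: "homeomorphism UNIV UNIV f g"
    and G [measurable]: "G \<in> sets borel" "bounded G"
    and fx [measurable]: "fx \<in> borel_measurable borel" and fy [measurable]: "fy \<in> borel_measurable borel"
    and der: "\<And>x. x \<in> G \<Longrightarrow> (f has_derivative (\<lambda>h. Re h *\<^sub>R fx x + Im h *\<^sub>R fy x)) (at x within G)"
    and h [measurable]: "h \<in> borel_measurable borel"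
  shows "(\<integral>\<^sup>+x. ennreal \<bar>jac (fx x) (fy x)\<bar> * h (f x) * indicator G x \<partial>lborel) = (\<integral>\<^sup>+y. h y * indicator (f ` G) y \<partial>lborel)"
proof -
  have fg: "f (g y) = y" "g (f x) = x" for x y
    using hom by (auto simp: homeomorphism_def)
  have fm [measurable]: "f \<in> borel_measurable borel"
    using hom by (auto simp: homeomorphism_def intro: borel_measurable_continuous_onI)
  have fG [measurable]: "f ` G \<in> sets borel"
    by (rule emeasure_image_eq_jac(1)[OF hom G fx fy der])
  have eq: "distr (density lborel (\<lambda>x. ennreal \<bar>jac (fx x) (fy x)\<bar> * indicator G x)) borel f = density lborel (indicator (f ` G))"
  proof (rule measure_eqI)
    fix A assume "A \<in> sets (distr (density lborel (\<lambda>x. ennreal \<bar>jac (fx x) (fy x)\<bar> * indicator G x)) borel f)"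
    then have A [measurable]: "A \<in> sets borel" by simp
    have fA [measurable]: "f -` A \<in> sets borel" using measurable_sets[OF fm A] by simp
    have "emeasure (distr (density lborel (\<lambda>x. ennreal \<bar>jac (fx x) (fy x)\<bar> * indicator G x)) borel f) A
      = (\<integral>\<^sup>+x. ennreal \<bar>jac (fx x) (fy x)\<bar> * indicator (G \<inter> f -` A) x \<partial>lborel)"
      by (simp add: emeasure_distr emeasure_density mult.assoc flip: indicator_inter_arith)
    also have "\<dots> = emeasure lborel (f ` (G \<inter> f -` A))"
    proof (rule emeasure_image_eq_jac(2)[OF hom _ _ fx fy, symmetric])
      show "(f has_derivative (\<lambda>h. Re h *\<^sub>R fx x + Im h *\<^sub>R fy x)) (at x within G \<inter> f -` A)" if "x \<in> G \<inter> f -` A" for x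
        using der[of x] that by (auto intro: has_derivative_subset)
    qed (use G in \<open>auto intro: bounded_Int\<close>)
    also have "f ` (G \<inter> f -` A) = f ` G \<inter> A" by auto
    also have "emeasure lborel (f ` G \<inter> A) = emeasure (density lborel (indicator (f ` G))) A"
      by (simp add: emeasure_density flip: indicator_inter_arith)
    finally show "emeasure (distr (density lborel (\<lambda>x. ennreal \<bar>jac (fx x) (fy x)\<bar> * indicator G x)) borel f) A
      = emeasure (density lborel (indicator (f ` G))) A" .
  qed simp
  have "(\<integral>\<^sup>+x. ennreal \<bar>jac (fx x) (fy x)\<bar> * h (f x) * indicator G x \<partial>lborel)
     = (\<integral>\<^sup>+y. h y \<partial>distr (density lborel (\<lambda>x. ennreal \<bar>jac (fx x) (fy x)\<bar> * indicator G x)) borel f)"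
    by (subst nn_integral_distr) (auto simp: nn_integral_density mult_ac)
  also have "\<dots> = (\<integral>\<^sup>+y. h y * indicator (f ` G) y \<partial>lborel)"
    unfolding eq by (subst nn_integral_density) (auto simp: mult.commute)
  finally show ?thesis .
qed

text \<open>Only an inequality survives: the null set left over by the pieces may have an image of
  positive area. Since almost every point lies in all late pieces, Fatou's lemma passes the bound
  from the pieces to \<open>U\<close>.\<close>

lemma nn_integral_jac_le_image:
  assumes hom: "homeomorphism UNIV UNIV f g" and lim: "C1_limit f fx fy"
    and U [measurable]: "U \<in> sets borel" "bounded U"
    and h [measurable]: "h \<in> borel_measurable borel"
  shows "(\<integral>\<^sup>+x. ennreal \<bar>jac (fx x) (fy x)\<bar> * h (f x) * indicator U x \<partial>lborel) \<le> (\<integral>\<^sup>+y. h y * indicator (f ` U) y \<partial>lborel)"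
proof -
  have fx [measurable]: "fx \<in> borel_measurable borel" and fy [measurable]: "fy \<in> borel_measurable borel"
    using lim by (auto simp: C1_limit_def)
  have fm [measurable]: "f \<in> borel_measurable borel"
    using hom by (auto simp: homeomorphism_def intro: borel_measurable_continuous_onI)
  obtain R where R: "0 \<le> R" "U \<subseteq> cball 0 R"
    using U(2) unfolding bounded_pos by (auto simp: subset_iff intro: less_imp_le)
  obtain G where G: "\<And>m. G m \<in> sets borel" "\<And>m. G m \<subseteq> cball 0 R"
    "\<And>m x. x \<in> G m \<Longrightarrow> (f has_derivative (\<lambda>h. Re h *\<^sub>R fx x + Im h *\<^sub>R fy x)) (at x within G m)"
    "AE x in lborel. x \<in> cball 0 R \<longrightarrow> (\<forall>\<^sub>F m in sequentially. x \<in> G m)"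
    using C1_limit_lusin[OF lim R(1)] by blast
  note [measurable] = G(1)
  let ?q = "\<lambda>m x. ennreal \<bar>jac (fx x) (fy x)\<bar> * h (f x) * indicator (U \<inter> G m) x"
  have "(\<integral>\<^sup>+x. ?q m x \<partial>lborel) \<le> (\<integral>\<^sup>+y. h y * indicator (f ` U) y \<partial>lborel)" for m
  proof -
    have "(\<integral>\<^sup>+x. ?q m x \<partial>lborel) = (\<integral>\<^sup>+y. h y * indicator (f ` (U \<inter> G m)) y \<partial>lborel)"
    proof (rule nn_integral_image_eq_jac[OF hom _ _ fx fy _ h])
      show "(f has_derivative (\<lambda>h. Re h *\<^sub>R fx x + Im h *\<^sub>R fy x)) (at x within U \<inter> G m)" if "x \<in> U \<inter> G m" for x
        using G(3)[of x m] that by (auto intro: has_derivative_subset)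
    qed (use U in \<open>auto intro: bounded_Int\<close>)
    also have "\<dots> \<le> (\<integral>\<^sup>+y. h y * indicator (f ` U) y \<partial>lborel)"
      by (intro nn_integral_mono mult_left_mono) (auto simp: indicator_def)
    finally show ?thesis .
  qed
  note le = this
  have "AE x in lborel. ennreal \<bar>jac (fx x) (fy x)\<bar> * h (f x) * indicator U x \<le> liminf (\<lambda>m. ?q m x)"
    using G(4)
  proof eventually_elim
    case (elim x)
    show ?case
    proof (cases "x \<in> U")
      case True
      then have "\<forall>\<^sub>F m in sequentially. x \<in> G m" using elim R(2) by auto
      then have "\<forall>\<^sub>F m in sequentially. ennreal \<bar>jac (fx x) (fy x)\<bar> * h (f x) * indicator U x \<le> ?q m x"
        by eventually_elim (use True in auto)
      then show ?thesis by (rule Liminf_bounded)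
    qed simp
  qed
  then have "(\<integral>\<^sup>+x. ennreal \<bar>jac (fx x) (fy x)\<bar> * h (f x) * indicator U x \<partial>lborel) \<le> (\<integral>\<^sup>+x. liminf (\<lambda>m. ?q m x) \<partial>lborel)"
    by (rule nn_integral_mono_AE)
  also have "\<dots> \<le> liminf (\<lambda>m. \<integral>\<^sup>+x. ?q m x \<partial>lborel)"
    by (intro nn_integral_liminf) auto
  also have "\<dots> \<le> (\<integral>\<^sup>+y. h y * indicator (f ` U) y \<partial>lborel)"
    by (intro Liminf_le) (auto simp: le)
  finally show ?thesis .
qed

section \<open>Mollification of weak derivatives\<close>

lemma Ck_SucI:
  assumes "\<And>z. (\<phi> has_derivative (\<lambda>h. Re h * \<phi>x z + Im h * \<phi>y z)) (at z)" "Ck k \<phi>x" "Ck k \<phi>y"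
  shows "Ck (Suc k) \<phi>"
  using assms unfolding Ck.simps by blast

lemma Ck_add: "Ck k \<phi> \<Longrightarrow> Ck k \<psi> \<Longrightarrow> Ck k (\<lambda>z. \<phi> z + \<psi> z)"
proof (induction k arbitrary: \<phi> \<psi>)
  case 0 then show ?case by (auto intro: continuous_intros)
next
  case (Suc k)
  from Suc.prems obtain \<phi>x \<phi>y \<psi>x \<psi>y where
    1: "\<And>z. (\<phi> has_derivative (\<lambda>h. Re h * \<phi>x z + Im h * \<phi>y z)) (at z)" "Ck k \<phi>x" "Ck k \<phi>y" and
    2: "\<And>z. (\<psi> has_derivative (\<lambda>h. Re h * \<psi>x z + Im h * \<psi>y z)) (at z)" "Ck k \<psi>x" "Ck k \<psi>y"
    by auto
  have "((\<lambda>z. \<phi> z + \<psi> z) has_derivative (\<lambda>h. Re h * (\<phi>x z + \<psi>x z) + Im h * (\<phi>y z + \<psi>y z))) (at z)" for z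
    by (rule has_derivative_eq_rhs[OF has_derivative_add[OF 1(1) 2(1)]]) (auto simp: algebra_simps)
  from this Suc.IH[OF 1(2) 2(2)] Suc.IH[OF 1(3) 2(3)] show ?case by (rule Ck_SucI)
qed

lemma Ck_cmult: "Ck k \<phi> \<Longrightarrow> Ck k (\<lambda>z. c * \<phi> z)"
proof (induction k arbitrary: \<phi>)
  case 0 then show ?case by (auto intro: continuous_intros)
next
  case (Suc k)
  from Suc.prems obtain \<phi>x \<phi>y where
    1: "\<And>z. (\<phi> has_derivative (\<lambda>h. Re h * \<phi>x z + Im h * \<phi>y z)) (at z)" "Ck k \<phi>x" "Ck k \<phi>y" 
    by auto
  have "((\<lambda>z. c * \<phi> z) has_derivative (\<lambda>h. Re h * (c * \<phi>x z) + Im h * (c * \<phi>y z))) (at z)" for z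
    by (rule has_derivative_eq_rhs[OF has_derivative_mult_right[OF 1(1)]]) (auto simp: algebra_simps)
  from this Suc.IH[OF 1(2)] Suc.IH[OF 1(3)] show ?case by (rule Ck_SucI)
qed

lemma has_derivative_affine_comp:
  fixes \<phi> :: "complex \<Rightarrow> real"
  assumes "\<And>z. (\<phi> has_derivative (\<lambda>h. Re h * \<phi>x z + Im h * \<phi>y z)) (at z)"
  shows "((\<lambda>z. \<phi> (a + b *\<^sub>R z)) has_derivative (\<lambda>h. Re h * (b * \<phi>x (a + b *\<^sub>R z)) + Im h * (b * \<phi>y (a + b *\<^sub>R z)))) (at z)"
proof -
  have "((\<lambda>z. a + b *\<^sub>R z) has_derivative (\<lambda>h. b *\<^sub>R h)) (at z)"
    by (auto intro!: derivative_eq_intros)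
  from has_derivative_compose[OF this assms] show ?thesis
    by (rule has_derivative_eq_rhs) (auto simp: algebra_simps)
qed

lemma Ck_affine: "Ck k \<phi> \<Longrightarrow> Ck k (\<lambda>z. \<phi> (a + b *\<^sub>R z))"
proof (induction k arbitrary: \<phi>)
  case 0 then show ?case by (auto intro!: continuous_intros intro: continuous_on_compose2)
next
  case (Suc k)
  from Suc.prems obtain \<phi>x \<phi>y where
    1: "\<And>z. (\<phi> has_derivative (\<lambda>h. Re h * \<phi>x z + Im h * \<phi>y z)) (at z)" "Ck k \<phi>x" "Ck k \<phi>y" 
    by auto
  have "Ck k (\<lambda>z. b * \<phi>x (a + b *\<^sub>R z))" "Ck k (\<lambda>z. b * \<phi>y (a + b *\<^sub>R z))"
    by (intro Ck_cmult Suc.IH 1)+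
  with has_derivative_affine_comp[OF 1(1)] show ?case by (rule Ck_SucI)
qed

text \<open>The extra power \<open>t ^ k\<close> is there for the induction: removing the lowest
  coefficient of the polynomial shifts a factor \<open>t\<close> into it.\<close>

lemma poly_mult_exp_minus_tendsto_0: "((\<lambda>t. t ^ k * poly (Q::real poly) t * exp (- t)) \<longlongrightarrow> 0) at_top"
proof (induction Q arbitrary: k)
  case 0 show ?case by simp
next
  case (pCons a p)
  have "((\<lambda>t::real. a * (t ^ k / exp t) + t ^ Suc k * poly p t * exp (- t)) \<longlongrightarrow> a * 0 + 0) at_top"
    by (intro tendsto_intros tendsto_power_div_exp_0 pCons.IH)
  then show ?case by (simp add: algebra_simps exp_minus divide_inverse)
qed

text \<open>The functions \<open>poly P (1 / x) * exp (- (1 / x))\<close>, extended by 0, form a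
  family closed under differentiation. Smoothness of all orders then follows by induction over the
  family, with no formula for higher derivatives.\<close>

definition bump_poly :: "real poly \<Rightarrow> real \<Rightarrow> real" where
  "bump_poly P x = (if 0 < x then poly P (1 / x) * exp (- (1 / x)) else 0)"

text \<open>In the variable \<open>y = 1 / x\<close> differentiation is \<open>- y\<^sup>2\<close>
  times the derivative in \<open>y\<close>, and the derivative of \<open>P * exp (- y)\<close> is
  \<open>(pderiv P - P) * exp (- y)\<close>. At 0 the exponential beats every polynomial.\<close>

lemma bump_poly_has_derivative:
  "(bump_poly P has_real_derivative bump_poly (monom 1 2 * (P - pderiv P)) x) (at x)"
proof -
  consider "x < 0" | "x = 0" | "0 < x" by linarith
  then show ?thesis
  proof cases
    case 1
    have "(bump_poly P has_real_derivative 0) (at x)"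
      by (rule has_field_derivative_transform_within_open[where f = "\<lambda>_. 0" and S = "{..<0}"])
         (use 1 in \<open>auto simp: bump_poly_def\<close>)
    then show ?thesis using 1 by (simp add: bump_poly_def)
  next
    case 3
    have "((\<lambda>x. poly P (1 / x) * exp (- (1 / x))) has_real_derivative bump_poly (monom 1 2 * (P - pderiv P)) x) (at x)"
      using 3 by (auto intro!: derivative_eq_intros DERIV_chain2[OF poly_DERIV]
         simp: bump_poly_def poly_monom power2_eq_square field_simps)
    then show ?thesis
      by (rule has_field_derivative_transform_within_open[where S = "{0<..}"])
         (use 3 in \<open>auto simp: bump_poly_def\<close>)
  next
    case 2
    have "((\<lambda>y. (bump_poly P y - bump_poly P 0) / (y - 0)) \<longlongrightarrow> 0) (at 0)"
    proof (rule filterlim_split_at)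
      show "((\<lambda>y. (bump_poly P y - bump_poly P 0) / (y - 0)) \<longlongrightarrow> 0) (at_left 0)"
        by (rule Lim_transform_eventually[OF tendsto_const])
           (auto simp: eventually_at_left_field bump_poly_def intro!: exI[of _ "-1"])
      have "((\<lambda>y. inverse y ^ 1 * poly P (inverse y) * exp (- inverse y)) \<longlongrightarrow> 0) (at_right (0::real))"
        by (rule filterlim_compose[OF poly_mult_exp_minus_tendsto_0 filterlim_inverse_at_top_right])
      then show "((\<lambda>y. (bump_poly P y - bump_poly P 0) / (y - 0)) \<longlongrightarrow> 0) (at_right 0)"
        by (rule Lim_transform_eventually)
           (auto simp: eventually_at_right_field bump_poly_def field_simps intro!: exI[of _ "1"])
    qed
    then show ?thesis using 2 by (simp add: has_field_derivative_iff bump_poly_def)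
  qed
qed

lemma continuous_on_bump_poly: "continuous_on S (bump_poly P)"
  using bump_poly_has_derivative by (meson DERIV_isCont continuous_at_imp_continuous_on)

text \<open>One factor for each side of the square with half side 1, each vanishing beyond its side.
  Separate polynomials keep the family closed under partial derivatives up to sums.\<close>

definition bump4 :: "real poly \<Rightarrow> real poly \<Rightarrow> real poly \<Rightarrow> real poly \<Rightarrow> complex \<Rightarrow> real" where
  "bump4 P Q P' Q' z = bump_poly P (1 - Re z) * bump_poly Q (1 + Re z) * (bump_poly P' (1 - Im z) * bump_poly Q' (1 + Im z))"

lemma bump4_has_derivative:
  fixes P Q P' Q' :: "real poly"
  defines "d \<equiv> \<lambda>P. monom 1 2 * (P - pderiv P)"
  shows "(bump4 P Q P' Q' has_derivative (\<lambda>h. Re h * (bump4 P (d Q) P' Q' z + (-1) * bump4 (d P) Q P' Q' z) +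
     Im h * (bump4 P Q P' (d Q') z + (-1) * bump4 P Q (d P') Q' z))) (at z)"
proof -
  have re: "((\<lambda>z. bump_poly P (1 - Re z)) has_derivative (\<lambda>h. bump_poly (d P) (1 - Re z) * (- Re h))) (at z)"
           "((\<lambda>z. bump_poly P (1 + Re z)) has_derivative (\<lambda>h. bump_poly (d P) (1 + Re z) * (Re h))) (at z)"
           "((\<lambda>z. bump_poly P (1 - Im z)) has_derivative (\<lambda>h. bump_poly (d P) (1 - Im z) * (- Im h))) (at z)"
           "((\<lambda>z. bump_poly P (1 + Im z)) has_derivative (\<lambda>h. bump_poly (d P) (1 + Im z) * (Im h))) (at z)" for P
  proof -
    have c: "((\<lambda>z. bump_poly P (g z)) has_derivative (\<lambda>h. bump_poly (d P) (g z) * g' h)) (at z)"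
      if "(g has_derivative g') (at z)" for g g'
      unfolding d_def
      by (rule has_derivative_compose[OF that bump_poly_has_derivative[THEN has_field_derivative_imp_has_derivative]])
    have d: "(Re has_derivative Re) (at z)" "(Im has_derivative Im) (at z)"
      by (intro bounded_linear_imp_has_derivative bounded_linear_Re bounded_linear_Im)+
    note d1 = has_derivative_diff[OF has_derivative_const d(1), of 1] has_derivative_add[OF has_derivative_const d(1), of 1]
      has_derivative_diff[OF has_derivative_const d(2), of 1] has_derivative_add[OF has_derivative_const d(2), of 1]
    show "((\<lambda>z. bump_poly P (1 - Re z)) has_derivative (\<lambda>h. bump_poly (d P) (1 - Re z) * (- Re h))) (at z)"
      "((\<lambda>z. bump_poly P (1 + Re z)) has_derivative (\<lambda>h. bump_poly (d P) (1 + Re z) * (Re h))) (at z)"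
      "((\<lambda>z. bump_poly P (1 - Im z)) has_derivative (\<lambda>h. bump_poly (d P) (1 - Im z) * (- Im h))) (at z)"
      "((\<lambda>z. bump_poly P (1 + Im z)) has_derivative (\<lambda>h. bump_poly (d P) (1 + Im z) * (Im h))) (at z)"
      using c[OF d1(1)] c[OF d1(2)] c[OF d1(3)] c[OF d1(4)] by simp_all
  qed
  show ?thesis
    unfolding bump4_def[abs_def]
    by (rule has_derivative_eq_rhs[OF has_derivative_mult[OF has_derivative_mult[OF re(1) re(2)] has_derivative_mult[OF re(3) re(4)]]])
       (auto simp: algebra_simps)
qed

lemma continuous_on_bump4: "continuous_on S (bump4 P Q P' Q')"
  unfolding bump4_def by (intro continuous_intros continuous_on_compose2[OF continuous_on_bump_poly[of UNIV]]) auto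

lemma Ck_bump4: "Ck k (bump4 P Q P' Q')"
proof (induction k arbitrary: P Q P' Q')
  case 0 show ?case by (simp add: continuous_on_bump4)
next
  case (Suc k)
  show ?case by (rule Ck_SucI[OF bump4_has_derivative]) (intro Ck_add Ck_cmult Suc.IH)+
qed

lemma bump4_eq_0: "1 \<le> \<bar>Re z\<bar> \<or> 1 \<le> \<bar>Im z\<bar> \<Longrightarrow> bump4 P Q P' Q' z = 0"
  by (auto simp: bump4_def bump_poly_def)

text \<open>The square lies in the disc of radius 2; this is the origin of the radius 2 in all later
  support conditions.\<close>

lemma bump4_support: "2 < cmod z \<Longrightarrow> bump4 P Q P' Q' z = 0"
  using cmod_le[of z] by (intro bump4_eq_0) linarith

lemma ex_mollifier:
  obtains \<eta> \<eta>x \<eta>y :: "complex \<Rightarrow> real" where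
    "\<And>k. Ck k \<eta>" "\<And>z. 0 \<le> \<eta> z" "(\<integral>\<^sup>+z. ennreal (\<eta> z) \<partial>lborel) = 1"
    "\<And>z. (\<eta> has_derivative (\<lambda>h. Re h * \<eta>x z + Im h * \<eta>y z)) (at z)"
    "\<And>k. Ck k \<eta>x" "\<And>k. Ck k \<eta>y"
    "\<And>z. 2 < cmod z \<Longrightarrow> \<eta> z = 0" "\<And>z. 2 < cmod z \<Longrightarrow> \<eta>x z = 0" "\<And>z. 2 < cmod z \<Longrightarrow> \<eta>y z = 0"
proof -
  let ?b = "bump4 1 1 1 1"
  define d :: "real poly" where "d = monom 1 2 * (1 - pderiv 1)"
  have nn: "0 \<le> ?b z" for z by (auto simp: bump4_def bump_poly_def)
  have cb: "continuous_on UNIV ?b" by (rule continuous_on_bump4)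
  have [measurable]: "?b \<in> borel_measurable borel" using cb by (rule borel_measurable_continuous_onI)
  define m where "m = (\<integral>\<^sup>+z. ennreal (?b z) \<partial>lborel)"
  have le1: "bump_poly 1 x \<le> 1" for x by (simp add: bump_poly_def)
  have b0: "0 \<le> bump_poly 1 x" for x by (simp add: bump_poly_def)
  have b1: "?b z \<le> 1" for z unfolding bump4_def using le1 b0 by (simp add: mult_le_one)
  have "m \<le> (\<integral>\<^sup>+z. 1 * indicator (cball (0::complex) 2) z \<partial>lborel)"
    unfolding m_def
  proof (rule nn_integral_mono)
    fix z
    show "ennreal (?b z) \<le> 1 * indicator (cball 0 2) z"
      using b1[of z] bump4_support[of z] by (cases "cmod z \<le> 2") (auto simp: ennreal_le_1)
  qed
  also have "\<dots> < \<infinity>" by (simp add: emeasure_cball)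
  finally have mfin: "m < \<infinity>" .
  have "m \<noteq> 0"
  proof
    assume "m = 0"
    then have "AE z in lborel. ennreal (?b z) = 0" unfolding m_def by (subst (asm) nn_integral_0_iff_AE) auto
    then have "AE z in lborel. z \<notin> ball (0::complex) 1"
    proof eventually_elim
      case (elim z)
      have "0 < ?b z" if "cmod z < 1"
        using that abs_Re_le_cmod[of z] abs_Im_le_cmod[of z]
        unfolding bump4_def bump_poly_def by (auto simp: abs_le_iff)
      then show ?case using elim nn[of z] by (auto simp: ennreal_eq_0_iff not_le)
    qed
    then have "emeasure lborel (ball (0::complex) 1) = 0"
      by (subst (asm) AE_iff_measurable[where N = "ball 0 1"]) auto
    then show False by (simp add: emeasure_ball unit_ball_vol_2)
  qed
  define M where "M = enn2real m"
  have M: "0 < M" "m = ennreal M"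
    using mfin \<open>m \<noteq> 0\<close> by (auto simp: M_def enn2real_positive_iff less_top zero_less_iff_neq_zero)
  show ?thesis
  proof (rule that[of "\<lambda>z. inverse M * ?b z" "\<lambda>z. inverse M * (bump4 1 d 1 1 z + (-1) * bump4 d 1 1 1 z)"
        "\<lambda>z. inverse M * (bump4 1 1 1 d z + (-1) * bump4 1 1 d 1 z)"])
    show "(\<integral>\<^sup>+z. ennreal (inverse M * ?b z) \<partial>lborel) = 1"
    proof -
      have "(\<integral>\<^sup>+z. ennreal (inverse M * ?b z) \<partial>lborel) = (\<integral>\<^sup>+z. ennreal (inverse M) * ennreal (?b z) \<partial>lborel)"
        using M nn by (intro nn_integral_cong) (simp add: ennreal_mult)
      also have "\<dots> = ennreal (inverse M) * m" unfolding m_def by (intro nn_integral_cmult) auto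
      also have "\<dots> = 1" using M by (simp flip: ennreal_mult)
      finally show ?thesis .
    qed
    show "((\<lambda>z. inverse M * ?b z) has_derivative (\<lambda>h. Re h * (inverse M * (bump4 1 d 1 1 z + (-1) * bump4 d 1 1 1 z)) +
       Im h * (inverse M * (bump4 1 1 1 d z + (-1) * bump4 1 1 d 1 z)))) (at z)" for z
      by (rule has_derivative_eq_rhs[OF has_derivative_mult_right[OF bump4_has_derivative[of 1 1 1 1, folded d_def]]]) (auto simp: algebra_simps)
    show "Ck k (\<lambda>z. inverse M * ?b z)" "Ck k (\<lambda>z. inverse M * (bump4 1 d 1 1 z + (-1) * bump4 d 1 1 1 z))"
      "Ck k (\<lambda>z. inverse M * (bump4 1 1 1 d z + (-1) * bump4 1 1 d 1 z))" for k
      by (intro Ck_cmult Ck_add Ck_bump4)+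
  qed (use M nn in \<open>auto simp: bump4_support\<close>)
qed

section \<open>Convolution with compactly supported kernels\<close>

lemma uniform_continuity_compact_support:
  fixes K :: "complex \<Rightarrow> 'a::real_normed_vector"
  assumes "continuous_on UNIV K" "\<And>z. \<rho> < cmod z \<Longrightarrow> K z = 0" "0 < e"
  obtains d where "0 < d" "\<And>x y. dist x y < d \<Longrightarrow> dist (K x) (K y) < e"
proof -
  have "uniformly_continuous_on (cball 0 (\<rho> + 1)) K"
    by (rule compact_uniformly_continuous[OF continuous_on_subset[OF assms(1)]]) auto
  then obtain d where d: "0 < d" "\<And>x y. x \<in> cball 0 (\<rho> + 1) \<Longrightarrow> y \<in> cball 0 (\<rho> + 1) \<Longrightarrow> dist x y < d \<Longrightarrow> dist (K x) (K y) < e"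
    using assms(3) unfolding uniformly_continuous_on_def by (metis dist_commute)
  show ?thesis
  proof (rule that[of "min d 1"])
    fix x y :: complex assume xy: "dist x y < min d 1"
    show "dist (K x) (K y) < e"
    proof (cases "\<rho> < cmod x \<and> \<rho> < cmod y")
      case True then show ?thesis using assms(2,3) by simp
    next
      case False
      have "cmod x \<le> cmod y + dist x y" "cmod y \<le> cmod x + dist x y"
        using norm_triangle_sub[of x y] norm_triangle_sub[of y x] by (auto simp: dist_norm norm_minus_commute)
      with False xy have "x \<in> cball 0 (\<rho> + 1)" "y \<in> cball 0 (\<rho> + 1)" by auto
      with d xy show ?thesis by auto
    qed
  qed (use d in auto)
qed

lemma integrable_compact_support:
  fixes q :: "complex \<Rightarrow> complex"
  assumes "continuous_on UNIV q" "\<And>w. w \<notin> cball z r \<Longrightarrow> q w = 0"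
  shows "integrable lborel q"
proof -
  have "integrable lborel (\<lambda>w. indicator (cball z r) w *\<^sub>R q w)"
    by (intro borel_integrable_compact continuous_on_subset[OF assms(1)]) auto
  also have "(\<lambda>w. indicator (cball z r) w *\<^sub>R q w) = q"
    using assms(2) by (auto simp: indicator_def fun_eq_iff)
  finally show ?thesis .
qed

lemma integrable_convolution:
  fixes K :: "complex \<Rightarrow> real" and f :: "complex \<Rightarrow> complex"
  assumes "continuous_on UNIV K" "\<And>z. \<rho> < cmod z \<Longrightarrow> K z = 0" "continuous_on UNIV f"
  shows "integrable lborel (\<lambda>w. K (z - w) *\<^sub>R f w)"
proof (rule integrable_compact_support[where z = z and r = \<rho>])
  show "continuous_on UNIV (\<lambda>w. K (z - w) *\<^sub>R f w)"
    by (intro continuous_intros assms continuous_on_compose2[OF assms(1)]) auto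
qed (use assms(2) in \<open>auto simp: dist_norm\<close>)

text \<open>The partial derivatives of the kernel are uniformly continuous, so the mean value
  inequality makes its first order remainder at most \<open>e * cmod h\<close> uniformly in the
  point. Only \<open>w\<close> in the disc \<open>D\<close> contribute, and \<open>f\<close> is
  integrable there.\<close>

lemma convolution_has_derivative:
  fixes K :: "complex \<Rightarrow> real" and f :: "complex \<Rightarrow> complex"
  assumes der: "\<And>z. (K has_derivative (\<lambda>h. Re h * Kx z + Im h * Ky z)) (at z)"
    and cx: "continuous_on UNIV Kx" and cy: "continuous_on UNIV Ky"
    and s: "\<And>z. \<rho> < cmod z \<Longrightarrow> K z = 0" "\<And>z. \<rho> < cmod z \<Longrightarrow> Kx z = 0" "\<And>z. \<rho> < cmod z \<Longrightarrow> Ky z = 0"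
    and f: "continuous_on UNIV f" and \<rho>: "0 \<le> \<rho>"
  shows "((\<lambda>z. LINT w|lborel. K (z - w) *\<^sub>R f w) has_derivative
     (\<lambda>h. Re h *\<^sub>R (LINT w|lborel. Kx (z - w) *\<^sub>R f w) + Im h *\<^sub>R (LINT w|lborel. Ky (z - w) *\<^sub>R f w))) (at z)"
proof -
  have cK: "continuous_on UNIV K" using der by (meson continuous_at_imp_continuous_on has_derivative_continuous)
  have int: "integrable lborel (\<lambda>w. K (z - w) *\<^sub>R f w)" "integrable lborel (\<lambda>w. Kx (z - w) *\<^sub>R f w)"
    "integrable lborel (\<lambda>w. Ky (z - w) *\<^sub>R f w)" for z
    by (rule integrable_convolution[where \<rho> = \<rho>]; (fact cK cx cy f | erule s))+
  define D where "D = cball z (\<rho> + 1)"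
  have "integrable lborel (\<lambda>w. indicator D w *\<^sub>R f w)"
    unfolding D_def by (intro borel_integrable_compact continuous_on_subset[OF f]) auto
  then have "integrable lborel (\<lambda>w. cmod (indicator D w *\<^sub>R f w))"
    by (rule Bochner_Integration.integrable_norm)
  then have iD: "integrable lborel (\<lambda>w. indicator D w * cmod (f w))"
    by simp
  define M where "M = (LINT w|lborel. indicator D w * cmod (f w))"
  have M: "0 \<le> M" unfolding M_def by (intro integral_nonneg_AE) auto
  have est: "\<exists>d>0. \<forall>v h. cmod h < d \<longrightarrow> \<bar>K (v + h) - K v - (Re h * Kx v + Im h * Ky v)\<bar> \<le> e * cmod h" if e: "0 < e" for e
  proof -
    obtain d1 where d1: "0 < d1" "\<And>x y. dist x y < d1 \<Longrightarrow> dist (Kx x) (Kx y) < e / 2"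
      using uniform_continuity_compact_support[OF cx s(2) half_gt_zero[OF e]] by metis
    obtain d2 where d2: "0 < d2" "\<And>x y. dist x y < d2 \<Longrightarrow> dist (Ky x) (Ky y) < e / 2"
      using uniform_continuity_compact_support[OF cy s(3) half_gt_zero[OF e]] by metis
    show ?thesis
    proof (intro exI[of _ "min d1 d2"] conjI allI impI)
      fix v h :: complex assume h: "cmod h < min d1 d2"
      let ?S = "cball v (cmod h)"
      have "norm (K (v + h) - K v - (\<lambda>x h. Re h * Kx x + Im h * Ky x) v (v + h - v)) \<le> norm (v + h - v) * e"
      proof (rule differentiable_bound_linearization[where S = ?S and f = K])
        show "(K has_derivative (\<lambda>h. Re h * Kx x + Im h * Ky x)) (at x within ?S)" for x
          using der has_derivative_at_withinI by blast
        show "v + t *\<^sub>R (v + h - v) \<in> ?S" if "t \<in> {0..1}" for t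
          using that by (simp add: dist_norm mult_left_le_one_le)
        fix x assume x: "x \<in> ?S"
        have 1: "\<bar>Kx x - Kx v\<bar> \<le> e / 2" "\<bar>Ky x - Ky v\<bar> \<le> e / 2"
          using d1(2)[of x v] d2(2)[of x v] x h by (auto simp: dist_norm norm_minus_commute)
        show "onorm ((\<lambda>h. Re h * Kx x + Im h * Ky x) - (\<lambda>h. Re h * Kx v + Im h * Ky v)) \<le> e"
        proof (rule onorm_bound)
          fix k :: complex
          have "norm (((\<lambda>h. Re h * Kx x + Im h * Ky x) - (\<lambda>h. Re h * Kx v + Im h * Ky v)) k)
             = \<bar>Re k * (Kx x - Kx v) + Im k * (Ky x - Ky v)\<bar>" by (simp add: algebra_simps)
          also have "\<dots> \<le> \<bar>Re k * (Kx x - Kx v)\<bar> + \<bar>Im k * (Ky x - Ky v)\<bar>" by (rule abs_triangle_ineq)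
          also have "\<dots> \<le> cmod k * (e / 2) + cmod k * (e / 2)"
            unfolding abs_mult by (intro add_mono mult_mono abs_Re_le_cmod abs_Im_le_cmod 1) auto
          finally show "norm (((\<lambda>h. Re h * Kx x + Im h * Ky x) - (\<lambda>h. Re h * Kx v + Im h * Ky v)) k) \<le> e * norm k"
            by (simp add: mult.commute)
        qed (use e in simp)
      qed simp
      then show "\<bar>K (v + h) - K v - (Re h * Kx v + Im h * Ky v)\<bar> \<le> e * cmod h" by (simp add: mult.commute)
    qed (use d1 d2 in auto)
  qed
  show ?thesis
    unfolding has_derivative_at_alt
  proof (intro conjI allI impI)
    show "bounded_linear (\<lambda>h. Re h *\<^sub>R (LINT w|lborel. Kx (z - w) *\<^sub>R f w) + Im h *\<^sub>R (LINT w|lborel. Ky (z - w) *\<^sub>R f w))"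
      by (intro bounded_linear_add bounded_linear_scaleR_const bounded_linear_Re bounded_linear_Im)
    fix e :: real assume e: "0 < e"
    \<comment> \<open>The summand 1 guards against \<open>M = 0\<close>.\<close>
    define e' where "e' = e / (M + 1)"
    have e': "0 < e'" using e M by (simp add: e'_def)
    obtain d where d: "0 < d" "\<And>v h. cmod h < d \<Longrightarrow> \<bar>K (v + h) - K v - (Re h * Kx v + Im h * Ky v)\<bar> \<le> e' * cmod h"
      using est[OF e'] by blast
    show "\<exists>d>0. \<forall>y. norm (y - z) < d \<longrightarrow>
       norm ((LINT w|lborel. K (y - w) *\<^sub>R f w) - (LINT w|lborel. K (z - w) *\<^sub>R f w) -
         (Re (y - z) *\<^sub>R (LINT w|lborel. Kx (z - w) *\<^sub>R f w) + Im (y - z) *\<^sub>R (LINT w|lborel. Ky (z - w) *\<^sub>R f w))) \<le> e * norm (y - z)"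
    \<comment> \<open>Increments of length below 1 keep the supports of the shifted kernels inside
      \<open>D\<close>, whose radius is \<open>\<rho> + 1\<close>.\<close>
    proof (intro exI[of _ "min d 1"] conjI allI impI)
      fix y assume y: "norm (y - z) < min d 1"
      define h where "h = y - z"
      have yz: "y = z + h" and h: "cmod h < d" "cmod h < 1" using y by (auto simp: h_def)
      define q where "q w = (K (y - w) - K (z - w) - (Re h * Kx (z - w) + Im h * Ky (z - w))) *\<^sub>R f w" for w
      have "(LINT w|lborel. K (y - w) *\<^sub>R f w) - (LINT w|lborel. K (z - w) *\<^sub>R f w) -
         (Re h *\<^sub>R (LINT w|lborel. Kx (z - w) *\<^sub>R f w) + Im h *\<^sub>R (LINT w|lborel. Ky (z - w) *\<^sub>R f w))
         = (LINT w|lborel. K (y - w) *\<^sub>R f w - K (z - w) *\<^sub>R f w - (Re h *\<^sub>R (Kx (z - w) *\<^sub>R f w) + Im h *\<^sub>R (Ky (z - w) *\<^sub>R f w)))"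
        by (simp add: int del: scaleR_scaleR)
      also have "\<dots> = (LINT w|lborel. q w)"
        unfolding q_def by (intro Bochner_Integration.integral_cong) (auto simp: algebra_simps)
      finally have eq: "(LINT w|lborel. K (y - w) *\<^sub>R f w) - (LINT w|lborel. K (z - w) *\<^sub>R f w) -
         (Re h *\<^sub>R (LINT w|lborel. Kx (z - w) *\<^sub>R f w) + Im h *\<^sub>R (LINT w|lborel. Ky (z - w) *\<^sub>R f w)) = (LINT w|lborel. q w)" .
      have qb: "cmod (q w) \<le> e' * cmod h * (indicator D w * cmod (f w))" for w
      proof (cases "w \<in> D")
        case True
        have "cmod (q w) \<le> (e' * cmod h) * cmod (f w)"
          unfolding q_def norm_scaleR yz using d(2)[OF h(1), of "z - w"]
          by (intro mult_right_mono) (auto simp: algebra_simps)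
        with True show ?thesis by simp
      next
        case False
        then have "\<rho> + 1 < cmod (z - w)" by (auto simp: D_def dist_norm)
        moreover have "cmod (z - w) \<le> cmod (y - w) + cmod h"
          using norm_triangle_ineq4[of "y - w" h] by (simp add: yz)
        ultimately have "\<rho> < cmod (z - w)" "\<rho> < cmod (y - w)" using h by auto
        then show ?thesis using False s by (simp add: q_def)
      qed
      have "cmod (LINT w|lborel. q w) \<le> (LINT w|lborel. e' * cmod h * (indicator D w * cmod (f w)))"
      proof (rule order_trans[OF integral_norm_bound integral_mono'])
        show "integrable lborel (\<lambda>w. e' * cmod h * (indicator D w * cmod (f w)))"
          using iD by simp
      qed (use qb e' in auto)
      also have "\<dots> = e' * cmod h * M" unfolding M_def by simp
      also have "\<dots> \<le> e * cmod h"
        unfolding e'_def using M e by (simp add: field_simps mult_left_mono)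
      finally show "norm ((LINT w|lborel. K (y - w) *\<^sub>R f w) - (LINT w|lborel. K (z - w) *\<^sub>R f w) -
         (Re (y - z) *\<^sub>R (LINT w|lborel. Kx (z - w) *\<^sub>R f w) + Im (y - z) *\<^sub>R (LINT w|lborel. Ky (z - w) *\<^sub>R f w))) \<le> e * norm (y - z)"
        using eq by (simp add: h_def)
    qed (use d in auto)
  qed
qed

section \<open>Approximation by continuous functions in the mean\<close>

lemma indicator_L1_approx:
  fixes A :: "complex set"
  assumes A: "A \<in> sets borel" and e: "0 < e"
  obtains \<psi> :: "complex \<Rightarrow> real" where "continuous_on UNIV \<psi>"
    "(\<integral>\<^sup>+z. ennreal \<bar>indicator A z - \<psi> z\<bar> \<partial>lborel) \<le> ennreal e"
proof -
  have AL: "A \<in> sets lebesgue" using A by auto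
  obtain U where U: "open U" "A \<subseteq> U" "emeasure lebesgue (U - A) < ennreal (e / 2)"
    by (rule sets_lebesgue_outer_open[OF AL half_gt_zero[OF e]])
  obtain C where C: "closed C" "C \<subseteq> A" "emeasure lebesgue (A - C) < ennreal (e / 2)"
    by (rule sets_lebesgue_inner_closed[OF AL half_gt_zero[OF e]])
  obtain \<psi> :: "complex \<Rightarrow> real" where \<psi>: "continuous_on UNIV \<psi>" "\<And>x. \<psi> x \<in> closed_segment 0 1"
    "\<And>x. \<psi> x = 0 \<longleftrightarrow> x \<in> - U" "\<And>x. \<psi> x = 1 \<longleftrightarrow> x \<in> C"
  proof (rule Urysohn_local_strong[where U = UNIV and S = "- U" and T = C and a = "0::real" and b = "1::real"])
    show "- U \<inter> C = {}" using U(2) C(2) by auto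
  qed (use U C in auto)
  have \<psi>01: "0 \<le> \<psi> x" "\<psi> x \<le> 1" for x using \<psi>(2)[of x] by (auto simp: closed_segment_eq_real_ivl)
  have [measurable]: "U \<in> sets borel" "C \<in> sets borel" "A \<in> sets borel" using U C A by auto
  have "(\<integral>\<^sup>+z. ennreal \<bar>indicator A z - \<psi> z\<bar> \<partial>lborel) \<le> (\<integral>\<^sup>+z. indicator (U - A) z + indicator (A - C) z \<partial>lborel)"
  proof (rule nn_integral_mono)
    fix z
    consider "z \<in> C" | "z \<in> A - C" | "z \<in> U - A" | "z \<notin> U" using U(2) C(2) by auto
    then show "ennreal \<bar>indicator A z - \<psi> z\<bar> \<le> indicator (U - A) z + indicator (A - C) z"
    proof cases
      case 1
      then have "\<psi> z = 1" "z \<in> A" using \<psi>(4) C(2) by auto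
      then show ?thesis by simp
    next
      case 4
      then have "\<psi> z = 0" "z \<notin> A" using \<psi>(3) U(2) by auto
      then show ?thesis by simp
    qed (use \<psi>01[of z] in \<open>auto simp: ennreal_le_1\<close>)
  qed
  also have "\<dots> = emeasure lborel (U - A) + emeasure lborel (A - C)"
    by (subst nn_integral_add) auto
  also have "\<dots> \<le> ennreal (e / 2) + ennreal (e / 2)"
    using U(3) C(3) by (intro add_mono) (auto simp: less_imp_le)
  also have "\<dots> = ennreal e" using e by (simp flip: ennreal_plus)
  finally show ?thesis using that \<psi>(1) by blast
qed

text \<open>Continuity is all that is asked of the approximation, because later only its uniform
  continuity on closed discs matters. The three cases of the induction are indicators, sums, and
  dominated limits.\<close>

lemma integrable_L1_approx:
  fixes G :: "complex \<Rightarrow> complex"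
  assumes "integrable lborel G" "0 < e"
  shows "\<exists>\<psi>. continuous_on UNIV \<psi> \<and> (\<integral>\<^sup>+z. ennreal (cmod (G z - \<psi> z)) \<partial>lborel) \<le> ennreal e"
  using assms
proof (induction G arbitrary: e rule: integrable_induct)
  case (base A c)
  define e' where "e' = e / (cmod c + 1)"
  have e': "0 < e'" using base(3) by (simp add: e'_def add_nonneg_pos)
  obtain \<psi> :: "complex \<Rightarrow> real" where \<psi>: "continuous_on UNIV \<psi>"
    "(\<integral>\<^sup>+z. ennreal \<bar>indicator A z - \<psi> z\<bar> \<partial>lborel) \<le> ennreal e'"
    using indicator_L1_approx[of A e'] base(1) e' by auto
  have [measurable]: "\<psi> \<in> borel_measurable borel" "A \<in> sets borel" using \<psi>(1) base(1) by (auto intro: borel_measurable_continuous_onI)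
  have "(\<integral>\<^sup>+z. ennreal (cmod (indicator A z *\<^sub>R c - \<psi> z *\<^sub>R c)) \<partial>lborel)
     = (\<integral>\<^sup>+z. ennreal (cmod c) * ennreal \<bar>indicator A z - \<psi> z\<bar> \<partial>lborel)"
    by (intro nn_integral_cong) (simp flip: scaleR_diff_left ennreal_mult add: mult.commute)
  also have "\<dots> = ennreal (cmod c) * (\<integral>\<^sup>+z. ennreal \<bar>indicator A z - \<psi> z\<bar> \<partial>lborel)"
    by (intro nn_integral_cmult) auto
  also have "\<dots> \<le> ennreal (cmod c) * ennreal e'" by (intro mult_left_mono \<psi>(2)) auto
  also have "\<dots> = ennreal (cmod c * e')" using e' by (simp add: ennreal_mult)
  also have "\<dots> \<le> ennreal e"
    using base(3) unfolding e'_def by (intro ennreal_leI) (simp add: divide_simps add_nonneg_pos mult_left_mono)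
  finally show ?case using \<psi>(1) by (intro exI[of _ "\<lambda>z. \<psi> z *\<^sub>R c"]) (auto intro!: continuous_intros)
next
  case (add f g)
  obtain \<psi>1 where 1: "continuous_on UNIV \<psi>1" "(\<integral>\<^sup>+z. ennreal (cmod (f z - \<psi>1 z)) \<partial>lborel) \<le> ennreal (e / 2)"
    using add.IH(1)[of "e / 2"] add.prems by auto
  obtain \<psi>2 where 2: "continuous_on UNIV \<psi>2" "(\<integral>\<^sup>+z. ennreal (cmod (g z - \<psi>2 z)) \<partial>lborel) \<le> ennreal (e / 2)"
    using add.IH(2)[of "e / 2"] add.prems by auto
  have [measurable]: "f \<in> borel_measurable borel" "g \<in> borel_measurable borel" using add by auto
  have [measurable]: "\<psi>1 \<in> borel_measurable borel" "\<psi>2 \<in> borel_measurable borel"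
    using 1 2 borel_measurable_continuous_onI by auto
  have "(\<integral>\<^sup>+z. ennreal (cmod (f z + g z - (\<psi>1 z + \<psi>2 z))) \<partial>lborel) \<le> (\<integral>\<^sup>+z. ennreal (cmod (f z - \<psi>1 z)) + ennreal (cmod (g z - \<psi>2 z)) \<partial>lborel)"
    by (intro nn_integral_mono) (simp flip: ennreal_plus add: ennreal_leI norm_diff_triangle_ineq)
  also have "\<dots> = (\<integral>\<^sup>+z. ennreal (cmod (f z - \<psi>1 z)) \<partial>lborel) + (\<integral>\<^sup>+z. ennreal (cmod (g z - \<psi>2 z)) \<partial>lborel)"
    by (intro nn_integral_add) auto
  also have "\<dots> \<le> ennreal (e / 2) + ennreal (e / 2)" by (intro add_mono 1 2)
  also have "\<dots> = ennreal e" using add.prems by (simp flip: ennreal_plus)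
  finally show ?case using 1 2 by (intro exI[of _ "\<lambda>z. \<psi>1 z + \<psi>2 z"]) (auto intro!: continuous_intros)
next
  case (lim f s)
  have "(\<lambda>i. \<integral>\<^sup>+z. ennreal (cmod (f z - s i z)) \<partial>lborel) \<longlonglongrightarrow> 0"
  proof (rule nn_integral_dominated_convergence_norm[where w = "\<lambda>x. 2 * cmod (f x)"])
    show "AE x in lborel. (\<lambda>i. s i x) \<longlonglongrightarrow> f x" using lim by auto
    show "(\<integral>\<^sup>+ x. ennreal (2 * cmod (f x)) \<partial>lborel) < \<infinity>"
      using integrable_norm[OF lim(4)] integrableD(2)[of lborel "\<lambda>x. 2 * cmod (f x)"] lim(4) by (simp add: less_top)
  qed (use lim in auto)
  from order_tendstoD(2)[OF this, of "ennreal (e / 2)"]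
  have "\<forall>\<^sub>F i in sequentially. (\<integral>\<^sup>+z. ennreal (cmod (s i z - f z)) \<partial>lborel) < ennreal (e / 2)"
    using lim.prems by (simp add: norm_minus_commute)
  then obtain i where i: "(\<integral>\<^sup>+z. ennreal (cmod (s i z - f z)) \<partial>lborel) < ennreal (e / 2)"
    by (auto dest: eventually_happens)
  obtain \<psi> where \<psi>: "continuous_on UNIV \<psi>" "(\<integral>\<^sup>+z. ennreal (cmod (s i z - \<psi> z)) \<partial>lborel) \<le> ennreal (e / 2)"
    using lim.IH[of "e / 2" i] lim.prems by auto
  have [measurable]: "f \<in> borel_measurable borel" "s i \<in> borel_measurable borel" using lim by auto
  have [measurable]: "\<psi> \<in> borel_measurable borel" using \<psi> borel_measurable_continuous_onI by auto
  have "(\<integral>\<^sup>+z. ennreal (cmod (f z - \<psi> z)) \<partial>lborel) \<le> (\<integral>\<^sup>+z. ennreal (cmod (s i z - f z)) + ennreal (cmod (s i z - \<psi> z)) \<partial>lborel)"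
  proof (intro nn_integral_mono)
    fix z
    have "cmod (f z - \<psi> z) \<le> cmod (s i z - f z) + cmod (s i z - \<psi> z)"
      using norm_triangle_ineq4[of "s i z - \<psi> z" "s i z - f z"] by simp
    then show "ennreal (cmod (f z - \<psi> z)) \<le> ennreal (cmod (s i z - f z)) + ennreal (cmod (s i z - \<psi> z))"
      by (simp flip: ennreal_plus add: ennreal_leI)
  qed
  also have "\<dots> = (\<integral>\<^sup>+z. ennreal (cmod (s i z - f z)) \<partial>lborel) + (\<integral>\<^sup>+z. ennreal (cmod (s i z - \<psi> z)) \<partial>lborel)"
    by (intro nn_integral_add) auto
  also have "\<dots> \<le> ennreal (e / 2) + ennreal (e / 2)" using i by (intro add_mono \<psi>) auto
  also have "\<dots> = ennreal e" using lim.prems by (simp flip: ennreal_plus)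
  finally show ?case using \<psi>(1) by blast
qed

lemma ennreal_tendsto_0I:
  fixes X :: "nat \<Rightarrow> ennreal"
  assumes "\<And>e::real. 0 < e \<Longrightarrow> \<forall>\<^sub>F n in sequentially. X n \<le> ennreal e"
  shows "X \<longlonglongrightarrow> 0"
proof (rule order_tendstoI)
  fix a :: ennreal assume "0 < a"
  then obtain b where b: "0 < b" "b < a" using dense by blast
  then have "b \<noteq> top" by auto
  then obtain e where "b = ennreal e" "0 \<le> e" by (cases b) auto
  with b have "\<forall>\<^sub>F n in sequentially. X n \<le> b" using assms[of e] by simp
  then show "\<forall>\<^sub>F n in sequentially. X n < a" by (rule eventually_mono) (use b in auto)
qed simp

text \<open>The definitions refer to the completed measure, whereas Fubini's theorem and the
  convolutions are used with Borel functions. Real and imaginary parts are replaced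
  separately.\<close>

lemma locally_integrable_borel_version:
  fixes g :: "complex \<Rightarrow> complex"
  assumes "locally_integrable g"
  obtains gb where "gb \<in> borel_measurable borel" "AE x in lborel. g x = gb x"
    "\<And>R. integrable lborel (\<lambda>x. indicator (cball 0 R) x *\<^sub>R gb x)"
proof -
  have int: "integrable lebesgue (\<lambda>x. indicator (cball 0 R) x *\<^sub>R g x)" for R :: real
    using assms unfolding locally_integrable_def set_integrable_def by auto
  have gm: "g \<in> borel_measurable lebesgue"
  proof (rule borel_measurable_LIMSEQ_metric)
    show "(\<lambda>x. indicator (cball 0 (real n)) x *\<^sub>R g x) \<in> borel_measurable lebesgue" for n
      using int[of "real n"] by (rule borel_measurable_integrable)
    fix x :: complex
    obtain m :: nat where "cmod x \<le> real m" using real_arch_simple by blast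
    then have "\<forall>\<^sub>F n in sequentially. indicator (cball 0 (real n)) x *\<^sub>R g x = g x"
      unfolding eventually_sequentially by (intro exI[of _ m]) auto
    then show "(\<lambda>n. indicator (cball 0 (real n)) x *\<^sub>R g x) \<longlonglongrightarrow> g x"
      by (rule tendsto_eventually)
  qed
  have ri: "Re \<in> borel_measurable borel" "Im \<in> borel_measurable borel"
    by (intro borel_measurable_continuous_onI continuous_intros)+
  have "(\<lambda>x. Re (g x)) \<in> borel_measurable lebesgue" "(\<lambda>x. Im (g x)) \<in> borel_measurable lebesgue"
    using gm ri by (auto intro: measurable_compose)
  from this[THEN completion_ex_borel_measurable_real]
  obtain a b where ab [measurable]: "a \<in> borel_measurable lborel" "b \<in> borel_measurable lborel"
    and ae: "AE x in lborel. Re (g x) = a x" "AE x in lborel. Im (g x) = b x" by blast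
  define gb where "gb x = of_real (a x) + \<i> * of_real (b x)" for x
  have gbm [measurable]: "gb \<in> borel_measurable borel" unfolding gb_def using ab by simp
  have AE: "AE x in lborel. g x = gb x"
    using ae by eventually_elim (auto simp: gb_def complex_eq_iff)
  show ?thesis
  proof (rule that[OF gbm AE])
    fix R
    have "AE x in lebesgue. indicator (cball 0 R) x *\<^sub>R g x = indicator (cball 0 R) x *\<^sub>R gb x"
      using AE_completion[OF AE] by eventually_elim simp
    moreover have "(\<lambda>x. indicator (cball 0 R) x *\<^sub>R gb x) \<in> borel_measurable lborel" by simp
    ultimately have "integrable lebesgue (\<lambda>x. indicator (cball 0 R) x *\<^sub>R gb x)"
      using int[of R] by (subst integrable_cong_AE[symmetric]) (auto intro: measurable_completion)
    then show "integrable lborel (\<lambda>x. indicator (cball 0 R) x *\<^sub>R gb x)"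
      by (subst (asm) integrable_completion) simp_all
  qed
qed

section \<open>Mollifiers and convergence in the mean\<close>

locale mollifier =
  fixes K :: "complex \<Rightarrow> real" and r :: real
  assumes cont: "continuous_on UNIV K" and nonneg: "\<And>z. 0 \<le> K z"
    and mass: "(\<integral>\<^sup>+z. ennreal (K z) \<partial>lborel) = 1" and supp: "\<And>z. r < cmod z \<Longrightarrow> K z = 0"
begin

lemma measurable_K [measurable]: "K \<in> borel_measurable borel"
  using cont by (rule borel_measurable_continuous_onI)

lemma mass_left: "(\<integral>\<^sup>+w. ennreal (K (z - w)) \<partial>lborel) = 1"
  using nn_integral_complex_affine[of "-1" "\<lambda>v. ennreal (K v)" z] mass by simp

lemma mass_right: "(\<integral>\<^sup>+z. ennreal (K (z - w)) \<partial>lborel) = 1"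
  using nn_integral_complex_affine[of 1 "\<lambda>v. ennreal (K v)" "-w"] mass by (simp add: algebra_simps)

lemma integrable_left: "integrable lborel (\<lambda>w. K (z - w))"
  by (rule integrableI_bounded) (auto simp: nonneg mass_left)

lemma integral_left: "(LINT w|lborel. K (z - w)) = 1"
proof -
  have "ennreal (LINT w|lborel. K (z - w)) = 1"
    using nn_integral_eq_integral[OF integrable_left, of z] by (simp add: nonneg mass_left)
  then show ?thesis by (simp add: ennreal_eq_1)
qed

lemma integrable_mult:
  fixes G :: "complex \<Rightarrow> complex"
  assumes "integrable lborel G"
  shows "integrable lborel (\<lambda>w. K (z - w) *\<^sub>R G w)"
proof -
  have "bounded (K ` cball 0 r)"
    by (intro compact_imp_bounded compact_continuous_image continuous_on_subset[OF cont]) auto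
  then obtain B where B: "0 < B" "\<And>v. v \<in> cball 0 r \<Longrightarrow> \<bar>K v\<bar> \<le> B" unfolding bounded_pos by auto
  have KB: "K v \<le> B" for v
    using B supp[of v] by (cases "cmod v \<le> r") (force, auto)
  have [measurable]: "G \<in> borel_measurable borel" using assms by auto
  show ?thesis
  proof (rule Bochner_Integration.integrable_bound)
    show "integrable lborel (\<lambda>w. B * cmod (G w))" using assms by auto
    show "AE w in lborel. norm (K (z - w) *\<^sub>R G w) \<le> norm (B * cmod (G w))"
      using B(1) KB nonneg by (intro AE_I2) (simp add: mult_right_mono)
  qed measurable
qed

text \<open>As the kernel has mass 1, a constant equals its own mollification and can be moved under
  the integral.\<close>

lemma convolution_error:
  fixes G :: "complex \<Rightarrow> complex"
  assumes "integrable lborel (\<lambda>w. K (z - w) *\<^sub>R G w)"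
  shows "ennreal (cmod ((LINT w|lborel. K (z - w) *\<^sub>R G w) - c)) \<le> (\<integral>\<^sup>+w. ennreal (K (z - w)) * ennreal (cmod (G w - c)) \<partial>lborel)"
proof -
  have i2: "integrable lborel (\<lambda>w. K (z - w) *\<^sub>R c)" using integrable_left by simp
  have "(LINT w|lborel. K (z - w) *\<^sub>R G w) - c = (LINT w|lborel. K (z - w) *\<^sub>R (G w - c))"
    using assms i2 by (simp add: scaleR_diff_right integrable_left integral_left)
  moreover have "integrable lborel (\<lambda>w. K (z - w) *\<^sub>R (G w - c))"
    using assms i2 by (simp add: scaleR_diff_right)
  ultimately have "ennreal (cmod ((LINT w|lborel. K (z - w) *\<^sub>R G w) - c)) \<le> (\<integral>\<^sup>+w. ennreal (cmod (K (z - w) *\<^sub>R (G w - c))) \<partial>lborel)"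
    using integral_norm_bound_ennreal by metis
  also have "\<dots> = (\<integral>\<^sup>+w. ennreal (K (z - w)) * ennreal (cmod (G w - c)) \<partial>lborel)"
    by (intro nn_integral_cong) (simp add: nonneg flip: ennreal_mult)
  finally show ?thesis .
qed

lemma convolution_error_le:
  fixes G :: "complex \<Rightarrow> complex"
  assumes "integrable lborel (\<lambda>w. K (z - w) *\<^sub>R G w)" "0 \<le> e" "\<And>w. cmod (z - w) \<le> r \<Longrightarrow> cmod (G w - c) \<le> e"
  shows "cmod ((LINT w|lborel. K (z - w) *\<^sub>R G w) - c) \<le> e"
proof -
  have "ennreal (cmod ((LINT w|lborel. K (z - w) *\<^sub>R G w) - c)) \<le> (\<integral>\<^sup>+w. ennreal (K (z - w)) * ennreal (cmod (G w - c)) \<partial>lborel)"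
    by (rule convolution_error[OF assms(1)])
  also have "\<dots> \<le> (\<integral>\<^sup>+w. ennreal (K (z - w)) * ennreal e \<partial>lborel)"
  proof (rule nn_integral_mono)
    fix w
    show "ennreal (K (z - w)) * ennreal (cmod (G w - c)) \<le> ennreal (K (z - w)) * ennreal e"
    proof (cases "cmod (z - w) \<le> r")
      case True then show ?thesis using assms(3)[of w] by (intro mult_left_mono ennreal_leI) auto
    qed (use supp[of "z - w"] in simp)
  qed
  also have "\<dots> = ennreal e" by (subst nn_integral_multc) (auto simp: mass_left)
  finally show ?thesis using assms(2) by simp
qed

text \<open>Passing from \<open>G\<close> to \<open>\<psi>\<close> costs \<open>e\<close> twice:
  once under the convolution, where Fubini's theorem and \<open>mass_right\<close> apply, and once
  at \<open>z\<close>. Passing from \<open>\<psi> w\<close> to \<open>\<psi> z\<close> costs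
  \<open>d\<close> times the area of the disc.\<close>

lemma convolution_L1_error:
  fixes G \<psi> :: "complex \<Rightarrow> complex"
  assumes G: "integrable lborel G" and \<psi>: "continuous_on UNIV \<psi>"
    and e: "(\<integral>\<^sup>+z. ennreal (cmod (G z - \<psi> z)) \<partial>lborel) \<le> ennreal e" "0 \<le> e"
    and d: "\<And>z w. z \<in> cball 0 R \<Longrightarrow> cmod (z - w) \<le> r \<Longrightarrow> cmod (\<psi> w - \<psi> z) \<le> d" "0 \<le> d" and R: "0 \<le> R"
  shows "(\<integral>\<^sup>+z. ennreal (cmod ((LINT w|lborel. K (z - w) *\<^sub>R G w) - G z)) * indicator (cball 0 R) z \<partial>lborel) \<le> ennreal (2 * e + d * (pi * R\<^sup>2))"
proof -
  have [measurable]: "G \<in> borel_measurable borel" "\<psi> \<in> borel_measurable borel"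
    using G \<psi> by (auto intro: borel_measurable_continuous_onI)
  let ?t = "\<lambda>z. \<integral>\<^sup>+w. ennreal (K (z - w)) * ennreal (cmod (G w - \<psi> w)) \<partial>lborel"
  have bd: "ennreal (cmod ((LINT w|lborel. K (z - w) *\<^sub>R G w) - G z)) * indicator (cball 0 R) z
     \<le> ?t z + ennreal d * indicator (cball 0 R) z + ennreal (cmod (G z - \<psi> z))" for z
  proof (cases "z \<in> cball 0 R")
    case True
    have "ennreal (cmod ((LINT w|lborel. K (z - w) *\<^sub>R G w) - G z)) \<le> (\<integral>\<^sup>+w. ennreal (K (z - w)) * ennreal (cmod (G w - G z)) \<partial>lborel)"
      by (rule convolution_error[OF integrable_mult[OF G]])
    also have "\<dots> \<le> (\<integral>\<^sup>+w. ennreal (K (z - w)) * ennreal (cmod (G w - \<psi> w)) + ennreal (K (z - w)) * ennreal (d + cmod (G z - \<psi> z)) \<partial>lborel)"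
    proof (rule nn_integral_mono)
      fix w
      show "ennreal (K (z - w)) * ennreal (cmod (G w - G z)) \<le> ennreal (K (z - w)) * ennreal (cmod (G w - \<psi> w)) + ennreal (K (z - w)) * ennreal (d + cmod (G z - \<psi> z))"
      proof (cases "cmod (z - w) \<le> r")
        case wr: True
        have "G w - G z = (G w - \<psi> w) + ((\<psi> w - \<psi> z) - (G z - \<psi> z))" by simp
        then have "cmod (G w - G z) \<le> cmod (G w - \<psi> w) + (cmod (\<psi> w - \<psi> z) + cmod (G z - \<psi> z))"
          by (metis norm_triangle_ineq norm_triangle_ineq4 add_left_mono order_trans)
        also have "\<dots> \<le> cmod (G w - \<psi> w) + (d + cmod (G z - \<psi> z))" using d(1)[OF True wr] by simp
        finally have "K (z - w) * cmod (G w - G z) \<le> K (z - w) * cmod (G w - \<psi> w) + K (z - w) * (d + cmod (G z - \<psi> z))"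
          using nonneg[of "z - w"] by (simp add: mult_left_mono flip: distrib_left)
        then show ?thesis using nonneg[of "z - w"] d(2)
          by (simp add: ennreal_leI flip: ennreal_mult ennreal_plus)
      qed (use supp[of "z - w"] in simp)
    qed
    also have "\<dots> = ?t z + (\<integral>\<^sup>+w. ennreal (K (z - w)) * ennreal (d + cmod (G z - \<psi> z)) \<partial>lborel)"
      by (intro nn_integral_add) auto
    also have "(\<integral>\<^sup>+w. ennreal (K (z - w)) * ennreal (d + cmod (G z - \<psi> z)) \<partial>lborel) = ennreal d + ennreal (cmod (G z - \<psi> z))"
      using d(2) by (subst nn_integral_multc) (auto simp: mass_left)
    finally show ?thesis using True by (simp add: add.assoc)
  qed simp
  have mt: "(\<lambda>p. ennreal (K (fst p - snd p)) * ennreal (cmod (G (snd p) - \<psi> (snd p)))) \<in> borel_measurable (borel \<Otimes>\<^sub>M borel)"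
    by measurable
  have [measurable]: "?t \<in> borel_measurable borel"
    using mt by (intro sigma_finite_measure.borel_measurable_nn_integral[OF sigma_finite_lborel])
       (simp add: case_prod_beta measurable_lborel1 cong: measurable_cong_sets)
  have "(\<integral>\<^sup>+z. ennreal (cmod ((LINT w|lborel. K (z - w) *\<^sub>R G w) - G z)) * indicator (cball 0 R) z \<partial>lborel)
     \<le> (\<integral>\<^sup>+z. ?t z + ennreal d * indicator (cball 0 R) z + ennreal (cmod (G z - \<psi> z)) \<partial>lborel)"
    by (intro nn_integral_mono bd)
  also have "\<dots> = (\<integral>\<^sup>+z. ?t z \<partial>lborel) + ennreal d * emeasure lborel (cball (0::complex) R) + (\<integral>\<^sup>+z. ennreal (cmod (G z - \<psi> z)) \<partial>lborel)"
    by (subst nn_integral_add, simp, simp, subst nn_integral_add) (auto simp: nn_integral_cmult)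
  also have "(\<integral>\<^sup>+z. ?t z \<partial>lborel) = (\<integral>\<^sup>+w. \<integral>\<^sup>+z. ennreal (K (z - w)) * ennreal (cmod (G w - \<psi> w)) \<partial>lborel \<partial>lborel)"
  proof (rule lborel_pair.Fubini')
    from measurable_pair_swap[OF mt]
    show "(\<lambda>(w, z). ennreal (K (z - w)) * ennreal (cmod (G w - \<psi> w))) \<in> borel_measurable (lborel \<Otimes>\<^sub>M lborel)"
      by (simp add: case_prod_beta cong: measurable_cong_sets)
  qed
  also have "\<dots> = (\<integral>\<^sup>+w. ennreal (cmod (G w - \<psi> w)) \<partial>lborel)"
    by (intro nn_integral_cong, subst nn_integral_multc) (auto simp: mass_right)
  also have "emeasure lborel (cball (0::complex) R) = ennreal (pi * R\<^sup>2)"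
    using R by (simp add: emeasure_cball unit_ball_vol_2)
  finally have "(\<integral>\<^sup>+z. ennreal (cmod ((LINT w|lborel. K (z - w) *\<^sub>R G w) - G z)) * indicator (cball 0 R) z \<partial>lborel)
     \<le> (\<integral>\<^sup>+w. ennreal (cmod (G w - \<psi> w)) \<partial>lborel) + ennreal d * ennreal (pi * R\<^sup>2) + (\<integral>\<^sup>+z. ennreal (cmod (G z - \<psi> z)) \<partial>lborel)" .
  also have "\<dots> \<le> ennreal e + ennreal d * ennreal (pi * R\<^sup>2) + ennreal e"
    by (intro add_mono e order_refl)
  also have "\<dots> = ennreal (2 * e + d * (pi * R\<^sup>2))"
    using e(2) d(2) by (simp flip: ennreal_mult ennreal_plus)
  finally show ?thesis .
qed

end

locale mollifiers =
  fixes \<eta> \<eta>x \<eta>y :: "complex \<Rightarrow> real"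
  assumes ck: "\<And>k. Ck k \<eta>" "\<And>k. Ck k \<eta>x" "\<And>k. Ck k \<eta>y"
    and nonneg: "\<And>z. 0 \<le> \<eta> z" and mass: "(\<integral>\<^sup>+z. ennreal (\<eta> z) \<partial>lborel) = 1"
    and der: "\<And>z. (\<eta> has_derivative (\<lambda>h. Re h * \<eta>x z + Im h * \<eta>y z)) (at z)"
    and supp: "\<And>z. 2 < cmod z \<Longrightarrow> \<eta> z = 0" "\<And>z. 2 < cmod z \<Longrightarrow> \<eta>x z = 0" "\<And>z. 2 < cmod z \<Longrightarrow> \<eta>y z = 0"
begin

text \<open>The factor \<open>(real n + 1)\<^sup>2\<close> preserves the mass, and
  \<open>n + 1\<close> keeps the scale positive at \<open>n = 0\<close>. The summand
  \<open>0\<close> gives the argument the affine form of \<open>Ck_affine\<close> and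
  \<open>has_derivative_affine_comp\<close>. The further factor in \<open>scaled'\<close> is the one
  the chain rule produces for partial derivatives.\<close>

definition scaled :: "(complex \<Rightarrow> real) \<Rightarrow> nat \<Rightarrow> complex \<Rightarrow> real" where
  "scaled \<kappa> n v = (real n + 1)\<^sup>2 * \<kappa> (0 + (real n + 1) *\<^sub>R v)"

definition scaled' :: "(complex \<Rightarrow> real) \<Rightarrow> nat \<Rightarrow> complex \<Rightarrow> real" where
  "scaled' \<kappa> n v = (real n + 1) * scaled \<kappa> n v"

lemma Ck_scaled: "(\<And>k. Ck k \<kappa>) \<Longrightarrow> Ck k (scaled \<kappa> n)" "(\<And>k. Ck k \<kappa>) \<Longrightarrow> Ck k (scaled' \<kappa> n)"
  unfolding scaled_def[abs_def] scaled'_def[abs_def] by (intro Ck_cmult Ck_affine; blast)+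

lemma scaled_der: "(scaled \<eta> n has_derivative (\<lambda>h. Re h * scaled' \<eta>x n z + Im h * scaled' \<eta>y n z)) (at z)"
  unfolding scaled_def[abs_def] scaled'_def
  by (rule has_derivative_eq_rhs[OF has_derivative_mult_right[OF has_derivative_affine_comp[OF der]]])
     (auto simp: algebra_simps)

lemma scaled_supp:
  assumes "2 / (real n + 1) < cmod z"
  shows "scaled \<eta> n z = 0" "scaled' \<eta>x n z = 0" "scaled' \<eta>y n z = 0"
proof -
  from assms have "2 < (real n + 1) * cmod z" by (simp add: field_simps)
  then have "2 < cmod (0 + (real n + 1) *\<^sub>R z)" unfolding add_0 norm_scaleR by simp
  note supp[OF this]
  then show "scaled \<eta> n z = 0" "scaled' \<eta>x n z = 0" "scaled' \<eta>y n z = 0"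
    unfolding scaled_def scaled'_def by simp_all
qed

lemma radius_le: "2 / (real n + 1) \<le> 2" "0 \<le> 2 / (real n + 1)"
  by (auto simp: field_simps)

lemma scaled_cont: "continuous_on UNIV (scaled \<eta> n)" "continuous_on UNIV (scaled' \<eta>x n)" "continuous_on UNIV (scaled' \<eta>y n)"
  using Ck_scaled(1)[OF ck(1), of 0 n] Ck_scaled(2)[OF ck(2), of 0 n] Ck_scaled(2)[OF ck(3), of 0 n] by auto

sublocale scaled: mollifier "scaled \<eta> n" "2 / (real n + 1)" for n
proof
  have [measurable]: "\<eta> \<in> borel_measurable borel" using ck(1)[of 0] by (auto intro: borel_measurable_continuous_onI)
  have "(\<integral>\<^sup>+z. ennreal (scaled \<eta> n z) \<partial>lborel) = ennreal ((real n + 1)\<^sup>2) * (\<integral>\<^sup>+z. ennreal (\<eta> ((real n + 1) *\<^sub>R z)) \<partial>lborel)"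
    unfolding scaled_def using nonneg by (subst nn_integral_cmult[symmetric]) (auto intro!: nn_integral_cong simp: ennreal_mult)
  also have "\<dots> = 1"
    using nn_integral_complex_affine[of "of_real (real n + 1)" "\<lambda>z. ennreal (\<eta> z)" 0] mass
    by (simp add: scaleR_conv_of_real norm_of_real del: of_real_add) 
  finally show "(\<integral>\<^sup>+z. ennreal (scaled \<eta> n z) \<partial>lborel) = 1" .
qed (use nonneg scaled_supp scaled_cont in \<open>auto simp: scaled_def\<close>)

text \<open>Mollification at \<open>z\<close> is testing against the reflected kernel. The sign
  caused by the reflection cancels the one in \<open>has_weak_deriv\<close>, so differentiating the
  kernel amounts to mollifying the weak derivative.\<close>

lemma scaled_test:
  "(\<lambda>w. scaled \<eta> n (z - w)) \<in> test_functions"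
  "frechet_derivative (\<lambda>w. scaled \<eta> n (z - w)) (at w) 1 = - scaled' \<eta>x n (z - w)"
  "frechet_derivative (\<lambda>w. scaled \<eta> n (z - w)) (at w) \<i> = - scaled' \<eta>y n (z - w)"
proof -
  have "Ck k (\<lambda>w. scaled \<eta> n (z + (-1) *\<^sub>R w))" for k
    by (intro Ck_affine Ck_scaled ck)
  then have 1: "Ck k (\<lambda>w. scaled \<eta> n (z - w))" for k by simp
  have "{w. scaled \<eta> n (z - w) \<noteq> 0} \<subseteq> cball z (2 / (real n + 1))"
    using scaled_supp(1)[of n] by (auto simp: dist_norm not_less[symmetric])
  then have "bounded {w. scaled \<eta> n (z - w) \<noteq> 0}" using bounded_cball bounded_subset by blast
  with 1 show "(\<lambda>w. scaled \<eta> n (z - w)) \<in> test_functions"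
    by (simp add: test_functions_def compact_closure)
  have "((\<lambda>w. scaled \<eta> n (z + (-1) *\<^sub>R w)) has_derivative
      (\<lambda>h. Re h * (-1 * scaled' \<eta>x n (z + (-1) *\<^sub>R w)) + Im h * (-1 * scaled' \<eta>y n (z + (-1) *\<^sub>R w)))) (at w)"
    by (rule has_derivative_affine_comp[OF scaled_der])
  then have "((\<lambda>w. scaled \<eta> n (z - w)) has_derivative
      (\<lambda>h. Re h * (-1 * scaled' \<eta>x n (z - w)) + Im h * (-1 * scaled' \<eta>y n (z - w)))) (at w)"
    by simp
  from frechet_derivative_at[OF this, symmetric]
  show "frechet_derivative (\<lambda>w. scaled \<eta> n (z - w)) (at w) 1 = - scaled' \<eta>x n (z - w)"
    "frechet_derivative (\<lambda>w. scaled \<eta> n (z - w)) (at w) \<i> = - scaled' \<eta>y n (z - w)"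
    by simp_all
qed

lemma L1_convergence:
  fixes g :: "complex \<Rightarrow> complex"
  assumes [measurable]: "g \<in> borel_measurable borel"
    and int: "\<And>R. integrable lborel (\<lambda>x. indicator (cball 0 R) x *\<^sub>R g x)" and R: "0 \<le> R"
  shows "(\<lambda>n. \<integral>\<^sup>+z. ennreal (cmod ((LINT w|lborel. scaled \<eta> n (z - w) *\<^sub>R g w) - g z)) * indicator (cball 0 R) z \<partial>lborel) \<longlonglongrightarrow> 0"
proof (rule ennreal_tendsto_0I)
  fix e :: real assume e: "0 < e"
  \<comment> \<open>For \<open>z\<close> in the disc of radius \<open>R\<close> the kernels see only
    the disc of radius \<open>R + 2\<close>, so \<open>g\<close> may be cut off there and becomes
    integrable.\<close>
  define G where "G x = indicator (cball 0 (R + 2)) x *\<^sub>R g x" for x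
  have G: "integrable lborel G" unfolding G_def[abs_def] by (rule int)
  define e1 where "e1 = e / 4"
  define X where "X = pi * R\<^sup>2 + 1"
  have X: "0 < X" by (simp add: X_def add_nonneg_pos)
  define d1 where "d1 = e / 2 / X"
  have ed: "0 < e1" "0 < d1" using e X by (auto simp: e1_def d1_def)
  obtain \<psi> where \<psi>: "continuous_on UNIV \<psi>" "(\<integral>\<^sup>+z. ennreal (cmod (G z - \<psi> z)) \<partial>lborel) \<le> ennreal e1"
    using integrable_L1_approx[OF G ed(1)] by blast
  have "uniformly_continuous_on (cball 0 (R + 2)) \<psi>"
    by (rule compact_uniformly_continuous[OF continuous_on_subset[OF \<psi>(1)]]) auto
  then obtain d where d: "0 < d" "\<And>x y. x \<in> cball 0 (R + 2) \<Longrightarrow> y \<in> cball 0 (R + 2) \<Longrightarrow> dist y x < d \<Longrightarrow> dist (\<psi> y) (\<psi> x) < d1"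
    using ed(2) unfolding uniformly_continuous_on_def by metis
  have "(\<lambda>n. 2 / (real n + 1)) \<longlonglongrightarrow> 0"
    using tendsto_mult[OF tendsto_const[of 2] LIMSEQ_inverse_real_of_nat] by (simp add: divide_inverse add.commute)
  then have "\<forall>\<^sub>F n in sequentially. 2 / (real n + 1) < d" using d(1) by (rule order_tendstoD)
  then show "\<forall>\<^sub>F n in sequentially. (\<integral>\<^sup>+z. ennreal (cmod ((LINT w|lborel. scaled \<eta> n (z - w) *\<^sub>R g w) - g z)) * indicator (cball 0 R) z \<partial>lborel) \<le> ennreal e"
  proof eventually_elim
    case (elim n)
    have near: "w \<in> cball 0 (R + 2)" if "z \<in> cball 0 R" "cmod (z - w) \<le> 2 / (real n + 1)" for z w
      using that radius_le(1)[of n] norm_triangle_sub[of w z] by (auto simp: norm_minus_commute)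
    have eq: "(LINT w|lborel. scaled \<eta> n (z - w) *\<^sub>R g w) - g z = (LINT w|lborel. scaled \<eta> n (z - w) *\<^sub>R G w) - G z"
      if z: "z \<in> cball 0 R" for z
    proof -
      have 1: "scaled \<eta> n (z - w) *\<^sub>R g w = scaled \<eta> n (z - w) *\<^sub>R G w" for w
        using near[OF z, of w] scaled_supp(1)[of n "z - w"]
        by (cases "cmod (z - w) \<le> 2 / (real n + 1)") (auto simp: G_def)
      have 2: "g z = G z" using z by (simp add: G_def)
      show ?thesis unfolding 1 2 ..
    qed
    have "(\<integral>\<^sup>+z. ennreal (cmod ((LINT w|lborel. scaled \<eta> n (z - w) *\<^sub>R g w) - g z)) * indicator (cball 0 R) z \<partial>lborel)
       = (\<integral>\<^sup>+z. ennreal (cmod ((LINT w|lborel. scaled \<eta> n (z - w) *\<^sub>R G w) - G z)) * indicator (cball 0 R) z \<partial>lborel)"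
      by (intro nn_integral_cong) (auto simp: indicator_def eq)
    also have "\<dots> \<le> ennreal (2 * e1 + d1 * (pi * R\<^sup>2))"
    proof (rule scaled.convolution_L1_error[OF G \<psi> _ _ _ R])
      show "cmod (\<psi> w - \<psi> z) \<le> d1" if "z \<in> cball 0 R" "cmod (z - w) \<le> 2 / (real n + 1)" for z w
        using d(2)[of z w] near[OF that] that elim by (auto simp: dist_norm norm_minus_commute less_imp_le)
    qed (use ed in auto)
    also have "\<dots> \<le> ennreal e"
    proof (rule ennreal_leI)
      have "d1 * (pi * R\<^sup>2) \<le> d1 * X" using ed unfolding X_def by (intro mult_left_mono) auto
      also have "\<dots> = e / 2" unfolding d1_def using X by simp
      finally show "2 * e1 + d1 * (pi * R\<^sup>2) \<le> e" by (simp add: e1_def)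
    qed
    finally show ?case .
  qed
qed

lemma weak_convolution:
  fixes f :: "complex \<Rightarrow> complex"
  assumes "has_weak_deriv f v g" and gb: "gb \<in> borel_measurable borel" and ae: "AE x in lborel. g x = gb x"
  shows "(LINT w|lebesgue. frechet_derivative (\<lambda>w. scaled \<eta> n (z - w)) (at w) v *\<^sub>R f w) = - (LINT w|lborel. scaled \<eta> n (z - w) *\<^sub>R gb w)"
proof -
  have "(LINT w|lebesgue. frechet_derivative (\<lambda>w. scaled \<eta> n (z - w)) (at w) v *\<^sub>R f w) = - (LINT w|lebesgue. scaled \<eta> n (z - w) *\<^sub>R g w)"
    using assms(1) scaled_test(1) unfolding has_weak_deriv_def by blast
  also have "(LINT w|lebesgue. scaled \<eta> n (z - w) *\<^sub>R g w) = (LINT w|lebesgue. scaled \<eta> n (z - w) *\<^sub>R gb w)"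
  proof (rule integral_cong_AE)
    have [measurable]: "gb \<in> borel_measurable borel" by (rule gb)
    have b: "(\<lambda>w. scaled \<eta> n (z - w) *\<^sub>R gb w) \<in> borel_measurable lborel" by measurable
    then show m: "(\<lambda>w. scaled \<eta> n (z - w) *\<^sub>R gb w) \<in> borel_measurable lebesgue" by (rule measurable_completion)
    have "AE w in lborel. scaled \<eta> n (z - w) *\<^sub>R gb w = scaled \<eta> n (z - w) *\<^sub>R g w"
      using ae by eventually_elim simp
    from borel_measurable_AE[OF m AE_completion[OF this]]
    show "(\<lambda>w. scaled \<eta> n (z - w) *\<^sub>R g w) \<in> borel_measurable lebesgue" .
    show "AE w in lebesgue. scaled \<eta> n (z - w) *\<^sub>R g w = scaled \<eta> n (z - w) *\<^sub>R gb w"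
      using AE_completion[OF ae] by eventually_elim simp
  qed
  also have "\<dots> = (LINT w|lborel. scaled \<eta> n (z - w) *\<^sub>R gb w)"
    using gb by (intro integral_completion) simp
  finally show ?thesis .
qed

text \<open>The mollifications of both derivatives coincide, since both are computed from
  \<open>f\<close>, and they converge in the mean on discs to the two derivatives. This makes the
  choice in \<open>weak_deriv\<close> harmless.\<close>

lemma AE_unique:
  assumes "has_weak_deriv f v g" "has_weak_deriv f v g'"
  shows "AE x in lborel. g x = g' x"
proof -
  obtain a where a [measurable]: "a \<in> borel_measurable borel" and a2: "AE x in lborel. g x = a x"
    "\<And>R. integrable lborel (\<lambda>x. indicator (cball 0 R) x *\<^sub>R a x)"
    using locally_integrable_borel_version[of g] assms(1) by (auto simp: has_weak_deriv_def)
  obtain b where b [measurable]: "b \<in> borel_measurable borel" and b2: "AE x in lborel. g' x = b x"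
    "\<And>R. integrable lborel (\<lambda>x. indicator (cball 0 R) x *\<^sub>R b x)"
    using locally_integrable_borel_version[of g'] assms(2) by (auto simp: has_weak_deriv_def)
  have eq: "(LINT w|lborel. scaled \<eta> n (z - w) *\<^sub>R a w) = (LINT w|lborel. scaled \<eta> n (z - w) *\<^sub>R b w)" for n z
    using weak_convolution[OF assms(1) a a2(1), where n = n and z = z] weak_convolution[OF assms(2) b b2(1), where n = n and z = z] by simp
  have "AE z in lborel. ennreal (cmod (a z - b z)) * indicator (cball 0 (real m)) z = 0" for m :: nat
  proof -
    let ?X = "\<lambda>q n. \<integral>\<^sup>+z. ennreal (cmod ((LINT w|lborel. scaled \<eta> n (z - w) *\<^sub>R q w) - q z)) * indicator (cball 0 (real m)) z \<partial>lborel"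
    have meas: "(\<lambda>z. LINT w|lborel. scaled \<eta> n (z - w) *\<^sub>R q w) \<in> borel_measurable borel"
      if [measurable]: "q \<in> borel_measurable borel" for q :: "complex \<Rightarrow> complex" and n
    proof -
      have "(\<lambda>p. scaled \<eta> n (fst p - snd p) *\<^sub>R q (snd p)) \<in> borel_measurable (borel \<Otimes>\<^sub>M borel)" by measurable
      then show ?thesis
        by (intro sigma_finite_measure.borel_measurable_lebesgue_integral[OF sigma_finite_lborel])
           (simp add: case_prod_beta measurable_lborel1 cong: measurable_cong_sets)
    qed
    note [measurable] = meas[OF a] meas[OF b]
    have "(\<integral>\<^sup>+z. ennreal (cmod (a z - b z)) * indicator (cball 0 (real m)) z \<partial>lborel) \<le> ?X a n + ?X b n" for n
    proof -
      have "(\<integral>\<^sup>+z. ennreal (cmod (a z - b z)) * indicator (cball 0 (real m)) z \<partial>lborel)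
        \<le> (\<integral>\<^sup>+z. ennreal (cmod ((LINT w|lborel. scaled \<eta> n (z - w) *\<^sub>R a w) - a z)) * indicator (cball 0 (real m)) z
           + ennreal (cmod ((LINT w|lborel. scaled \<eta> n (z - w) *\<^sub>R b w) - b z)) * indicator (cball 0 (real m)) z \<partial>lborel)"
      proof (rule nn_integral_mono)
        fix z
        have "cmod (a z - b z) \<le> cmod ((LINT w|lborel. scaled \<eta> n (z - w) *\<^sub>R a w) - a z) + cmod ((LINT w|lborel. scaled \<eta> n (z - w) *\<^sub>R b w) - b z)"
          using norm_triangle_ineq4[of "(LINT w|lborel. scaled \<eta> n (z - w) *\<^sub>R b w) - b z" "(LINT w|lborel. scaled \<eta> n (z - w) *\<^sub>R a w) - a z"] eq[where n = n and z = z]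
          by simp
        then show "ennreal (cmod (a z - b z)) * indicator (cball 0 (real m)) z \<le> ennreal (cmod ((LINT w|lborel. scaled \<eta> n (z - w) *\<^sub>R a w) - a z)) * indicator (cball 0 (real m)) z
           + ennreal (cmod ((LINT w|lborel. scaled \<eta> n (z - w) *\<^sub>R b w) - b z)) * indicator (cball 0 (real m)) z"
          by (auto simp: indicator_def ennreal_leI simp flip: ennreal_plus)
      qed
      also have "\<dots> = ?X a n + ?X b n" by (rule nn_integral_add) measurable
      finally show ?thesis .
    qed
    moreover have "(\<lambda>n. ?X a n + ?X b n) \<longlonglongrightarrow> 0 + 0"
      by (intro tendsto_add L1_convergence a b a2 b2) auto
    ultimately have "(\<integral>\<^sup>+z. ennreal (cmod (a z - b z)) * indicator (cball 0 (real m)) z \<partial>lborel) \<le> 0 + 0"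
      by (intro LIMSEQ_le_const) auto
    then show ?thesis by (subst (asm) add_0_right, subst (asm) le_zero_eq, subst (asm) nn_integral_0_iff_AE) auto
  qed
  then have "AE z in lborel. \<forall>m::nat. ennreal (cmod (a z - b z)) * indicator (cball 0 (real m)) z = 0"
    by (subst AE_all_countable) auto
  then show ?thesis using a2(1) b2(1)
  proof eventually_elim
    case (elim z)
    obtain m :: nat where "cmod z \<le> real m" using real_arch_simple by blast
    then show ?case using elim(1)[rule_format, of m] elim(2,3) by simp
  qed
qed

text \<open>The gradient of the mollified map has two expressions. With the derivative on the kernel
  it is visibly continuous; with the kernel on the weak derivative it converges in the mean.\<close>

lemma ex_C1_limit:
  assumes f: "continuous_on UNIV f" and w1: "has_weak_deriv f 1 g1" and w2: "has_weak_deriv f \<i> g2"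
  obtains fx fy where "C1_limit f fx fy" "AE x in lborel. g1 x = fx x" "AE x in lborel. g2 x = fy x"
proof -
  obtain a where a [measurable]: "a \<in> borel_measurable borel" and a2: "AE x in lborel. g1 x = a x"
    "\<And>R. integrable lborel (\<lambda>x. indicator (cball 0 R) x *\<^sub>R a x)"
    using locally_integrable_borel_version[of g1] w1 by (auto simp: has_weak_deriv_def)
  obtain b where b [measurable]: "b \<in> borel_measurable borel" and b2: "AE x in lborel. g2 x = b x"
    "\<And>R. integrable lborel (\<lambda>x. indicator (cball 0 R) x *\<^sub>R b x)"
    using locally_integrable_borel_version[of g2] w2 by (auto simp: has_weak_deriv_def)
  define \<phi> where "\<phi> n z = (LINT w|lborel. scaled \<eta> n (z - w) *\<^sub>R f w)" for n z
  define \<phi>x where "\<phi>x n z = (LINT w|lborel. scaled' \<eta>x n (z - w) *\<^sub>R f w)" for n z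
  define \<phi>y where "\<phi>y n z = (LINT w|lborel. scaled' \<eta>y n (z - w) *\<^sub>R f w)" for n z
  have fb: "f \<in> borel_measurable borel" using f by (rule borel_measurable_continuous_onI)
  have ic: "integrable lborel (\<lambda>w. scaled \<eta> n (z - w) *\<^sub>R f w)" "integrable lborel (\<lambda>w. scaled' \<eta>x n (z - w) *\<^sub>R f w)"
    "integrable lborel (\<lambda>w. scaled' \<eta>y n (z - w) *\<^sub>R f w)" for n z
    by (rule integrable_convolution[where \<rho> = "2 / (real n + 1)"]; (fact scaled_cont f | erule scaled_supp))+
  have x1: "\<phi>x n z = (LINT w|lborel. scaled \<eta> n (z - w) *\<^sub>R a w)" for n z
    using weak_convolution[OF w1 a a2(1), where n = n and z = z] ic(2)[of n z]
    unfolding \<phi>x_def scaled_test scaleR_minus_left by (subst (asm) integral_completion) (auto dest: borel_measurable_integrable)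
  have y1: "\<phi>y n z = (LINT w|lborel. scaled \<eta> n (z - w) *\<^sub>R b w)" for n z
    using weak_convolution[OF w2 b b2(1), where n = n and z = z] ic(3)[of n z]
    unfolding \<phi>y_def scaled_test scaleR_minus_left by (subst (asm) integral_completion) (auto dest: borel_measurable_integrable)
  \<comment> \<open>Continuity is read off from differentiability, which costs one more derivative
    of the kernel; partial derivatives inherit the support because the kernel vanishes on an open
    set outside it.\<close>
  have cont: "continuous_on UNIV (\<lambda>z. LINT w|lborel. \<kappa> (z - w) *\<^sub>R f w)"
    if k: "\<And>k. Ck k \<kappa>" and s: "\<And>z. \<rho> < cmod z \<Longrightarrow> \<kappa> z = 0" and \<rho>: "0 \<le> \<rho>" for \<kappa> and \<rho>
  proof -
    from k[of "Suc 0"] obtain \<kappa>x \<kappa>y where d: "\<And>z. (\<kappa> has_derivative (\<lambda>h. Re h * \<kappa>x z + Im h * \<kappa>y z)) (at z)"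
      "continuous_on UNIV \<kappa>x" "continuous_on UNIV \<kappa>y" by auto
    have "\<kappa>x z = 0 \<and> \<kappa>y z = 0" if z: "\<rho> < cmod z" for z
    proof -
      have "((\<lambda>z. 0::real) has_derivative (\<lambda>h. Re h * \<kappa>x z + Im h * \<kappa>y z)) (at z)"
      proof (rule has_derivative_transform_within_open[OF d(1)])
        show "open {z. \<rho> < cmod z}" by (intro open_Collect_less continuous_intros)
      qed (use z s in auto)
      from has_derivative_unique[OF this has_derivative_const]
      have "Re h * \<kappa>x z + Im h * \<kappa>y z = 0" for h by (simp add: fun_eq_iff)
      from this[of 1] this[of \<i>] show ?thesis by simp
    qed
    then have "((\<lambda>z. LINT w|lborel. \<kappa> (z - w) *\<^sub>R f w) has_derivative
     (\<lambda>h. Re h *\<^sub>R (LINT w|lborel. \<kappa>x (z - w) *\<^sub>R f w) + Im h *\<^sub>R (LINT w|lborel. \<kappa>y (z - w) *\<^sub>R f w))) (at z)" for z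
      by (intro convolution_has_derivative[OF d s _ _ f \<rho>]) auto
    then show ?thesis by (meson continuous_at_imp_continuous_on has_derivative_continuous)
  qed
  have cxy: "continuous_on UNIV (\<phi>x n)" "continuous_on UNIV (\<phi>y n)" for n
    unfolding \<phi>x_def[abs_def] \<phi>y_def[abs_def]
    by (rule cont[OF Ck_scaled(2)[OF ck(2)] scaled_supp(2) radius_le(2)], assumption)
       (rule cont[OF Ck_scaled(2)[OF ck(3)] scaled_supp(3) radius_le(2)])
  have "C1_limit f a b"
    unfolding C1_limit_def
  proof (intro conjI exI allI)
    show "(\<phi> n has_derivative (\<lambda>h. Re h *\<^sub>R \<phi>x n z + Im h *\<^sub>R \<phi>y n z)) (at z)" for n z
      unfolding \<phi>_def[abs_def] \<phi>x_def \<phi>y_def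
      by (rule convolution_has_derivative[OF scaled_der scaled_cont(2,3) scaled_supp f radius_le(2)])
    show "continuous_on UNIV (\<phi>x n)" "continuous_on UNIV (\<phi>y n)" for n by (fact cxy)+
    show "uniform_limit (cball 0 R) \<phi> f sequentially" for R
      unfolding uniform_limit_iff
    proof (intro allI impI)
      fix e :: real assume e: "0 < e"
      have "uniformly_continuous_on (cball 0 (R + 2)) f"
        by (rule compact_uniformly_continuous[OF continuous_on_subset[OF f]]) auto
      then obtain d where d: "0 < d" "\<And>x y. x \<in> cball 0 (R + 2) \<Longrightarrow> y \<in> cball 0 (R + 2) \<Longrightarrow> dist y x < d \<Longrightarrow> dist (f y) (f x) < e / 2"
        using half_gt_zero[OF e] unfolding uniformly_continuous_on_def by metis
      have "(\<lambda>n. 2 / (real n + 1)) \<longlonglongrightarrow> 0"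
    using tendsto_mult[OF tendsto_const[of 2] LIMSEQ_inverse_real_of_nat] by (simp add: divide_inverse add.commute)
      then have "\<forall>\<^sub>F n in sequentially. 2 / (real n + 1) < d" using d(1) by (rule order_tendstoD)
      then show "\<forall>\<^sub>F n in sequentially. \<forall>z\<in>cball 0 R. dist (\<phi> n z) (f z) < e"
      proof (rule eventually_mono, intro ballI)
        fix n and z :: complex assume n: "2 / (real n + 1) < d" and z: "z \<in> cball 0 R"
        have "cmod (\<phi> n z - f z) \<le> e / 2"
          unfolding \<phi>_def
        proof (rule scaled.convolution_error_le[OF ic(1)])
          fix w assume w: "cmod (z - w) \<le> 2 / (real n + 1)"
          have "w \<in> cball 0 (R + 2)" "z \<in> cball 0 (R + 2)"
            using z w radius_le(1)[of n] norm_triangle_sub[of w z] by (auto simp: norm_minus_commute)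
          then show "cmod (f w - f z) \<le> e / 2"
            using d(2)[of z w] w n by (auto simp: dist_norm norm_minus_commute less_imp_le)
        qed (use e in auto)
        then show "dist (\<phi> n z) (f z) < e" using e by (simp add: dist_norm)
      qed
    qed
    show "(\<lambda>n. \<integral>\<^sup>+z. ennreal (cmod (\<phi>x n z - a z) + cmod (\<phi>y n z - b z)) * indicator (cball 0 R) z \<partial>lborel) \<longlonglongrightarrow> 0" for R
    proof -
      have [measurable]: "\<phi>x n \<in> borel_measurable borel" "\<phi>y n \<in> borel_measurable borel" for n
        using cxy by (auto intro: borel_measurable_continuous_onI)
      show ?thesis
      proof (cases "0 \<le> R")
        case True
        have "(\<lambda>n. (\<integral>\<^sup>+z. ennreal (cmod (\<phi>x n z - a z)) * indicator (cball 0 R) z \<partial>lborel)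
           + (\<integral>\<^sup>+z. ennreal (cmod (\<phi>y n z - b z)) * indicator (cball 0 R) z \<partial>lborel)) \<longlonglongrightarrow> 0 + 0"
          unfolding x1 y1 by (intro tendsto_add L1_convergence a b a2 b2 True)
        moreover have "(\<integral>\<^sup>+z. ennreal (cmod (\<phi>x n z - a z) + cmod (\<phi>y n z - b z)) * indicator (cball 0 R) z \<partial>lborel)
          = (\<integral>\<^sup>+z. ennreal (cmod (\<phi>x n z - a z)) * indicator (cball 0 R) z \<partial>lborel)
           + (\<integral>\<^sup>+z. ennreal (cmod (\<phi>y n z - b z)) * indicator (cball 0 R) z \<partial>lborel)" for n
          by (subst nn_integral_add[symmetric]) (auto simp: distrib_right intro!: nn_integral_cong)
        ultimately show ?thesis by simp
      qed simp
    qed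
  qed (use f a b in auto)
  with a2(1) b2(1) show ?thesis using that by blast
qed

end

lemma ex_mollifiers: "\<exists>\<eta> \<eta>x \<eta>y. mollifiers \<eta> \<eta>x \<eta>y"
proof -
  obtain \<eta> \<eta>x \<eta>y :: "complex \<Rightarrow> real" where *:
    "\<And>k. Ck k \<eta>" "\<And>z. 0 \<le> \<eta> z" "(\<integral>\<^sup>+z. ennreal (\<eta> z) \<partial>lborel) = 1"
    "\<And>z. (\<eta> has_derivative (\<lambda>h. Re h * \<eta>x z + Im h * \<eta>y z)) (at z)"
    "\<And>k. Ck k \<eta>x" "\<And>k. Ck k \<eta>y"
    "\<And>z. 2 < cmod z \<Longrightarrow> \<eta> z = 0" "\<And>z. 2 < cmod z \<Longrightarrow> \<eta>x z = 0" "\<And>z. 2 < cmod z \<Longrightarrow> \<eta>y z = 0"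
    by (rule ex_mollifier) blast
  show ?thesis by (intro exI) (unfold_locales; fact *)
qed

lemma weak_deriv_unique:
  assumes "has_weak_deriv f v g" "has_weak_deriv f v g'"
  shows "AE x in lborel. g x = g' x"
  using ex_mollifiers mollifiers.AE_unique[OF _ assms] by blast

lemma weak_deriv_C1_limit:
  assumes "continuous_on UNIV f" "has_weak_deriv f 1 g1" "has_weak_deriv f \<i> g2"
  obtains fx fy where "C1_limit f fx fy" "AE x in lborel. g1 x = fx x" "AE x in lborel. g2 x = fy x"
  using ex_mollifiers mollifiers.ex_C1_limit[OF _ assms] by metis

text \<open>Permits a change of the derivatives on a null set, after which the distortion inequality
  can be assumed at every point.\<close>

lemma C1_limit_cong_AE:
  assumes lim: "C1_limit u ux uy" and m: "vx \<in> borel_measurable borel" "vy \<in> borel_measurable borel"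
    and ae: "AE z in lborel. ux z = vx z" "AE z in lborel. uy z = vy z"
  shows "C1_limit u vx vy"
proof -
  obtain \<phi> \<phi>x \<phi>y where *:
    "\<And>n z. (\<phi> n has_derivative (\<lambda>h. Re h *\<^sub>R \<phi>x n z + Im h *\<^sub>R \<phi>y n z)) (at z)"
    "\<And>n::nat. continuous_on UNIV (\<phi>x n)" "\<And>n. continuous_on UNIV (\<phi>y n)"
    "\<And>R. uniform_limit (cball 0 R) \<phi> u sequentially"
    "\<And>R. (\<lambda>n. \<integral>\<^sup>+z. ennreal (cmod (\<phi>x n z - ux z) + cmod (\<phi>y n z - uy z)) * indicator (cball 0 R) z \<partial>lborel)
           \<longlonglongrightarrow> 0"
    "continuous_on UNIV u"
    using lim unfolding C1_limit_def by blast
  have eq: "(\<integral>\<^sup>+z. ennreal (cmod (\<phi>x n z - ux z) + cmod (\<phi>y n z - uy z)) * indicator (cball 0 R) z \<partial>lborel)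
     = (\<integral>\<^sup>+z. ennreal (cmod (\<phi>x n z - vx z) + cmod (\<phi>y n z - vy z)) * indicator (cball 0 R) z \<partial>lborel)" for n R
  proof (rule nn_integral_cong_AE)
    show "AE z in lborel. ennreal (cmod (\<phi>x n z - ux z) + cmod (\<phi>y n z - uy z)) * indicator (cball 0 R) z
       = ennreal (cmod (\<phi>x n z - vx z) + cmod (\<phi>y n z - vy z)) * indicator (cball 0 R) z"
      using ae by eventually_elim simp
  qed
  show ?thesis unfolding C1_limit_def
  proof (intro conjI exI allI)
    show "(\<lambda>n. \<integral>\<^sup>+z. ennreal (cmod (\<phi>x n z - vx z) + cmod (\<phi>y n z - vy z)) * indicator (cball 0 R) z \<partial>lborel) \<longlonglongrightarrow> 0" for R
      using *(5)[of R] unfolding eq .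
  qed (fact * m)+
qed

section \<open>Translation invariance of the distortion\<close>

lemma lebesgue_translation: "lebesgue = distr lebesgue lebesgue (\<lambda>x::'a::euclidean_space. c + x)"
proof -
  have "lebesgue = density (distr lebesgue lebesgue (\<lambda>x. c + (\<Sum>j\<in>Basis. (1 * (x \<bullet> j)) *\<^sub>R j))) (\<lambda>_::'a. ennreal (\<Prod>j\<in>(Basis::'a set). \<bar>1\<bar>))"
    using lebesgue_affine_euclidean[of "\<lambda>_. 1" c] by simp
  then show ?thesis by (simp add: euclidean_representation density_1)
qed

lemma measurable_translation: "(\<lambda>x::'a::euclidean_space. c + x) \<in> lebesgue \<rightarrow>\<^sub>M lebesgue"
proof -
  have "(\<lambda>x. c + (\<Sum>j\<in>Basis. (1 * (x \<bullet> j)) *\<^sub>R j)) \<in> lebesgue \<rightarrow>\<^sub>M lebesgue"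
    using lebesgue_affine_measurable[of "\<lambda>_. 1" c] by simp
  then show ?thesis by (simp add: euclidean_representation)
qed

lemma AE_translation:
  assumes "AE x in lebesgue. P x" shows "AE x in lebesgue. P (c + x :: 'a::euclidean_space)"
proof -
  obtain N where N: "{x \<in> space lebesgue. \<not> P x} \<subseteq> N" "emeasure lebesgue N = 0" "N \<in> sets lebesgue"
    using AE_E[OF assms] by blast
  have "emeasure lebesgue ((\<lambda>x. c + x) -` N) = 0"
    using N emeasure_distr[OF measurable_translation N(3), of c] lebesgue_translation[of c] by simp
  moreover have "(\<lambda>x. c + x) -` N \<in> sets lebesgue"
    using measurable_sets[OF measurable_translation N(3), of c] by simp
  ultimately show ?thesis using N(1)
    by (intro AE_I[where N = "(\<lambda>x. c + x) -` N"]) auto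
qed

lemma integrable_translation_iff:
  fixes g :: "'a::euclidean_space \<Rightarrow> 'b::{banach, second_countable_topology}"
  assumes "g \<in> borel_measurable lebesgue"
  shows "integrable lebesgue (\<lambda>x. g (c + x)) \<longleftrightarrow> integrable lebesgue g"
  using integrable_distr_eq[OF measurable_translation assms, of c] lebesgue_translation[of c] by simp

lemma integral_translation:
  fixes g :: "'a::euclidean_space \<Rightarrow> 'b::{banach, second_countable_topology}"
  assumes "g \<in> borel_measurable lebesgue"
  shows "(LINT x|lebesgue. g (c + x)) = (LINT x|lebesgue. g x)"
  using integral_distr[OF measurable_translation assms, of c] lebesgue_translation[of c] by simp

lemma locally_integrable_measurable:
  fixes g :: "complex \<Rightarrow> 'b::{banach, second_countable_topology}"
  assumes "locally_integrable g" shows "g \<in> borel_measurable lebesgue"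
proof (rule borel_measurable_LIMSEQ_metric)
  have "integrable lebesgue (\<lambda>x. indicator (cball 0 R) x *\<^sub>R g x)" for R :: real
    using assms unfolding locally_integrable_def set_integrable_def by auto
  then show "(\<lambda>x. indicator (cball 0 (real n)) x *\<^sub>R g x) \<in> borel_measurable lebesgue" for n
    by (rule borel_measurable_integrable)
  fix x :: complex
  obtain m :: nat where "cmod x \<le> real m" using real_arch_simple by blast
  then have "\<forall>\<^sub>F n in sequentially. indicator (cball 0 (real n)) x *\<^sub>R g x = g x"
    unfolding eventually_sequentially by (intro exI[of _ m]) auto
  then show "(\<lambda>n. indicator (cball 0 (real n)) x *\<^sub>R g x) \<longlonglongrightarrow> g x"
    by (rule tendsto_eventually)
qed

lemma locally_integrable_translation:
  fixes g :: "complex \<Rightarrow> 'b::{banach, second_countable_topology}"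
  assumes g: "locally_integrable g" shows "locally_integrable (\<lambda>z. g (c + z))"
  unfolding locally_integrable_def
proof (intro allI impI)
  fix S :: "complex set" assume S: "compact S"
  have S': "compact ((\<lambda>z. c + z) ` S)" using compact_translation[OF S] .
  have i: "integrable lebesgue (\<lambda>x. indicator ((\<lambda>z. c + z) ` S) x *\<^sub>R g x)"
    using g S' unfolding locally_integrable_def set_integrable_def by blast
  have "(\<lambda>x. indicator ((\<lambda>z. c + z) ` S) (c + x) *\<^sub>R g (c + x)) = (\<lambda>x. indicator S x *\<^sub>R g (c + x))"
    by (auto simp: indicator_def fun_eq_iff)
  then show "set_integrable lebesgue S (\<lambda>z. g (c + z))"
    using i integrable_translation_iff[OF borel_measurable_integrable[OF i], of c] unfolding set_integrable_def by simp
qed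

lemma locally_integrable_cong_AE:
  fixes g g' :: "complex \<Rightarrow> 'b::euclidean_space"
  assumes g: "locally_integrable g" and ae: "AE x in lebesgue. g x = g' x"
  shows "locally_integrable g'"
  unfolding locally_integrable_def
proof (intro allI impI)
  fix S :: "complex set" assume S: "compact S"
  have i: "integrable lebesgue (\<lambda>x. indicator S x *\<^sub>R g x)"
    using g S unfolding locally_integrable_def set_integrable_def by blast
  have ae': "AE x in lebesgue. indicator S x *\<^sub>R g x = indicator S x *\<^sub>R g' x"
    using ae by eventually_elim simp
  show "set_integrable lebesgue S g'"
    using i ae' borel_measurable_AE[OF borel_measurable_integrable[OF i] ae'] unfolding set_integrable_def
    by (subst integrable_cong_AE[symmetric]) auto
qed

lemma locally_integrable_continuous:
  fixes f :: "complex \<Rightarrow> complex"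
  assumes "continuous_on UNIV f" shows "locally_integrable f"
  unfolding locally_integrable_def set_integrable_def
proof (intro allI impI)
  fix S :: "complex set" assume "compact S"
  then have i: "integrable lborel (\<lambda>x. indicator S x *\<^sub>R f x)"
    by (intro borel_integrable_compact continuous_on_subset[OF assms]) auto
  then show "integrable lebesgue (\<lambda>x. indicator S x *\<^sub>R f x)"
    by (subst integrable_completion) (auto dest: borel_measurable_integrable)
qed

lemma test_function_support:
  assumes "\<phi> \<in> test_functions" obtains \<rho> where "0 \<le> \<rho>" "\<And>z. \<rho> < cmod z \<Longrightarrow> \<phi> z = 0"
proof -
  have "bounded {z. \<phi> z \<noteq> 0}"
    using assms unfolding test_functions_def by (auto dest: compact_imp_bounded intro: bounded_subset[OF _ closure_subset])
  then obtain B where "0 < B" "\<And>z. \<phi> z \<noteq> 0 \<Longrightarrow> cmod z \<le> B" unfolding bounded_pos by auto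
  then show ?thesis using that[of B] by (meson less_imp_le not_less)
qed

lemma test_function_partials:
  assumes t: "\<phi> \<in> test_functions"
  obtains \<phi>x \<phi>y \<rho> where "\<And>z. (\<phi> has_derivative (\<lambda>h. Re h * \<phi>x z + Im h * \<phi>y z)) (at z)"
    "continuous_on UNIV \<phi>x" "continuous_on UNIV \<phi>y" "0 \<le> \<rho>" "\<And>z. \<rho> < cmod z \<Longrightarrow> \<phi> z = 0"
    "\<And>z. \<rho> < cmod z \<Longrightarrow> \<phi>x z = 0" "\<And>z. \<rho> < cmod z \<Longrightarrow> \<phi>y z = 0"
proof -
  obtain \<rho> where r: "0 \<le> \<rho>" "\<And>z. \<rho> < cmod z \<Longrightarrow> \<phi> z = 0" using test_function_support[OF t] by blast
  have "Ck (Suc 0) \<phi>" using t unfolding test_functions_def by blast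
  then obtain \<phi>x \<phi>y where d: "\<And>z. (\<phi> has_derivative (\<lambda>h. Re h * \<phi>x z + Im h * \<phi>y z)) (at z)"
    "continuous_on UNIV \<phi>x" "continuous_on UNIV \<phi>y" by auto
  have "\<phi>x z = 0 \<and> \<phi>y z = 0" if z: "\<rho> < cmod z" for z
  proof -
    have "((\<lambda>z. 0::real) has_derivative (\<lambda>h. Re h * \<phi>x z + Im h * \<phi>y z)) (at z)"
    proof (rule has_derivative_transform_within_open[OF d(1)])
      show "open {z. \<rho> < cmod z}" by (intro open_Collect_less continuous_intros)
    qed (use z r in auto)
    from has_derivative_unique[OF this has_derivative_const]
    have "Re h * \<phi>x z + Im h * \<phi>y z = 0" for h by (simp add: fun_eq_iff)
    from this[of 1] this[of \<i>] show ?thesis by simp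
  qed
  then show ?thesis using that d r by blast
qed

lemma test_function_translation:
  assumes "\<phi> \<in> test_functions" shows "(\<lambda>z. \<phi> (c + z)) \<in> test_functions"
proof -
  have "Ck k (\<lambda>z. \<phi> (c + 1 *\<^sub>R z))" for k
    using assms unfolding test_functions_def by (intro Ck_affine) blast
  moreover obtain \<rho> where r: "0 \<le> \<rho>" "\<And>z. \<rho> < cmod z \<Longrightarrow> \<phi> z = 0" using test_function_support[OF assms] by blast
  have "{z. \<phi> (c + z) \<noteq> 0} \<subseteq> cball (- c) \<rho>"
  proof
    fix z assume "z \<in> {z. \<phi> (c + z) \<noteq> 0}"
    then have "cmod (c + z) \<le> \<rho>" using r(2) by (auto simp: not_less[symmetric])
    moreover have "dist z (- c) = cmod (c + z)" by (simp add: dist_norm add.commute)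
    ultimately show "z \<in> cball (- c) \<rho>" by (metis dist_commute mem_cball)
  qed
  then have "bounded {z. \<phi> (c + z) \<noteq> 0}" using bounded_cball bounded_subset by blast
  ultimately show ?thesis by (simp add: test_functions_def compact_closure)
qed

text \<open>The translation is moved onto the test function by \<open>\<psi>\<close>. What remains
  is that the constant \<open>b\<close> contributes nothing.\<close>

lemma has_weak_deriv_translation:
  fixes f :: "complex \<Rightarrow> complex"
  assumes w: "has_weak_deriv f v g" and f: "continuous_on UNIV f" and v: "v = 1 \<or> v = \<i>"
  shows "has_weak_deriv (\<lambda>z. f (c + z) - b) v (\<lambda>z. g (c + z))"
  unfolding has_weak_deriv_def
proof (intro conjI ballI)
  have g: "locally_integrable g" using w by (simp add: has_weak_deriv_def)
  then show "locally_integrable (\<lambda>z. g (c + z))" by (rule locally_integrable_translation)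
  fix \<phi> assume t: "\<phi> \<in> test_functions"
  obtain \<phi>x \<phi>y \<rho> where d: "\<And>z. (\<phi> has_derivative (\<lambda>h. Re h * \<phi>x z + Im h * \<phi>y z)) (at z)"
    and cx: "continuous_on UNIV \<phi>x" and cy: "continuous_on UNIV \<phi>y" and r: "0 \<le> \<rho>"
    and s: "\<And>z. \<rho> < cmod z \<Longrightarrow> \<phi> z = 0" "\<And>z. \<rho> < cmod z \<Longrightarrow> \<phi>x z = 0" "\<And>z. \<rho> < cmod z \<Longrightarrow> \<phi>y z = 0"
    using test_function_partials[OF t] by blast
  define k where "k z = Re v * \<phi>x z + Im v * \<phi>y z" for z
  have fd: "frechet_derivative \<phi> (at z) v = k z" for z
    using frechet_derivative_at[OF d, symmetric] by (simp add: k_def)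
  have ck: "continuous_on UNIV k" unfolding k_def[abs_def] by (intro continuous_intros cx cy)
  have sk: "\<And>z. \<rho> < cmod z \<Longrightarrow> k z = 0" using s by (simp add: k_def)
  have cp: "continuous_on UNIV \<phi>" using d by (meson continuous_at_imp_continuous_on has_derivative_continuous)
  define \<psi> where "\<psi> z = \<phi> (- c + z)" for z
  have \<psi>t: "\<psi> \<in> test_functions" unfolding \<psi>_def[abs_def] by (rule test_function_translation[OF t])
  have fd2: "frechet_derivative \<psi> (at z) v = k (- c + z)" for z
  proof -
    have "(\<psi> has_derivative (\<lambda>h. Re h * (1 * \<phi>x (- c + 1 *\<^sub>R z)) + Im h * (1 * \<phi>y (- c + 1 *\<^sub>R z)))) (at z)"
      using has_derivative_affine_comp[OF d, of "- c" 1 z] by (simp add: \<psi>_def[abs_def])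
    from frechet_derivative_at[OF this, symmetric] show ?thesis by (simp add: k_def)
  qed
  have intb: "integrable lborel (\<lambda>z. k z *\<^sub>R q z)" if "continuous_on UNIV q" for q :: "complex \<Rightarrow> complex"
    by (rule integrable_compact_support[where z = 0 and r = \<rho>])
       (use sk in \<open>auto intro!: continuous_intros ck that\<close>)
  have intl: "integrable lebesgue (\<lambda>z. k z *\<^sub>R q z)" if "continuous_on UNIV q" for q :: "complex \<Rightarrow> complex"
    using intb[OF that] by (subst integrable_completion) (auto dest: borel_measurable_integrable)
  have cf: "continuous_on UNIV (\<lambda>z. f (c + z))" by (intro continuous_on_compose2[OF f] continuous_intros) auto
  \<comment> \<open>The integral of a partial derivative of a test function vanishes: the
    convolution of \<open>\<phi>\<close> with a constant does not depend on \<open>z\<close>, so its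
    derivative, given by \<open>convolution_has_derivative\<close>, is 0.\<close>
  have k0: "(LINT z|lebesgue. k z *\<^sub>R b) = 0"
  proof -
    have const: "(LINT w|lborel. \<phi> (z - w) *\<^sub>R b) = (LINT w|lborel. \<phi> (0 - w) *\<^sub>R b)" for z
    proof -
      have "(LINT w|lborel. \<phi> (z - w) *\<^sub>R b) = (LINT w|lebesgue. \<phi> (z - w) *\<^sub>R b)"
        by (intro integral_completion[symmetric]) (auto intro!: borel_measurable_continuous_onI continuous_intros continuous_on_compose2[OF cp])
      also have "\<dots> = (LINT w|lebesgue. \<phi> (z - (z + w)) *\<^sub>R b)"
        by (rule integral_translation[symmetric], rule measurable_completion)
           (auto intro!: borel_measurable_continuous_onI continuous_intros continuous_on_compose2[OF cp])
      also have "\<dots> = (LINT w|lborel. \<phi> (0 - w) *\<^sub>R b)"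
        by (subst integral_completion) (auto intro!: borel_measurable_continuous_onI continuous_intros continuous_on_compose2[OF cp])
      finally show ?thesis .
    qed
    have fe: "(\<lambda>z. LINT w|lborel. \<phi> (z - w) *\<^sub>R b) = (\<lambda>_. LINT w|lborel. \<phi> (0 - w) *\<^sub>R b)"
      by (rule ext) (rule const)
    have D: "((\<lambda>z. LINT w|lborel. \<phi> (z - w) *\<^sub>R b) has_derivative
     (\<lambda>h. Re h *\<^sub>R (LINT w|lborel. \<phi>x (z - w) *\<^sub>R b) + Im h *\<^sub>R (LINT w|lborel. \<phi>y (z - w) *\<^sub>R b))) (at z)" for z
      by (rule convolution_has_derivative[OF d cx cy s continuous_on_const r])
    have "((\<lambda>z. LINT w|lborel. \<phi> (0 - w) *\<^sub>R b) has_derivative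
     (\<lambda>h. Re h *\<^sub>R (LINT w|lborel. \<phi>x (0 - w) *\<^sub>R b) + Im h *\<^sub>R (LINT w|lborel. \<phi>y (0 - w) *\<^sub>R b))) (at 0)"
      using D[of 0] by (subst (asm) fe)
    from has_derivative_unique[OF this has_derivative_const]
    have z: "Re h *\<^sub>R (LINT w|lborel. \<phi>x (0 - w) *\<^sub>R b) + Im h *\<^sub>R (LINT w|lborel. \<phi>y (0 - w) *\<^sub>R b) = 0" for h
      by (simp add: fun_eq_iff)
    have "(LINT z|lebesgue. k z *\<^sub>R b) = (LINT z|lborel. k z *\<^sub>R b)"
      using intb[of "\<lambda>_. b"] by (intro integral_completion) (auto dest: borel_measurable_integrable)
    also have "\<dots> = (LINT z|lborel. k (0 - z) *\<^sub>R b)"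
    proof -
      have l: "lborel = distr lborel borel (\<lambda>w::complex. - w)"
        using lborel_complex_affine[of "-1" 0] by (simp add: density_1)
      have "(\<lambda>z. k z *\<^sub>R b) \<in> borel_measurable borel"
        by (intro borel_measurable_continuous_onI continuous_intros ck)
      then show ?thesis using integral_distr[of uminus lborel borel "\<lambda>z. k z *\<^sub>R b"] unfolding l[symmetric] by simp
    qed
    also have "\<dots> = 0" using z[of v] v by (auto simp: k_def)
    finally show ?thesis .
  qed
  have fm: "f \<in> borel_measurable lebesgue" using f by (intro measurable_completion) (auto intro: borel_measurable_continuous_onI)
  have km: "(\<lambda>z. k (- c + z)) \<in> borel_measurable lebesgue"
    by (intro measurable_completion) (auto intro!: borel_measurable_continuous_onI continuous_on_compose2[OF ck] continuous_intros)
  have pm: "\<psi> \<in> borel_measurable lebesgue" unfolding \<psi>_def[abs_def]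
    by (intro measurable_completion) (auto intro!: borel_measurable_continuous_onI continuous_on_compose2[OF cp] continuous_intros)
  have "(LINT z|lebesgue. frechet_derivative \<phi> (at z) v *\<^sub>R (f (c + z) - b)) = (LINT z|lebesgue. k z *\<^sub>R f (c + z)) - (LINT z|lebesgue. k z *\<^sub>R b)"
    unfolding fd scaleR_diff_right by (intro Bochner_Integration.integral_diff intl cf continuous_on_const)
  also have "\<dots> = (LINT z|lebesgue. k (- c + (c + z)) *\<^sub>R f (c + z))" using k0 by simp
  also have "\<dots> = (LINT z|lebesgue. k (- c + z) *\<^sub>R f z)"
    by (rule integral_translation) (use km fm in measurable)
  also have "\<dots> = (LINT z|lebesgue. frechet_derivative \<psi> (at z) v *\<^sub>R f z)" unfolding fd2 ..
  also have "\<dots> = - (LINT z|lebesgue. \<psi> z *\<^sub>R g z)"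
    using w \<psi>t unfolding has_weak_deriv_def by blast
  also have "(LINT z|lebesgue. \<psi> z *\<^sub>R g z) = (LINT z|lebesgue. \<psi> (c + z) *\<^sub>R g (c + z))"
    by (rule integral_translation[symmetric]) (use pm locally_integrable_measurable[OF g] in measurable)
  also have "(\<lambda>z. \<psi> (c + z) *\<^sub>R g (c + z)) = (\<lambda>z. \<phi> z *\<^sub>R g (c + z))" by (simp add: \<psi>_def)
  finally show "(LINT z|lebesgue. frechet_derivative \<phi> (at z) v *\<^sub>R (f (c + z) - b)) = - (LINT z|lebesgue. \<phi> z *\<^sub>R g (c + z))" .
qed

lemma finite_distortion_weak_derivs:
  assumes "finite_distortion f"
  shows "has_weak_deriv f 1 (weak_deriv f 1)" "has_weak_deriv f \<i> (weak_deriv f \<i>)" "continuous_on UNIV f"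
  using assms someI_ex[of "has_weak_deriv f 1"] someI_ex[of "has_weak_deriv f \<i>"]
  unfolding finite_distortion_def W11_loc_def weak_deriv_def plane_homeomorphism_def homeomorphism_def by blast+

lemma weak_deriv_translation:
  fixes b c :: complex
  assumes "finite_distortion f"
  defines "F \<equiv> \<lambda>z. f (c + z) - b"
  shows "AE z in lebesgue. weak_deriv F 1 z = weak_deriv f 1 (c + z)"
    "AE z in lebesgue. weak_deriv F \<i> z = weak_deriv f \<i> (c + z)"
proof -
  note w = finite_distortion_weak_derivs[OF assms(1)]
  have t: "has_weak_deriv F v (\<lambda>z. weak_deriv f v (c + z))" if "v = 1 \<or> v = \<i>" for v
    unfolding F_def using that w by (intro has_weak_deriv_translation) auto
  have "has_weak_deriv F v (weak_deriv F v)" if "v = 1 \<or> v = \<i>" for v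
    unfolding weak_deriv_def[of F] using someI[of "has_weak_deriv F v", OF t[OF that]] .
  from weak_deriv_unique[OF this t]
  show "AE z in lebesgue. weak_deriv F 1 z = weak_deriv f 1 (c + z)"
    "AE z in lebesgue. weak_deriv F \<i> z = weak_deriv f \<i> (c + z)"
    by (auto intro: AE_completion)
qed

lemma distortion_bound_translation:
  assumes f: "finite_distortion f" and K: "distortion_bound f K"
  shows "distortion_bound (\<lambda>z. f (c + z) - b) (\<lambda>z. K (c + z))"
  unfolding distortion_bound_def
proof (intro conjI allI)
  show "(\<lambda>z. K (c + z)) \<in> borel_measurable lebesgue"
    using measurable_compose[OF measurable_translation, of K borel c] K by (simp add: distortion_bound_def)
  show "1 \<le> K (c + z)" for z using K by (simp add: distortion_bound_def)
  have "AE z in lebesgue. (onorm (weak_differential f z))\<^sup>2 \<le> K z * jacobian f z"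
    using K by (simp add: distortion_bound_def)
  from AE_translation[OF this, of c] weak_deriv_translation[OF f, where c = c and b = b]
  show "AE z in lebesgue. (onorm (weak_differential (\<lambda>z. f (c + z) - b) z))\<^sup>2 \<le> K (c + z) * jacobian (\<lambda>z. f (c + z) - b) z"
    by eventually_elim (simp add: weak_differential_def jacobian_def)
qed

lemma finite_distortion_translation:
  assumes f: "finite_distortion f"
  shows "finite_distortion (\<lambda>z. f (c + z) - b)" (is "finite_distortion ?F")
  unfolding finite_distortion_def
proof (intro conjI)
  note w = finite_distortion_weak_derivs[OF f]
  obtain g where g: "homeomorphism UNIV UNIV f g"
    using f by (auto simp: finite_distortion_def plane_homeomorphism_def)
  have "homeomorphism UNIV UNIV ?F (\<lambda>y. g (y + b) - c)"
  proof (rule homeomorphismI)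
    show "continuous_on UNIV ?F" "continuous_on UNIV (\<lambda>y. g (y + b) - c)"
      using g unfolding homeomorphism_def
      by (auto intro!: continuous_intros intro: continuous_on_compose2)
  qed (use g in \<open>auto simp: homeomorphism_def\<close>)
  then show "plane_homeomorphism ?F" unfolding plane_homeomorphism_def by blast
  have sp: "winding_number (f \<circ> circlepath z r) (f z) = 1" if "0 < r" for z r
    using f that by (simp add: finite_distortion_def sense_preserving_def)
  show "sense_preserving ?F"
    unfolding sense_preserving_def
  proof (intro allI impI)
    fix z :: complex and r :: real assume r: "0 < r"
    have "(\<lambda>w. (f \<circ> circlepath (c + z) r) w - f (c + z)) = (\<lambda>w. (?F \<circ> circlepath z r) w - ?F z)"
      by (auto simp: circlepath fun_eq_iff add.assoc)
    then show "winding_number (?F \<circ> circlepath z r) (?F z) = 1"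
      using sp[OF r, of "c + z"] winding_number_offset[of "f \<circ> circlepath (c + z) r" "f (c + z)"]
        winding_number_offset[of "?F \<circ> circlepath z r" "?F z"] by simp
  qed
  have t: "has_weak_deriv ?F v (\<lambda>z. weak_deriv f v (c + z))" if "v = 1 \<or> v = \<i>" for v
    using that w by (intro has_weak_deriv_translation) auto
  have cF: "continuous_on UNIV ?F"
    by (intro continuous_intros continuous_on_compose2[OF w(3)]) auto
  show "W11_loc ?F"
    unfolding W11_loc_def using t locally_integrable_continuous[OF cF] by blast
  have "locally_integrable (\<lambda>z. jacobian f (c + z))"
    using f by (intro locally_integrable_translation) (simp add: finite_distortion_def)
  moreover have "AE z in lebesgue. jacobian f (c + z) = jacobian ?F z"
    using weak_deriv_translation[OF f, where c = c and b = b] by eventually_elim (simp add: jacobian_def)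
  ultimately show "locally_integrable (jacobian ?F)" by (rule locally_integrable_cong_AE)
  show "\<exists>K. distortion_bound ?F K"
    using f distortion_bound_translation[OF f] unfolding finite_distortion_def by blast
qed

text \<open>The compression bound speaks of the origin and of maps fixing it. This lemma makes it
  available at every point \<open>c\<close>, for \<open>f (c + v) - f c\<close>.\<close>

lemma exp_integrable_distortion_translation:
  assumes "exp_integrable_distortion p f"
  shows "exp_integrable_distortion p (\<lambda>z. f (c + z) - b)" (is "exp_integrable_distortion p ?F")
proof -
  have f: "finite_distortion f" using assms by (simp add: exp_integrable_distortion_def)
  obtain K where K: "is_distortion f K" "locally_integrable (\<lambda>z. exp (p * K z))"
    using assms by (auto simp: exp_integrable_distortion_def)
  have "is_distortion ?F (\<lambda>z. K (c + z))"
    unfolding is_distortion_def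
  proof (intro conjI allI impI)
    show "distortion_bound ?F (\<lambda>z. K (c + z))"
      using K(1) by (intro distortion_bound_translation f) (simp add: is_distortion_def)
    \<comment> \<open>Minimality is pulled back: a competitor for the translated map, translated by
      \<open>- c\<close>, competes for \<open>f\<close>.\<close>
    fix K' assume "distortion_bound ?F K'"
    from distortion_bound_translation[OF finite_distortion_translation[OF f] this, where c = "- c" and b = "- b"]
    have "distortion_bound f (\<lambda>z. K' (- c + z))" by simp
    then have "AE z in lebesgue. K z \<le> K' (- c + z)" using K(1) by (simp add: is_distortion_def)
    from AE_translation[OF this, of c] show "AE z in lebesgue. K (c + z) \<le> K' z" by simp
  qed
  moreover have "locally_integrable (\<lambda>z. exp (p * K (c + z)))"
    using locally_integrable_translation[OF K(2)] .
  ultimately show ?thesis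
    unfolding exp_integrable_distortion_def using finite_distortion_translation[OF f] by blast
qed

text \<open>Here the almost everywhere conditions become Borel functions with inequalities at every
  point, and the operator norm becomes a bound on each vector \<open>h\<close>, the form in which
  curves use it.\<close>

lemma exp_integrable_distortion_data:
  assumes "exp_integrable_distortion p f"
  obtains g fx fy K where "homeomorphism UNIV UNIV f g" "C1_limit f fx fy" "K \<in> borel_measurable borel" "\<And>z. 1 \<le> K z"
    "\<And>z h. (cmod (Re h *\<^sub>R fx z + Im h *\<^sub>R fy z))\<^sup>2 \<le> K z * jac (fx z) (fy z) * (cmod h)\<^sup>2"
    "\<And>R. (\<integral>\<^sup>+z. ennreal (exp (p * K z)) * indicator (cball 0 R) z \<partial>lborel) < \<infinity>"
proof -
  have f: "finite_distortion f" using assms by (simp add: exp_integrable_distortion_def)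
  obtain K where K: "distortion_bound f K" "locally_integrable (\<lambda>z. exp (p * K z))"
    using assms by (auto simp: exp_integrable_distortion_def is_distortion_def)
  obtain g where g: "homeomorphism UNIV UNIV f g"
    using f by (auto simp: finite_distortion_def plane_homeomorphism_def)
  note w = finite_distortion_weak_derivs[OF f]
  obtain fx fy where lim: "C1_limit f fx fy" and ax: "AE x in lborel. weak_deriv f 1 x = fx x" "AE x in lborel. weak_deriv f \<i> x = fy x"
    using weak_deriv_C1_limit[OF w(3,1,2)] by blast
  have [measurable]: "fx \<in> borel_measurable borel" "fy \<in> borel_measurable borel" using lim by (auto simp: C1_limit_def)
  obtain Kb where Kb [measurable]: "Kb \<in> borel_measurable lborel" and aK: "AE x in lborel. K x = Kb x"
    using completion_ex_borel_measurable_real[of K lborel] K(1) by (auto simp: distortion_bound_def)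
  have aD: "AE z in lborel. (onorm (weak_differential f z))\<^sup>2 \<le> K z * jacobian f z"
    using K(1) by (simp add: distortion_bound_def AE_completion_iff)
  let ?P = "\<lambda>z. weak_deriv f 1 z = fx z \<and> weak_deriv f \<i> z = fy z \<and> K z = Kb z \<and> (onorm (weak_differential f z))\<^sup>2 \<le> K z * jacobian f z"
  have "AE z in lborel. ?P z"
    using ax aK aD by eventually_elim simp
  from AE_E[OF this] obtain N where N: "{z \<in> space lborel. \<not> ?P z} \<subseteq> N" "emeasure lborel N = 0" "N \<in> sets lborel"
    by blast
  have N': "?P z" if "z \<notin> N" for z
  proof (rule ccontr)
    assume "\<not> ?P z"
    then have "z \<in> {z \<in> space lborel. \<not> ?P z}" by simp
    with N(1) that show False by blast
  qed
  have [measurable]: "N \<in> sets borel" using N(3) by simp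
  have aN: "AE z in lborel. z \<notin> N" using N by (intro AE_not_in) (simp add: null_setsI)
  \<comment> \<open>With these values on the null set the distortion inequality reads 0 at most 0
    and \<open>K'\<close> is still at least 1.\<close>
  define fx' fy' K' where "fx' z = (if z \<in> N then 0 else fx z)" and "fy' z = (if z \<in> N then 0 else fy z)"
    and "K' z = (if z \<in> N then 1 else Kb z)" for z
  have m: "fx' \<in> borel_measurable borel" "fy' \<in> borel_measurable borel" "K' \<in> borel_measurable borel"
    unfolding fx'_def[abs_def] fy'_def[abs_def] K'_def[abs_def] using Kb by measurable
  have "AE z in lborel. fx z = fx' z" "AE z in lborel. fy z = fy' z"
    using aN by (eventually_elim, simp add: fx'_def fy'_def)+
  then have lim': "C1_limit f fx' fy'" by (rule C1_limit_cong_AE[OF lim m(1,2)])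
  show ?thesis
  proof (rule that[OF g lim' m(3)])
    have "1 \<le> K z" for z using K(1) by (simp add: distortion_bound_def)
    then show "1 \<le> K' z" for z using N'[of z] by (auto simp: K'_def) metis
    show "(cmod (Re h *\<^sub>R fx' z + Im h *\<^sub>R fy' z))\<^sup>2 \<le> K' z * jac (fx' z) (fy' z) * (cmod h)\<^sup>2" for z h
    proof (cases "z \<in> N")
      case False
      have bl: "bounded_linear (weak_differential f z)"
        unfolding weak_differential_def
        by (intro bounded_linear_add bounded_linear_scaleR_const bounded_linear_Re bounded_linear_Im)
      have "cmod (weak_differential f z h) \<le> onorm (weak_differential f z) * cmod h" by (rule onorm[OF bl])
      then have "(cmod (weak_differential f z h))\<^sup>2 \<le> (onorm (weak_differential f z) * cmod h)\<^sup>2"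
        by (intro power_mono) auto
      also have "\<dots> \<le> K z * jacobian f z * (cmod h)\<^sup>2"
      proof -
        have "(onorm (weak_differential f z))\<^sup>2 \<le> K z * jacobian f z" using N'[OF False] by blast
        then show ?thesis unfolding power_mult_distrib by (rule mult_right_mono) simp
      qed
      finally show ?thesis
        using N'[OF False] False by (simp add: weak_differential_def jacobian_def jac_def fx'_def fy'_def K'_def)
    qed (simp add: fx'_def fy'_def jac_def)
    show "(\<integral>\<^sup>+z. ennreal (exp (p * K' z)) * indicator (cball 0 R) z \<partial>lborel) < \<infinity>" for R
    proof -
      have i: "integrable lebesgue (\<lambda>z. indicator (cball 0 R) z *\<^sub>R exp (p * K z))"
        using K(2) unfolding locally_integrable_def set_integrable_def by auto
      have "(\<integral>\<^sup>+z. ennreal (exp (p * K' z)) * indicator (cball 0 R) z \<partial>lborel)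
         = (\<integral>\<^sup>+z. ennreal (norm (indicator (cball 0 R) z *\<^sub>R exp (p * K z))) \<partial>lborel)"
      proof (rule nn_integral_cong_AE)
        show "AE z in lborel. ennreal (exp (p * K' z)) * indicator (cball 0 R) z = ennreal (norm (indicator (cball 0 R) z *\<^sub>R exp (p * K z)))"
          using aN
        proof eventually_elim
          case (elim z)
          then show ?case using N'[OF elim] by (auto simp: indicator_def K'_def)
        qed
      qed
      also have "\<dots> = (\<integral>\<^sup>+z. ennreal (norm (indicator (cball 0 R) z *\<^sub>R exp (p * K z))) \<partial>lebesgue)"
        by (rule nn_integral_completion[symmetric])
      also have "\<dots> < \<infinity>" using i by (simp add: integrable_iff_bounded)
      finally show ?thesis .
    qed
  qed
qed

section \<open>Hausdorff measure of sets of high density\<close>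

lemma hausdorff_dim_le:
  assumes "0 < d" "hausdorff_measure d A = 0"
  shows "hausdorff_dim A \<le> ereal d"
  unfolding hausdorff_dim_def using assms by (auto intro!: Inf_lower)

text \<open>A disc of radius \<open>\<rho>\<close> with mass at least \<open>\<rho> powr d\<close>
  has \<open>\<rho> powr d'\<close> at most \<open>\<rho> powr (d' - d)\<close> times its mass, a
  small multiple at small scales. Disjoint Vitali discs let the masses be added. As \<open>k\<close>
  is only locally integrable and \<open>A\<close> may be unbounded, the masses are damped by a
  weight \<open>w\<close>, and the scale at a point depends on its position.\<close>

lemma hausdorff_measure_zero:
  fixes A :: "complex set" and k :: "complex \<Rightarrow> ennreal"
  assumes k [measurable]: "k \<in> borel_measurable borel"
    and fin: "\<And>R. (\<integral>\<^sup>+z. k z * indicator (cball 0 R) z \<partial>lborel) < \<infinity>"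
    and d: "d < d'" "0 < d'"
    and dens: "\<And>z \<delta>. z \<in> A \<Longrightarrow> 0 < \<delta> \<Longrightarrow> \<exists>\<rho>. 0 < \<rho> \<and> \<rho> < \<delta> \<and> ennreal (\<rho> powr d) \<le> (\<integral>\<^sup>+v. k v * indicator (cball z \<rho>) v \<partial>lborel)"
  shows "hausdorff_measure d' A = 0"
proof -
  have pre: "hausdorff_premeasure d' \<delta> A \<le> ennreal \<epsilon>" if \<delta>: "0 < \<delta>" and \<epsilon>: "0 < \<epsilon>" for \<delta> \<epsilon> :: real
  proof -
    define M where "M n = enn2real (\<integral>\<^sup>+z. k z * indicator (cball 0 (real n + 1)) z \<partial>lborel)" for n :: nat
    have M: "(\<integral>\<^sup>+z. k z * indicator (cball 0 (real n + 1)) z \<partial>lborel) = ennreal (M n)" "0 \<le> M n" for n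
      using fin[of "real n + 1"] by (auto simp: M_def less_top)
    \<comment> \<open>Chosen so that the weighted mass of the disc with index \<open>n\<close> is at
      most \<open>\<epsilon> * (1/2) ^ Suc n\<close>, with total at most \<open>\<epsilon>\<close>;
      the summand 1 excludes division by 0.\<close>
    define c where "c n = \<epsilon> * (1/2) ^ Suc n / (M n + 1)" for n
    have c: "0 < c n" "c n * M n \<le> \<epsilon> * (1/2) ^ Suc n" for n
    proof -
      have "0 < M n + 1" using M(2)[of n] by linarith
      then show "0 < c n" using \<epsilon> by (simp add: c_def)
      have "c n * M n \<le> c n * (M n + 1)" using \<open>0 < c n\<close> by (intro mult_left_mono) auto
      also have "\<dots> = \<epsilon> * (1/2) ^ Suc n" using \<open>0 < M n + 1\<close> by (metis c_def less_irrefl nonzero_eq_divide_eq)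
      finally show "c n * M n \<le> \<epsilon> * (1/2) ^ Suc n" .
    qed
    define w where "w z = (\<Sum>n. ennreal (c n) * indicator (cball 0 (real n + 1)) z)" for z :: complex
    have [measurable]: "w \<in> borel_measurable borel" unfolding w_def by measurable
    have total: "(\<integral>\<^sup>+z. k z * w z * indicator UNIV z \<partial>lborel) \<le> ennreal \<epsilon>"
    proof -
      have "(\<integral>\<^sup>+z. k z * w z * indicator UNIV z \<partial>lborel) = (\<integral>\<^sup>+z. (\<Sum>n. ennreal (c n) * (k z * indicator (cball 0 (real n + 1)) z)) \<partial>lborel)"
        unfolding w_def by (intro nn_integral_cong) (simp add: mult.left_commute flip: ennreal_suminf_cmult)
      also have "\<dots> = (\<Sum>n. \<integral>\<^sup>+z. ennreal (c n) * (k z * indicator (cball 0 (real n + 1)) z) \<partial>lborel)"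
        by (intro nn_integral_suminf) auto
      also have "\<dots> = (\<Sum>n. ennreal (c n) * ennreal (M n))"
        by (intro suminf_cong, subst nn_integral_cmult) (auto simp: M(1))
      also have "\<dots> \<le> (\<Sum>n. ennreal (\<epsilon> * (1/2) ^ Suc n))"
        using c M(2) by (intro suminf_le summableI) (auto simp: less_imp_le ennreal_leI simp flip: ennreal_mult)
      also have "\<dots> = ennreal (\<epsilon> * 1)"
        using \<epsilon> by (intro suminf_ennreal_eq sums_mult power_half_series) auto
      finally show ?thesis by simp
    qed
    define n where "n z = nat \<lceil>cmod z\<rceil>" for z
    have n: "cmod z \<le> real (n z)" for z unfolding n_def by linarith
    \<comment> \<open>The radius at which \<open>10 powr d' * r powr (d' - d)\<close> equals
      \<open>c j\<close>. The number 10 is the ratio between the diameter of a fivefold enlarged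
      disc and the original radius.\<close>
    define r where "r j = (c j / 10 powr d') powr (1 / (d' - d))" for j
    have r: "0 < r j" for j using c(1)[of j] by (simp add: r_def)
    have "\<forall>z\<in>A. \<exists>\<rho>. 0 < \<rho> \<and> \<rho> < min 1 (min (\<delta> / 10) (r (n z))) \<and> ennreal (\<rho> powr d) \<le> (\<integral>\<^sup>+v. k v * indicator (cball z \<rho>) v \<partial>lborel)"
      using dens \<delta> r by (intro ballI dens) auto
    from bchoice[OF this] obtain \<rho> where R: "\<forall>z\<in>A. 0 < \<rho> z \<and> \<rho> z < min 1 (min (\<delta> / 10) (r (n z))) \<and> ennreal (\<rho> z powr d) \<le> (\<integral>\<^sup>+v. k v * indicator (cball z (\<rho> z)) v \<partial>lborel)"
      by blast
    have \<rho>: "0 < \<rho> z" "\<rho> z < 1" "\<rho> z < \<delta> / 10" "\<rho> z < r (n z)"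
       "ennreal (\<rho> z powr d) \<le> (\<integral>\<^sup>+v. k v * indicator (cball z (\<rho> z)) v \<partial>lborel)" if "z \<in> A" for z
      using bspec[OF R that] by auto
    have "A \<subseteq> (\<Union>i\<in>A. cball (id i) (\<rho> i))" using \<rho>(1) by (force intro: less_imp_le)
    then obtain J :: "nat set" and e where J: "e ` J \<subseteq> A"
      "disjoint_family_on (\<lambda>n. cball (id (e n)) (\<rho> (e n))) J"
      "A \<subseteq> (\<Union>n\<in>J. cball (id (e n)) (5 * \<rho> (e n)))"
      by (rule Vitali_covering_sequence[where S=A and K=A and a=id and r=\<rho> and B=1]) (use \<rho>(1,2) in \<open>auto simp: less_imp_le\<close>)
    define U where "U i = (if i \<in> J then cball (e i) (5 * \<rho> (e i)) else {})" for i
    have eJ: "e i \<in> A" if "i \<in> J" for i using J(1) that by auto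
    have diam: "diameter (U i) = (if i \<in> J then 10 * \<rho> (e i) else 0)" for i
      using \<rho>(1)[OF eJ[of i]] by (auto simp: U_def)
    have "hausdorff_premeasure d' \<delta> A \<le> (\<Sum>i. ennreal (diameter (U i) powr d'))"
      unfolding hausdorff_premeasure_def
    proof (rule INF_lower, intro CollectI conjI allI)
      show "A \<subseteq> (\<Union>i. U i)" using J(3) by (force simp: U_def)
      show "bounded (U i)" for i by (simp add: U_def)
      show "diameter (U i) \<le> \<delta>" for i using \<rho>(3)[OF eJ[of i]] \<delta> by (auto simp: diam)
    qed
    also have "\<dots> \<le> (\<Sum>i. if i \<in> J then (\<integral>\<^sup>+z. (k z * w z) * indicator (cball (e i) (\<rho> (e i))) z \<partial>lborel) else 0)"
    proof (intro suminf_le summableI)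
      fix i
      show "ennreal (diameter (U i) powr d') \<le> (if i \<in> J then (\<integral>\<^sup>+z. (k z * w z) * indicator (cball (e i) (\<rho> (e i))) z \<partial>lborel) else 0)"
      proof (cases "i \<in> J")
        case True
        define z where "z = e i"
        have z: "z \<in> A" using eJ[OF True] by (simp add: z_def)
        note rz = \<rho>[OF z]
        have "(\<rho> z) powr (d' - d) \<le> r (n z) powr (d' - d)"
          using rz d by (intro powr_mono2) auto
        also have "\<dots> = c (n z) / 10 powr d'"
          using d c(1)[of "n z"] by (simp add: r_def powr_powr)
        finally have *: "10 powr d' * (\<rho> z) powr (d' - d) \<le> c (n z)" by (simp add: field_simps)
        have "(10 * \<rho> z) powr d' = (10 powr d' * (\<rho> z) powr (d' - d)) * (\<rho> z) powr d"
          using rz by (simp add: powr_mult flip: powr_add)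
        also have "\<dots> \<le> c (n z) * (\<rho> z) powr d" using * by (intro mult_right_mono) auto
        finally have "ennreal ((10 * \<rho> z) powr d') \<le> ennreal (c (n z)) * ennreal ((\<rho> z) powr d)"
          using c(1)[of "n z"] by (simp add: ennreal_leI flip: ennreal_mult)
        also have "\<dots> \<le> ennreal (c (n z)) * (\<integral>\<^sup>+v. k v * indicator (cball z (\<rho> z)) v \<partial>lborel)"
          by (intro mult_left_mono rz) auto
        also have "\<dots> = (\<integral>\<^sup>+v. ennreal (c (n z)) * (k v * indicator (cball z (\<rho> z)) v) \<partial>lborel)"
          by (rule nn_integral_cmult[symmetric]) auto
        also have "\<dots> \<le> (\<integral>\<^sup>+v. (k v * w v) * indicator (cball z (\<rho> z)) v \<partial>lborel)"
        proof (rule nn_integral_mono)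
          fix v
          show "ennreal (c (n z)) * (k v * indicator (cball z (\<rho> z)) v) \<le> (k v * w v) * indicator (cball z (\<rho> z)) v"
          proof (cases "v \<in> cball z (\<rho> z)")
            case True
            then have "v \<in> cball 0 (real (n z) + 1)"
              using n[of z] rz(2) norm_triangle_sub[of v z] by (auto simp: dist_norm norm_minus_commute)
            then have "ennreal (c (n z)) \<le> w v"
              using sum_le_suminf[OF summableI, of "{n z}" "\<lambda>n. ennreal (c n) * indicator (cball 0 (real n + 1)) v"] by (simp add: w_def)
            then have "k v * ennreal (c (n z)) \<le> k v * w v" by (intro mult_left_mono) auto
            with True show ?thesis by (simp add: mult.commute)
          qed simp
        qed
        finally show ?thesis using True by (simp add: diam z_def)
      qed (simp add: diam)
    qed
    also have "\<dots> \<le> (\<integral>\<^sup>+z. k z * w z * indicator UNIV z \<partial>lborel)"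
      using J(2) by (intro suminf_nn_integral_disjoint_le) auto
    also note total
    finally show ?thesis .
  qed
  have "hausdorff_premeasure d' \<delta> A = 0" if "0 < \<delta>" for \<delta>
  proof -
    have "hausdorff_premeasure d' \<delta> A \<le> 0"
      by (rule ennreal_le_epsilon) (use pre[OF that] in auto)
    then show ?thesis by simp
  qed
  then show ?thesis by (simp add: hausdorff_measure_def)
qed

section \<open>The modulus constant\<close>

text \<open>A recursive form of the sums in \<open>curve_length\<close>, so that inserting and
  concatenating partition points can be treated by induction on lists.\<close>

fun chord_sum :: "(real \<Rightarrow> complex) \<Rightarrow> real list \<Rightarrow> ennreal" where
  "chord_sum \<gamma> (x # y # zs) = ennreal (dist (\<gamma> x) (\<gamma> y)) + chord_sum \<gamma> (y # zs)"
| "chord_sum \<gamma> _ = 0"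

lemma chord_sum_eq: "(\<Sum>i<length ts - 1. ennreal (dist (\<gamma> (ts ! i)) (\<gamma> (ts ! Suc i)))) = chord_sum \<gamma> ts"
proof (induction \<gamma> ts rule: chord_sum.induct)
  case (1 \<gamma> x y zs)
  have "(\<Sum>i<length (x # y # zs) - 1. ennreal (dist (\<gamma> ((x # y # zs) ! i)) (\<gamma> ((x # y # zs) ! Suc i))))
     = ennreal (dist (\<gamma> x) (\<gamma> y)) + (\<Sum>i<length (y # zs) - 1. ennreal (dist (\<gamma> ((y # zs) ! i)) (\<gamma> ((y # zs) ! Suc i))))"
    by (simp add: sum.lessThan_Suc_shift del: sum.lessThan_Suc)
  then show ?case using 1 by simp
qed auto

lemma curve_length_eq: "curve_length \<gamma> a b = (SUP ts\<in>{ts. sorted ts \<and> set ts \<subseteq> {a..b}}. chord_sum \<gamma> ts)"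
  unfolding curve_length_def chord_sum_eq ..

lemma chord_sum_le: "sorted ts \<Longrightarrow> set ts \<subseteq> {a..b} \<Longrightarrow> chord_sum \<gamma> ts \<le> curve_length \<gamma> a b"
  unfolding curve_length_eq by (rule SUP_upper) simp

lemma curve_length_leI: "(\<And>ts. sorted ts \<Longrightarrow> set ts \<subseteq> {a..b} \<Longrightarrow> chord_sum \<gamma> ts \<le> M) \<Longrightarrow> curve_length \<gamma> a b \<le> M"
  unfolding curve_length_eq by (rule SUP_least) simp

lemma curve_length_mono: "a' \<le> a \<Longrightarrow> b \<le> b' \<Longrightarrow> curve_length \<gamma> a b \<le> curve_length \<gamma> a' b'"
  by (rule curve_length_leI, rule chord_sum_le) auto

lemma dist_le_curve_length: "a \<le> b \<Longrightarrow> ennreal (dist (\<gamma> a) (\<gamma> b)) \<le> curve_length \<gamma> a b"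
  using chord_sum_le[of "[a, b]" a b \<gamma>] by simp

lemma chord_sum_Cons: "chord_sum \<gamma> ts \<le> chord_sum \<gamma> (x # ts)"
  by (cases ts) auto

lemma chord_sum_append: "chord_sum \<gamma> ts + chord_sum \<gamma> us \<le> chord_sum \<gamma> (ts @ us)"
proof (induction \<gamma> ts rule: chord_sum.induct)
  case (1 \<gamma> x y zs) then show ?case by (simp add: add.assoc add_left_mono)
qed (auto simp: chord_sum_Cons)

lemma chord_sum_insert: "chord_sum \<gamma> (xs @ ys) \<le> chord_sum \<gamma> (xs @ [b]) + chord_sum \<gamma> (b # ys)"
proof (induction \<gamma> xs rule: chord_sum.induct)
  case (1 \<gamma> x y zs) then show ?case by (simp add: add.assoc add_left_mono)
next
  case ("2_1" \<gamma>) then show ?case by (simp add: chord_sum_Cons)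
next
  case ("2_2" \<gamma> x)
  show ?case
  proof (cases ys)
    case (Cons y ys')
    have "ennreal (dist (\<gamma> x) (\<gamma> y)) \<le> ennreal (dist (\<gamma> x) (\<gamma> b)) + ennreal (dist (\<gamma> b) (\<gamma> y))"
      by (simp flip: ennreal_plus add: ennreal_leI dist_triangle)
    then show ?thesis using Cons by (simp add: add_right_mono flip: add.assoc)
  qed simp
qed

lemma curve_length_superadditive:
  assumes "a \<le> b" "b \<le> c"
  shows "curve_length \<gamma> a b + curve_length \<gamma> b c \<le> curve_length \<gamma> a c"
proof -
  have 1: "chord_sum \<gamma> ts + chord_sum \<gamma> us \<le> curve_length \<gamma> a c"
    if "sorted ts" "set ts \<subseteq> {a..b}" "sorted us" "set us \<subseteq> {b..c}" for ts us
  proof (rule order_trans[OF chord_sum_append chord_sum_le])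
    show "sorted (ts @ us)" using that by (force simp: sorted_append)
    show "set (ts @ us) \<subseteq> {a..c}" using that assms by force
  qed
  have ne: "{ts. sorted ts \<and> set ts \<subseteq> {x..y}} \<noteq> {}" for x y :: real by (auto intro: exI[of _ "[]"])
  have "chord_sum \<gamma> ts + curve_length \<gamma> b c \<le> curve_length \<gamma> a c" if "sorted ts" "set ts \<subseteq> {a..b}" for ts
    unfolding curve_length_eq[of \<gamma> b c] ennreal_SUP_add_right[OF ne] using that 1 by (intro SUP_least) auto
  then show ?thesis
    unfolding curve_length_eq[of \<gamma> a b] ennreal_SUP_add_left[OF ne, symmetric] by (intro SUP_least) auto
qed

text \<open>A partition of the long interval is cut at \<open>b\<close>, and \<open>b\<close> is
  inserted into both halves, which does not decrease the sum.\<close>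

lemma curve_length_subadditive:
  assumes "a \<le> b" "b \<le> c"
  shows "curve_length \<gamma> a c \<le> curve_length \<gamma> a b + curve_length \<gamma> b c"
proof (rule curve_length_leI)
  fix ts :: "real list" assume ts: "sorted ts" "set ts \<subseteq> {a..c}"
  define xs ys where "xs = takeWhile (\<lambda>t. t \<le> b) ts" and "ys = dropWhile (\<lambda>t. t \<le> b) ts"
  have eq: "ts = xs @ ys" by (simp add: xs_def ys_def)
  have xs: "\<And>t. t \<in> set xs \<Longrightarrow> t \<le> b" unfolding xs_def by (auto dest: set_takeWhileD)
  have s: "sorted xs" "sorted ys" using ts(1) unfolding eq sorted_append by auto
  have ys: "b \<le> t" if t: "t \<in> set ys" for t
  proof -
    obtain y ys' where y: "ys = y # ys'" using t by (cases ys) auto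
    then have "\<not> y \<le> b" using hd_dropWhile[of "\<lambda>t. t \<le> b" ts] unfolding ys_def by (metis list.distinct(1) list.sel(1))
    moreover have "y \<le> t" using s(2) t y by auto
    ultimately show ?thesis by simp
  qed
  have "chord_sum \<gamma> ts \<le> chord_sum \<gamma> (xs @ [b]) + chord_sum \<gamma> (b # ys)"
    unfolding eq by (rule chord_sum_insert)
  also have "\<dots> \<le> curve_length \<gamma> a b + curve_length \<gamma> b c"
  proof (intro add_mono chord_sum_le)
    show "sorted (xs @ [b])" "sorted (b # ys)" using s xs ys by (auto simp: sorted_append)
    show "set (xs @ [b]) \<subseteq> {a..b}" "set (b # ys) \<subseteq> {b..c}" using xs ys ts(2) assms unfolding eq by auto
  qed
  finally show "chord_sum \<gamma> ts \<le> curve_length \<gamma> a b + curve_length \<gamma> b c" .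
qed

lemma chord_sum_tendsto:
  fixes q :: "'a \<Rightarrow> real \<Rightarrow> real"
  assumes "\<And>t. t \<in> set ts \<Longrightarrow> ((\<lambda>s. \<gamma> (q s t)) \<longlongrightarrow> \<gamma> t) F"
  shows "((\<lambda>s. chord_sum \<gamma> (map (q s) ts)) \<longlongrightarrow> chord_sum \<gamma> ts) F"
  using assms
proof (induction \<gamma> ts rule: chord_sum.induct)
  case (1 \<gamma> x y zs)
  then show ?case by (auto intro!: tendsto_intros tendsto_ennrealI)
qed auto

text \<open>Replacing each partition point \<open>x\<close> by \<open>min s x\<close> gives a
  partition of \<open>{0..s}\<close>, and the sums converge as \<open>s\<close> tends to
  \<open>t\<close> because the path is continuous. The next lemma is the mirror image with
  \<open>max\<close>.\<close>

lemma curve_length_lsc_left: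
  assumes \<gamma>: "path \<gamma>" and t: "0 < t" "t \<le> 1" and M: "\<And>s. 0 \<le> s \<Longrightarrow> s < t \<Longrightarrow> curve_length \<gamma> 0 s \<le> M"
  shows "curve_length \<gamma> 0 t \<le> M"
proof (rule curve_length_leI)
  fix ts assume ts: "sorted ts" "set ts \<subseteq> {0..t}"
  have c: "continuous_on {0..1} \<gamma>" using \<gamma> by (simp add: path_def)
  have e: "\<forall>\<^sub>F s in at_left t. 0 < s \<and> s < t"
    using eventually_at_left_real[OF t(1)] by eventually_elim auto
  have "((\<lambda>s. chord_sum \<gamma> (map (\<lambda>x. min s x) ts)) \<longlongrightarrow> chord_sum \<gamma> ts) (at_left t)"
  proof (rule chord_sum_tendsto)
    fix x assume x: "x \<in> set ts"
    have "((\<lambda>s. min s x) \<longlongrightarrow> min t x) (at_left t)" by (intro tendsto_intros)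
    then have "((\<lambda>s. min s x) \<longlongrightarrow> x) (at_left t)" using x ts(2) by (auto simp: min_absorb2)
    then show "((\<lambda>s. \<gamma> (min s x)) \<longlongrightarrow> \<gamma> x) (at_left t)"
    proof (rule continuous_on_tendsto_compose[OF c])
      show "x \<in> {0..1}" using x ts(2) t by auto
      show "\<forall>\<^sub>F s in at_left t. min s x \<in> {0..1}" using e by eventually_elim (use x ts(2) t in auto)
    qed
  qed
  then show "chord_sum \<gamma> ts \<le> M"
  proof (rule tendsto_upperbound)
    show "\<forall>\<^sub>F s in at_left t. chord_sum \<gamma> (map (\<lambda>x. min s x) ts) \<le> M"
      using e
    proof eventually_elim
      case (elim s)
      have "chord_sum \<gamma> (map (\<lambda>x. min s x) ts) \<le> curve_length \<gamma> 0 s"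
      proof (rule chord_sum_le)
        show "sorted (map (\<lambda>x. min s x) ts)"
          using ts(1) by (simp add: sorted_iff_nth_mono min.coboundedI2)
        show "set (map (\<lambda>x. min s x) ts) \<subseteq> {0..s}" using ts(2) elim by auto
      qed
      also have "\<dots> \<le> M" using M elim by simp
      finally show ?case .
    qed
  qed simp
qed

lemma curve_length_lsc_right:
  assumes \<gamma>: "path \<gamma>" and t: "0 \<le> t" "t < 1" and M: "\<And>s. t < s \<Longrightarrow> s \<le> 1 \<Longrightarrow> curve_length \<gamma> s 1 \<le> M"
  shows "curve_length \<gamma> t 1 \<le> M"
proof (rule curve_length_leI)
  fix ts assume ts: "sorted ts" "set ts \<subseteq> {t..1}"
  have c: "continuous_on {0..1} \<gamma>" using \<gamma> by (simp add: path_def)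
  have e: "\<forall>\<^sub>F s in at_right t. t < s \<and> s < 1"
    using eventually_at_right_real[OF t(2)] by eventually_elim auto
  have "((\<lambda>s. chord_sum \<gamma> (map (\<lambda>x. max s x) ts)) \<longlongrightarrow> chord_sum \<gamma> ts) (at_right t)"
  proof (rule chord_sum_tendsto)
    fix x assume x: "x \<in> set ts"
    have "((\<lambda>s. max s x) \<longlongrightarrow> max t x) (at_right t)" by (intro tendsto_intros)
    then have "((\<lambda>s. max s x) \<longlongrightarrow> x) (at_right t)" using x ts(2) by (auto simp: max_absorb2)
    then show "((\<lambda>s. \<gamma> (max s x)) \<longlongrightarrow> \<gamma> x) (at_right t)"
    proof (rule continuous_on_tendsto_compose[OF c])
      show "x \<in> {0..1}" using x ts(2) t by auto
      show "\<forall>\<^sub>F s in at_right t. max s x \<in> {0..1}" using e by eventually_elim (use x ts(2) t in auto)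
    qed
  qed
  then show "chord_sum \<gamma> ts \<le> M"
  proof (rule tendsto_upperbound)
    show "\<forall>\<^sub>F s in at_right t. chord_sum \<gamma> (map (\<lambda>x. max s x) ts) \<le> M"
      using e
    proof eventually_elim
      case (elim s)
      have "chord_sum \<gamma> (map (\<lambda>x. max s x) ts) \<le> curve_length \<gamma> s 1"
      proof (rule chord_sum_le)
        show "sorted (map (\<lambda>x. max s x) ts)"
          using ts(1) by (simp add: sorted_iff_nth_mono max.coboundedI2)
        show "set (map (\<lambda>x. max s x) ts) \<subseteq> {s..1}" using ts(2) elim by auto
      qed
      also have "\<dots> \<le> M" using M elim by simp
      finally show ?case .
    qed
  qed simp
qed

lemma curve_length_0: "curve_length \<gamma> a a = 0"
proof -
  have "chord_sum \<gamma> ts = 0" if "set ts \<subseteq> {a..a}" for ts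
    using that by (induction \<gamma> ts rule: chord_sum.induct) auto
  then show ?thesis by (intro antisym curve_length_leI) auto
qed

text \<open>The choice in \<open>arc_length_param\<close> is meaningful only if every length up to
  the total is attained, that is, if the length function does not jump. The candidate is the last
  parameter with length at most \<open>u\<close>.\<close>

lemma curve_length_surj:
  assumes \<gamma>: "rectifiable \<gamma>" and u: "0 \<le> u" "ennreal u \<le> curve_length \<gamma> 0 1"
  shows "\<exists>t\<in>{0..1}. curve_length \<gamma> 0 t = ennreal u"
proof -
  have p: "path \<gamma>" and fin: "curve_length \<gamma> 0 1 < \<infinity>" using \<gamma> by (auto simp: rectifiable_def)
  define T where "T = {t\<in>{0..1}. curve_length \<gamma> 0 t \<le> ennreal u}"
  have T0: "0 \<in> T" by (simp add: T_def curve_length_0)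
  have bd: "bdd_above T" by (auto simp: T_def intro: bdd_aboveI[of _ 1])
  define t where "t = Sup T"
  have t01: "0 \<le> t" "t \<le> 1"
    using cSup_upper[OF T0 bd] T0 by (auto simp: t_def T_def intro!: cSup_least)
  have below: "curve_length \<gamma> 0 s \<le> ennreal u" if s: "s < t" for s
  proof -
    have "\<exists>s'\<in>T. s < s'" using s less_cSup_iff[OF _ bd, of s] T0 unfolding t_def by blast
    then obtain s' where "s' \<in> T" "s < s'" by blast
    then show ?thesis using curve_length_mono[of 0 0 s s' \<gamma>] by (auto simp: T_def)
  qed
  have above: "ennreal u < curve_length \<gamma> 0 s" if "t < s" "s \<le> 1" for s
  proof (rule ccontr)
    assume "\<not> ?thesis"
    then have "s \<in> T" using that t01 by (auto simp: T_def)
    then have "s \<le> t" unfolding t_def by (rule cSup_upper[OF _ bd])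
    with that show False by simp
  qed
  have le: "curve_length \<gamma> 0 t \<le> ennreal u"
  proof (cases "t = 0")
    case False
    then show ?thesis using curve_length_lsc_left[OF p _ t01(2) below] t01 by auto
  qed (simp add: curve_length_0)
  have "curve_length \<gamma> 0 t = ennreal u"
  proof (rule ccontr)
    assume "curve_length \<gamma> 0 t \<noteq> ennreal u"
    with le have lt: "curve_length \<gamma> 0 t < ennreal u" by simp
    have t1: "t < 1"
    proof (rule ccontr)
      assume "\<not> t < 1"
      then have "t = 1" using t01 by simp
      with lt u(2) show False by simp
    qed
    define L where "L = enn2real (curve_length \<gamma> 0 1)"
    have L: "curve_length \<gamma> 0 1 = ennreal L" "0 \<le> L" using fin by (auto simp: L_def less_top)
    have uL: "u \<le> L" using u L by simp
    \<comment> \<open>Beyond \<open>t\<close> more than \<open>u\<close> has been used up, so the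
      remaining pieces have length at most \<open>L - u\<close>. Semicontinuity extends this to the
      piece starting at \<open>t\<close>, and the whole curve would be shorter than
      \<open>L\<close>.\<close>
    have "curve_length \<gamma> t 1 \<le> ennreal (L - u)"
    proof (rule curve_length_lsc_right[OF p t01(1) t1])
      fix s assume s: "t < s" "s \<le> 1"
      have "ennreal u + curve_length \<gamma> s 1 \<le> curve_length \<gamma> 0 s + curve_length \<gamma> s 1"
        using above[OF s] by (intro add_right_mono) auto
      also have "\<dots> \<le> ennreal u + ennreal (L - u)"
        using curve_length_superadditive[of 0 s 1 \<gamma>] s t01 u uL by (simp add: L flip: ennreal_plus)
      finally show "curve_length \<gamma> s 1 \<le> ennreal (L - u)" by (simp add: ennreal_add_left_cancel_le)
    qed
    then have "curve_length \<gamma> 0 t + curve_length \<gamma> t 1 \<le> curve_length \<gamma> 0 t + ennreal (L - u)"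
      by (rule add_left_mono)
    also have "\<dots> < ennreal u + ennreal (L - u)"
    proof -
      obtain a where a: "curve_length \<gamma> 0 t = ennreal a" "0 \<le> a" using lt by (cases "curve_length \<gamma> 0 t") auto
      then have "a < u" using lt by (simp add: ennreal_less_iff)
      then show ?thesis using a u uL by (simp add: ennreal_less_iff flip: ennreal_plus)
    qed
    also have "\<dots> = ennreal L" using u uL by (simp flip: ennreal_plus)
    finally show False
      using curve_length_subadditive[of 0 t 1 \<gamma>] t01 L by simp
  qed
  then show ?thesis using t01 by auto
qed

text \<open>The constant is what the last step needs: \<open>14 < (15 / 4)\<^sup>2\<close> and \<open>pi + 2 * (exp 1 - 1) \<ge> 5\<close>.\<close>

lemma modulus_constant_le:
  assumes C: "modulus_constant C"
  shows "C \<le> 14"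
proof -
  \<comment> \<open>Diameters and distance are all 1, so the logarithm in the modulus bound is
    \<open>ln 2\<close>. The density lives on the unit neighbourhood of \<open>E\<close>, hence the
    radius \<open>3 / 2\<close>; the rough values of \<open>pi\<close> and \<open>ln 2\<close> give
    the bound 13.5.\<close>
  define E F :: "complex set" where "E = cball 0 (1/2)" and "F = cball 2 (1/2)"
  define \<rho> :: "complex \<Rightarrow> ennreal" where "\<rho> = indicator (cball 0 (3/2))"
  have dEF: "1 \<le> dist x y" if "x \<in> E" "y \<in> F" for x y
  proof -
    have "dist 0 (2::complex) \<le> dist 0 x + dist x y + dist y 2"
      by (meson dist_triangle dist_triangle_le add_mono order_refl order_trans dist_triangle2 add_right_mono)
    moreover have "dist 0 x \<le> 1/2" "dist y 2 \<le> 1/2" using that by (auto simp: E_def F_def dist_commute)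
    ultimately show ?thesis by simp
  qed
  have cont: "continuum E" "continuum F" by (auto simp: continuum_def E_def F_def)
  have disj: "E \<inter> F = {}" using dEF by force
  have ne: "E \<noteq> {}" "F \<noteq> {}" by (auto simp: E_def F_def)
  have "1 \<le> setdist E F" using ne dEF by (intro le_setdistI) auto
  moreover have "setdist E F \<le> 1"
    using setdist_le_dist[of "1/2" E "3/2" F] by (simp add: E_def F_def dist_norm)
  ultimately have sd: "setdist E F = 1" by simp
  have di: "diameter E = 1" "diameter F = 1" by (auto simp: E_def F_def)
  have adm: "1 \<le> line_integral \<rho> \<gamma>" if g: "\<gamma> \<in> connecting_paths E F" "rectifiable \<gamma>" for \<gamma>
  proof -
    have s: "\<gamma> 0 \<in> E" "\<gamma> 1 \<in> F" using g(1) by (auto simp: connecting_paths_def pathstart_def pathfinish_def)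
    define L where "L = enn2real (curve_length \<gamma> 0 1)"
    have L: "curve_length \<gamma> 0 1 = ennreal L" "0 \<le> L" using g(2) by (auto simp: L_def less_top rectifiable_def)
    have "ennreal 1 \<le> ennreal (dist (\<gamma> 0) (\<gamma> 1))" using dEF[OF s] by (intro ennreal_leI)
    also have "\<dots> \<le> curve_length \<gamma> 0 1" by (rule dist_le_curve_length) simp
    finally have L1: "1 \<le> L" using L by simp
    \<comment> \<open>The first unit of arc length stays within distance 1 of the starting point in
      \<open>E\<close>, so this portion alone already gives line integral 1.\<close>
    have "\<rho> (arc_length_param \<gamma> u) = 1" if u: "u \<in> {0..1}" for u
    proof -
      have "ennreal u \<le> curve_length \<gamma> 0 1" using u L1 L by (simp add: ennreal_leI)
      with curve_length_surj[OF g(2), of u] u have "\<exists>t. t \<in> {0..1} \<and> curve_length \<gamma> 0 t = ennreal u" by auto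
      from someI_ex[OF this] obtain t where t: "t \<in> {0..1}" "curve_length \<gamma> 0 t = ennreal u" "arc_length_param \<gamma> u = \<gamma> t"
        unfolding arc_length_param_def by blast
      have "ennreal (dist (\<gamma> 0) (\<gamma> t)) \<le> ennreal u" using dist_le_curve_length[of 0 t \<gamma>] t by simp
      then have "dist (\<gamma> 0) (\<gamma> t) \<le> 1" using u by simp
      moreover have "cmod (\<gamma> 0) \<le> 1/2" using s by (simp add: E_def)
      moreover have "cmod (\<gamma> t) \<le> cmod (\<gamma> 0) + dist (\<gamma> 0) (\<gamma> t)"
        using norm_triangle_sub[of "\<gamma> t" "\<gamma> 0"] by (simp add: dist_norm norm_minus_commute)
      ultimately show ?thesis using t(3) by (simp add: \<rho>_def)
    qed
    then have "(\<integral>\<^sup>+u. indicator {0..1::real} u \<partial>lborel) \<le> (\<integral>\<^sup>+u\<in>{0..L}. \<rho> (arc_length_param \<gamma> u) \<partial>lborel)"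
      using L1 by (intro nn_integral_mono) (auto simp: indicator_def)
    then show ?thesis by (simp add: line_integral_def L_def)
  qed
  have "modulus (connecting_paths E F) \<le> (\<integral>\<^sup>+z. (\<rho> z)\<^sup>2 \<partial>lborel)"
    unfolding modulus_def using adm by (intro INF_lower) (auto simp: \<rho>_def)
  also have "\<dots> = (\<integral>\<^sup>+z. indicator (cball 0 (3/2)) (z::complex) \<partial>lborel)"
    by (intro nn_integral_cong) (auto simp: \<rho>_def indicator_def)
  also have "\<dots> = ennreal (pi * (3/2)\<^sup>2)" by (simp add: emeasure_cball_complex del: ennreal_mult)
  finally have m: "modulus (connecting_paths E F) \<le> ennreal (pi * (3/2)\<^sup>2)" .
  have "ennreal (C * ln 2) \<le> modulus (connecting_paths E F)"
    using C[unfolded modulus_constant_def, THEN conjunct2, rule_format, OF cont disj] by (simp add: sd di)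
  from this m have "ennreal (C * ln 2) \<le> ennreal (pi * (3/2)\<^sup>2)" by (rule order_trans)
  then have "C * ln 2 \<le> pi * (3/2)\<^sup>2" by (subst (asm) ennreal_le_iff) auto
  moreover have "pi * (3/2)\<^sup>2 \<le> 4 * (3/2)\<^sup>2" using pi_less_4 by (intro mult_right_mono) auto
  moreover have "C * (2/3) \<le> C * ln 2"
    using C ln2_ge_two_thirds by (intro mult_left_mono) (auto simp: modulus_constant_def)
  ultimately show ?thesis by (simp add: power2_eq_square)
qed

section \<open>Variation of the logarithm\<close>

text \<open>Near 0 the map \<open>exp z - z\<close> has derivative at most \<open>e\<close> in
  modulus, so \<open>exp\<close> is almost an isometry there. This compares short increments of a
  curve with those of its logarithm.\<close>

lemma exp_near_0_expansion:
  fixes e :: real assumes "0 < e"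
  obtains \<eta> where "0 < \<eta>" "\<And>u v::complex. cmod u < \<eta> \<Longrightarrow> cmod v < \<eta> \<Longrightarrow> (1 - e) * cmod (v - u) \<le> cmod (exp v - exp u)"
    "\<And>u::complex. cmod u < \<eta> \<Longrightarrow> cmod (exp u) \<le> 1 + e"
proof -
  have "isCont exp (0::complex)" by (intro continuous_intros)
  then obtain \<eta> where \<eta>: "0 < \<eta>" "\<And>z::complex. cmod z < \<eta> \<Longrightarrow> cmod (exp z - 1) < e"
    using assms unfolding continuous_at_eps_delta by (force simp: dist_norm)
  show ?thesis
  proof (rule that[OF \<eta>(1)])
    fix u v :: complex assume uv: "cmod u < \<eta>" "cmod v < \<eta>"
    have "cmod ((exp v - v) - (exp u - u)) \<le> e * cmod (v - u)"
    proof (rule field_differentiable_bound[where S = "ball 0 \<eta>" and f' = "\<lambda>z. exp z - 1"])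
      show "((\<lambda>z. exp z - z) has_field_derivative exp z - 1) (at z within ball 0 \<eta>)" for z :: complex
        by (auto intro!: derivative_eq_intros)
      show "cmod (exp z - 1) \<le> e" if "z \<in> ball 0 \<eta>" for z using \<eta>(2)[of z] that by simp
    qed (use uv in auto)
    moreover have "cmod (v - u) \<le> cmod (exp v - exp u) + cmod ((exp v - v) - (exp u - u))"
      using norm_triangle_ineq4[of "exp v - exp u" "(exp v - v) - (exp u - u)"] by simp
    ultimately show "(1 - e) * cmod (v - u) \<le> cmod (exp v - exp u)" by (simp add: algebra_simps)
  next
    fix u :: complex assume "cmod u < \<eta>"
    from \<eta>(2)[OF this] show "cmod (exp u) \<le> 1 + e" using norm_triangle_sub[of "exp u" 1] by simp
  qed
qed

lemma nn_integral_Icc_split: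
  fixes q :: "real \<Rightarrow> ennreal"
  assumes [measurable]: "q \<in> borel_measurable borel" and "a \<le> b" "b \<le> c"
  shows "(\<integral>\<^sup>+t. q t * indicator {a..b} t \<partial>lborel) + (\<integral>\<^sup>+t. q t * indicator {b..c} t \<partial>lborel) = (\<integral>\<^sup>+t. q t * indicator {a..c} t \<partial>lborel)"
proof -
  have "(\<integral>\<^sup>+t. q t * indicator {a..b} t \<partial>lborel) + (\<integral>\<^sup>+t. q t * indicator {b..c} t \<partial>lborel)
     = (\<integral>\<^sup>+t. q t * indicator {a..b} t + q t * indicator {b..c} t \<partial>lborel)"
    by (rule nn_integral_add[symmetric]) auto
  also have "\<dots> = (\<integral>\<^sup>+t. q t * indicator {a..c} t \<partial>lborel)"
  proof (rule nn_integral_cong_AE)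
    show "AE t in lborel. q t * indicator {a..b} t + q t * indicator {b..c} t = q t * indicator {a..c} t"
      using AE_lborel_singleton[of b] by eventually_elim (use assms in \<open>auto simp: indicator_def\<close>)
  qed
  finally show ?thesis .
qed

text \<open>On short arcs the bound holds up to a factor \<open>1 + \<epsilon>\<close>, which is removed by refining the subdivision.\<close>

lemma log_lift_bound:
  fixes h \<gamma> :: "real \<Rightarrow> complex" and q :: "real \<Rightarrow> ennreal"
  assumes ab: "a \<le> b" and h: "continuous_on {a..b} h" and \<gamma>: "\<And>t. t \<in> {a..b} \<Longrightarrow> \<gamma> t = exp (h t)"
    and \<gamma>m [measurable]: "\<gamma> \<in> borel_measurable borel" and q [measurable]: "q \<in> borel_measurable borel"
    and bd: "\<And>s t. a \<le> s \<Longrightarrow> s \<le> t \<Longrightarrow> t \<le> b \<Longrightarrow> ennreal (cmod (\<gamma> t - \<gamma> s)) \<le> (\<integral>\<^sup>+x. q x * indicator {s..t} x \<partial>lborel)"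
  shows "ennreal (cmod (h b - h a)) \<le> (\<integral>\<^sup>+x. q x * ennreal (1 / cmod (\<gamma> x)) * indicator {a..b} x \<partial>lborel)"
proof -
  define I where "I s t = (\<integral>\<^sup>+x. q x * ennreal (1 / cmod (\<gamma> x)) * indicator {s..t} x \<partial>lborel)" for s t
  have step: "ennreal (cmod (h b - h a)) \<le> ennreal (1 + \<epsilon>) * I a b" if \<epsilon>: "0 < \<epsilon>" for \<epsilon> :: real
  proof -
    \<comment> \<open>The solution of \<open>(1 + e) / (1 - e) = 1 + \<epsilon>\<close>: the
      numerator bounds \<open>cmod (\<gamma> \<tau>)\<close> on a short arc, the denominator comes
      from the near isometry.\<close>
    define e where "e = \<epsilon> / (2 + \<epsilon>)"
    have e: "0 < e" "e < 1" using \<epsilon> by (auto simp: e_def)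
    have e2: "(1 + e) = (1 + \<epsilon>) * (1 - e)" using \<epsilon> by (simp add: e_def field_simps)
    obtain \<eta> where \<eta>: "0 < \<eta>" "\<And>u v::complex. cmod u < \<eta> \<Longrightarrow> cmod v < \<eta> \<Longrightarrow> (1 - e) * cmod (v - u) \<le> cmod (exp v - exp u)"
      "\<And>u::complex. cmod u < \<eta> \<Longrightarrow> cmod (exp u) \<le> 1 + e"
      using exp_near_0_expansion[OF e(1)] by metis
    define P where "P s t \<longleftrightarrow> (a \<le> s \<and> t \<le> b \<longrightarrow> ennreal (cmod (h t - h s)) \<le> ennreal (1 + \<epsilon>) * I s t)" for s t
    have "P a b"
    \<comment> \<open>The property is additive over adjacent intervals and holds on all short
      intervals around each point; bisection then gives it on the whole interval without an explicit
      subdivision.\<close>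
    proof (rule Bolzano[OF ab])
      fix s t u assume *: "P s t" "P t u" "s \<le> t" "t \<le> u"
      show "P s u" unfolding P_def
      proof
        assume b: "a \<le> s \<and> u \<le> b"
        have "cmod (h u - h s) \<le> cmod (h t - h s) + cmod (h u - h t)"
          using norm_triangle_ineq[of "h t - h s" "h u - h t"] by simp
        then have "ennreal (cmod (h u - h s)) \<le> ennreal (cmod (h t - h s)) + ennreal (cmod (h u - h t))"
          by (simp flip: ennreal_plus add: ennreal_leI)
        also have "\<dots> \<le> ennreal (1 + \<epsilon>) * I s t + ennreal (1 + \<epsilon>) * I t u"
          using * b unfolding P_def by (intro add_mono) auto
        also have "\<dots> = ennreal (1 + \<epsilon>) * I s u"
          unfolding I_def distrib_left[symmetric] using * by (subst nn_integral_Icc_split) auto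
        finally show "ennreal (cmod (h u - h s)) \<le> ennreal (1 + \<epsilon>) * I s u" .
      qed
    next
      fix x assume x: "a \<le> x" "x \<le> b"
      obtain d where d: "0 < d" "\<And>t. t \<in> {a..b} \<Longrightarrow> dist t x < d \<Longrightarrow> dist (h t) (h x) < \<eta>"
        using h x \<eta>(1) unfolding continuous_on_iff by (metis atLeastAtMost_iff)
      show "\<exists>d>0. \<forall>s t. s \<le> x \<and> x \<le> t \<and> t - s < d \<longrightarrow> P s t"
      proof (intro exI[of _ d] conjI allI impI)
        fix s t assume st: "s \<le> x \<and> x \<le> t \<and> t - s < d"
        show "P s t" unfolding P_def
        proof
          assume b: "a \<le> s \<and> t \<le> b"
          define g where "g = cmod (\<gamma> x)"
          have \<gamma>x: "\<gamma> x = exp (h x)" using \<gamma> x by auto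
          have g: "0 < g" by (simp add: g_def \<gamma>x)
          have near: "cmod (h \<tau> - h x) < \<eta>" if "\<tau> \<in> {s..t}" for \<tau>
            using d(2)[of \<tau>] that st b by (auto simp: dist_norm abs_less_iff)
          have \<gamma>\<tau>: "\<gamma> \<tau> = \<gamma> x * exp (h \<tau> - h x)" if "\<tau> \<in> {s..t}" for \<tau>
            using \<gamma>[of \<tau>] \<gamma>x that b by (auto simp flip: exp_add)
          have up: "cmod (\<gamma> \<tau>) \<le> g * (1 + e)" if "\<tau> \<in> {s..t}" for \<tau>
            using \<eta>(3)[OF near[OF that]] g by (simp add: \<gamma>\<tau>[OF that] norm_mult g_def)
          have "(1 - e) * cmod (h t - h s) \<le> cmod (exp (h t - h x) - exp (h s - h x))"
            using \<eta>(2)[OF near near, of s t] st by simp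
          then have "g * ((1 - e) * cmod (h t - h s)) \<le> g * cmod (exp (h t - h x) - exp (h s - h x))"
            using g by (intro mult_left_mono) auto
          also have "\<dots> = cmod (\<gamma> t - \<gamma> s)"
            using \<gamma>\<tau>[of t] \<gamma>\<tau>[of s] st by (simp add: g_def norm_mult flip: right_diff_distrib)
          finally have "ennreal (g * ((1 - e) * cmod (h t - h s))) \<le> ennreal (cmod (\<gamma> t - \<gamma> s))"
            by (rule ennreal_leI)
          also have "\<dots> \<le> (\<integral>\<^sup>+x. q x * indicator {s..t} x \<partial>lborel)" using bd st b by auto
          also have "\<dots> \<le> (\<integral>\<^sup>+x. ennreal (g * (1 + e)) * (q x * ennreal (1 / cmod (\<gamma> x)) * indicator {s..t} x) \<partial>lborel)"
          proof (rule nn_integral_mono)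
            fix \<tau>
            show "q \<tau> * indicator {s..t} \<tau> \<le> ennreal (g * (1 + e)) * (q \<tau> * ennreal (1 / cmod (\<gamma> \<tau>)) * indicator {s..t} \<tau>)"
            proof (cases "\<tau> \<in> {s..t}")
              case True
              have "\<gamma> \<tau> \<noteq> 0" using \<gamma>\<tau>[OF True] \<gamma>x by simp
              then have "1 \<le> g * (1 + e) * (1 / cmod (\<gamma> \<tau>))" using up[OF True] by simp
              then have "1 \<le> ennreal (g * (1 + e)) * ennreal (1 / cmod (\<gamma> \<tau>))"
                using g e by (simp flip: ennreal_mult ennreal_1 add: ennreal_leI del: ennreal_1)
              then have "q \<tau> * 1 \<le> q \<tau> * (ennreal (g * (1 + e)) * ennreal (1 / cmod (\<gamma> \<tau>)))"
                by (intro mult_left_mono) auto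
              with True show ?thesis by (simp add: mult_ac)
            qed simp
          qed
          also have "\<dots> = ennreal (g * (1 + e)) * I s t" unfolding I_def by (rule nn_integral_cmult) measurable
          finally have *: "ennreal (g * ((1 - e) * cmod (h t - h s))) \<le> ennreal (g * (1 + e)) * I s t" .
          show "ennreal (cmod (h t - h s)) \<le> ennreal (1 + \<epsilon>) * I s t"
          proof (cases "I s t")
            case (real i)
            have "g * ((1 - e) * cmod (h t - h s)) \<le> g * (1 + e) * i"
              using * real g e by (subst (asm) real(2), subst (asm) ennreal_mult[symmetric]) auto
            then have "(1 - e) * cmod (h t - h s) \<le> (1 - e) * ((1 + \<epsilon>) * i)"
              using g unfolding e2 by (simp add: mult.assoc mult.left_commute)
            then have "cmod (h t - h s) \<le> (1 + \<epsilon>) * i" using e by simp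
            then have "ennreal (cmod (h t - h s)) \<le> ennreal ((1 + \<epsilon>) * i)" by (rule ennreal_leI)
            also have "\<dots> = ennreal (1 + \<epsilon>) * ennreal i" using real \<epsilon> by (intro ennreal_mult) auto
            finally show ?thesis unfolding real(2) .
          next
            case top then show ?thesis using \<epsilon> by (simp add: ennreal_mult_top)
          qed
        qed
      qed (use d in auto)
    qed
    then show ?thesis by (simp add: P_def)
  qed
  have "ennreal (cmod (h b - h a)) \<le> I a b"
  proof (cases "I a b")
    case (real i)
    have "cmod (h b - h a) \<le> i"
    proof (rule field_le_epsilon)
      fix e :: real assume e: "0 < e"
      have "0 < e / (i + 1)" using e real by simp
      from step[OF this] have "ennreal (cmod (h b - h a)) \<le> ennreal ((1 + e / (i + 1)) * i)"
        unfolding real(2) using real(1) \<open>0 < e / (i + 1)\<close> by (subst ennreal_mult) auto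
      then have "cmod (h b - h a) \<le> (1 + e / (i + 1)) * i"
        using real(1) \<open>0 < e / (i + 1)\<close> by (subst (asm) ennreal_le_iff) auto
      also have "\<dots> = i + e * (i / (i + 1))" by (simp add: algebra_simps)
      also have "\<dots> \<le> i + e * 1" using e real by (intro add_left_mono mult_left_mono) auto
      finally show "cmod (h b - h a) \<le> i + e" by simp
    qed
    then show ?thesis using real by (simp add: ennreal_leI)
  qed simp
  then show ?thesis by (simp add: I_def)
qed

text \<open>An average argument off a null set. The strict inequality is the reason for the summand
  1 in \<open>C1\<close> and in the bound of \<open>ray_average\<close>.\<close>

lemma exists_below_average:
  assumes [measurable]: "A \<in> sets M" and P: "AE w in M. P w"
    and lt: "(\<integral>\<^sup>+w. l w * indicator A w \<partial>M) < L * emeasure M A"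
  shows "\<exists>w\<in>A. P w \<and> l w < L"
proof (rule ccontr)
  assume "\<not> ?thesis"
  then have c: "L \<le> l w" if "w \<in> A" "P w" for w using that not_less by blast
  from P have "AE w in M. L * indicator A w \<le> l w * indicator A w"
    by eventually_elim (auto simp: indicator_def c)
  then have "(\<integral>\<^sup>+w. L * indicator A w \<partial>M) \<le> (\<integral>\<^sup>+w. l w * indicator A w \<partial>M)"
    by (rule nn_integral_mono_AE)
  then show False using lt by (simp add: nn_integral_cmult_indicator not_less)
qed

text \<open>By invariance of domain the image of the open disc is open, so no nonzero linear
  functional is maximal at an interior point. The functionals in the directions
  \<open>h v - h v'\<close> and its negative move both points to the boundary without shortening the
  distance.\<close>

lemma ball_image_diameter_le_sphere:
  fixes h :: "complex \<Rightarrow> complex"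
  assumes h: "continuous_on (cball b \<rho>) h" and inj: "inj_on h (ball b \<rho>)" and \<rho>: "0 < \<rho>"
    and v: "v \<in> cball b \<rho>" "v' \<in> cball b \<rho>"
  shows "\<exists>x\<in>sphere b \<rho>. \<exists>x'\<in>sphere b \<rho>. cmod (h v - h v') \<le> cmod (h x - h x')"
proof -
  have op: "open (h ` ball b \<rho>)"
    by (rule invariance_of_domain[OF continuous_on_subset[OF h] _ inj]) auto
  have max: "\<exists>x\<in>sphere b \<rho>. \<forall>y\<in>cball b \<rho>. D \<bullet> h y \<le> D \<bullet> h x" if D: "D \<noteq> 0" for D
  proof -
    obtain x where x: "x \<in> cball b \<rho>" "\<And>y. y \<in> cball b \<rho> \<Longrightarrow> D \<bullet> h y \<le> D \<bullet> h x"
    proof -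
      have "continuous_on (cball b \<rho>) (\<lambda>y. D \<bullet> h y)" by (intro continuous_intros h)
      from continuous_attains_sup[OF _ _ this] show thesis using \<rho> that by fastforce
    qed
    have "x \<notin> ball b \<rho>"
    proof
      assume "x \<in> ball b \<rho>"
      then obtain e where e: "0 < e" "ball (h x) e \<subseteq> h ` ball b \<rho>" using op by (meson imageI open_contains_ball)
      define t where "t = e / (2 * norm D)"
      have t: "0 < t" "norm (t *\<^sub>R D) < e" using e(1) D by (auto simp: t_def)
      then have "h x + t *\<^sub>R D \<in> h ` ball b \<rho>" using e(2) by (auto simp: subset_iff dist_norm)
      then obtain y where y: "y \<in> ball b \<rho>" "h y = h x + t *\<^sub>R D" by auto
      then have "D \<bullet> h x + t * (D \<bullet> D) \<le> D \<bullet> h x" using x(2)[of y] by (auto simp: inner_add_right)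
      moreover have "0 < t * (D \<bullet> D)" using t D by simp
      ultimately show False by simp
    qed
    then show ?thesis by (intro bexI[of _ x]) (use x in auto)
  qed
  show ?thesis
  proof (cases "h v = h v'")
    case True
    obtain x where "x \<in> sphere b \<rho>" using \<rho> by (metis ex_in_conv less_imp_le sphere_eq_empty not_less)
    with True show ?thesis by force
  next
    case False
    define D where "D = h v - h v'"
    have D: "D \<noteq> 0" "- D \<noteq> 0" using False by (auto simp: D_def)
    obtain x x' where x: "x \<in> sphere b \<rho>" "D \<bullet> h v \<le> D \<bullet> h x" "x' \<in> sphere b \<rho>" "- D \<bullet> h v' \<le> - D \<bullet> h x'"
      using max[OF D(1)] max[OF D(2)] v by metis
    have "norm D * norm D = D \<bullet> D" by (simp add: dot_square_norm power2_eq_square)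
    also have "\<dots> = D \<bullet> h v + - D \<bullet> h v'" by (simp add: D_def inner_diff_right inner_diff_left)
    also have "\<dots> \<le> D \<bullet> h x + - D \<bullet> h x'" using x by linarith
    also have "\<dots> = D \<bullet> (h x - h x')" by (simp add: inner_diff_right)
    also have "\<dots> \<le> norm D * norm (h x - h x')" by (rule norm_cauchy_schwarz)
    finally have "norm D \<le> norm (h x - h x')" using D by simp
    with x show ?thesis unfolding D_def by blast
  qed
qed

text \<open>Two logarithms of the same curve differ by integer multiples of
  \<open>2 * pi * \<i>\<close>; a continuous function with such separated values is
  constant.\<close>

lemma lift_difference:
  fixes k k' :: "real \<Rightarrow> complex"
  assumes c: "continuous_on {a..b} k" "continuous_on {a..b} k'" and e: "\<And>s. s \<in> {a..b} \<Longrightarrow> exp (k s) = exp (k' s)"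
    and ab: "a \<le> b"
  shows "k b - k a = k' b - k' a"
proof -
  have "(\<lambda>s. k s - k' s) constant_on {a..b}"
  proof (rule continuous_discrete_range_constant)
    show "continuous_on {a..b} (\<lambda>s. k s - k' s)" by (intro continuous_intros c)
    fix x assume x: "x \<in> {a..b}"
    show "\<exists>e>0. \<forall>y. y \<in> {a..b} \<and> k y - k' y \<noteq> k x - k' x \<longrightarrow> e \<le> norm (k y - k' y - (k x - k' x))"
    proof (intro exI[of _ 1] conjI allI impI)
      fix y assume y: "y \<in> {a..b} \<and> k y - k' y \<noteq> k x - k' x"
      let ?d = "k y - k' y - (k x - k' x)"
      have "exp ?d = 1" using e[of x] e[of y] x y by (simp add: exp_diff)
      then obtain n :: int where n: "Re ?d = 0" "Im ?d = of_int (2 * n) * pi" unfolding exp_eq_1 by auto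
      have "n \<noteq> 0" using n y by (auto simp: complex_eq_iff)
      then have "1 \<le> \<bar>real_of_int n\<bar>" by linarith
      moreover have "\<bar>Im ?d\<bar> = \<bar>real_of_int n\<bar> * (2 * pi)" unfolding n by (simp add: abs_mult)
      moreover have "\<bar>real_of_int n\<bar> * 1 \<le> \<bar>real_of_int n\<bar> * (2 * pi)" using pi_gt3 by (intro mult_left_mono) auto
      ultimately show "1 \<le> norm ?d" using abs_Im_le_cmod[of ?d] by linarith
    qed simp
  qed simp
  then obtain z where "\<And>s. s \<in> {a..b} \<Longrightarrow> k s - k' s = z" unfolding constant_on_def by blast
  from this[of a] this[of b] ab show ?thesis by (simp add: algebra_simps)
qed

lemma chain_bound:
  fixes k :: "real \<Rightarrow> complex"
  assumes "\<And>s t. a \<le> s \<Longrightarrow> s \<le> t \<Longrightarrow> t \<le> b \<Longrightarrow> t - s \<le> \<delta> \<Longrightarrow> cmod (k t - k s) \<le> \<Omega>"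
    and "a \<le> b" "b - a \<le> real n * \<delta>" "0 \<le> \<delta>" "0 \<le> \<Omega>"
  shows "cmod (k b - k a) \<le> real n * \<Omega>"
  using assms
proof (induction n arbitrary: a)
  case (Suc n)
  show ?case
  proof (cases "b - a \<le> \<delta>")
    case True
    then have "cmod (k b - k a) \<le> \<Omega>" using Suc.prems by auto
    also have "\<dots> \<le> real (Suc n) * \<Omega>" using Suc.prems(5) by (simp add: algebra_simps)
    finally show ?thesis .
  next
    case False
    have "cmod (k b - k (a + \<delta>)) \<le> real n * \<Omega>"
      using Suc.prems False by (intro Suc.IH) (auto simp: algebra_simps)
    moreover have "cmod (k (a + \<delta>) - k a) \<le> \<Omega>" using Suc.prems False by auto
    moreover have "cmod (k b - k a) \<le> cmod (k b - k (a + \<delta>)) + cmod (k (a + \<delta>) - k a)"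
      using norm_triangle_ineq[of "k b - k (a + \<delta>)" "k (a + \<delta>) - k a"] by simp
    ultimately show ?thesis by (simp add: algebra_simps)
  qed
qed auto

text \<open>Layer cake: \<open>1 / |v|\<^sup>2\<close> is the integral of \<open>2 / u ^ 3\<close> over \<open>u > |v|\<close>.\<close>

lemma log_area_annulus:
  assumes m: "0 < m" "m \<le> R"
  shows "(\<integral>\<^sup>+v. ennreal (1 / (cmod v)\<^sup>2) * indicator {v. m \<le> cmod v \<and> cmod v \<le> R} v \<partial>lborel) \<le> ennreal (2 * pi * ln (R / m) + pi)"
proof -
  have R: "0 < R" using m by simp
  let ?in = "\<lambda>v u. ennreal (2 / u ^ 3) * indicator {m..R} u * (if cmod v \<le> u then 1 else 0)"
  have FTC: "(\<integral>\<^sup>+u. ennreal (2 / u ^ 3) * indicator {x..R} u \<partial>lborel) = ennreal (1 / x\<^sup>2 - 1 / R\<^sup>2)" if "0 < x" "x \<le> R" for x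
  proof -
    have "(\<integral>\<^sup>+u. ennreal (2 / u ^ 3) * indicator {x..R} u \<partial>lborel) = ennreal ((- 1 / R\<^sup>2) - (- 1 / x\<^sup>2))"
      using that by (intro nn_integral_FTC_Icc)
        (auto intro!: derivative_eq_intros simp: field_simps power2_eq_square power3_eq_cube)
    then show ?thesis by simp
  qed
  have FTC2: "(\<integral>\<^sup>+u. ennreal (2 * pi / u) * indicator {m..R} u \<partial>lborel) = ennreal (2 * pi * ln (R / m))"
  proof -
    have "(\<integral>\<^sup>+u. ennreal (2 * pi / u) * indicator {m..R} u \<partial>lborel) = ennreal (2 * pi * ln R - 2 * pi * ln m)"
      using m by (intro nn_integral_FTC_Icc) (auto intro!: derivative_eq_intros simp: field_simps)
    then show ?thesis using m R by (simp add: ln_div algebra_simps)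
  qed
  have mp: "(\<lambda>p. ?in (fst p) (snd p)) \<in> borel_measurable (borel \<Otimes>\<^sub>M borel)"
  proof -
    let ?S = "{p :: complex \<times> real. cmod (fst p) \<le> snd p}"
    have "?S \<in> sets (borel \<Otimes>\<^sub>M borel)"
      unfolding borel_prod by (intro borel_closed closed_Collect_le continuous_intros)
    then have 1: "(\<lambda>p. indicator ?S p :: ennreal) \<in> borel_measurable (borel \<Otimes>\<^sub>M borel)"
      by (rule borel_measurable_indicator)
    have "(\<lambda>p. ennreal (2 / snd p ^ 3) * indicator {m..R} (snd p) * indicator ?S p) \<in> borel_measurable (borel \<Otimes>\<^sub>M borel)"
      by (intro borel_measurable_times_ennreal 1) measurable
    also have "(\<lambda>p. ennreal (2 / snd p ^ 3) * indicator {m..R} (snd p) * indicator ?S p) = (\<lambda>p. ?in (fst p) (snd p))"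
      by (auto simp: fun_eq_iff indicator_def)
    finally show ?thesis .
  qed
  \<comment> \<open>The integral over \<open>u\<close> stops at \<open>R\<close>. The missing tail
    \<open>1 / R\<^sup>2\<close>, integrated over the disc, is the additive
    \<open>pi\<close>.\<close>
  have pt: "ennreal (1 / (cmod v)\<^sup>2) * indicator {v. m \<le> cmod v \<and> cmod v \<le> R} v
      \<le> (\<integral>\<^sup>+u. ?in v u \<partial>lborel) + ennreal (1 / R\<^sup>2) * indicator (cball 0 R) v" for v
  proof (cases "m \<le> cmod v \<and> cmod v \<le> R")
    case True
    have "(\<integral>\<^sup>+u. ?in v u \<partial>lborel) = (\<integral>\<^sup>+u. ennreal (2 / u ^ 3) * indicator {cmod v..R} u \<partial>lborel)"
      using True by (intro nn_integral_cong) (auto simp: indicator_def)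
    also have "\<dots> = ennreal (1 / (cmod v)\<^sup>2 - 1 / R\<^sup>2)" using True m by (intro FTC) auto
    finally have f: "(\<integral>\<^sup>+u. ?in v u \<partial>lborel) = ennreal (1 / (cmod v)\<^sup>2 - 1 / R\<^sup>2)" .
    have "1 / R\<^sup>2 \<le> 1 / (cmod v)\<^sup>2"
    proof -
      have "0 < cmod v" using True m by linarith
      then show ?thesis using True R by (intro divide_left_mono power_mono) auto
    qed
    then have "(\<integral>\<^sup>+u. ?in v u \<partial>lborel) + ennreal (1 / R\<^sup>2) = ennreal (1 / (cmod v)\<^sup>2)"
      unfolding f by (subst ennreal_plus[symmetric]) auto
    with True show ?thesis by simp
  qed simp
  have mi [measurable]: "(\<lambda>v. \<integral>\<^sup>+u. ?in v u \<partial>lborel) \<in> borel_measurable borel"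
    using mp by (intro sigma_finite_measure.borel_measurable_nn_integral[OF sigma_finite_lborel])
       (simp add: case_prod_beta measurable_lborel1 cong: measurable_cong_sets)
  have "(\<integral>\<^sup>+v. ennreal (1 / (cmod v)\<^sup>2) * indicator {v. m \<le> cmod v \<and> cmod v \<le> R} v \<partial>lborel)
    \<le> (\<integral>\<^sup>+v. (\<integral>\<^sup>+u. ?in v u \<partial>lborel) + ennreal (1 / R\<^sup>2) * indicator (cball 0 R) v \<partial>lborel)"
    by (intro nn_integral_mono pt)
  also have "\<dots> = (\<integral>\<^sup>+v. \<integral>\<^sup>+u. ?in v u \<partial>lborel \<partial>lborel) + (\<integral>\<^sup>+v. ennreal (1 / R\<^sup>2) * indicator (cball (0::complex) R) v \<partial>lborel)"
    by (intro nn_integral_add) auto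
  also have "(\<integral>\<^sup>+v. ennreal (1 / R\<^sup>2) * indicator (cball (0::complex) R) v \<partial>lborel) = ennreal pi"
    using R by (simp add: nn_integral_cmult_indicator emeasure_cball_complex flip: ennreal_mult)
  also have "(\<integral>\<^sup>+v. \<integral>\<^sup>+u. ?in v u \<partial>lborel \<partial>lborel) = (\<integral>\<^sup>+u. \<integral>\<^sup>+v. ?in v u \<partial>lborel \<partial>lborel)"
  proof (rule lborel_pair.Fubini')
    from measurable_pair_swap[OF mp]
    show "(\<lambda>(u, v). ?in v u) \<in> borel_measurable (lborel \<Otimes>\<^sub>M lborel)"
      by (simp add: case_prod_beta cong: measurable_cong_sets)
  qed
  also have "\<dots> \<le> (\<integral>\<^sup>+u. ennreal (2 * pi / u) * indicator {m..R} u \<partial>lborel)"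
  proof (rule nn_integral_mono)
    fix u
    show "(\<integral>\<^sup>+v. ?in v u \<partial>lborel) \<le> ennreal (2 * pi / u) * indicator {m..R} u"
    proof (cases "u \<in> {m..R}")
      case True
      have "(\<integral>\<^sup>+v. ?in v u \<partial>lborel) = (\<integral>\<^sup>+v. ennreal (2 / u ^ 3) * indicator (cball (0::complex) u) v \<partial>lborel)"
        using True by (intro nn_integral_cong) (auto simp: indicator_def)
      also have "\<dots> = ennreal (2 / u ^ 3) * emeasure lborel (cball (0::complex) u)"
        by (rule nn_integral_cmult_indicator) simp
      also have "\<dots> = ennreal (2 / u ^ 3) * ennreal (pi * u\<^sup>2)"
        using True m by (subst emeasure_cball_complex) auto
      also have "\<dots> = ennreal (2 / u ^ 3 * (pi * u\<^sup>2))" using True m by (intro ennreal_mult[symmetric]) auto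
      also have "2 / u ^ 3 * (pi * u\<^sup>2) = 2 * pi / u"
        using True m by (simp add: power2_eq_square power3_eq_cube)
      finally show ?thesis using True by simp
    qed simp
  qed
  also note FTC2
  also have "ennreal (2 * pi * ln (R / m)) + ennreal pi = ennreal (2 * pi * ln (R / m) + pi)"
    using m R by (intro ennreal_plus[symmetric]) auto
  finally show ?thesis by (simp add: add_right_mono)
qed

section \<open>Rotation at a point\<close>

text \<open>\<open>M0\<close> and \<open>B0\<close> bound the logarithm of the modulus of
  \<open>f (c + v) - f c\<close> above and below, the latter only to order \<open>X\<^sup>2\<close>.
  Radius 3 covers all points that occur: the annulus of radii 1 and 2, and discs of radius at most
  \<open>1 / 2\<close> about points of modulus at most 2.\<close>

locale rotation_point =
  fixes f g fx fy :: "complex \<Rightarrow> complex" and K :: "complex \<Rightarrow> real" and p d C0 M0 B0 :: real and c :: complex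
  assumes hom: "homeomorphism UNIV UNIV f g" and lim: "C1_limit f fx fy"
    and Km [measurable]: "K \<in> borel_measurable borel" and K1: "\<And>z. 1 \<le> K z"
    and dil: "\<And>z h. (cmod (Re h *\<^sub>R fx z + Im h *\<^sub>R fy z))\<^sup>2 \<le> K z * jac (fx z) (fy z) * (cmod h)\<^sup>2"
    and p: "0 < p" and d: "0 \<le> d" "d \<le> 2" and C0: "0 < C0"
    and mass: "\<And>t. 0 < t \<Longrightarrow> t \<le> 3 \<Longrightarrow>
      (\<integral>\<^sup>+z. ennreal (exp (p * K z)) * indicator (cball c t) z \<partial>lborel) \<le> ennreal (C0 * t powr d)"
    and M0: "0 \<le> M0" "\<And>v. cmod v \<le> 3 \<Longrightarrow> cmod (f (c + v) - f c) \<le> exp M0"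
    and B0: "0 \<le> B0" "\<And>X v. 0 \<le> X \<Longrightarrow> exp (- X) \<le> cmod v \<Longrightarrow> cmod v \<le> 3 \<Longrightarrow> exp (- (B0 * (X + 1)\<^sup>2)) \<le> cmod (f (c + v) - f c)"
begin

abbreviation "F v \<equiv> f (c + v) - f c"
abbreviation "J z \<equiv> jac (fx z) (fy z)"

lemma inj: "f x = f y \<longleftrightarrow> x = y"
  using hom by (metis homeomorphism_apply1 UNIV_I)

lemma contf: "continuous_on S f"
  using hom by (auto simp: homeomorphism_def intro: continuous_on_subset)

lemma contF: "continuous_on S (\<lambda>v. F v)"
  by (intro continuous_intros continuous_on_compose2[OF contf[of UNIV]]) auto

lemma meas [measurable]: "f \<in> borel_measurable borel" "fx \<in> borel_measurable borel" "fy \<in> borel_measurable borel"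
  using contf[of UNIV] lim by (auto simp: C1_limit_def intro: borel_measurable_continuous_onI)

lemma jac_nonneg: "0 \<le> J z"
proof -
  have "0 \<le> (cmod (fx z))\<^sup>2" by simp
  also have "\<dots> \<le> K z * J z" using dil[of 1 z] by simp
  finally have "0 \<le> K z * J z" .
  then show ?thesis using K1[of z] by (simp add: zero_le_mult_iff)
qed

text \<open>An upper bound for the operator norm of the differential of a logarithm of
  \<open>f - f c\<close>; \<open>log_jac\<close> is its Jacobian, the density of logarithmic image
  area.\<close>

definition log_stretch :: "complex \<Rightarrow> ennreal" where
  "log_stretch z = ennreal (sqrt (K z * J z)) * ennreal (1 / cmod (f z - f c))"

definition log_jac :: "complex \<Rightarrow> ennreal" where
  "log_jac z = ennreal (J z / (cmod (f z - f c))\<^sup>2)"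

lemma measurable_log_stretch [measurable]: "log_stretch \<in> borel_measurable borel" "log_jac \<in> borel_measurable borel"
  unfolding log_stretch_def log_jac_def by measurable

text \<open>The arithmetic-geometric mean inequality with a free weight. Integrated and optimised
  over \<open>\<eta>\<close>, it yields the Cauchy-Schwarz bound while only integrals of
  \<open>K\<close> and \<open>log_jac\<close> appear.\<close>

lemma log_stretch_le:
  assumes \<eta>: "0 < \<eta>"
  shows "log_stretch z \<le> ennreal (\<eta> / 2) * ennreal (K z) + ennreal (1 / (2 * \<eta>)) * log_jac z"
proof -
  define t where "t = 1 / cmod (f z - f c)"
  define a b where "a = sqrt \<eta> * sqrt (K z)" and "b = sqrt (J z) * t / sqrt \<eta>"
  have t: "0 \<le> t" by (simp add: t_def)
  have K0: "0 \<le> K z" using K1[of z] by linarith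
  have "sqrt (K z * J z) * t = a * b" using \<eta> by (simp add: a_def b_def real_sqrt_mult)
  also have "\<dots> \<le> (a\<^sup>2 + b\<^sup>2) / 2" using sum_squares_bound[of a b] by simp
  also have "\<dots> = \<eta> / 2 * K z + 1 / (2 * \<eta>) * (J z * t\<^sup>2)"
    using \<eta> K0 jac_nonneg[of z] by (simp add: a_def b_def power_mult_distrib power_divide field_simps)
  also have "J z * t\<^sup>2 = J z / (cmod (f z - f c))\<^sup>2" by (simp add: t_def power_divide)
  finally have "ennreal (sqrt (K z * J z) * t) \<le> ennreal (\<eta> / 2 * K z + 1 / (2 * \<eta>) * (J z / (cmod (f z - f c))\<^sup>2))"
    by (rule ennreal_leI)
  also have "\<dots> = ennreal (\<eta> / 2) * ennreal (K z) + ennreal (1 / (2 * \<eta>)) * log_jac z"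
  proof -
    have "ennreal (\<eta> / 2 * K z) = ennreal (\<eta> / 2) * ennreal (K z)"
      "ennreal (1 / (2 * \<eta>) * (J z / (cmod (f z - f c))\<^sup>2)) = ennreal (1 / (2 * \<eta>)) * log_jac z"
      unfolding log_jac_def using \<eta> K0 jac_nonneg[of z] by (intro ennreal_mult; simp)+
    moreover have "0 \<le> \<eta> / 2 * K z" "0 \<le> 1 / (2 * \<eta>) * (J z / (cmod (f z - f c))\<^sup>2)"
      using \<eta> K0 jac_nonneg[of z] by simp_all
    ultimately show ?thesis by (simp only: ennreal_plus)
  qed
  also have "ennreal (sqrt (K z * J z) * t) = log_stretch z"
    unfolding log_stretch_def t_def using K0 jac_nonneg[of z] by (intro ennreal_mult) auto
  finally show ?thesis .
qed

text \<open>The image lies between the circles of radii \<open>exp (- Y)\<close> and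
  \<open>exp M0\<close> about \<open>f c\<close>, so the area inequality reduces the claim to the
  logarithmic area of a round annulus.\<close>

lemma area_le:
  assumes r: "0 < r" and Y: "0 \<le> Y" and lb: "\<And>v. r \<le> cmod v \<Longrightarrow> cmod v \<le> 3 \<Longrightarrow> exp (- Y) \<le> cmod (F v)"
  shows "(\<integral>\<^sup>+z. log_jac z * indicator {z. r \<le> cmod (z - c) \<and> cmod (z - c) \<le> 3} z \<partial>lborel) \<le> ennreal (2 * pi * (M0 + Y) + pi)"
proof -
  let ?U = "{z. r \<le> cmod (z - c) \<and> cmod (z - c) \<le> 3}"
  define h where "h y = ennreal (1 / (cmod (y - f c))\<^sup>2)" for y
  have [measurable]: "h \<in> borel_measurable borel" unfolding h_def by measurable
  have U: "?U \<in> sets borel" "bounded ?U"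
    by (intro borel_closed closed_Collect_conj closed_Collect_le continuous_intros)
       (rule bounded_subset[OF bounded_cball[of c 3]], auto simp: dist_norm norm_minus_commute)
  have sub: "f ` ?U \<subseteq> {y. exp (- Y) \<le> cmod (y - f c) \<and> cmod (y - f c) \<le> exp M0}"
    using lb[of "z - c" for z] M0(2)[of "z - c" for z] by auto
  have "(\<integral>\<^sup>+z. log_jac z * indicator ?U z \<partial>lborel) = (\<integral>\<^sup>+z. ennreal \<bar>J z\<bar> * h (f z) * indicator ?U z \<partial>lborel)"
    by (intro nn_integral_cong) (simp add: log_jac_def h_def jac_nonneg flip: ennreal_mult)
  also have "\<dots> \<le> (\<integral>\<^sup>+y. h y * indicator (f ` ?U) y \<partial>lborel)"
    by (rule nn_integral_jac_le_image[OF hom lim U]) measurable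
  also have "\<dots> \<le> (\<integral>\<^sup>+y. h y * indicator {y. exp (- Y) \<le> cmod (y - f c) \<and> cmod (y - f c) \<le> exp M0} y \<partial>lborel)"
    using sub by (intro nn_integral_mono mult_left_mono) (auto simp: indicator_def)
  also have "\<dots> = (\<integral>\<^sup>+v. h (f c + 1 * v) * indicator {y. exp (- Y) \<le> cmod (y - f c) \<and> cmod (y - f c) \<le> exp M0} (f c + 1 * v) \<partial>lborel)"
    by (subst nn_integral_complex_affine[of 1 _ "f c"]) auto
  also have "\<dots> = (\<integral>\<^sup>+v. ennreal (1 / (cmod v)\<^sup>2) * indicator {v. exp (- Y) \<le> cmod v \<and> cmod v \<le> exp M0} v \<partial>lborel)"
    by (intro nn_integral_cong) (simp add: h_def indicator_def)
  also have "\<dots> \<le> ennreal (2 * pi * ln (exp M0 / exp (- Y)) + pi)"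
    using M0(1) Y by (intro log_area_annulus) auto
  also have "ln (exp M0 / exp (- Y)) = M0 + Y" by (simp add: ln_div)
  finally show ?thesis .
qed

text \<open>The logarithm \<open>h\<close> is quantified inside the almost everywhere statement. A
  good \<open>w\<close> can thus be selected first and then serve any logarithm along its
  curve.\<close>

lemma path_log:
  assumes S: "0 \<le> S"
  shows "AE w in lborel. \<forall>s1 s2 h. 0 \<le> s1 \<longrightarrow> s1 \<le> s2 \<longrightarrow> s2 \<le> S \<longrightarrow> continuous_on {s1..s2} h \<longrightarrow>
     (\<forall>s\<in>{s1..s2}. f (x0 + exp (\<zeta> * complex_of_real s) * w) - f c = exp (h s)) \<longrightarrow>
     ennreal (cmod (h s2 - h s1)) \<le>
       (\<integral>\<^sup>+s. log_stretch (x0 + exp (\<zeta> * complex_of_real s) * w) * ennreal (cmod (\<zeta> * exp (\<zeta> * complex_of_real s) * w)) * indicator {s1..s2} s \<partial>lborel)"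
proof -
  have N: "(\<lambda>z. ennreal (sqrt (K z * J z))) \<in> borel_measurable borel" by measurable
  have bd: "ennreal (cmod (Re h *\<^sub>R fx z + Im h *\<^sub>R fy z)) \<le> ennreal (sqrt (K z * J z)) * ennreal (cmod h)" for z h
  proof -
    have KJ: "0 \<le> K z * J z" using jac_nonneg[of z] K1[of z] by simp
    have "cmod (Re h *\<^sub>R fx z + Im h *\<^sub>R fy z) \<le> sqrt (K z * J z) * cmod h"
      by (rule power2_le_imp_le) (use dil[of h z] KJ in \<open>auto simp: power_mult_distrib\<close>)
    then show ?thesis using KJ by (simp add: ennreal_leI flip: ennreal_mult)
  qed
  show ?thesis
    using C1_limit_path_bound[OF lim S N bd, of x0 \<zeta>]
  proof eventually_elim
    case (elim w)
    show ?case
    proof (intro allI impI)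
      fix s1 s2 :: real and h :: "real \<Rightarrow> complex"
      assume s: "0 \<le> s1" "s1 \<le> s2" "s2 \<le> S" and h: "continuous_on {s1..s2} h"
        and e: "\<forall>s\<in>{s1..s2}. f (x0 + exp (\<zeta> * complex_of_real s) * w) - f c = exp (h s)"
      let ?g = "\<lambda>s::real. x0 + exp (\<zeta> * complex_of_real s) * w"
      let ?q = "\<lambda>s. ennreal (sqrt (K (?g s) * J (?g s))) * ennreal (cmod (\<zeta> * exp (\<zeta> * complex_of_real s) * w))"
      have gm [measurable]: "?g \<in> borel_measurable borel" "(\<lambda>s::real. \<zeta> * exp (\<zeta> * complex_of_real s) * w) \<in> borel_measurable borel"
        by (intro borel_measurable_continuous_onI continuous_intros)+
      have "ennreal (cmod (h s2 - h s1)) \<le> (\<integral>\<^sup>+s. ?q s * ennreal (1 / cmod (f (?g s) - f c)) * indicator {s1..s2} s \<partial>lborel)"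
      proof (rule log_lift_bound[where \<gamma> = "\<lambda>s. f (?g s) - f c" and q = ?q, OF s(2) h])
        show "f (?g t) - f c = exp (h t)" if "t \<in> {s1..s2}" for t using e that by auto
        show "(\<lambda>s. f (?g s) - f c) \<in> borel_measurable borel" by measurable
        show "?q \<in> borel_measurable borel" by measurable
        show "ennreal (cmod ((f (?g t) - f c) - (f (?g s) - f c))) \<le> (\<integral>\<^sup>+x. ?q x * indicator {s..t} x \<partial>lborel)"
          if "s1 \<le> s" "s \<le> t" "t \<le> s2" for s t
          using elim[rule_format, of s t] that s by simp
      qed
      also have "\<dots> = (\<integral>\<^sup>+s. log_stretch (?g s) * ennreal (cmod (\<zeta> * exp (\<zeta> * complex_of_real s) * w)) * indicator {s1..s2} s \<partial>lborel)"
        by (intro nn_integral_cong) (simp add: log_stretch_def mult_ac)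
      finally show "ennreal (cmod (h s2 - h s1)) \<le> (\<integral>\<^sup>+s. log_stretch (?g s) * ennreal (cmod (\<zeta> * exp (\<zeta> * complex_of_real s) * w)) * indicator {s1..s2} s \<partial>lborel)" .
    qed
  qed
qed

text \<open>The threshold \<open>b\<close> stays free: \<open>K_integral\<close> takes
  \<open>2 * X\<close>, and \<open>ray_K\<close> takes \<open>(2 - d) * s\<close>.\<close>

lemma K_young: "ennreal (K z) \<le> ennreal (1 / p) * (ennreal (exp (- b)) * ennreal (exp (p * K z)) + ennreal b)" if "0 \<le> b"
proof -
  have "p * K z - b \<le> exp (p * K z - b)" using exp_ge_add_one_self[of "p * K z - b"] by linarith
  then have "p * K z \<le> exp (- b) * exp (p * K z) + b" by (simp flip: exp_add)
  then have "K z \<le> 1 / p * (exp (- b) * exp (p * K z) + b)" using p by (simp add: field_simps)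
  then show ?thesis using p that by (simp add: ennreal_leI flip: ennreal_mult ennreal_plus)
qed

definition CK where "CK = (9 * C0 + 2) / p"
definition CJ where "CJ = 2 * pi * (M0 + 4 * B0) + pi"
text \<open>The quotient \<open>8 / 3\<close> is \<open>(r / 2) * (r / 2) * (2 * pi)\<close> over
  the area \<open>3 * pi * r\<^sup>2 / 16\<close> of the starting annulus; the summand 1 makes the
  average strictly smaller.\<close>

definition C1 where "C1 = 8 / 3 * (CK + CJ) + 1"
text \<open>The exponent \<open>3 / 2\<close> is the geometric mean of the orders in
  \<open>K_integral\<close> and \<open>log_jac_integral\<close>, namely 1 and 2.\<close>

definition \<Omega> where "\<Omega> X = C1 * ((X + 1) * sqrt (X + 1))"

lemma constants_pos: "0 < CK" "0 < CJ" "0 < C1"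
proof -
  show 1: "0 < CK" using C0 p by (simp add: CK_def)
  have "0 \<le> 2 * pi * (M0 + 4 * B0)" using M0(1) B0(1) by simp
  then show 2: "0 < CJ" unfolding CJ_def using pi_gt_zero by linarith
  show "0 < C1" unfolding C1_def using 1 2 by (intro add_pos_pos mult_pos_pos) auto
qed

lemma K_integral:
  assumes X: "0 \<le> X" and r: "r = exp (- X)" and b: "cmod b \<le> 2 * r"
  shows "(\<integral>\<^sup>+z. ennreal (K z) * indicator (cball (c + b) (r / 2)) z \<partial>lborel) \<le> ennreal (r\<^sup>2 * CK * (X + 1))"
proof -
  have r01: "0 < r" "r \<le> 1" using X r by auto
  let ?B = "cball (c + b) (r / 2)"
  have sub: "?B \<subseteq> cball c 3"
  proof
    fix z assume "z \<in> ?B"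
    then have "cmod (z - (c + b)) \<le> 1/2" using r01 by (auto simp: dist_norm norm_minus_commute)
    moreover have "cmod (z - c) \<le> cmod (z - (c + b)) + cmod b" using norm_triangle_ineq[of "z - (c + b)" b] by simp
    ultimately show "z \<in> cball c 3" using b r01 by (auto simp: dist_norm norm_minus_commute)
  qed
  have "(\<integral>\<^sup>+z. ennreal (K z) * indicator ?B z \<partial>lborel)
     \<le> (\<integral>\<^sup>+z. ennreal (1 / p) * (ennreal (exp (- (2 * X))) * (ennreal (exp (p * K z)) * indicator (cball c 3) z) + ennreal (2 * X) * indicator ?B z) \<partial>lborel)"
  proof (rule nn_integral_mono)
    fix z
    show "ennreal (K z) * indicator ?B z \<le> ennreal (1 / p) * (ennreal (exp (- (2 * X))) * (ennreal (exp (p * K z)) * indicator (cball c 3) z) + ennreal (2 * X) * indicator ?B z)"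
    proof (cases "z \<in> ?B")
      case True
      then have "z \<in> cball c 3" using sub by blast
      with True show ?thesis using K_young[of "2 * X" z] X by simp
    qed simp
  qed
  also have "\<dots> = ennreal (1 / p) * (ennreal (exp (- (2 * X))) * (\<integral>\<^sup>+z. ennreal (exp (p * K z)) * indicator (cball c 3) z \<partial>lborel) + ennreal (2 * X) * emeasure lborel ?B)"
    by (subst nn_integral_cmult, measurable, subst nn_integral_add, measurable, subst nn_integral_cmult, measurable)
       (simp add: nn_integral_cmult_indicator)
  also have "emeasure lborel ?B = ennreal (pi * (r / 2)\<^sup>2)" using r01 by (intro emeasure_cball_complex) auto
  also have "ennreal (1 / p) * (ennreal (exp (- (2 * X))) * (\<integral>\<^sup>+z. ennreal (exp (p * K z)) * indicator (cball c 3) z \<partial>lborel) + ennreal (2 * X) * ennreal (pi * (r / 2)\<^sup>2))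
     \<le> ennreal (1 / p) * (ennreal (r\<^sup>2) * ennreal (C0 * 9) + ennreal (2 * X) * ennreal (r\<^sup>2))"
  proof (intro mult_left_mono add_mono mult_mono ennreal_leI)
    show "exp (- (2 * X)) \<le> r\<^sup>2" by (simp add: r power2_eq_square flip: exp_add)
    have "(3::real) powr d \<le> 3 powr 2" using d by (intro powr_mono) auto
    then have "C0 * 3 powr d \<le> C0 * 9" using C0 by simp
    then show "(\<integral>\<^sup>+z. ennreal (exp (p * K z)) * indicator (cball c 3) z \<partial>lborel) \<le> ennreal (C0 * 9)"
      using mass[of 3] by (simp add: order_trans ennreal_leI)
    have "pi * (r / 2)\<^sup>2 \<le> 4 * (r / 2)\<^sup>2" using pi_less_4 by (intro mult_right_mono) auto
    then show "pi * (r / 2)\<^sup>2 \<le> r\<^sup>2" by (simp add: power_divide)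
  qed auto
  also have "\<dots> = ennreal (1 / p * (r\<^sup>2 * (C0 * 9) + 2 * X * r\<^sup>2))"
    using p C0 X by (simp flip: ennreal_mult ennreal_plus)
  also have "\<dots> \<le> ennreal (r\<^sup>2 * CK * (X + 1))"
  proof (rule ennreal_leI)
    have "1 / p * (r\<^sup>2 * (C0 * 9) + 2 * X * r\<^sup>2) = r\<^sup>2 / p * (9 * C0 + 2 * X)" by (simp add: field_simps)
    also have "\<dots> \<le> r\<^sup>2 / p * ((9 * C0 + 2) * (X + 1))"
      using p C0 X by (intro mult_left_mono) (auto simp: algebra_simps)
    also have "\<dots> = r\<^sup>2 * CK * (X + 1)" by (simp add: CK_def)
    finally show "1 / p * (r\<^sup>2 * (C0 * 9) + 2 * X * r\<^sup>2) \<le> r\<^sup>2 * CK * (X + 1)" .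
  qed
  finally show ?thesis .
qed

lemma log_jac_integral:
  assumes X: "0 \<le> X" and r: "r = exp (- X)" and b: "r \<le> cmod b" "cmod b \<le> 2 * r"
  shows "(\<integral>\<^sup>+z. log_jac z * indicator (cball (c + b) (r / 2)) z \<partial>lborel) \<le> ennreal (CJ * (X + 1)\<^sup>2)"
proof -
  have r01: "0 < r" "r \<le> 1" using X r by auto
  let ?U = "{z. r / 2 \<le> cmod (z - c) \<and> cmod (z - c) \<le> 3}"
  define Y where "Y = B0 * (X + 2)\<^sup>2"
  have sub: "cball (c + b) (r / 2) \<subseteq> ?U"
  proof
    fix z assume "z \<in> cball (c + b) (r / 2)"
    then have "cmod (z - (c + b)) \<le> r/2" using r01 by (auto simp: dist_norm norm_minus_commute)
    moreover have "cmod (z - c) \<le> cmod (z - (c + b)) + cmod b" using norm_triangle_ineq[of "z - (c + b)" b] by simp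
    moreover have "cmod b \<le> cmod (z - c) + cmod (z - (c + b))" using norm_triangle_ineq4[of "z - c" "z - (c + b)"] by simp
    ultimately show "z \<in> ?U" using b r01 by auto
  qed
  have "(\<integral>\<^sup>+z. log_jac z * indicator (cball (c + b) (r / 2)) z \<partial>lborel) \<le> (\<integral>\<^sup>+z. log_jac z * indicator ?U z \<partial>lborel)"
    using sub by (intro nn_integral_mono mult_left_mono) (auto simp: indicator_def)
  also have "\<dots> \<le> ennreal (2 * pi * (M0 + Y) + pi)"
  proof (rule area_le)
    show "0 < r / 2" "0 \<le> Y" using r01 B0(1) by (auto simp: Y_def)
    fix v assume v: "r / 2 \<le> cmod v" "cmod v \<le> 3"
    \<comment> \<open>Since \<open>exp 1\<close> is at least 2, halving the inner radius costs at
      most a shift of \<open>X\<close> by 1.\<close>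
    have "exp (- (X + 1)) = r * exp (-1)" by (simp add: r flip: exp_add)
    also have "\<dots> \<le> r * (1 / 2)"
      using exp_ge_add_one_self[of 1] r01 by (intro mult_left_mono) (auto simp: exp_minus field_simps)
    finally have "exp (- (X + 1)) \<le> cmod v" using v by simp
    from B0(2)[OF _ this v(2)] X show "exp (- Y) \<le> cmod (F v)" by (simp add: Y_def add.assoc)
  qed
  also have "\<dots> \<le> ennreal (CJ * (X + 1)\<^sup>2)"
  proof (rule ennreal_leI)
    have 1: "1 \<le> (X + 1)\<^sup>2" using X by (simp add: power2_eq_square algebra_simps)
    have "(X + 2)\<^sup>2 \<le> (2 * (X + 1))\<^sup>2" using X by (intro power_mono) auto
    then have "(X + 2)\<^sup>2 \<le> 4 * (X + 1)\<^sup>2" by (simp only: power_mult_distrib) simp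
    then have "B0 * (X + 2)\<^sup>2 \<le> B0 * (4 * (X + 1)\<^sup>2)" using B0(1) by (intro mult_left_mono)
    moreover have "M0 * 1 \<le> M0 * (X + 1)\<^sup>2" using M0(1) 1 by (intro mult_left_mono)
    ultimately have "M0 + Y \<le> (M0 + 4 * B0) * (X + 1)\<^sup>2" by (simp add: Y_def algebra_simps)
    then have A: "2 * pi * (M0 + Y) \<le> 2 * pi * ((M0 + 4 * B0) * (X + 1)\<^sup>2)" by (intro mult_left_mono) auto
    have B: "pi * 1 \<le> pi * (X + 1)\<^sup>2" using 1 by (intro mult_left_mono) auto
    have "CJ * (X + 1)\<^sup>2 = 2 * pi * ((M0 + 4 * B0) * (X + 1)\<^sup>2) + pi * (X + 1)\<^sup>2" by (simp add: CJ_def algebra_simps)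
    with A B show "2 * pi * (M0 + Y) + pi \<le> CJ * (X + 1)\<^sup>2" by linarith
  qed
  finally show ?thesis .
qed

text \<open>Rotations preserve area, so every angle contributes the same integral \<open>I\<close>,
  and a starting point of less than average logarithmic length exists. Its radius exceeds
  \<open>r / 4\<close>, hence its circle encloses the disc on which \<open>oscillation\<close> is
  stated.\<close>

lemma circle_average:
  assumes X: "0 \<le> X" and r: "r = exp (- X)" and b: "r \<le> cmod b" "cmod b \<le> 2 * r"
  shows "\<exists>w. r / 4 < cmod w \<and> cmod w \<le> r / 2 \<and>
    (\<forall>s1 s2 h. 0 \<le> s1 \<longrightarrow> s1 \<le> s2 \<longrightarrow> s2 \<le> 2 * pi \<longrightarrow> continuous_on {s1..s2} h \<longrightarrow>
      (\<forall>s\<in>{s1..s2}. f (c + b + exp (\<i> * complex_of_real s) * w) - f c = exp (h s)) \<longrightarrow> cmod (h s2 - h s1) \<le> \<Omega> X)"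
proof -
  have r01: "0 < r" "r \<le> 1" using X r by auto
  define A where "A = cball (0::complex) (r / 2) - cball 0 (r / 4)"
  have [measurable]: "A \<in> sets borel" unfolding A_def by (intro sets.Diff cball_borel)
  define l where "l w = (\<integral>\<^sup>+s. log_stretch (c + b + exp (\<i> * complex_of_real s) * w) * ennreal (cmod (\<i> * exp (\<i> * complex_of_real s) * w)) * indicator {0..2 * pi} s \<partial>lborel)" for w
  \<comment> \<open>The weight that balances the orders \<open>r\<^sup>2 * (X + 1)\<close> and
    \<open>(X + 1)\<^sup>2\<close> of the two integrals.\<close>
  define \<eta> where "\<eta> = sqrt (X + 1) / r"
  have \<eta>: "0 < \<eta>" using X r01 by (simp add: \<eta>_def)
  define I where "I = (\<integral>\<^sup>+z. log_stretch z * indicator (cball (c + b) (r / 2)) z \<partial>lborel)"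
  have "I \<le> (\<integral>\<^sup>+z. ennreal (\<eta> / 2) * (ennreal (K z) * indicator (cball (c + b) (r / 2)) z)
        + ennreal (1 / (2 * \<eta>)) * (log_jac z * indicator (cball (c + b) (r / 2)) z) \<partial>lborel)"
    unfolding I_def by (intro nn_integral_mono) (auto simp: indicator_def log_stretch_le[OF \<eta>])
  also have "\<dots> = ennreal (\<eta> / 2) * (\<integral>\<^sup>+z. ennreal (K z) * indicator (cball (c + b) (r / 2)) z \<partial>lborel)
      + ennreal (1 / (2 * \<eta>)) * (\<integral>\<^sup>+z. log_jac z * indicator (cball (c + b) (r / 2)) z \<partial>lborel)"
    by (subst nn_integral_add, measurable, subst nn_integral_cmult, measurable, subst nn_integral_cmult, measurable)
  also have "\<dots> \<le> ennreal (\<eta> / 2) * ennreal (r\<^sup>2 * CK * (X + 1)) + ennreal (1 / (2 * \<eta>)) * ennreal (CJ * (X + 1)\<^sup>2)"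
    by (intro add_mono mult_left_mono K_integral[OF X r b(2)] log_jac_integral[OF X r b]) auto
  also have "\<dots> = ennreal (\<eta> / 2 * (r\<^sup>2 * CK * (X + 1)) + 1 / (2 * \<eta>) * (CJ * (X + 1)\<^sup>2))"
    using \<eta> constants_pos X by (simp flip: ennreal_mult ennreal_plus)
  also have "\<eta> / 2 * (r\<^sup>2 * CK * (X + 1)) + 1 / (2 * \<eta>) * (CJ * (X + 1)\<^sup>2) = r / 2 * ((CK + CJ) * ((X + 1) * sqrt (X + 1)))"
  proof -
    define q where "q = sqrt (X + 1)"
    have q: "0 < q" "X + 1 = q\<^sup>2" using X by (auto simp: q_def)
    show ?thesis unfolding \<eta>_def q_def[symmetric] unfolding q(2) using q(1) r01
      by (simp add: field_simps power2_eq_square)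
  qed
  finally have I: "I \<le> ennreal (r / 2 * ((CK + CJ) * ((X + 1) * sqrt (X + 1))))" .
  have "(\<integral>\<^sup>+w. l w * indicator A w \<partial>lborel)
      = (\<integral>\<^sup>+s. (\<integral>\<^sup>+w. log_stretch (c + b + exp (\<i> * complex_of_real s) * w) * ennreal (cmod (\<i> * exp (\<i> * complex_of_real s) * w)) * indicator A w \<partial>lborel)
              * indicator {0..2 * pi} s \<partial>lborel)"
    unfolding l_def using nn_integral_path_swap[of log_stretch A "c + b" \<i> 0 "2 * pi"] by simp
  also have "\<dots> \<le> (\<integral>\<^sup>+s. ennreal (r / 2) * I * indicator {0..2 * pi} s \<partial>lborel)"
  proof (intro nn_integral_mono mult_right_mono)
    fix s :: real
    define a where "a = exp (\<i> * complex_of_real s)"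
    have a: "cmod a = 1" "a \<noteq> 0" by (auto simp: a_def norm_exp_eq_Re)
    have "(\<integral>\<^sup>+w. log_stretch (c + b + a * w) * ennreal (cmod (\<i> * a * w)) * indicator A w \<partial>lborel)
       \<le> (\<integral>\<^sup>+w. ennreal (r / 2) * (log_stretch (c + b + a * w) * indicator (cball (c + b) (r / 2)) (c + b + a * w)) \<partial>lborel)"
    proof (rule nn_integral_mono)
      fix w
      have "log_stretch (c + b + a * w) * ennreal (cmod (\<i> * a * w)) \<le> log_stretch (c + b + a * w) * ennreal (r / 2)" if "w \<in> A"
        using that by (intro mult_left_mono ennreal_leI) (auto simp: A_def norm_mult a)
      then show "log_stretch (c + b + a * w) * ennreal (cmod (\<i> * a * w)) * indicator A w
          \<le> ennreal (r / 2) * (log_stretch (c + b + a * w) * indicator (cball (c + b) (r / 2)) (c + b + a * w))"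
        by (auto simp: indicator_def A_def dist_norm norm_mult a mult.commute)
    qed
    also have "\<dots> = ennreal (r / 2) * (\<integral>\<^sup>+w. log_stretch (c + b + a * w) * indicator (cball (c + b) (r / 2)) (c + b + a * w) \<partial>lborel)"
      by (intro nn_integral_cmult) measurable
    also have "(\<integral>\<^sup>+w. log_stretch (c + b + a * w) * indicator (cball (c + b) (r / 2)) (c + b + a * w) \<partial>lborel) = I"
      unfolding I_def using nn_integral_complex_affine[OF a(2), of "\<lambda>z. log_stretch z * indicator (cball (c + b) (r / 2)) z" "c + b"] by (simp add: a)
    finally show "(\<integral>\<^sup>+w. log_stretch (c + b + exp (\<i> * complex_of_real s) * w) * ennreal (cmod (\<i> * exp (\<i> * complex_of_real s) * w)) * indicator A w \<partial>lborel)
       \<le> ennreal (r / 2) * I" unfolding a_def .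
  qed simp
  also have "\<dots> = ennreal (r / 2) * I * ennreal (2 * pi)"
    by (simp add: nn_integral_cmult_indicator)
  also have "\<dots> \<le> ennreal (r / 2) * ennreal (r / 2 * ((CK + CJ) * ((X + 1) * sqrt (X + 1)))) * ennreal (2 * pi)"
    by (intro mult_right_mono mult_left_mono I) auto
  also have "\<dots> = ennreal (r / 2 * (r / 2 * ((CK + CJ) * ((X + 1) * sqrt (X + 1)))) * (2 * pi))"
    using r01 constants_pos X by (simp flip: ennreal_mult)
  also have "\<dots> < ennreal (\<Omega> X * (3 * pi * r\<^sup>2 / 16))"
  proof (rule ennreal_lessI)
    have pos: "0 < (X + 1) * sqrt (X + 1)" using X by simp
    show "0 < \<Omega> X * (3 * pi * r\<^sup>2 / 16)" using constants_pos pos r01 by (simp add: \<Omega>_def)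
    have "\<Omega> X * (3 * pi * r\<^sup>2 / 16) = r / 2 * (r / 2 * ((CK + CJ) * ((X + 1) * sqrt (X + 1)))) * (2 * pi)
        + ((X + 1) * sqrt (X + 1)) * (3 * pi * r\<^sup>2 / 16)"
    proof -
      have "(8 / 3 * a + 1) * q * (3 * pi * r\<^sup>2 / 16) = r / 2 * (r / 2 * (a * q)) * (2 * pi) + q * (3 * pi * r\<^sup>2 / 16)" for a q :: real
        by (simp add: field_simps power2_eq_square)
      then show ?thesis unfolding \<Omega>_def C1_def .
    qed
    moreover have "0 < ((X + 1) * sqrt (X + 1)) * (3 * pi * r\<^sup>2 / 16)" using pos r01 by simp
    ultimately show "r / 2 * (r / 2 * ((CK + CJ) * ((X + 1) * sqrt (X + 1)))) * (2 * pi) < \<Omega> X * (3 * pi * r\<^sup>2 / 16)" by linarith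
  qed
  also have "\<dots> = ennreal (\<Omega> X) * emeasure lborel A"
  proof -
    have "emeasure lborel A = emeasure lborel (cball (0::complex) (r / 2)) - emeasure lborel (cball (0::complex) (r / 4))"
      unfolding A_def using r01 by (intro emeasure_Diff) (auto simp: emeasure_cball_complex)
    also have "\<dots> = ennreal (3 * pi * r\<^sup>2 / 16)"
      using r01 by (simp add: emeasure_cball_complex ennreal_minus power_divide field_simps)
    finally have "emeasure lborel A = ennreal (3 * pi * r\<^sup>2 / 16)" .
    moreover have "0 \<le> \<Omega> X" using constants_pos X by (simp add: \<Omega>_def)
    ultimately show ?thesis by (simp only:) (rule ennreal_mult, auto)
  qed
  finally have lt: "(\<integral>\<^sup>+w. l w * indicator A w \<partial>lborel) < ennreal (\<Omega> X) * emeasure lborel A" .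
  have "A \<in> sets lborel" by simp
  from exists_below_average[OF this path_log[of "2 * pi" "c + b" \<i>] lt]
  obtain w where w: "w \<in> A" "l w < ennreal (\<Omega> X)"
    and pl: "\<And>s1 s2 h. 0 \<le> s1 \<Longrightarrow> s1 \<le> s2 \<Longrightarrow> s2 \<le> 2 * pi \<Longrightarrow> continuous_on {s1..s2} h \<Longrightarrow>
     (\<forall>s\<in>{s1..s2}. f (c + b + exp (\<i> * complex_of_real s) * w) - f c = exp (h s)) \<Longrightarrow>
     ennreal (cmod (h s2 - h s1)) \<le>
       (\<integral>\<^sup>+s. log_stretch (c + b + exp (\<i> * complex_of_real s) * w) * ennreal (cmod (\<i> * exp (\<i> * complex_of_real s) * w)) * indicator {s1..s2} s \<partial>lborel)"
    by auto
  have \<Omega>0: "0 \<le> \<Omega> X" using constants_pos X by (simp add: \<Omega>_def)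
  show ?thesis
  proof (intro exI[of _ w] conjI allI impI)
    show "r / 4 < cmod w" "cmod w \<le> r / 2" using w(1) by (auto simp: A_def)
    fix s1 s2 :: real and h :: "real \<Rightarrow> complex"
    assume s: "0 \<le> s1" "s1 \<le> s2" "s2 \<le> 2 * pi" and h: "continuous_on {s1..s2} h"
      "\<forall>s\<in>{s1..s2}. f (c + b + exp (\<i> * complex_of_real s) * w) - f c = exp (h s)"
    have "ennreal (cmod (h s2 - h s1)) \<le> (\<integral>\<^sup>+s. log_stretch (c + b + exp (\<i> * complex_of_real s) * w) * ennreal (cmod (\<i> * exp (\<i> * complex_of_real s) * w)) * indicator {s1..s2} s \<partial>lborel)"
      by (rule pl[OF s h])
    also have "\<dots> \<le> l w" unfolding l_def using s by (intro nn_integral_mono mult_left_mono) (auto simp: indicator_def)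
    also have "\<dots> \<le> ennreal (\<Omega> X)" using w(2) by simp
    finally show "cmod (h s2 - h s1) \<le> \<Omega> X" using \<Omega>0 by simp
  qed
qed

text \<open>A logarithm of the injective \<open>F\<close> is injective, so distances inside the good
  circle are dominated by distances between points on it, and an arc of the circle joins
  these.\<close>

lemma oscillation:
  assumes X: "0 \<le> X" and r: "r = exp (- X)" and b: "r \<le> cmod b" "cmod b \<le> 2 * r"
    and h: "continuous_on (cball b (r / 2)) h" "\<And>v. v \<in> cball b (r / 2) \<Longrightarrow> F v = exp (h v)"
    and v: "v \<in> cball b (r / 4)" "v' \<in> cball b (r / 4)"
  shows "cmod (h v - h v') \<le> \<Omega> X"
proof -
  have r01: "0 < r" "r \<le> 1" using X r by auto
  obtain w where w: "r / 4 < cmod w" "cmod w \<le> r / 2" and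
    path: "\<And>s1 s2 h. 0 \<le> s1 \<Longrightarrow> s1 \<le> s2 \<Longrightarrow> s2 \<le> 2 * pi \<Longrightarrow> continuous_on {s1..s2} h \<Longrightarrow>
      (\<forall>s\<in>{s1..s2}. f (c + b + exp (\<i> * complex_of_real s) * w) - f c = exp (h s)) \<Longrightarrow> cmod (h s2 - h s1) \<le> \<Omega> X"
    using circle_average[OF X r b] by blast
  define \<rho> where "\<rho> = cmod w"
  have \<rho>: "0 < \<rho>" "r / 4 < \<rho>" "\<rho> \<le> r / 2" using w r01 by (auto simp: \<rho>_def)
  have sub: "cball b \<rho> \<subseteq> cball b (r / 2)" using \<rho> by auto
  define \<gamma> where "\<gamma> s = b + exp (\<i> * complex_of_real s) * w" for s
  have \<gamma>s: "\<gamma> s \<in> sphere b \<rho>" for s by (simp add: \<gamma>_def dist_norm \<rho>_def norm_mult norm_exp_eq_Re)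
  have le: "cmod (h (\<gamma> s2) - h (\<gamma> s1)) \<le> \<Omega> X" if s: "0 \<le> s1" "s1 \<le> s2" "s2 \<le> 2 * pi" for s1 s2
  proof (rule path[OF s])
    show "continuous_on {s1..s2} (\<lambda>s. h (\<gamma> s))"
    proof (rule continuous_on_compose2[OF h(1)])
      show "continuous_on {s1..s2} \<gamma>" unfolding \<gamma>_def by (intro continuous_intros)
      show "\<gamma> ` {s1..s2} \<subseteq> cball b (r / 2)" using \<gamma>s \<rho> by (auto simp: sphere_def)
    qed
    show "\<forall>s\<in>{s1..s2}. f (c + b + exp (\<i> * complex_of_real s) * w) - f c = exp (h (\<gamma> s))"
    proof
      fix s
      have "\<gamma> s \<in> cball b (r / 2)" using \<gamma>s[of s] \<rho> by auto
      from h(2)[OF this] show "f (c + b + exp (\<i> * complex_of_real s) * w) - f c = exp (h (\<gamma> s))"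
        by (simp add: \<gamma>_def add.assoc)
    qed
  qed
  have par: "\<exists>s. 0 \<le> s \<and> s \<le> 2 * pi \<and> x = \<gamma> s" if "x \<in> sphere b \<rho>" for x
  proof -
    have w0: "w \<noteq> 0" using \<rho> by (auto simp: \<rho>_def)
    define u where "u = (x - b) / w"
    have "cmod u = 1" using that w0 by (simp add: u_def norm_divide dist_norm \<rho>_def norm_minus_commute)
    then have "u = exp (\<i> * complex_of_real (Arg2pi u))" "0 \<le> Arg2pi u" "Arg2pi u < 2 * pi" using Arg2pi[of u] by (auto simp: is_Arg_def)
    then show ?thesis using w0 by (intro exI[of _ "Arg2pi u"]) (auto simp: \<gamma>_def u_def)
  qed
  have "inj_on h (ball b \<rho>)"
  proof (rule inj_onI)
    fix x y assume xy: "x \<in> ball b \<rho>" "y \<in> ball b \<rho>" "h x = h y"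
    then have "F x = F y" using h(2)[of x] h(2)[of y] \<rho> by auto
    then show "x = y" using inj by auto
  qed
  moreover have "v \<in> cball b \<rho>" "v' \<in> cball b \<rho>" using v \<rho> by auto
  ultimately obtain x x' where x: "x \<in> sphere b \<rho>" "x' \<in> sphere b \<rho>" "cmod (h v - h v') \<le> cmod (h x - h x')"
    using ball_image_diameter_le_sphere[OF continuous_on_subset[OF h(1) sub] _ \<rho>(1)] by blast
  obtain s s' where s: "0 \<le> s" "s \<le> 2 * pi" "x = \<gamma> s" "0 \<le> s'" "s' \<le> 2 * pi" "x' = \<gamma> s'"
    using par[OF x(1)] par[OF x(2)] by blast
  have "cmod (h x - h x') \<le> \<Omega> X"
    using le[of s s'] le[of s' s] s by (cases "s \<le> s'") (auto simp: norm_minus_commute)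
  with x(3) show ?thesis by simp
qed


text \<open>Rescaling the disc of radius \<open>2 * exp (- s)\<close> to unit size multiplies the
  mass bound by \<open>exp ((2 - d) * s)\<close>, up to a constant. The factor
  \<open>exp (- b)\<close> cancels exactly this growth, leaving a bounded term and \<open>b\<close>
  times the area \<open>3 * pi\<close>.\<close>

lemma ray_K:
  assumes s: "0 \<le> s"
  shows "(\<integral>\<^sup>+w. ennreal (K (c + of_real (exp (- s)) * w)) * indicator (cball 0 2 - ball 0 1) w \<partial>lborel)
     \<le> ennreal (1 / p * (4 * C0 + 3 * pi * ((2 - d) * s)))"
proof -
  define A where "A = cball (0::complex) 2 - ball 0 1"
  have [measurable]: "A \<in> sets borel" unfolding A_def by auto
  have eA: "emeasure lborel A = ennreal (3 * pi)"
  proof -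
    have "emeasure lborel A = emeasure lborel (cball (0::complex) 2) - emeasure lborel (ball (0::complex) 1)"
      unfolding A_def by (intro emeasure_Diff) (auto simp: emeasure_ball)
    also have "\<dots> = ennreal (3 * pi)"
      by (simp add: emeasure_cball_complex emeasure_ball unit_ball_vol_2 ennreal_minus)
    finally show ?thesis .
  qed
  define b where "b = (2 - d) * s"
  have b: "0 \<le> b" using s d by (simp add: b_def)
  define t where "t = exp (- s)"
  have t: "0 < t" "t \<le> 1" using s by (auto simp: t_def)
  define I where "I = (\<integral>\<^sup>+z. ennreal (exp (p * K z)) * indicator (cball c (2 * t)) z \<partial>lborel)"
  have "(\<integral>\<^sup>+w. ennreal (K (c + of_real t * w)) * indicator A w \<partial>lborel)
     \<le> (\<integral>\<^sup>+w. ennreal (1 / p) * (ennreal (exp (- b)) * (ennreal (exp (p * K (c + of_real t * w))) * indicator (cball c (2 * t)) (c + of_real t * w))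
          + ennreal b * indicator A w) \<partial>lborel)"
  proof (rule nn_integral_mono)
    fix w
    show "ennreal (K (c + of_real t * w)) * indicator A w \<le> ennreal (1 / p) * (ennreal (exp (- b)) * (ennreal (exp (p * K (c + of_real t * w))) * indicator (cball c (2 * t)) (c + of_real t * w))
          + ennreal b * indicator A w)"
    proof (cases "w \<in> A")
      case True
      then have "c + of_real t * w \<in> cball c (2 * t)" using t by (auto simp: A_def dist_norm norm_mult)
      with True show ?thesis using K_young[OF b, of "c + of_real t * w"] by simp
    qed simp
  qed
  also have "\<dots> = ennreal (1 / p) * (ennreal (exp (- b)) * (\<integral>\<^sup>+w. ennreal (exp (p * K (c + of_real t * w))) * indicator (cball c (2 * t)) (c + of_real t * w) \<partial>lborel)
          + ennreal b * emeasure lborel A)"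
    by (subst nn_integral_cmult, measurable, subst nn_integral_add, measurable, subst nn_integral_cmult, measurable)
       (simp add: nn_integral_cmult_indicator)
  also have "(\<integral>\<^sup>+w. ennreal (exp (p * K (c + of_real t * w))) * indicator (cball c (2 * t)) (c + of_real t * w) \<partial>lborel)
     = ennreal (1 / t\<^sup>2) * I"
  proof -
    have "I = ennreal (t\<^sup>2) * (\<integral>\<^sup>+w. ennreal (exp (p * K (c + of_real t * w))) * indicator (cball c (2 * t)) (c + of_real t * w) \<partial>lborel)"
      unfolding I_def using nn_integral_complex_affine[of "of_real t" "\<lambda>z. ennreal (exp (p * K z)) * indicator (cball c (2 * t)) z" c] t by simp
    then show ?thesis using t by (simp add: field_simps flip: mult.assoc ennreal_mult)
  qed
  also have "ennreal (1 / p) * (ennreal (exp (- b)) * (ennreal (1 / t\<^sup>2) * I) + ennreal b * emeasure lborel A)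
     \<le> ennreal (1 / p) * (ennreal (exp (- b)) * (ennreal (1 / t\<^sup>2) * ennreal (C0 * (2 * t) powr d)) + ennreal b * ennreal (3 * pi))"
    unfolding eA I_def using t by (intro mult_left_mono add_mono mass order_refl) auto
  also have "\<dots> = ennreal (1 / p * (exp (- b) * (1 / t\<^sup>2 * (C0 * (2 * t) powr d)) + b * (3 * pi)))"
    using b p C0 by (simp flip: ennreal_mult ennreal_plus)
  also have "\<dots> \<le> ennreal (1 / p * (4 * C0 + 3 * pi * ((2 - d) * s)))"
  proof (intro ennreal_leI mult_left_mono add_mono)
    have "t powr d = exp (- (s * d))" by (simp add: t_def powr_def)
    moreover have "1 / t\<^sup>2 = exp (2 * s)" by (simp add: t_def exp_minus power2_eq_square field_simps flip: exp_add)
    ultimately have "exp (- b) * (1 / t\<^sup>2 * (C0 * (2 * t) powr d)) = C0 * 2 powr d * (exp (- b) * exp (2 * s) * exp (- (s * d)))"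
      using t by (simp add: powr_mult)
    also have "exp (- b) * exp (2 * s) * exp (- (s * d)) = 1"
      by (simp add: b_def algebra_simps flip: exp_add)
    also have "C0 * 2 powr d * 1 \<le> 4 * C0"
      using powr_mono[of d 2 2] d C0 by simp
    finally show "exp (- b) * (1 / t\<^sup>2 * (C0 * (2 * t) powr d)) \<le> 4 * C0" .
  qed (use p b_def in auto)
  finally show ?thesis unfolding t_def A_def .
qed

text \<open>The annulus \<open>{1..2}\<close> is swept inwards by the flow \<open>w \<mapsto> exp (- s) * w\<close>, so that each point is met for a time \<open>ln 2\<close>.\<close>

lemma ray_log_jac:
  assumes X: "0 \<le> X" and Y: "0 \<le> Y" and lb: "\<And>v. exp (- X) \<le> cmod v \<Longrightarrow> cmod v \<le> 3 \<Longrightarrow> exp (- Y) \<le> cmod (F v)"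
  shows "(\<integral>\<^sup>+s. (\<integral>\<^sup>+v. log_jac v * indicator {v. exp (- s) \<le> cmod (v - c) \<and> cmod (v - c) \<le> 2 * exp (- s)} v \<partial>lborel) * indicator {0..X} s \<partial>lborel)
    \<le> ennreal (2 * pi * (M0 + Y) + pi)"
proof -
  let ?S = "{p :: complex \<times> real. exp (- snd p) \<le> cmod (fst p - c) \<and> cmod (fst p - c) \<le> 2 * exp (- snd p)}"
  let ?U = "{z. exp (- X) \<le> cmod (z - c) \<and> cmod (z - c) \<le> 3}"
  have S: "?S \<in> sets (borel \<Otimes>\<^sub>M borel)"
    unfolding borel_prod by (intro borel_closed closed_Collect_conj closed_Collect_le continuous_intros)
  have Us: "{v. exp (- s) \<le> cmod (v - c) \<and> cmod (v - c) \<le> 2 * exp (- s)} \<in> sets borel" for s :: real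
    by (intro borel_closed closed_Collect_conj closed_Collect_le continuous_intros)
  have U: "?U \<in> sets borel"
    by (intro borel_closed closed_Collect_conj closed_Collect_le continuous_intros)
  have Sv: "{s. exp (- s) \<le> cmod (v - c) \<and> cmod (v - c) \<le> 2 * exp (- s)} \<in> sets borel" for v
    by (intro borel_closed closed_Collect_conj closed_Collect_le continuous_intros)
  have mp: "(\<lambda>p. log_jac (fst p) * indicator ?S p * indicator {0..X} (snd p)) \<in> borel_measurable (borel \<Otimes>\<^sub>M borel)"
    by (intro borel_measurable_times_ennreal borel_measurable_indicator S) measurable
  have "(\<integral>\<^sup>+s. (\<integral>\<^sup>+v. log_jac v * indicator {v. exp (- s) \<le> cmod (v - c) \<and> cmod (v - c) \<le> 2 * exp (- s)} v \<partial>lborel) * indicator {0..X} s \<partial>lborel)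
     = (\<integral>\<^sup>+s. \<integral>\<^sup>+v. log_jac v * indicator ?S (v, s) * indicator {0..X} s \<partial>lborel \<partial>lborel)"
    using Us by (intro nn_integral_cong, subst nn_integral_multc[symmetric]) (auto intro!: nn_integral_cong simp: indicator_def)
  also have "\<dots> = (\<integral>\<^sup>+v. \<integral>\<^sup>+s. log_jac v * indicator ?S (v, s) * indicator {0..X} s \<partial>lborel \<partial>lborel)"
  proof (rule lborel_pair.Fubini'[symmetric])
    from measurable_pair_swap[OF mp]
    show "(\<lambda>(s, v). log_jac v * indicator ?S (v, s) * indicator {0..X} s) \<in> borel_measurable (lborel \<Otimes>\<^sub>M lborel)"
      by (simp add: case_prod_beta cong: measurable_cong_sets)
  qed
  also have "\<dots> \<le> (\<integral>\<^sup>+v. log_jac v * indicator ?U v \<partial>lborel)"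
  proof (rule nn_integral_mono)
    fix v
    have "(\<integral>\<^sup>+s. log_jac v * indicator ?S (v, s) * indicator {0..X} s \<partial>lborel)
      \<le> (\<integral>\<^sup>+s. log_jac v * indicator ?U v * indicator {- ln (cmod (v - c)) .. ln 2 - ln (cmod (v - c))} s \<partial>lborel)"
    proof (rule nn_integral_mono)
      fix s
      show "log_jac v * indicator ?S (v, s) * indicator {0..X} s \<le> log_jac v * indicator ?U v * indicator {- ln (cmod (v - c)) .. ln 2 - ln (cmod (v - c))} s"
      proof (cases "(v, s) \<in> ?S \<and> s \<in> {0..X}")
        case True
        define a where "a = cmod (v - c)"
        have a: "exp (- s) \<le> a" "a \<le> 2 * exp (- s)" "0 \<le> s" "s \<le> X" using True by (auto simp: a_def)
        have a0: "0 < a" using a(1) exp_gt_zero[of "- s"] by linarith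
        have "exp (- X) \<le> exp (- s)" "exp (- s) \<le> 1" using a by auto
        then have "exp (- X) \<le> a" "a \<le> 3" using a(1,2) by linarith+
        then have "v \<in> ?U" unfolding a_def by simp
        moreover have "- s \<le> ln a" using a(1) a0 by (simp add: ln_ge_iff)
        moreover have "ln a \<le> ln 2 - s"
        proof -
          have "ln a \<le> ln (2 * exp (- s))" using a(2) a0 by simp
          then show ?thesis by (simp add: ln_mult)
        qed
        ultimately show ?thesis unfolding a_def[symmetric] by (auto simp: indicator_def)
      qed auto
    qed
    also have "\<dots> = log_jac v * indicator ?U v * ennreal (ln 2)"
      by (simp add: nn_integral_cmult_indicator)
    \<comment> \<open>Rounding \<open>ln 2\<close> up to 1 enlarges the final rate by a factor that
      \<open>modulus_constant_estimate\<close> can afford.\<close>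
    also have "\<dots> \<le> log_jac v * indicator ?U v * 1"
      using ln_2_less_1 by (intro mult_left_mono) (auto simp: ennreal_le_1)
    finally show "(\<integral>\<^sup>+s. log_jac v * indicator ?S (v, s) * indicator {0..X} s \<partial>lborel) \<le> log_jac v * indicator ?U v" by simp
  qed
  also have "\<dots> \<le> ennreal (2 * pi * (M0 + Y) + pi)"
    by (rule area_le[OF _ Y lb]) auto
  finally show ?thesis .
qed

text \<open>Twofold use: \<open>ray_rate X\<close> is the square of the coefficient of
  \<open>sqrt Y\<close> in \<open>ray_average\<close>, and, once the recursion is solved, the
  leading bound of the rotation. It is normalised so that
  \<open>P * Q = (3 * pi)\<^sup>2 * (ray_rate X * (Y + M0 + 1 / 2))\<close> for the \<open>P\<close>
  and \<open>Q\<close> of the next proof.\<close>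

definition ray_rate where "ray_rate X = 4 / 3 * ((2 - d) / p * X\<^sup>2 + 8 * C0 / (3 * pi * p) * X)"

text \<open>\<open>\<eta>\<close> balances the two terms of \<open>log_stretch_le\<close>, as in the Cauchy-Schwarz inequality.\<close>

lemma ray_average:
  assumes X: "0 < X" and Y: "0 \<le> Y" and lb: "\<And>v. exp (- X) \<le> cmod v \<Longrightarrow> cmod v \<le> 3 \<Longrightarrow> exp (- Y) \<le> cmod (F v)"
  shows "\<exists>w. 1 \<le> cmod w \<and> cmod w \<le> 2 \<and>
    (\<forall>h. continuous_on {0..X} h \<longrightarrow> (\<forall>s\<in>{0..X}. F (of_real (exp (- s)) * w) = exp (h s)) \<longrightarrow>
       cmod (h X - h 0) \<le> sqrt (ray_rate X * (Y + M0 + 1 / 2)) + 1)"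
proof -
  define A where "A = cball (0::complex) 2 - ball 0 1"
  have Am [measurable]: "A \<in> sets borel" unfolding A_def by auto
  have eA: "emeasure lborel A = ennreal (3 * pi)"
  proof -
    have "emeasure lborel A = emeasure lborel (cball (0::complex) 2) - emeasure lborel (ball (0::complex) 1)"
      unfolding A_def by (intro emeasure_Diff) (auto simp: emeasure_ball)
    also have "\<dots> = ennreal (3 * pi)"
      by (simp add: emeasure_cball_complex emeasure_ball unit_ball_vol_2 ennreal_minus)
    finally show ?thesis .
  qed
  \<comment> \<open>\<open>P\<close> is the bound of \<open>ray_K\<close> integrated over
    \<open>{0..X}\<close>. \<open>Q\<close> is the area bound of \<open>ray_log_jac\<close> times 4,
    the square of the largest modulus of \<open>w\<close>.\<close>
  define P where "P = 1 / p * (4 * C0 * X + 3 * pi * (2 - d) * X\<^sup>2 / 2)"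
  define Q where "Q = 4 * (2 * pi * (M0 + Y) + pi)"
  have P: "0 < P"
  proof -
    have "0 < 4 * C0 * X" "0 \<le> 3 * pi * (2 - d) * X\<^sup>2 / 2" using C0 X d by auto
    then have "0 < 4 * C0 * X + 3 * pi * (2 - d) * X\<^sup>2 / 2" by linarith
    then show ?thesis using p by (simp add: P_def)
  qed
  have Q: "0 < Q"
  proof -
    have "0 \<le> 2 * pi * (M0 + Y)" using M0(1) Y by simp
    then have "0 < 2 * pi * (M0 + Y) + pi" using pi_gt_zero by (rule add_nonneg_pos)
    then show ?thesis by (simp add: Q_def)
  qed
  define \<eta> where "\<eta> = sqrt Q / sqrt P"
  have \<eta>: "0 < \<eta>" using P Q by (simp add: \<eta>_def)
  define l where "l w = (\<integral>\<^sup>+s. log_stretch (c + exp (- 1 * complex_of_real s) * w) * ennreal (cmod (- 1 * exp (- 1 * complex_of_real s) * w)) * indicator {0..X} s \<partial>lborel)" for w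
  have "(\<integral>\<^sup>+w. l w * indicator A w \<partial>lborel)
      = (\<integral>\<^sup>+s. (\<integral>\<^sup>+w. log_stretch (c + exp (- 1 * complex_of_real s) * w) * ennreal (cmod (- 1 * exp (- 1 * complex_of_real s) * w)) * indicator A w \<partial>lborel)
              * indicator {0..X} s \<partial>lborel)"
    unfolding l_def using nn_integral_path_swap[of log_stretch A c "- 1" 0 X] by simp
  also have "\<dots> \<le> (\<integral>\<^sup>+s. ennreal (\<eta> / 2) * (ennreal (1 / p * (4 * C0 + 3 * pi * ((2 - d) * s))) * indicator {0..X} s)
       + ennreal (1 / (2 * \<eta>)) * (4 * ((\<integral>\<^sup>+v. log_jac v * indicator {v. exp (- s) \<le> cmod (v - c) \<and> cmod (v - c) \<le> 2 * exp (- s)} v \<partial>lborel) * indicator {0..X} s)) \<partial>lborel)"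
  proof (rule nn_integral_mono)
    fix s :: real
    let ?j = "(\<integral>\<^sup>+v. log_jac v * indicator {v. exp (- s) \<le> cmod (v - c) \<and> cmod (v - c) \<le> 2 * exp (- s)} v \<partial>lborel)"
    show "(\<integral>\<^sup>+w. log_stretch (c + exp (- 1 * complex_of_real s) * w) * ennreal (cmod (- 1 * exp (- 1 * complex_of_real s) * w)) * indicator A w \<partial>lborel) * indicator {0..X} s
      \<le> ennreal (\<eta> / 2) * (ennreal (1 / p * (4 * C0 + 3 * pi * ((2 - d) * s))) * indicator {0..X} s) + ennreal (1 / (2 * \<eta>)) * (4 * (?j * indicator {0..X} s))"
    proof (cases "s \<in> {0..X}")
      case True
      define t where "t = exp (- s)"
      have t: "0 < t" by (simp add: t_def)
      have e: "exp (- 1 * complex_of_real s) = of_real t" by (simp add: t_def flip: exp_of_real)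
      have pt: "log_stretch (c + of_real t * w) * ennreal (cmod (- 1 * of_real t * w)) * indicator A w
         \<le> ennreal (\<eta> / 2) * (ennreal (K (c + of_real t * w)) * indicator (cball 0 2 - ball 0 1) w)
          + ennreal (1 / (2 * \<eta>)) * (ennreal (4 * t\<^sup>2) * (log_jac (c + of_real t * w) * indicator {v. t \<le> cmod (v - c) \<and> cmod (v - c) \<le> 2 * t} (c + of_real t * w)))" for w
      proof (cases "w \<in> A")
        case wA: True
        define \<tau> where "\<tau> = t * cmod w"
        have w: "1 \<le> cmod w" "cmod w \<le> 2" using wA by (auto simp: A_def)
        have "0 < cmod w" using w by linarith
        then have \<tau>: "0 < \<tau>" "t \<le> \<tau>" "\<tau> \<le> 2 * t" using t w by (auto simp: \<tau>_def mult.commute[of _ t])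
        let ?z = "c + of_real t * w"
        have ring: "(a * k + b * j) * u = a * u * k + b * u * j" for a b k j u :: ennreal
          by (simp only: distrib_right mult.assoc mult.commute[of k u] mult.commute[of j u])
        \<comment> \<open>The weight is divided by the speed \<open>\<tau>\<close> of the ray, so
          that after multiplication by \<open>\<tau>\<close> the term with \<open>K\<close> no
          longer depends on the scale and the other one carries the Jacobian factor
          \<open>\<tau>\<^sup>2\<close>.\<close>
        have "log_stretch ?z * ennreal \<tau> \<le> (ennreal (\<eta> / \<tau> / 2) * ennreal (K ?z) + ennreal (1 / (2 * (\<eta> / \<tau>))) * log_jac ?z) * ennreal \<tau>"
          using \<eta> \<tau> by (intro mult_right_mono log_stretch_le) auto
        also have "\<dots> = ennreal (\<eta> / \<tau> / 2) * ennreal \<tau> * ennreal (K ?z) + ennreal (1 / (2 * (\<eta> / \<tau>))) * ennreal \<tau> * log_jac ?z"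
          by (rule ring)
        also have "ennreal (\<eta> / \<tau> / 2) * ennreal \<tau> = ennreal (\<eta> / 2)"
          using \<tau> \<eta> by (simp flip: ennreal_mult)
        also have "ennreal (1 / (2 * (\<eta> / \<tau>))) * ennreal \<tau> = ennreal (1 / (2 * \<eta>)) * ennreal (\<tau>\<^sup>2)"
          using \<tau> \<eta> by (simp add: power2_eq_square field_simps flip: ennreal_mult)
        also have "ennreal (\<eta> / 2) * ennreal (K ?z) + ennreal (1 / (2 * \<eta>)) * ennreal (\<tau>\<^sup>2) * log_jac ?z
           \<le> ennreal (\<eta> / 2) * ennreal (K ?z) + ennreal (1 / (2 * \<eta>)) * ennreal (4 * t\<^sup>2) * log_jac ?z"
        proof (intro add_left_mono mult_right_mono mult_left_mono ennreal_leI)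
          have "\<tau>\<^sup>2 \<le> (2 * t)\<^sup>2" using \<tau> by (intro power_mono) auto
          then show "\<tau>\<^sup>2 \<le> 4 * t\<^sup>2" by (simp add: power_mult_distrib)
        qed auto
        finally have "log_stretch ?z * ennreal \<tau> \<le> ennreal (\<eta> / 2) * ennreal (K ?z) + ennreal (1 / (2 * \<eta>)) * (ennreal (4 * t\<^sup>2) * log_jac ?z)"
          by (simp add: mult.assoc)
        moreover have "cmod (- 1 * of_real t * w) = \<tau>" using t by (simp add: \<tau>_def norm_mult)
        moreover have "?z \<in> {v. t \<le> cmod (v - c) \<and> cmod (v - c) \<le> 2 * t}" using \<tau> t by (simp add: \<tau>_def norm_mult)
        moreover have "w \<in> cball 0 2 - ball 0 1" using wA by (simp add: A_def)
        ultimately show ?thesis using wA by simp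
      qed simp
      have Us [measurable]: "{v. t \<le> cmod (v - c) \<and> cmod (v - c) \<le> 2 * t} \<in> sets borel"
        by (intro borel_closed closed_Collect_conj closed_Collect_le continuous_intros)
      have [measurable]: "cball (0::complex) 2 - ball 0 1 \<in> sets borel" by auto
      have jw [measurable]: "(\<lambda>z. log_jac z * indicator {v. t \<le> cmod (v - c) \<and> cmod (v - c) \<le> 2 * t} z) \<in> borel_measurable borel"
        by measurable
      have aff: "(\<lambda>w. c + complex_of_real t * w) \<in> borel_measurable borel" by measurable
      have jw2 [measurable]: "(\<lambda>w. log_jac (c + of_real t * w) * indicator {v. t \<le> cmod (v - c) \<and> cmod (v - c) \<le> 2 * t} (c + of_real t * w)) \<in> borel_measurable borel"
        using measurable_compose[OF aff jw] by simp
      have kk [measurable]: "(\<lambda>w. ennreal (K (c + of_real t * w)) * indicator (cball 0 2 - ball 0 1) w) \<in> borel_measurable borel"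
        unfolding A_def[symmetric] by measurable
      have "(\<integral>\<^sup>+w. log_stretch (c + of_real t * w) * ennreal (cmod (- 1 * of_real t * w)) * indicator A w \<partial>lborel)
        \<le> (\<integral>\<^sup>+w. ennreal (\<eta> / 2) * (ennreal (K (c + of_real t * w)) * indicator (cball 0 2 - ball 0 1) w)
          + ennreal (1 / (2 * \<eta>)) * (ennreal (4 * t\<^sup>2) * (log_jac (c + of_real t * w) * indicator {v. t \<le> cmod (v - c) \<and> cmod (v - c) \<le> 2 * t} (c + of_real t * w))) \<partial>lborel)"
        by (intro nn_integral_mono pt)
      also have "\<dots> = ennreal (\<eta> / 2) * (\<integral>\<^sup>+w. ennreal (K (c + of_real t * w)) * indicator (cball 0 2 - ball 0 1) w \<partial>lborel)
          + ennreal (1 / (2 * \<eta>)) * (ennreal (4 * t\<^sup>2) * (\<integral>\<^sup>+w. log_jac (c + of_real t * w) * indicator {v. t \<le> cmod (v - c) \<and> cmod (v - c) \<le> 2 * t} (c + of_real t * w) \<partial>lborel))"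
        using jw2 kk by (simp add: nn_integral_add nn_integral_cmult)
      also have "ennreal (4 * t\<^sup>2) * (\<integral>\<^sup>+w. log_jac (c + of_real t * w) * indicator {v. t \<le> cmod (v - c) \<and> cmod (v - c) \<le> 2 * t} (c + of_real t * w) \<partial>lborel) = 4 * ?j"
      proof -
        have "?j = ennreal (t\<^sup>2) * (\<integral>\<^sup>+w. log_jac (c + of_real t * w) * indicator {v. t \<le> cmod (v - c) \<and> cmod (v - c) \<le> 2 * t} (c + of_real t * w) \<partial>lborel)"
          using nn_integral_complex_affine[of "of_real t", OF _ jw, of c] t unfolding t_def[symmetric] by simp
        then show ?thesis by (simp add: ennreal_mult mult.assoc)
      qed
      also have "ennreal (\<eta> / 2) * (\<integral>\<^sup>+w. ennreal (K (c + of_real t * w)) * indicator (cball 0 2 - ball 0 1) w \<partial>lborel) + ennreal (1 / (2 * \<eta>)) * (4 * ?j)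
        \<le> ennreal (\<eta> / 2) * ennreal (1 / p * (4 * C0 + 3 * pi * ((2 - d) * s))) + ennreal (1 / (2 * \<eta>)) * (4 * ?j)"
        unfolding t_def using True by (intro add_right_mono mult_left_mono ray_K) auto
      finally show ?thesis unfolding e using True by simp
    qed simp
  qed
  also have "\<dots> = ennreal (\<eta> / 2) * (\<integral>\<^sup>+s. ennreal (1 / p * (4 * C0 + 3 * pi * ((2 - d) * s))) * indicator {0..X} s \<partial>lborel)
     + ennreal (1 / (2 * \<eta>)) * (4 * (\<integral>\<^sup>+s. (\<integral>\<^sup>+v. log_jac v * indicator {v. exp (- s) \<le> cmod (v - c) \<and> cmod (v - c) \<le> 2 * exp (- s)} v \<partial>lborel) * indicator {0..X} s \<partial>lborel))"
  proof -
    let ?S = "{p :: real \<times> complex. exp (- fst p) \<le> cmod (snd p - c) \<and> cmod (snd p - c) \<le> 2 * exp (- fst p)}"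
    have S: "?S \<in> sets (borel \<Otimes>\<^sub>M borel)"
      unfolding borel_prod by (intro borel_closed closed_Collect_conj closed_Collect_le continuous_intros)
    have "(\<lambda>p. log_jac (snd p) * indicator ?S p) \<in> borel_measurable (borel \<Otimes>\<^sub>M borel)"
      by (intro borel_measurable_times_ennreal borel_measurable_indicator S) measurable
    then have "(\<lambda>s. \<integral>\<^sup>+v. log_jac v * indicator ?S (s, v) \<partial>lborel) \<in> borel_measurable borel"
      by (intro sigma_finite_measure.borel_measurable_nn_integral[OF sigma_finite_lborel])
         (simp add: case_prod_beta measurable_lborel1 cong: measurable_cong_sets)
    also have "(\<lambda>s. \<integral>\<^sup>+v. log_jac v * indicator ?S (s, v) \<partial>lborel) = (\<lambda>s. \<integral>\<^sup>+v. log_jac v * indicator {v. exp (- s) \<le> cmod (v - c) \<and> cmod (v - c) \<le> 2 * exp (- s)} v \<partial>lborel)"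
      by (auto simp: fun_eq_iff indicator_def intro!: nn_integral_cong)
    finally have "(\<lambda>s. (\<integral>\<^sup>+v. log_jac v * indicator {v. exp (- s) \<le> cmod (v - c) \<and> cmod (v - c) \<le> 2 * exp (- s)} v \<partial>lborel) * indicator {0..X} s) \<in> borel_measurable borel"
      by (intro borel_measurable_times_ennreal) auto
    then show ?thesis by (simp add: nn_integral_add nn_integral_cmult)
  qed
  also have "\<dots> \<le> ennreal (\<eta> / 2) * ennreal P + ennreal (1 / (2 * \<eta>)) * ennreal Q"
  proof (intro add_mono mult_left_mono)
    have "(\<integral>\<^sup>+s. ennreal (1 / p * (4 * C0 + 3 * pi * ((2 - d) * s))) * indicator {0..X} s \<partial>lborel)
       = ennreal (1 / p * (4 * C0 * X + 3 * pi * (2 - d) * X\<^sup>2 / 2) - 1 / p * (4 * C0 * 0 + 3 * pi * (2 - d) * 0\<^sup>2 / 2))"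
    proof (rule nn_integral_FTC_Icc[where F = "\<lambda>x. 1 / p * (4 * C0 * x + 3 * pi * (2 - d) * x\<^sup>2 / 2)"])
      fix x :: real assume x: "x \<in> {0..X}"
      show "((\<lambda>x. 1 / p * (4 * C0 * x + 3 * pi * (2 - d) * x\<^sup>2 / 2)) has_real_derivative 1 / p * (4 * C0 + 3 * pi * ((2 - d) * x))) (at x)"
        using p by (auto intro!: derivative_eq_intros simp: field_simps)
      show "0 \<le> 1 / p * (4 * C0 + 3 * pi * ((2 - d) * x))" using p C0 d x by simp
    qed (use X in auto)
    then show "(\<integral>\<^sup>+s. ennreal (1 / p * (4 * C0 + 3 * pi * ((2 - d) * s))) * indicator {0..X} s \<partial>lborel) \<le> ennreal P"
      by (simp add: P_def)
    have "4 * (\<integral>\<^sup>+s. (\<integral>\<^sup>+v. log_jac v * indicator {v. exp (- s) \<le> cmod (v - c) \<and> cmod (v - c) \<le> 2 * exp (- s)} v \<partial>lborel) * indicator {0..X} s \<partial>lborel)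
      \<le> 4 * ennreal (2 * pi * (M0 + Y) + pi)"
      using X Y lb by (intro mult_left_mono ray_log_jac) auto
    also have "\<dots> = ennreal Q"
      unfolding Q_def using M0(1) Y by (subst ennreal_mult) auto
    finally show "4 * (\<integral>\<^sup>+s. (\<integral>\<^sup>+v. log_jac v * indicator {v. exp (- s) \<le> cmod (v - c) \<and> cmod (v - c) \<le> 2 * exp (- s)} v \<partial>lborel) * indicator {0..X} s \<partial>lborel) \<le> ennreal Q" .
  qed auto
  also have "\<dots> = ennreal (\<eta> / 2 * P + 1 / (2 * \<eta>) * Q)"
    using \<eta> P Q by (simp flip: ennreal_mult ennreal_plus)
  also have "\<eta> / 2 * P + 1 / (2 * \<eta>) * Q = sqrt P * sqrt Q"
  proof -
    define a b where "a = sqrt P" and "b = sqrt Q"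
    have ab: "0 < a" "0 < b" "P = a\<^sup>2" "Q = b\<^sup>2" using P Q by (auto simp: a_def b_def)
    show ?thesis unfolding \<eta>_def a_def[symmetric] b_def[symmetric] unfolding ab(3,4) using ab(1,2)
      by (simp add: field_simps power2_eq_square)
  qed
  also have "sqrt P * sqrt Q = 3 * pi * sqrt (ray_rate X * (Y + M0 + 1 / 2))"
  proof -
    have "P * Q = (3 * pi)\<^sup>2 * (ray_rate X * (Y + M0 + 1 / 2))"
      using p by (simp add: P_def Q_def ray_rate_def field_simps power2_eq_square)
    then have "sqrt (P * Q) = sqrt ((3 * pi)\<^sup>2) * sqrt (ray_rate X * (Y + M0 + 1 / 2))" by (simp only: real_sqrt_mult)
    then show ?thesis by (simp add: real_sqrt_mult)
  qed
  also have "ennreal (3 * pi * sqrt (ray_rate X * (Y + M0 + 1 / 2))) < ennreal ((sqrt (ray_rate X * (Y + M0 + 1 / 2)) + 1) * (3 * pi))"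
  proof (rule ennreal_lessI)
    have "0 \<le> ray_rate X * (Y + M0 + 1 / 2)" using d p C0 X Y M0(1) by (simp add: ray_rate_def)
    then have q: "0 \<le> sqrt (ray_rate X * (Y + M0 + 1 / 2))" by simp
    then show "0 < (sqrt (ray_rate X * (Y + M0 + 1 / 2)) + 1) * (3 * pi)" by (intro mult_pos_pos add_nonneg_pos) auto
    show "3 * pi * sqrt (ray_rate X * (Y + M0 + 1 / 2)) < (sqrt (ray_rate X * (Y + M0 + 1 / 2)) + 1) * (3 * pi)"
      by (simp add: distrib_right)
  qed
  also have "\<dots> = ennreal (sqrt (ray_rate X * (Y + M0 + 1 / 2)) + 1) * emeasure lborel A"
  proof -
    have "0 \<le> ray_rate X * (Y + M0 + 1 / 2)" using d p C0 X Y M0(1) by (simp add: ray_rate_def)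
    then show ?thesis unfolding eA by (intro ennreal_mult) auto
  qed
  finally have lt: "(\<integral>\<^sup>+w. l w * indicator A w \<partial>lborel) < ennreal (sqrt (ray_rate X * (Y + M0 + 1 / 2)) + 1) * emeasure lborel A" .
  have "A \<in> sets lborel" by simp
  from exists_below_average[OF this path_log[of X c "- 1"] lt] X
  obtain w where w: "w \<in> A" "l w < ennreal (sqrt (ray_rate X * (Y + M0 + 1 / 2)) + 1)"
    and pl: "\<And>s1 s2 h. 0 \<le> s1 \<Longrightarrow> s1 \<le> s2 \<Longrightarrow> s2 \<le> X \<Longrightarrow> continuous_on {s1..s2} h \<Longrightarrow>
     (\<forall>s\<in>{s1..s2}. f (c + exp (- 1 * complex_of_real s) * w) - f c = exp (h s)) \<Longrightarrow>
     ennreal (cmod (h s2 - h s1)) \<le>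
       (\<integral>\<^sup>+s. log_stretch (c + exp (- 1 * complex_of_real s) * w) * ennreal (cmod (- 1 * exp (- 1 * complex_of_real s) * w)) * indicator {s1..s2} s \<partial>lborel)"
    by auto
  have e: "exp (- 1 * complex_of_real s) = of_real (exp (- s))" for s by (simp flip: exp_of_real)
  show ?thesis
  proof (intro exI[of _ w] conjI allI impI)
    show "1 \<le> cmod w" "cmod w \<le> 2" using w(1) by (auto simp: A_def)
    fix h :: "real \<Rightarrow> complex"
    assume h: "continuous_on {0..X} h" "\<forall>s\<in>{0..X}. F (of_real (exp (- s)) * w) = exp (h s)"
    have "ennreal (cmod (h X - h 0)) \<le> l w"
      unfolding l_def using X h by (intro pl) (auto simp only: e)
    also have "\<dots> < ennreal (sqrt (ray_rate X * (Y + M0 + 1 / 2)) + 1)" by (rule w(2))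
    finally show "cmod (h X - h 0) \<le> sqrt (ray_rate X * (Y + M0 + 1 / 2)) + 1"
      by (subst (asm) ennreal_less_iff) auto
  qed
qed

end

section \<open>The prescribed branch of the argument\<close>

lemma rcis_polar:
  fixes v :: complex
  obtains \<theta> where "0 \<le> \<theta>" "\<theta> < 2 * pi" "v = rcis (cmod v) \<theta>"
  using Arg2pi[of v] that[of "Arg2pi v"] by (auto simp: is_Arg_def rcis_def cis_conv_exp)

text \<open>If \<open>sqrt y\<close> exceeded \<open>S + sqrt E\<close>, both factors of
  \<open>(sqrt y - S) * sqrt y\<close> would be too large for the product to be at most
  \<open>E\<close>.\<close>

lemma le_sqrt_recursion:
  fixes y S E :: real
  assumes "0 \<le> y" "0 \<le> S" "0 \<le> E" "y \<le> S * sqrt y + E"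
  shows "sqrt y \<le> S + sqrt E"
proof (rule ccontr)
  assume "\<not> ?thesis"
  then have gt: "S + sqrt E < sqrt y" by simp
  have "0 \<le> sqrt E" "0 \<le> sqrt y" using assms by auto
  then have "sqrt E \<le> sqrt y - S" "sqrt E \<le> sqrt y" "0 \<le> sqrt y - S" using gt assms(2) by linarith+
  then have "sqrt E * sqrt E \<le> (sqrt y - S) * sqrt y"
    using \<open>0 \<le> sqrt E\<close> by (intro mult_mono)
  moreover have "(sqrt y - S) * sqrt y \<le> E" using assms by (simp add: algebra_simps)
  ultimately have eq: "(sqrt y - S) * sqrt y = E" using assms(3) by simp
  have "sqrt E < sqrt y - S" "0 < sqrt y" using gt assms real_sqrt_ge_zero[OF assms(3)] by linarith+
  moreover have "sqrt E \<le> sqrt y" using gt assms(2) by linarith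
  ultimately have "sqrt E * sqrt y < (sqrt y - S) * sqrt y" by simp
  moreover have "sqrt E * sqrt E \<le> sqrt E * sqrt y" using \<open>sqrt E \<le> sqrt y\<close> assms(3) by (intro mult_left_mono) auto
  ultimately show False using eq assms(3) by simp
qed

locale rotation_branch = rotation_point +
  fixes \<alpha> :: "complex \<Rightarrow> complex \<Rightarrow> real"
  assumes branch: "arg_branch f \<alpha>"
begin

text \<open>The logarithm of \<open>F\<close> whose imaginary part is the given branch. It may jump
  across the positive real axis, so all curves below keep their angle in the range from 0 to
  \<open>2 * pi\<close>.\<close>

definition H :: "complex \<Rightarrow> complex" where
  "H v = Complex (ln (cmod (F v))) (\<alpha> c v)"

lemma F_nonzero: "v \<noteq> 0 \<Longrightarrow> F v \<noteq> 0"
  using inj[of "c + v" c] by simp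

lemma exp_H:
  assumes "v \<noteq> 0" shows "F v = exp (H v)"
proof -
  have "F v = rcis (cmod (F v)) (\<alpha> c v)" using branch assms unfolding arg_branch_def by blast
  moreover have "exp (H v) = rcis (cmod (F v)) (\<alpha> c v)"
    using F_nonzero[OF assms] by (simp add: H_def exp_eq_polar rcis_def)
  ultimately show ?thesis by simp
qed

lemma continuous_H:
  assumes \<theta>: "continuous_on T t" "continuous_on T \<theta>" "\<And>s. s \<in> T \<Longrightarrow> 0 < t s" "\<And>s. s \<in> T \<Longrightarrow> 0 \<le> \<theta> s \<and> \<theta> s < 2 * pi"
  shows "continuous_on T (\<lambda>s. H (rcis (t s) (\<theta> s)))"
proof -
  have "continuous_on ({0<..} \<times> {0..<2 * pi}) (\<lambda>(t, \<theta>). \<alpha> c (rcis t \<theta>))" using branch by (auto simp: arg_branch_def)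
  then have "continuous_on T (\<lambda>s. (\<lambda>(t, \<theta>). \<alpha> c (rcis t \<theta>)) (t s, \<theta> s))"
    by (rule continuous_on_compose2) (use \<theta> in \<open>auto intro!: continuous_intros\<close>)
  then have 1: "continuous_on T (\<lambda>s. \<alpha> c (rcis (t s) (\<theta> s)))" by simp
  have r: "continuous_on T (\<lambda>s. rcis (t s) (\<theta> s))"
    unfolding rcis_def cis_conv_exp by (intro continuous_intros \<theta>)
  have "rcis (t s) (\<theta> s) \<noteq> 0" if "s \<in> T" for s using \<theta>(3)[OF that] by (simp add: rcis_def)
  then have nz: "F (rcis (t s) (\<theta> s)) \<noteq> 0" if "s \<in> T" for s using that F_nonzero by blast
  have 2: "continuous_on T (\<lambda>s. ln (cmod (F (rcis (t s) (\<theta> s)))))"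
    by (intro continuous_on_ln continuous_on_norm continuous_on_compose2[OF contF r subset_UNIV]) (use nz in auto)
  show ?thesis unfolding H_def Complex_eq
    by (intro continuous_on_add continuous_on_mult continuous_on_of_real continuous_on_const 1 2)
qed

lemma \<Omega>_nonneg: "0 \<le> X \<Longrightarrow> 0 \<le> \<Omega> X"
  using constants_pos by (simp add: \<Omega>_def)

text \<open>\<open>H\<close> need not be continuous on the disc, but its increment along the curve
  equals that of a genuine logarithm of \<open>F\<close> on the disc, to which
  \<open>oscillation\<close> applies.\<close>

lemma H_short:
  fixes a b :: real
  assumes X: "0 \<le> X" and r: "r = exp (- X)" and ab: "a \<le> b"
    and k: "continuous_on {a..b} (\<lambda>s. H (\<psi> s))" and \<psi>: "continuous_on {a..b} \<psi>"
    and bd: "\<And>s. s \<in> {a..b} \<Longrightarrow> r \<le> cmod (\<psi> s) \<and> cmod (\<psi> s) \<le> 2 * r \<and> dist (\<psi> a) (\<psi> s) \<le> r / 4"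
  shows "cmod (H (\<psi> b) - H (\<psi> a)) \<le> \<Omega> X"
proof -
  have r0: "0 < r" using r by simp
  let ?B = "cball (\<psi> a) (r / 2)"
  have aa: "a \<in> {a..b}" using ab by simp
  have a: "r \<le> cmod (\<psi> a)" "cmod (\<psi> a) \<le> 2 * r" using bd[OF aa] by auto
  have nz: "F v \<noteq> 0" if "v \<in> ?B" for v
  proof (rule F_nonzero)
    show "v \<noteq> 0" using that a r0 by (auto simp: dist_norm)
  qed
  obtain h where h: "continuous_on ?B h" "\<And>v. v \<in> ?B \<Longrightarrow> F v = exp (h v)"
    using continuous_logarithm_on_cball[OF contF nz] by blast
  have in1: "\<psi> s \<in> cball (\<psi> a) (r / 4)" if "s \<in> {a..b}" for s using bd[OF that] by simp
  then have in2: "\<psi> s \<in> ?B" if "s \<in> {a..b}" for s using that r0 by fastforce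
  have "H (\<psi> b) - H (\<psi> a) = h (\<psi> b) - h (\<psi> a)"
  proof (rule lift_difference[OF k _ _ ab])
    show "continuous_on {a..b} (\<lambda>s. h (\<psi> s))"
      by (rule continuous_on_compose2[OF h(1) \<psi>]) (use in2 in auto)
    show "exp (H (\<psi> s)) = exp (h (\<psi> s))" if "s \<in> {a..b}" for s
    proof -
      have "\<psi> s \<noteq> 0" using bd[OF that] r0 by auto
      then show ?thesis using exp_H h(2)[OF in2[OF that]] by metis
    qed
  qed
  also have "cmod \<dots> \<le> \<Omega> X"
    using in1[of a] in1[of b] ab by (intro oscillation[OF X r a h]) auto
  finally show ?thesis .
qed

lemma rcis_dist_angle: "0 \<le> t \<Longrightarrow> dist (rcis t a) (rcis t b) \<le> t * \<bar>a - b\<bar>"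
proof -
  assume t: "0 \<le> t"
  have "dist (rcis t a) (rcis t b) = t * cmod (cis a - cis b)"
    using t by (simp add: dist_norm rcis_def norm_mult flip: right_diff_distrib)
  also have "cmod (cis a - cis b) \<le> \<bar>a - b\<bar>"
  proof -
    have "norm (exp (\<i> * complex_of_real a) - exp (\<i> * complex_of_real b)) \<le> 1 * norm (a - b)"
    proof (rule differentiable_bound[of UNIV "\<lambda>t. exp (\<i> * complex_of_real t)" "\<lambda>x h. h *\<^sub>R (\<i> * exp (\<i> * complex_of_real x))"])
      fix x :: real
      have "((\<lambda>t. exp (\<i> * complex_of_real t)) has_vector_derivative \<i> * exp (\<i> * complex_of_real x)) (at x within UNIV)"
        by (rule has_vector_derivative_real_field) (auto intro!: derivative_eq_intros)
      then show "((\<lambda>t. exp (\<i> * complex_of_real t)) has_derivative (\<lambda>h. h *\<^sub>R (\<i> * exp (\<i> * complex_of_real x)))) (at x within UNIV)"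
        by (simp only: has_vector_derivative_def)
      show "onorm (\<lambda>h::real. h *\<^sub>R (\<i> * exp (\<i> * complex_of_real x))) \<le> 1"
        by (rule onorm_le) (simp add: norm_mult)
    qed auto
    then show ?thesis by (simp add: cis_conv_exp)
  qed
  finally show ?thesis using t by (simp add: mult_left_mono)
qed

text \<open>The points are joined by an arc of the circle through \<open>v\<close> and then a radial
  segment, with no crossing of the positive real axis. As \<open>2 * pi\<close> is at most 7, 112
  angular steps of \<open>1 / 16\<close> suffice; 8 radial steps of \<open>r / 8\<close> bring the
  total to 120. Each step stays within \<open>r / 4\<close> of its start.\<close>

lemma H_annulus:
  assumes X: "0 \<le> X" and r: "r = exp (- X)"
    and v: "r \<le> cmod v" "cmod v \<le> 2 * r" and v': "r \<le> cmod v'" "cmod v' \<le> 2 * r"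
  shows "cmod (H v - H v') \<le> 120 * \<Omega> X"
proof -
  have r0: "0 < r" using r by simp
  obtain \<theta> where \<theta>: "0 \<le> \<theta>" "\<theta> < 2 * pi" "v = rcis (cmod v) \<theta>" by (rule rcis_polar)
  obtain \<theta>' where \<theta>': "0 \<le> \<theta>'" "\<theta>' < 2 * pi" "v' = rcis (cmod v') \<theta>'" by (rule rcis_polar)
  have angle: "cmod (H (rcis t y) - H (rcis t x)) \<le> real 112 * \<Omega> X"
    if "r \<le> t" "t \<le> 2 * r" "0 \<le> x" "x \<le> y" "y < 2 * pi" for t x y
  proof (rule chain_bound[where \<delta> = "1/16"])
    fix s s' assume s: "x \<le> s" "s \<le> s'" "s' \<le> y" "s' - s \<le> 1/16"
    show "cmod (H (rcis t s') - H (rcis t s)) \<le> \<Omega> X"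
    proof (rule H_short[OF X r s(2), of "\<lambda>\<tau>. rcis t \<tau>"])
      show "continuous_on {s..s'} (\<lambda>\<tau>. H (rcis t \<tau>))"
        using that s r0 by (intro continuous_H) (auto intro!: continuous_intros)
      show "continuous_on {s..s'} (\<lambda>\<tau>. rcis t \<tau>)"
        unfolding rcis_def cis_conv_exp by (intro continuous_intros)
      fix \<tau> assume \<tau>: "\<tau> \<in> {s..s'}"
      have "dist (rcis t s) (rcis t \<tau>) \<le> t * \<bar>s - \<tau>\<bar>" using that r0 by (intro rcis_dist_angle) auto
      also have "\<dots> \<le> (2 * r) * (1/16)" using that r0 \<tau> s by (intro mult_mono) auto
      finally show "r \<le> cmod (rcis t \<tau>) \<and> cmod (rcis t \<tau>) \<le> 2 * r \<and> dist (rcis t s) (rcis t \<tau>) \<le> r / 4"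
        using that r0 by auto
    qed
  next
    have "y - x \<le> 2 * pi" using that by simp
    also have "\<dots> \<le> 2 * 3.5" using pi_approx by simp
    finally show "y - x \<le> real 112 * (1/16)" by simp
  qed (use that \<Omega>_nonneg[OF X] in auto)
  have radial: "cmod (H (rcis y \<theta>') - H (rcis x \<theta>')) \<le> real 8 * \<Omega> X"
    if "r \<le> x" "x \<le> y" "y \<le> 2 * r" for x y
  proof (rule chain_bound[where \<delta> = "r/8"])
    fix s s' assume s: "x \<le> s" "s \<le> s'" "s' \<le> y" "s' - s \<le> r/8"
    show "cmod (H (rcis s' \<theta>') - H (rcis s \<theta>')) \<le> \<Omega> X"
    proof (rule H_short[OF X r s(2), of "\<lambda>\<tau>. rcis \<tau> \<theta>'"])
      show "continuous_on {s..s'} (\<lambda>\<tau>. H (rcis \<tau> \<theta>'))"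
        using that s r0 \<theta>' by (intro continuous_H) (auto intro!: continuous_intros)
      show "continuous_on {s..s'} (\<lambda>\<tau>. rcis \<tau> \<theta>')"
        unfolding rcis_def by (intro continuous_intros)
      fix \<tau> assume \<tau>: "\<tau> \<in> {s..s'}"
      have "dist (rcis s \<theta>') (rcis \<tau> \<theta>') = \<bar>s - \<tau>\<bar>"
        by (simp add: dist_norm rcis_def norm_mult flip: left_diff_distrib of_real_diff)
      also have "\<dots> \<le> r / 8" using \<tau> s by auto
      finally show "r \<le> cmod (rcis \<tau> \<theta>') \<and> cmod (rcis \<tau> \<theta>') \<le> 2 * r \<and> dist (rcis s \<theta>') (rcis \<tau> \<theta>') \<le> r / 4"
        using that r0 s \<tau> by auto
    qed
  qed (use that \<Omega>_nonneg[OF X] r0 in auto)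
  have 1: "cmod (H v - H (rcis (cmod v) \<theta>')) \<le> 112 * \<Omega> X"
    using angle[of "cmod v" \<theta> \<theta>'] angle[of "cmod v" \<theta>' \<theta>] \<theta> \<theta>' v
    by (cases "\<theta> \<le> \<theta>'") (auto simp: norm_minus_commute)
  have 2: "cmod (H (rcis (cmod v) \<theta>') - H v') \<le> 8 * \<Omega> X"
    using radial[of "cmod v" "cmod v'"] radial[of "cmod v'" "cmod v"] \<theta>'(3) v v'
    by (cases "cmod v \<le> cmod v'") (auto simp: norm_minus_commute)
  show ?thesis
    using norm_triangle_ineq[of "H v - H (rcis (cmod v) \<theta>')" "H (rcis (cmod v) \<theta>') - H v'"] 1 2 by simp
qed

text \<open>Collects everything of lower order: two passages across annuli
  (\<open>240 * C1\<close>), the initial value \<open>H 1\<close>, the strictness slack of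
  \<open>ray_average\<close>, and the constants that turn \<open>Y\<close> into \<open>y\<close> in
  \<open>rotation_bound\<close>.\<close>

definition err_const where "err_const = 2 + 240 * C1 + cmod (H 1) + M0 + B0"

lemma err_const_ge_1: "1 \<le> err_const"
  using constants_pos M0 B0 by (simp add: err_const_def)

lemma ray_rate_nonneg: "0 \<le> X \<Longrightarrow> 0 \<le> ray_rate X"
  using d p C0 by (simp add: ray_rate_def)

lemma ray_rate_mono: "0 \<le> X \<Longrightarrow> X \<le> X' \<Longrightarrow> ray_rate X \<le> ray_rate X'"
  unfolding ray_rate_def using d p C0 by (intro mult_left_mono add_mono power_mono) auto

text \<open>From \<open>v\<close> one crosses its annulus to the end of the good ray, follows the
  ray to its start at modulus between 1 and 2, and crosses to the base point 1. \<open>Y\<close>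
  belongs to the larger scale \<open>X\<close>, so the right side is the same for all
  \<open>X'\<close> up to \<open>X\<close>.\<close>

lemma H_bound:
  assumes X: "0 < X'" "X' \<le> X" and Y: "0 \<le> Y" and lb: "\<And>v. exp (- X) \<le> cmod v \<Longrightarrow> cmod v \<le> 3 \<Longrightarrow> exp (- Y) \<le> cmod (F v)"
    and v: "cmod v = exp (- X')"
  shows "cmod (H v) \<le> sqrt (ray_rate X) * sqrt (Y + M0 + 1 / 2) + (1 + 240 * C1 + cmod (H 1)) * ((X + 1) * sqrt (X + 1))"
proof -
  have "exp (- Y) \<le> cmod (F v)" if "exp (- X') \<le> cmod v" "cmod v \<le> 3" for v
  proof (rule lb[OF _ that(2)])
    show "exp (- X) \<le> cmod v" using X by (intro order_trans[OF _ that(1)]) auto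
  qed
  from ray_average[OF X(1) Y this] obtain w where w: "1 \<le> cmod w" "cmod w \<le> 2"
    and ray: "\<And>h. continuous_on {0..X'} h \<Longrightarrow> (\<forall>s\<in>{0..X'}. F (of_real (exp (- s)) * w) = exp (h s)) \<Longrightarrow>
       cmod (h X' - h 0) \<le> sqrt (ray_rate X' * (Y + M0 + 1 / 2)) + 1" by blast
  obtain \<theta> where \<theta>: "0 \<le> \<theta>" "\<theta> < 2 * pi" "w = rcis (cmod w) \<theta>" by (rule rcis_polar)
  have w0: "w \<noteq> 0" "0 < cmod w" using w by auto
  define h where "h s = H (of_real (exp (- s)) * w)" for s
  have hw: "of_real (exp (- s)) * w = rcis (exp (- s) * cmod w) \<theta>" for s
    by (subst \<theta>(3)) (simp add: rcis_def)
  have R: "cmod (h X' - h 0) \<le> sqrt (ray_rate X' * (Y + M0 + 1 / 2)) + 1"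
  proof (rule ray)
    show "continuous_on {0..X'} h"
      unfolding h_def hw using \<theta> w0 by (intro continuous_H) (auto intro!: continuous_intros)
    show "\<forall>s\<in>{0..X'}. F (of_real (exp (- s)) * w) = exp (h s)"
      unfolding h_def using w0 by (auto intro!: exp_H)
  qed
  have 1: "cmod (H v - h X') \<le> 120 * \<Omega> X'"
    unfolding h_def
  proof (rule H_annulus)
    show "0 \<le> X'" using X by simp
    show "exp (- X') \<le> cmod (of_real (exp (- X')) * w)" "cmod (of_real (exp (- X')) * w) \<le> 2 * exp (- X')"
      using w by (auto simp: norm_mult)
  qed (use v in auto)
  have 2: "cmod (h 0 - H 1) \<le> 120 * \<Omega> 0"
    unfolding h_def by (rule H_annulus[where r = 1]) (use w in auto)
  define q where "q = (X + 1) * sqrt (X + 1)"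
  have mono: "(X' + 1) * sqrt (X' + 1) \<le> q" "1 \<le> q"
  proof -
    show "(X' + 1) * sqrt (X' + 1) \<le> q" unfolding q_def using X by (intro mult_mono) auto
    have "1 * 1 \<le> (X + 1) * sqrt (X + 1)" using X by (intro mult_mono) auto
    then show "1 \<le> q" by (simp add: q_def)
  qed
  have O: "\<Omega> X' \<le> C1 * q" "\<Omega> 0 \<le> C1 * q" unfolding \<Omega>_def using mono constants_pos by auto
  have "sqrt (ray_rate X' * (Y + M0 + 1 / 2)) \<le> sqrt (ray_rate X * (Y + M0 + 1 / 2))"
    using ray_rate_mono[of X' X] X Y M0(1) by (intro real_sqrt_le_mono mult_right_mono) auto
  then have R': "cmod (h X' - h 0) \<le> sqrt (ray_rate X) * sqrt (Y + M0 + 1 / 2) + 1"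
    using R by (simp add: real_sqrt_mult)
  have "H v = (H v - h X') + ((h X' - h 0) + ((h 0 - H 1) + H 1))" by simp
  then have "cmod (H v) = cmod ((H v - h X') + ((h X' - h 0) + ((h 0 - H 1) + H 1)))" by (rule arg_cong)
  also have "\<dots> \<le> cmod (H v - h X') + (cmod (h X' - h 0) + (cmod (h 0 - H 1) + cmod (H 1)))"
    by (rule norm_triangle_le[OF add_left_mono[OF norm_triangle_le[OF add_left_mono[OF norm_triangle_ineq]]]])
  also have "\<dots> \<le> 120 * (C1 * q) + ((sqrt (ray_rate X) * sqrt (Y + M0 + 1 / 2) + 1) + (120 * (C1 * q) + cmod (H 1)))"
    using 1 2 O R' by linarith
  also have "\<dots> \<le> sqrt (ray_rate X) * sqrt (Y + M0 + 1 / 2) + (1 + 240 * C1 + cmod (H 1)) * q"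
  proof -
    have "(1 + cmod (H 1)) * 1 \<le> (1 + cmod (H 1)) * q" using mono(2) by (intro mult_left_mono) auto
    then show ?thesis by (simp add: algebra_simps)
  qed
  finally show ?thesis by (simp add: q_def)
qed

text \<open>\<open>H_bound\<close> is used twice with the same \<open>Y\<close>: at the minimiser
  \<open>u\<close>, where the real part gives the recursion for \<open>Y\<close>, and then at
  \<open>v\<close>, where the imaginary part is the rotation.\<close>

lemma rotation_bound:
  assumes X: "0 < X" and v: "cmod v = exp (- X)"
  defines "E \<equiv> err_const * ((X + 1) * sqrt (X + 1))"
  shows "\<bar>\<alpha> c v\<bar> \<le> ray_rate X + sqrt (ray_rate X) * sqrt E + E"
proof -
  let ?R = "{u. exp (- X) \<le> cmod u \<and> cmod u \<le> 3}"
  have q: "1 \<le> (X + 1) * sqrt (X + 1)"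
  proof -
    have "1 * 1 \<le> (X + 1) * sqrt (X + 1)" using X by (intro mult_mono) auto
    then show ?thesis by simp
  qed
  have cl: "closed ?R" by (intro closed_Collect_conj closed_Collect_le continuous_intros)
  have "bounded ?R" by (rule bounded_subset[OF bounded_cball[of 0 3]]) auto
  with cl have comp: "compact ?R" by (simp add: compact_eq_bounded_closed)
  have "v \<in> ?R" using v X by (auto intro: order_trans[of _ 1])
  then have "?R \<noteq> {}" by blast
  moreover have "continuous_on ?R (\<lambda>u. cmod (F u))" by (intro continuous_on_norm contF)
  ultimately obtain u where u: "u \<in> ?R" "\<And>z. z \<in> ?R \<Longrightarrow> cmod (F u) \<le> cmod (F z)"
    using continuous_attains_inf[OF comp] by blast
  have u0: "u \<noteq> 0" using u(1) by (auto simp: not_le)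
  have Fu: "0 < cmod (F u)" using F_nonzero[OF u0] by simp
  define Y where "Y = max 0 (- ln (cmod (F u)))"
  have Y0: "0 \<le> Y" by (simp add: Y_def)
  have lb: "exp (- Y) \<le> cmod (F z)" if "exp (- X) \<le> cmod z" "cmod z \<le> 3" for z
  proof -
    have "exp (- Y) \<le> exp (ln (cmod (F u)))" by (simp add: Y_def)
    also have "\<dots> = cmod (F u)" using Fu by simp
    also have "\<dots> \<le> cmod (F z)" using that by (intro u(2)) auto
    finally show ?thesis .
  qed
  define y where "y = Y + M0 + 1 / 2"
  have y0: "0 \<le> y" using Y0 M0(1) by (simp add: y_def)
  have E: "0 \<le> E" using err_const_ge_1 q by (simp add: E_def)
  have S: "0 \<le> sqrt (ray_rate X)" using ray_rate_nonneg X by simp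
  define D where "D = (1 + 240 * C1 + cmod (H 1)) * ((X + 1) * sqrt (X + 1))"
  have DE: "D + (M0 + B0 + 1 / 2) \<le> E" "0 \<le> D"
  proof -
    have "(M0 + B0 + 1 / 2) * 1 \<le> (M0 + B0 + 1) * ((X + 1) * sqrt (X + 1))"
      using q M0(1) B0(1) by (intro mult_mono) auto
    moreover have "E = D + (M0 + B0 + 1) * ((X + 1) * sqrt (X + 1))"
      unfolding E_def D_def err_const_def by (simp add: algebra_simps)
    ultimately show "D + (M0 + B0 + 1 / 2) \<le> E" by simp
    show "0 \<le> D" unfolding D_def using q constants_pos by simp
  qed
  \<comment> \<open>A minimiser of modulus at least 1 is not at the end of any ray considered; there
    the lower bound \<open>B0\<close> at \<open>X = 0\<close> takes over.\<close>
  have Yb: "Y \<le> sqrt (ray_rate X) * sqrt y + D + B0"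
  proof (cases "1 \<le> cmod u")
    case True
    have "exp (- B0) \<le> cmod (F u)" using B0(2)[of 0 u] True u(1) by simp
    then have "ln (exp (- B0)) \<le> ln (cmod (F u))" using Fu by (subst ln_le_cancel_iff) auto
    then have "Y \<le> B0" using B0(1) by (simp add: Y_def)
    then show ?thesis using S y0 DE(2) by (simp add: add_increasing)
  next
    case False
    define X' where "X' = - ln (cmod u)"
    have ue: "cmod u = exp (- X')" using u0 by (simp add: X'_def)
    have X': "0 < X'" "X' \<le> X"
    proof -
      show "0 < X'" using False u0 by (simp add: X'_def)
      have "exp (- X) \<le> exp (- X')" using u(1) ue by auto
      then show "X' \<le> X" by simp
    qed
    have "- ln (cmod (F u)) \<le> \<bar>Re (H u)\<bar>" by (simp add: H_def)
    also have "\<dots> \<le> cmod (H u)" by (rule abs_Re_le_cmod)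
    also have "\<dots> \<le> sqrt (ray_rate X) * sqrt y + D"
      unfolding y_def D_def by (rule H_bound[OF X' Y0 lb ue])
    finally have "- ln (cmod (F u)) \<le> sqrt (ray_rate X) * sqrt y + D" .
    moreover have "0 \<le> sqrt (ray_rate X) * sqrt y" using S y0 by simp
    ultimately show ?thesis using DE(2) B0(1) by (simp add: Y_def)
  qed
  have "y \<le> sqrt (ray_rate X) * sqrt y + E" using Yb DE(1) by (simp add: y_def)
  from le_sqrt_recursion[OF y0 S E this] have sy: "sqrt y \<le> sqrt (ray_rate X) + sqrt E" .
  have "\<bar>\<alpha> c v\<bar> = \<bar>Im (H v)\<bar>" by (simp add: H_def)
  also have "\<dots> \<le> cmod (H v)" by (rule abs_Im_le_cmod)
  also have "\<dots> \<le> sqrt (ray_rate X) * sqrt y + D"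
    unfolding y_def D_def by (rule H_bound[OF X order_refl Y0 lb v])
  also have "\<dots> \<le> sqrt (ray_rate X) * (sqrt (ray_rate X) + sqrt E) + E"
    using sy S DE M0(1) B0(1) by (intro add_mono mult_left_mono) auto
  also have "\<dots> = ray_rate X + sqrt (ray_rate X) * sqrt E + E"
    using ray_rate_nonneg[of X] X by (simp add: distrib_left)
  finally show ?thesis .
qed

end

section \<open>Rates in the limit of small scales, and the dimension\<close>

text \<open>The compression bound holds only near 0. On the compact remainder \<open>F\<close> has a
  positive minimum \<open>m\<close>, and since \<open>(X + 1)\<^sup>2\<close> is at least 1, all
  constants are absorbed into the coefficient \<open>B\<close>.\<close>

lemma annulus_lower_bound:
  fixes F :: "complex \<Rightarrow> complex"
  assumes cont: "continuous_on UNIV F" and nz: "\<And>v. v \<noteq> 0 \<Longrightarrow> F v \<noteq> 0" and C: "0 \<le> C" and c0: "0 < c0"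
    and ev: "\<forall>\<^sub>F v in at 0. c0 * exp (- C * (ln (1 / cmod v))\<^sup>2) \<le> cmod (F v)"
  obtains B where "0 \<le> B" "\<And>X v. 0 \<le> X \<Longrightarrow> exp (- X) \<le> cmod v \<Longrightarrow> cmod v \<le> 3 \<Longrightarrow> exp (- (B * (X + 1)\<^sup>2)) \<le> cmod (F v)"
proof -
  obtain \<delta>0 where \<delta>0: "0 < \<delta>0" "\<And>v. v \<noteq> 0 \<Longrightarrow> cmod v < \<delta>0 \<Longrightarrow> c0 * exp (- C * (ln (1 / cmod v))\<^sup>2) \<le> cmod (F v)"
    using ev unfolding eventually_at by (auto simp: dist_norm)
  define \<delta> where "\<delta> = min \<delta>0 1"
  have \<delta>: "0 < \<delta>" "\<delta> \<le> \<delta>0" "\<delta> \<le> 1" using \<delta>0(1) by (auto simp: \<delta>_def)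
  let ?R = "{u. \<delta> \<le> cmod u \<and> cmod u \<le> 3}"
  have cl: "closed ?R" by (intro closed_Collect_conj closed_Collect_le continuous_intros)
  have "bounded ?R" by (rule bounded_subset[OF bounded_cball[of 0 3]]) auto
  with cl have comp: "compact ?R" by (simp add: compact_eq_bounded_closed)
  have "complex_of_real 1 \<in> ?R" using \<delta> by simp
  then have "?R \<noteq> {}" by blast
  moreover have "continuous_on ?R (\<lambda>u. cmod (F u))"
    by (intro continuous_on_norm continuous_on_subset[OF cont]) auto
  ultimately obtain u where u: "u \<in> ?R" "\<And>z. z \<in> ?R \<Longrightarrow> cmod (F u) \<le> cmod (F z)"
    using continuous_attains_inf[OF comp] by blast
  define m where "m = cmod (F u)"
  have "u \<noteq> 0" using u(1) \<delta>(1) by auto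
  then have m: "0 < m" using nz[of u] by (simp add: m_def)
  define B where "B = C + \<bar>ln c0\<bar> + \<bar>ln m\<bar>"
  show thesis
  proof (rule that)
    show B: "0 \<le> B" using C by (simp add: B_def)
    fix X :: real and v :: complex
    assume X: "0 \<le> X" and v: "exp (- X) \<le> cmod v" "cmod v \<le> 3"
    have X1: "1 \<le> (X + 1)\<^sup>2" using X by (simp add: power2_eq_square algebra_simps)
    have v0: "0 < cmod v" using v(1) exp_gt_zero[of "- X"] by linarith
    show "exp (- (B * (X + 1)\<^sup>2)) \<le> cmod (F v)"
    proof (cases "\<delta> \<le> cmod v")
      case True
      have "B * 1 \<le> B * (X + 1)\<^sup>2" using B X1 by (intro mult_left_mono) auto
      moreover have "- B \<le> ln m" using C unfolding B_def by linarith
      ultimately have "- (B * (X + 1)\<^sup>2) \<le> ln m" by linarith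
      then have "exp (- (B * (X + 1)\<^sup>2)) \<le> exp (ln m)" by (rule exp_le_cancel_iff[THEN iffD2])
      also have "\<dots> = m" using m by simp
      also have "m \<le> cmod (F v)" unfolding m_def using True v(2) by (intro u(2)) auto
      finally show ?thesis .
    next
      case False
      define L where "L = ln (1 / cmod v)"
      have L: "L = - ln (cmod v)" using v0 by (simp add: L_def ln_div)
      have "ln (exp (- X)) \<le> ln (cmod v)" using v(1) v0 by (subst ln_le_cancel_iff) auto
      then have LX: "L \<le> X" by (simp add: L)
      have L0: "0 \<le> L" using False \<delta>(3) v0 by (simp add: L)
      have "L\<^sup>2 \<le> (X + 1)\<^sup>2" using LX L0 by (intro power_mono) auto
      then have "C * L\<^sup>2 \<le> C * (X + 1)\<^sup>2" using C by (intro mult_left_mono) auto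
      moreover have "(\<bar>ln c0\<bar> + \<bar>ln m\<bar>) * 1 \<le> (\<bar>ln c0\<bar> + \<bar>ln m\<bar>) * (X + 1)\<^sup>2" using X1 by (intro mult_left_mono) auto
      moreover have "B * (X + 1)\<^sup>2 = C * (X + 1)\<^sup>2 + (\<bar>ln c0\<bar> + \<bar>ln m\<bar>) * (X + 1)\<^sup>2" by (simp add: B_def algebra_simps)
      ultimately have "- (B * (X + 1)\<^sup>2) \<le> ln c0 + - C * L\<^sup>2" by simp
      then have "exp (- (B * (X + 1)\<^sup>2)) \<le> exp (ln c0 + - C * L\<^sup>2)" by (rule exp_le_cancel_iff[THEN iffD2])
      also have "\<dots> = c0 * exp (- C * L\<^sup>2)" using c0 by (simp only: exp_add exp_ln)
      also have "\<dots> \<le> cmod (F v)" unfolding L_def using v0 False \<delta>(2) by (intro \<delta>0(2)) auto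
      finally show ?thesis .
    qed
  qed
qed

text \<open>After division by \<open>(X n)\<^sup>2\<close> the mixed term has order
  \<open>X powr (7/4)\<close> over \<open>X powr 2\<close> and the last one
  \<open>X powr (3/2)\<close> over \<open>X powr 2\<close>, so only \<open>k\<close> remains in the
  limit.\<close>

lemma quadratic_rate_le:
  fixes X :: "nat \<Rightarrow> real"
  assumes k: "0 \<le> k" "0 \<le> m" "0 \<le> E" and X: "filterlim X at_top sequentially"
    and le: "\<forall>\<^sub>F n in sequentially. a * (X n)\<^sup>2 \<le> (k * (X n)\<^sup>2 + m * X n)
        + sqrt (k * (X n)\<^sup>2 + m * X n) * sqrt (E * ((X n + 1) * sqrt (X n + 1))) + E * ((X n + 1) * sqrt (X n + 1))"
  shows "a \<le> k"
proof -
  define q where "q x = (x + 1) * sqrt (x + 1)" for x :: real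
  have 1: "((\<lambda>x::real. inverse x) \<longlongrightarrow> 0) at_top" by (rule tendsto_inverse_0_at_top) (rule filterlim_ident)
  have 2: "((\<lambda>x::real. sqrt (q x) / x) \<longlongrightarrow> 0) at_top" unfolding q_def by real_asymp
  have 3: "((\<lambda>x::real. q x / x\<^sup>2) \<longlongrightarrow> 0) at_top" unfolding q_def by real_asymp
  define h where "h x = (k + m * inverse x) + sqrt (k + m * inverse x) * sqrt E * (sqrt (q x) / x) + E * (q x / x\<^sup>2)" for x
  have "(h \<longlongrightarrow> (k + m * 0) + sqrt (k + m * 0) * sqrt E * 0 + E * 0) at_top"
    unfolding h_def by (intro tendsto_intros 1 2 3)
  then have "(h \<longlongrightarrow> k) at_top" by simp
  then have lim: "(\<lambda>n. h (X n)) \<longlonglongrightarrow> k" using X by (rule filterlim_compose)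
  have "\<forall>\<^sub>F n in sequentially. 0 < X n" using X by (simp add: filterlim_at_top_dense)
  with le have "\<forall>\<^sub>F n in sequentially. a \<le> h (X n)"
  proof eventually_elim
    case (elim n)
    define x where "x = X n"
    have x: "0 < x" using elim by (simp add: x_def)
    have S: "k * x\<^sup>2 + m * x = x\<^sup>2 * (k + m * inverse x)" using x by (simp add: field_simps power2_eq_square)
    have "sqrt (k * x\<^sup>2 + m * x) = x * sqrt (k + m * inverse x)" unfolding S using x by (simp add: real_sqrt_mult)
    moreover have "sqrt (E * q x) = sqrt E * sqrt (q x)" by (rule real_sqrt_mult)
    ultimately have "a * x\<^sup>2 \<le> x\<^sup>2 * (k + m * inverse x) + (x * sqrt (k + m * inverse x)) * (sqrt E * sqrt (q x)) + E * q x"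
      using elim(1) S unfolding x_def[symmetric] q_def[symmetric] by simp
    also have "\<dots> = h x * x\<^sup>2"
    proof -
      have "x\<^sup>2 * w + (x * v) * (e * r) + E * Q = (w + v * e * (r / x) + E * (Q / x\<^sup>2)) * x\<^sup>2" for w v e r Q
        using x by (simp add: field_simps power2_eq_square)
      then show ?thesis unfolding h_def .
    qed
    finally show "a \<le> h (X n)" using x by (simp add: x_def[symmetric])
  qed
  then show ?thesis by (rule tendsto_lowerbound[OF lim]) simp
qed

lemma rotation_rate_le:
  assumes comp: "compression_constant Cb" and p: "0 < p" and f: "exp_integrable_distortion p f" and \<alpha>: "arg_branch f \<alpha>"
    and data: "homeomorphism UNIV UNIV f g" "C1_limit f fx fy" "K \<in> borel_measurable borel" "\<And>z. 1 \<le> K z"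
      "\<And>z h. (cmod (Re h *\<^sub>R fx z + Im h *\<^sub>R fy z))\<^sup>2 \<le> K z * jac (fx z) (fy z) * (cmod h)\<^sup>2"
    and d: "0 \<le> d" "d \<le> 2" and C0: "0 < C0"
    and mass: "\<And>t. 0 < t \<Longrightarrow> t \<le> 3 \<Longrightarrow>
      (\<integral>\<^sup>+z. ennreal (exp (p * K z)) * indicator (cball c t) z \<partial>lborel) \<le> ennreal (C0 * t powr d)"
    and l: "\<And>n. l n \<noteq> 0" "(\<lambda>n. cmod (l n)) \<longlonglongrightarrow> 0"
    and rate: "\<And>n. a * (ln (1 / cmod (l n)))\<^sup>2 \<le> \<bar>\<alpha> c (l n)\<bar>"
  shows "a \<le> 4 / 3 * ((2 - d) / p)"
proof -
  define F where "F v = f (c + v) - f c" for v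
  have contf: "continuous_on UNIV f" using data(1) by (simp add: homeomorphism_def)
  have contF: "continuous_on UNIV F"
    unfolding F_def by (intro continuous_intros continuous_on_compose2[OF contf]) auto
  have inj: "f x = f y \<longleftrightarrow> x = y" for x y
    using data(1) by (metis homeomorphism_apply1 UNIV_I)
  have "exp_integrable_distortion p F" unfolding F_def by (rule exp_integrable_distortion_translation[OF f])
  moreover have "F 0 = 0" by (simp add: F_def)
  ultimately obtain c0 where c0: "0 < c0" "\<forall>\<^sub>F v in at 0. c0 * exp (- (Cb / p) * (ln (1 / cmod v))\<^sup>2) \<le> cmod (F v)"
    using comp p unfolding compression_constant_def by blast
  have Cb: "0 \<le> Cb / p" using comp p by (simp add: compression_constant_def)
  have Fnz: "F v \<noteq> 0" if "v \<noteq> 0" for v using inj[of "c + v" c] that by (simp add: F_def)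
  obtain B where B: "0 \<le> B" "\<And>X v. 0 \<le> X \<Longrightarrow> exp (- X) \<le> cmod v \<Longrightarrow> cmod v \<le> 3 \<Longrightarrow> exp (- (B * (X + 1)\<^sup>2)) \<le> cmod (F v)"
    using annulus_lower_bound[OF contF Fnz Cb c0] by blast
  have "compact (F ` cball 0 3)" by (intro compact_continuous_image continuous_on_subset[OF contF]) auto
  then have "bounded (F ` cball 0 3)" by (rule compact_imp_bounded)
  then obtain b where b: "\<And>v. v \<in> cball 0 3 \<Longrightarrow> cmod (F v) \<le> b" unfolding bounded_iff by blast
  have M: "cmod (F v) \<le> exp (max 0 b)" if "cmod v \<le> 3" for v
  proof -
    have "cmod (F v) \<le> b" using that by (intro b) simp
    then show ?thesis using exp_ge_add_one_self[of "max 0 b"] by linarith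
  qed
  interpret rotation_branch f g fx fy K p d C0 "max 0 b" B c \<alpha>
    by unfold_locales (use data p d C0 mass B M \<alpha> in \<open>auto simp: F_def\<close>)
  define X where "X n = ln (1 / cmod (l n))" for n
  have "filterlim (\<lambda>n. cmod (l n)) (at_right 0) sequentially"
    using l by (auto simp: filterlim_at intro!: always_eventually)
  then have "filterlim (\<lambda>n. ln (cmod (l n))) at_bot sequentially"
    by (rule filterlim_compose[OF ln_at_0])
  then have "filterlim (\<lambda>n. - ln (cmod (l n))) at_top sequentially"
    by (simp add: filterlim_uminus_at_top)
  moreover have "X = (\<lambda>n. - ln (cmod (l n)))" using l(1) by (simp add: X_def ln_div fun_eq_iff)
  ultimately have Xlim: "filterlim X at_top sequentially" by simp
  then have Xpos: "\<forall>\<^sub>F n in sequentially. 0 < X n" by (simp add: filterlim_at_top_dense)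
  define k m where "k = 4 / 3 * ((2 - d) / p)" and "m = 4 / 3 * (8 * C0 / (3 * pi * p))"
  have km: "0 \<le> k" "0 \<le> m" using d p C0 by (simp_all add: k_def m_def)
  have ray_rate: "ray_rate x = k * x\<^sup>2 + m * x" for x using p by (simp add: ray_rate_def k_def m_def field_simps)
  have "a \<le> k"
  proof (rule quadratic_rate_le[OF km _ Xlim])
    show "0 \<le> err_const" using err_const_ge_1 by simp
    show "\<forall>\<^sub>F n in sequentially. a * (X n)\<^sup>2 \<le> (k * (X n)\<^sup>2 + m * X n)
        + sqrt (k * (X n)\<^sup>2 + m * X n) * sqrt (err_const * ((X n + 1) * sqrt (X n + 1))) + err_const * ((X n + 1) * sqrt (X n + 1))"
      using Xpos
    proof eventually_elim
      case (elim n)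
      have "cmod (l n) = exp (- X n)" using l(1)[of n] by (simp add: X_def ln_div)
      from rotation_bound[OF elim this] rate[of n] show ?case unfolding ray_rate X_def[symmetric] by linarith
    qed
  qed
  then show ?thesis by (simp add: k_def)
qed

text \<open>The left side is linear in \<open>Ct\<close> and the right side grows like its square
  root, so the comparison depends on an upper bound for \<open>Ct\<close>.\<close>

lemma modulus_constant_estimate:
  assumes "modulus_constant Ct"
  shows "Ct / (pi + 2 * (exp 1 - 1)) \<le> 3 / 4 * (sqrt (Ct * pi) / sqrt 2)"
proof -
  have Ct: "0 < Ct" "Ct \<le> 14" using assms modulus_constant_le by (auto simp: modulus_constant_def)
  have "5 \<le> pi + 2 * (exp 1 - 1)" using exp_ge_add_one_self[of 1] pi_approx by simp
  then have "Ct / (pi + 2 * (exp 1 - 1)) \<le> Ct / 5" using Ct by (intro divide_left_mono) auto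
  also have "Ct / 5 = sqrt Ct * (sqrt Ct / 5)" using Ct by simp
  also have "\<dots> \<le> sqrt Ct * (3 / 4)"
  proof (intro mult_left_mono)
    have "sqrt Ct \<le> sqrt ((15 / 4)\<^sup>2)" using Ct by (intro real_sqrt_le_mono) (simp add: power2_eq_square)
    then show "sqrt Ct / 5 \<le> 3 / 4" by simp
  qed (use Ct in simp)
  also have "\<dots> \<le> 3 / 4 * (sqrt Ct * sqrt (pi / 2))"
  proof -
    have "sqrt 1 \<le> sqrt (pi / 2)" using pi_ge_two by (intro real_sqrt_le_mono) simp
    then have "sqrt Ct * 1 \<le> sqrt Ct * sqrt (pi / 2)" using Ct by (intro mult_left_mono) auto
    then show ?thesis by simp
  qed
  also have "sqrt Ct * sqrt (pi / 2) = sqrt (Ct * pi) / sqrt 2" by (simp add: real_sqrt_mult real_sqrt_divide)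
  finally show ?thesis .
qed

theorem theorem3:
  fixes Cbar Ctilde p s :: real
    and f :: "complex \<Rightarrow> complex"
    and A :: "complex set"
    and \<alpha> :: "complex \<Rightarrow> complex \<Rightarrow> real"
  assumes "compression_constant Cbar"
    and "modulus_constant Ctilde"
    and "0 < p"
    and "0 < s" "s < 2"
    and "exp_integrable_distortion p f"
    and "arg_branch f \<alpha>"
    and "\<And>z. z \<in> A \<Longrightarrow>
      \<exists>l :: nat \<Rightarrow> complex. (\<forall>n. l n \<noteq> 0) \<and> (\<lambda>n. cmod (l n)) \<longlonglongrightarrow> 0 \<and>
        (\<forall>n. \<bar>\<alpha> z (l n)\<bar> \<ge>
           (2 - s) * sqrt (Ctilde * pi) * Cbar / (sqrt 2 * p) * (ln (1 / cmod (l n)))\<^sup>2)"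
  shows "hausdorff_dim A \<le> ereal (2 - Cbar * Ctilde * (2 - s) / (pi + 2 * (exp 1 - 1)))"
proof (cases "A = {}")
  case True
  then show ?thesis by (simp add: hausdorff_dim_def)
next
  case False
  define T where "T = Cbar * Ctilde * (2 - s) / (pi + 2 * (exp 1 - 1))"
  have Cb: "0 < Cbar" using assms(1) by (simp add: compression_constant_def)
  have Ct: "0 < Ctilde" using assms(2) by (simp add: modulus_constant_def)
  have "0 < pi + 2 * (exp 1 - 1 :: real)" by (intro add_pos_nonneg mult_nonneg_nonneg) auto
  then have T: "0 < T" unfolding T_def using Cb Ct assms(5) by simp
  define a where "a = (2 - s) * sqrt (Ctilde * pi) * Cbar / (sqrt 2 * p)"
  \<comment> \<open>Compares the claimed gain \<open>T\<close> with the assumed rotation rate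
    \<open>a\<close>. The factor \<open>3 / 4\<close> is the reciprocal of the \<open>4 / 3\<close>
    in \<open>rotation_rate_le\<close>.\<close>
  have Ta: "T \<le> 3 / 4 * (p * a)"
  proof -
    have "T = (2 - s) * Cbar * (Ctilde / (pi + 2 * (exp 1 - 1)))" by (simp add: T_def)
    also have "\<dots> \<le> (2 - s) * Cbar * (3 / 4 * (sqrt (Ctilde * pi) / sqrt 2))"
      using Cb assms(5) by (intro mult_left_mono modulus_constant_estimate assms(2)) simp
    also have "\<dots> = 3 / 4 * (p * a)" using assms(3) by (simp add: a_def)
    finally show ?thesis .
  qed
  obtain g fx fy K where data: "homeomorphism UNIV UNIV f g" "C1_limit f fx fy" and K [measurable]: "K \<in> borel_measurable borel"
    and K1: "\<And>z. 1 \<le> K z"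
    and dil: "\<And>z h. (cmod (Re h *\<^sub>R fx z + Im h *\<^sub>R fy z))\<^sup>2 \<le> K z * jac (fx z) (fy z) * (cmod h)\<^sup>2"
    and fin: "\<And>R. (\<integral>\<^sup>+z. ennreal (exp (p * K z)) * indicator (cball 0 R) z \<partial>lborel) < \<infinity>"
  proof (rule exp_integrable_distortion_data[OF assms(6)], goal_cases)
    case (1 g fx fy K)
    show ?case by (rule 1(1)[OF 1(2-7)])
  qed
  define \<mu> where "\<mu> z t = (\<integral>\<^sup>+v. ennreal (exp (p * K v)) * indicator (cball z t) v \<partial>lborel)" for z t
  have \<mu>_mono: "\<mu> z t \<le> \<mu> z t'" if "t \<le> t'" for z t t'
    unfolding \<mu>_def using that by (intro nn_integral_mono mult_left_mono) (auto simp: indicator_def)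
  have \<mu>_fin: "\<mu> z 3 < \<infinity>" for z
  proof -
    have "cball z 3 \<subseteq> cball 0 (cmod z + 3)" by (rule cball_subset_cball_iff[THEN iffD2]) (simp add: dist_norm)
    then have "\<mu> z 3 \<le> (\<integral>\<^sup>+v. ennreal (exp (p * K v)) * indicator (cball 0 (cmod z + 3)) v \<partial>lborel)"
      unfolding \<mu>_def by (intro nn_integral_mono mult_left_mono) (auto simp: indicator_def)
    then show ?thesis using fin[of "cmod z + 3"] by (rule order.strict_trans1)
  qed
  define M where "M z = enn2real (\<mu> z 3)" for z
  have M: "0 \<le> M z" "\<mu> z 3 = ennreal (M z)" for z using \<mu>_fin[of z] by (auto simp: M_def)
  \<comment> \<open>Read contrapositively: with an exponent \<open>d\<close> above
    \<open>2 - T\<close>, no point of \<open>A\<close> has all its discs of mass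
    \<open>O(t powr d)\<close>, so high density must occur there at arbitrarily small
    scales.\<close>
  have key: "T \<le> 2 - d"
    if z: "z \<in> A" and d: "0 \<le> d" "d \<le> 2" and C0: "0 < C0" and mass: "\<And>t. 0 < t \<Longrightarrow> t \<le> 3 \<Longrightarrow> \<mu> z t \<le> ennreal (C0 * t powr d)"
    for z d C0
  proof -
    from assms(8)[OF z] obtain l :: "nat \<Rightarrow> complex" where l: "\<And>n. l n \<noteq> 0" "(\<lambda>n. cmod (l n)) \<longlonglongrightarrow> 0"
      "\<And>n. a * (ln (1 / cmod (l n)))\<^sup>2 \<le> \<bar>\<alpha> z (l n)\<bar>" unfolding a_def by blast
    have "a \<le> 4 / 3 * ((2 - d) / p)"
      by (rule rotation_rate_le[OF assms(1,3,6,7) data K K1 dil d C0 mass[unfolded \<mu>_def] l])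
    then have "p * a \<le> 4 / 3 * (2 - d)" using assms(3) by (simp add: field_simps)
    then show ?thesis using Ta by simp
  qed
  obtain z0 where z0: "z0 \<in> A" using False by blast
  \<comment> \<open>The exponent 0 is available at every point, as the mass is locally finite. A
    point of \<open>A\<close> thus forces \<open>T \<le> 2\<close>, which makes every
    \<open>d'\<close> above \<open>2 - T\<close> positive, as \<open>hausdorff_dim_le\<close>
    requires.\<close>
  have "T \<le> 2 - 0"
  proof (rule key[OF z0, of 0 "M z0 + 1"])
    fix t :: real assume t: "0 < t" "t \<le> 3"
    have "\<mu> z0 t \<le> ennreal (M z0)" using \<mu>_mono[OF t(2)] M(2) by metis
    also have "\<dots> \<le> ennreal ((M z0 + 1) * t powr 0)" using t by (intro ennreal_leI) simp
    finally show "\<mu> z0 t \<le> ennreal ((M z0 + 1) * t powr 0)" .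
  qed (use M(1)[of z0] in auto)
  then have T2: "T \<le> 2" by simp
  have "hausdorff_dim A \<le> ereal d'" if d': "2 - T < d'" for d'
  proof (rule hausdorff_dim_le)
    show "0 < d'" using T2 d' by simp
    \<comment> \<open>Strictly between \<open>2 - T\<close> and \<open>d'\<close>: the first gap
      produces the contradiction with \<open>key\<close>, the second is needed for Hausdorff measure
      zero. The minimum with 2 keeps \<open>d\<close> in the range allowed in
      \<open>key\<close>.\<close>
    define d where "d = (2 - T + min d' 2) / 2"
    have d: "2 - T < d" "d < d'" "d \<le> 2" "0 \<le> d" using T T2 d' by (auto simp: d_def min_def)
    show "hausdorff_measure d' A = 0"
    proof (rule hausdorff_measure_zero[where k = "\<lambda>z. ennreal (exp (p * K z))" and d = d])
      fix z \<delta> assume z: "z \<in> A" and \<delta>: "0 < (\<delta>::real)"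
      show "\<exists>\<rho>>0. \<rho> < \<delta> \<and> ennreal (\<rho> powr d) \<le> (\<integral>\<^sup>+v. ennreal (exp (p * K v)) * indicator (cball z \<rho>) v \<partial>lborel)"
      proof (rule ccontr)
        assume "\<not> ?thesis"
        then have small: "\<mu> z t < ennreal (t powr d)" if "0 < t" "t < \<delta>" for t
          using that by (auto simp: \<mu>_def not_le)
        \<comment> \<open>The summand 1 serves the radii below \<open>\<delta>\<close>; for larger
          ones the full mass \<open>M z\<close> is at most
          \<open>M z / \<delta> powr d * t powr d\<close>.\<close>
        define C0 where "C0 = 1 + M z / \<delta> powr d"
        have C1: "1 \<le> C0" "M z / \<delta> powr d \<le> C0" using M(1) by (auto simp: C0_def)
        have "T \<le> 2 - d"
        proof (rule key[OF z d(4) d(3), of C0])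
          show "0 < C0" using C1 by simp
          fix t :: real assume t: "0 < t" "t \<le> 3"
          show "\<mu> z t \<le> ennreal (C0 * t powr d)"
          proof (cases "t < \<delta>")
            case True
            have "1 * t powr d \<le> C0 * t powr d" using C1 by (intro mult_right_mono) auto
            then have "ennreal (t powr d) \<le> ennreal (C0 * t powr d)" by (intro ennreal_leI) simp
            with small[OF t(1) True] show ?thesis by (meson order.trans less_imp_le)
          next
            case False
            have "M z = M z / \<delta> powr d * \<delta> powr d" using \<delta> by simp
            also have "\<dots> \<le> C0 * t powr d"
              using False C1 \<delta> d(4) by (intro mult_mono powr_mono2) auto
            finally have "ennreal (M z) \<le> ennreal (C0 * t powr d)" by (rule ennreal_leI)
            moreover have "\<mu> z t \<le> ennreal (M z)" using \<mu>_mono[OF t(2)] M(2) by metis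
            ultimately show ?thesis by (rule order.trans[rotated])
          qed
        qed
        then show False using d(1) by simp
      qed
    qed (use d T2 fin in auto)
  qed
  then have "hausdorff_dim A \<le> ereal (2 - T) + ereal e" if "0 < e" for e using that by simp
  then have "hausdorff_dim A \<le> ereal (2 - T)" by (rule ereal_le_epsilon2)
  then show ?thesis by (simp add: T_def)
qed

end
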